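(* Let $k$ be an infinite field, $H$ a Hopf algebra over $k$, and $\alpha:H\times H\to k$ a normalized convolution-invertible two-cocycle. If $\alpha$ is a nice nondegenerate two-cocycle, then $\mu_\sigma:\mathcal U_H^{\alpha}\to\mathcal A_H^{\alpha}$ induces an isomorphism of $H$-comodule algebras $$\mathcal B_H^{\alpha}\otimes_{\mathcal Z_H^{\alpha}}\mathcal U_H^{\alpha}\cong\mathcal A_H^{\alpha}.$$
   Context: All algebras are associative unital $k$-algebras; unadorned tensor products are over $k$; $\Delta$, $\varepsilon$ are the comultiplication and counit of $H$, with Sweedler notation. An $H$-comodule algebra is an algebra with a right $H$-coaction that is an algebra morphism; morphisms are algebra morphisms that are comodule maps. Cocycles and twisted algebras: let $R$ be a commutative algebra. A two-cocycle with values in $R$ is a bilinear map $\gamma:H\times H\to R$ with $\sum\gamma(x_{(1)},y_{(1)})\gamma(x_{(2)}y_{(2)},z)=\sum\gamma(y_{(1)},z_{(1)})\gamma(x,y_{(2)}z_{(2)})$ for all $x,y,z\in H$; it is normalized if $\gamma(x,1)=\gamma(1,x)=\varepsilon(x)1$ for all $x\in H$, and convolution-invertible if it is invertible for convolution in $\operatorname{Hom}(H\otimes H,R)$. The twisted algebra $R\otimes{}^{\gamma}H$ is $R\otimes H$ with product $(b\otimes x)\cdot_\gamma(c\otimes y)=\sum bc\,\gamma(x_{(1)},y_{(1)})\otimes x_{(2)}y_{(2)}$ and coaction $\mathrm{id}_R\otimes\Delta$. For $R=k$ and $\gamma=\alpha$ write ${}^{\alpha}H=k\otimes{}^{\alpha}H$.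 Universal cocycle: let $t_H$ be a copy of the vector space $H$ (with identity map $h\mapsto t_h$), $S(t_H)$ its symmetric algebra, $K_H$ the field of fractions of $S(t_H)$. Let $t^{-1}:H\to K_H$, $h\mapsto t_h^{-1}$, be the unique linear map with $\sum t_{h_{(1)}}t^{-1}_{h_{(2)}}=\sum t^{-1}_{h_{(1)}}t_{h_{(2)}}=\varepsilon(h)1$ for all $h\in H$ (it exists; note that $t^{-1}_h$ is in general not $1/t_h$). $S(t_H)_{\Theta}$ is the subalgebra of $K_H$ generated by all $t_h$ and $t_h^{-1}$, $h\in H$. Define $\sigma:H\times H\to S(t_H)_{\Theta}$ by $\sigma(x,y)=\sum t_{x_{(1)}}t_{y_{(1)}}\alpha(x_{(2)},y_{(2)})t^{-1}_{x_{(3)}y_{(3)}}$; it is a convolution-invertible two-cocycle with convolution inverse $\sigma^{-1}(x,y)=\sum t_{x_{(1)}y_{(1)}}\alpha^{-1}(x_{(2)},y_{(2)})t^{-1}_{x_{(3)}}t^{-1}_{y_{(3)}}$, where $\alpha^{-1}$ is the convolution inverse of $\alpha$. $\mathcal B_H^{\alpha}\subset S(t_H)_{\Theta}$ is the subalgebra generated by all values of $\sigma$ and $\sigma^{-1}$, and $\mathcal A_H^{\alpha}=\mathcal B_H^{\alpha}\otimes{}^{\sigma}H$ is the twisted algebra, with unit $t_1^{-1}\otimes1$. The map $\varphi:S(t_H)_\Theta\otimes{}^{\sigma}H\to S(t_H)_\Theta\otimes{}^{\alpha}H$, $\varphi(b\otimes h)=\sum b\,t_{h_{(1)}}\otimes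 h_{(2)}$, is an $S(t_H)_\Theta$-linear isomorphism of $H$-comodule algebras with inverse $\varphi^{-1}(b\otimes h)=\sum b\,t^{-1}_{h_{(1)}}\otimes h_{(2)}$. Identities: $X_H$ is a copy of $H$ (with identity map $h\mapsto X_h$); $T(X_H)$ is the tensor algebra, an $H$-comodule algebra with coaction determined by $\delta(X_h)=\sum X_{h_{(1)}}\otimes h_{(2)}$. $I_H({}^{\alpha}H)$ is the ideal of those $P\in T(X_H)$ with $\mu(P)=0$ for all $H$-comodule algebra morphisms $\mu:T(X_H)\to{}^{\alpha}H$; $\mathcal U_H^{\alpha}=T(X_H)/I_H({}^{\alpha}H)$, and $\mathcal Z_H^{\alpha}$ is the center of $\mathcal U_H^{\alpha}$. The algebra morphism $T(X_H)\to S(t_H)\otimes{}^{\alpha}H$, $X_h\mapsto\sum t_{h_{(1)}}\otimes h_{(2)}$, induces an injective $H$-comodule algebra morphism $\mu_\alpha:\mathcal U_H^{\alpha}\to S(t_H)\otimes{}^{\alpha}H\subset S(t_H)_\Theta\otimes{}^{\alpha}H$; $\mu_\sigma=\varphi^{-1}\circ\mu_\alpha$ is an injective $H$-comodule algebra morphism which takes values in $\mathcal A_H^{\alpha}$. Nondegenerate and nice: $\alpha$ is nondegenerate if the center of ${}^{\alpha}H$ is $k1$. In that case $\mu_\alpha(\mathcal Z_H^{\alpha})\subset\mathcal B_H^{\alpha}\otimes1$, so $\mu_\alpha$ identifies $\mathcal Z_H^{\alpha}$ with a subalgebra of $\mathcal B_H^{\alpha}$, which makes $\mathcal B_H^{\alpha}$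 a $\mathcal Z_H^{\alpha}$-algebra. A nondegenerate two-cocycle $\alpha$ is said to be nice if $\mathcal B_H^{\alpha}$ is a localization of $\mu_\alpha(\mathcal Z_H^{\alpha})$ or, equivalently, if their fields of fractions coincide. The induced map is $b\otimes w\mapsto b\,\mu_\sigma(w)$. *)

theory Defs
  imports "HOL-Algebra.Free_Abelian_Groups" "HOL-Algebra.Module" "HOL-Algebra.QuotRing"
    "HOL-Algebra.Subrings"
begin

section \<open>Algebras and linear maps\<close>

text \<open>The locale \<^locale>\<open>algebra\<close> of HOL-Algebra only covers commutative algebras.\<close>

locale assoc_algebra = module R A + A: ring A for R (structure) and A (structure) +
  assumes smult_mult_left:
      "\<lbrakk>c \<in> carrier R; x \<in> carrier A; y \<in> carrier A\<rbrakk>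
        \<Longrightarrow> (c \<odot>\<^bsub>A\<^esub> x) \<otimes>\<^bsub>A\<^esub> y = c \<odot>\<^bsub>A\<^esub> (x \<otimes>\<^bsub>A\<^esub> y)"
    and smult_mult_right:
      "\<lbrakk>c \<in> carrier R; x \<in> carrier A; y \<in> carrier A\<rbrakk>
        \<Longrightarrow> x \<otimes>\<^bsub>A\<^esub> (c \<odot>\<^bsub>A\<^esub> y) = c \<odot>\<^bsub>A\<^esub> (x \<otimes>\<^bsub>A\<^esub> y)"

definition with_smult :: "('a, 'm) ring_scheme \<Rightarrow> ('r \<Rightarrow> 'a \<Rightarrow> 'a) \<Rightarrow> ('r, 'a) module" where
  "with_smult A f = \<lparr>carrier = carrier A, monoid.mult = monoid.mult A, monoid.one = monoid.one A,
     ring.zero = ring.zero A, ring.add = ring.add A, smult = f\<rparr>"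

definition self_algebra :: "('k, 'm) ring_scheme \<Rightarrow> ('k, 'k) module" where
  "self_algebra K = with_smult K (monoid.mult K)"

definition lin_map ::
  "('r, 'l) ring_scheme \<Rightarrow> ('r, 'a, 'm) module_scheme \<Rightarrow> ('r, 'b, 'n) module_scheme \<Rightarrow> ('a \<Rightarrow> 'b) set"
where
  "lin_map R M N = {f \<in> carrier M \<rightarrow> carrier N.
     (\<forall>x\<in>carrier M. \<forall>y\<in>carrier M. f (x \<oplus>\<^bsub>M\<^esub> y) = f x \<oplus>\<^bsub>N\<^esub> f y) \<and>
     (\<forall>c\<in>carrier R. \<forall>x\<in>carrier M. f (c \<odot>\<^bsub>M\<^esub> x) = c \<odot>\<^bsub>N\<^esub> f x)}"

definition bilin_map ::
  "('r, 'l) ring_scheme \<Rightarrow> ('r, 'a, 'm) module_scheme \<Rightarrow> ('r, 'b, 'n) module_scheme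
    \<Rightarrow> ('r, 'c, 'p) module_scheme \<Rightarrow> ('a \<Rightarrow> 'b \<Rightarrow> 'c) set"
where
  "bilin_map R M N P = {f. (\<forall>x\<in>carrier M. f x \<in> lin_map R N P) \<and>
     (\<forall>y\<in>carrier N. (\<lambda>x. f x y) \<in> lin_map R M P)}"

definition alg_hom ::
  "('r, 'l) ring_scheme \<Rightarrow> ('r, 'a, 'm) module_scheme \<Rightarrow> ('r, 'b, 'n) module_scheme \<Rightarrow> ('a \<Rightarrow> 'b) set"
where
  "alg_hom R A B = ring_hom A B \<inter> lin_map R A B"

definition center :: "('a, 'm) ring_scheme \<Rightarrow> 'a set" where
  "center A = {z \<in> carrier A. \<forall>a\<in>carrier A. z \<otimes>\<^bsub>A\<^esub> a = a \<otimes>\<^bsub>A\<^esub> z}"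

definition subalg_gen ::
  "('r, 'l) ring_scheme \<Rightarrow> ('r, 'a, 'm) module_scheme \<Rightarrow> 'a set \<Rightarrow> 'a set" where
  "subalg_gen R A X = \<Inter>{B. subring B A \<and> (\<forall>c\<in>carrier R. \<forall>b\<in>B. c \<odot>\<^bsub>A\<^esub> b \<in> B) \<and> X \<subseteq> B}"

definition quot_algebra :: "('r, 'a, 'm) module_scheme \<Rightarrow> 'a set \<Rightarrow> ('r, 'a set) module" where
  "quot_algebra A I = with_smult (A Quot I) (\<lambda>c C. \<Union>a\<in>C. I +>\<^bsub>A\<^esub> (c \<odot>\<^bsub>A\<^esub> a))"

text \<open>A commutative ring \<open>B\<close> is a localization of its subring \<open>Z\<close>. As \<open>Z \<rightarrow> B\<close> is injective,
  the usual condition on the kernel of the localization map is void.\<close>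

definition is_localization :: "('a, 'm) ring_scheme \<Rightarrow> 'a set \<Rightarrow> bool" where
  "is_localization B Z \<longleftrightarrow> (\<exists>S. S \<subseteq> Z \<and> \<one>\<^bsub>B\<^esub> \<in> S \<and> (\<forall>s\<in>S. \<forall>s'\<in>S. s \<otimes>\<^bsub>B\<^esub> s' \<in> S) \<and>
     S \<subseteq> Units B \<and> (\<forall>b\<in>carrier B. \<exists>z\<in>Z. \<exists>s\<in>S. b = z \<otimes>\<^bsub>B\<^esub> inv\<^bsub>B\<^esub> s))"


section \<open>Tensor products\<close>

text \<open>\<open>M \<otimes>\<^sub>R N\<close> is the free abelian group on \<open>M \<times> N\<close> modulo the bilinearity relations. The
  underlying module depends only on the module structures of \<open>M\<close> and \<open>N\<close>; the product
  \<open>(x \<otimes> y)(x' \<otimes> y') = xx' \<otimes> yy'\<close> is meaningful if both are algebras.\<close>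

type_synonym ('a, 'b) tens = "('a \<times> 'b \<Rightarrow>\<^sub>0 int) set"

definition tensor_rels ::
  "('r, 'l) ring_scheme \<Rightarrow> ('r, 'a, 'm) module_scheme \<Rightarrow> ('r, 'b, 'n) module_scheme
    \<Rightarrow> ('a \<times> 'b \<Rightarrow>\<^sub>0 int) set"
where
  "tensor_rels R M N =
     {frag_of (x \<oplus>\<^bsub>M\<^esub> x', y) - frag_of (x, y) - frag_of (x', y) | x x' y.
        x \<in> carrier M \<and> x' \<in> carrier M \<and> y \<in> carrier N} \<union>
     {frag_of (x, y \<oplus>\<^bsub>N\<^esub> y') - frag_of (x, y) - frag_of (x, y') | x y y'.
        x \<in> carrier M \<and> y \<in> carrier N \<and> y' \<in> carrier N} \<union>
     {frag_of (r \<odot>\<^bsub>M\<^esub> x, y) - frag_of (x, r \<odot>\<^bsub>N\<^esub> y) | r x y.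
        r \<in> carrier R \<and> x \<in> carrier M \<and> y \<in> carrier N}"

definition tensor_ker ::
  "('r, 'l) ring_scheme \<Rightarrow> ('r, 'a, 'm) module_scheme \<Rightarrow> ('r, 'b, 'n) module_scheme
    \<Rightarrow> ('a \<times> 'b \<Rightarrow>\<^sub>0 int) set"
where
  "tensor_ker R M N = generate (free_Abelian_group (carrier M \<times> carrier N)) (tensor_rels R M N)"

definition tensor_group ::
  "('r, 'l) ring_scheme \<Rightarrow> ('r, 'a, 'm) module_scheme \<Rightarrow> ('r, 'b, 'n) module_scheme
    \<Rightarrow> ('a, 'b) tens monoid"
where
  "tensor_group R M N = free_Abelian_group (carrier M \<times> carrier N) Mod tensor_ker R M N"

definition tens ::
  "('r, 'l) ring_scheme \<Rightarrow> ('r, 'a, 'm) module_scheme \<Rightarrow> ('r, 'b, 'n) module_scheme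
    \<Rightarrow> 'a \<Rightarrow> 'b \<Rightarrow> ('a, 'b) tens"
where
  "tens R M N x y =
     tensor_ker R M N #>\<^bsub>free_Abelian_group (carrier M \<times> carrier N)\<^esub> frag_of (x, y)"

text \<open>\<open>tensor_lift R M N G f\<close> is the additive map \<open>x \<otimes> y \<mapsto> f x y\<close> from \<open>M \<otimes>\<^sub>R N\<close> to \<open>G\<close>. It exists
  for balanced biadditive \<open>f\<close> and is then determined on the carrier.\<close>

definition tensor_lift ::
  "('r, 'l) ring_scheme \<Rightarrow> ('r, 'a, 'm) module_scheme \<Rightarrow> ('r, 'b, 'n) module_scheme
    \<Rightarrow> ('c, 'p) monoid_scheme \<Rightarrow> ('a \<Rightarrow> 'b \<Rightarrow> 'c) \<Rightarrow> ('a, 'b) tens \<Rightarrow> 'c"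
where
  "tensor_lift R M N G f = (SOME g. g \<in> hom (tensor_group R M N) G \<and>
     (\<forall>x\<in>carrier M. \<forall>y\<in>carrier N. g (tens R M N x y) = f x y))"

definition tensor ::
  "('r, 'l) ring_scheme \<Rightarrow> ('r, 'a, 'm) module_scheme \<Rightarrow> ('r, 'b, 'n) module_scheme
    \<Rightarrow> ('r, ('a, 'b) tens) module"
where
  "tensor R M N = \<lparr>carrier = carrier (tensor_group R M N),
     monoid.mult = (\<lambda>s t. tensor_lift R M N (tensor_group R M N)
       (\<lambda>x y. tensor_lift R M N (tensor_group R M N)
          (\<lambda>x' y'. tens R M N (x \<otimes>\<^bsub>M\<^esub> x') (y \<otimes>\<^bsub>N\<^esub> y')) t) s),
     monoid.one = tens R M N \<one>\<^bsub>M\<^esub> \<one>\<^bsub>N\<^esub>,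
     ring.zero = \<one>\<^bsub>tensor_group R M N\<^esub>,
     ring.add = monoid.mult (tensor_group R M N),
     smult = (\<lambda>r. tensor_lift R M N (tensor_group R M N) (\<lambda>x y. tens R M N (r \<odot>\<^bsub>M\<^esub> x) y))\<rparr>"


section \<open>Hopf algebras and comodule algebras\<close>

record ('k, 'h) hopf = "('k, 'h) module" +
  comult :: "'h \<Rightarrow> ('h, 'h) tens"
  counit :: "'h \<Rightarrow> 'k"
  antipode :: "'h \<Rightarrow> 'h"

text \<open>Sweedler sums: \<open>sw K H P f h\<close> is \<open>\<Sum> f h\<^sub>(\<^sub>1\<^sub>) h\<^sub>(\<^sub>2\<^sub>)\<close>, formed in \<open>P\<close>; \<open>sw3\<close> is the threefold
  version.\<close>

definition sw ::
  "'k ring \<Rightarrow> ('k, 'h) hopf \<Rightarrow> ('c, 'p) ring_scheme \<Rightarrow> ('h \<Rightarrow> 'h \<Rightarrow> 'c) \<Rightarrow> 'h \<Rightarrow> 'c" where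
  "sw K H P f h = tensor_lift K H H (add_monoid P) f (comult H h)"

definition sw3 ::
  "'k ring \<Rightarrow> ('k, 'h) hopf \<Rightarrow> ('c, 'p) ring_scheme \<Rightarrow> ('h \<Rightarrow> 'h \<Rightarrow> 'h \<Rightarrow> 'c) \<Rightarrow> 'h \<Rightarrow> 'c" where
  "sw3 K H P f h = sw K H P (\<lambda>x y. sw K H P (f x) y) h"

definition hopf_algebra :: "'k ring \<Rightarrow> ('k, 'h) hopf \<Rightarrow> bool" where
  "hopf_algebra K H \<longleftrightarrow>
     assoc_algebra K H \<and>
     comult H \<in> alg_hom K H (tensor K H H) \<and>
     counit H \<in> alg_hom K H (self_algebra K) \<and>
     antipode H \<in> lin_map K H H \<and>
     (\<forall>h\<in>carrier H.
        sw K H (tensor K H (tensor K H H)) (\<lambda>x y. tens K H (tensor K H H) x (comult H y)) h =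
        sw K H (tensor K H (tensor K H H))
          (\<lambda>x y. sw K H (tensor K H (tensor K H H))
             (\<lambda>x1 x2. tens K H (tensor K H H) x1 (tens K H H x2 y)) x) h) \<and>
     (\<forall>h\<in>carrier H. sw K H H (\<lambda>x y. counit H x \<odot>\<^bsub>H\<^esub> y) h = h) \<and>
     (\<forall>h\<in>carrier H. sw K H H (\<lambda>x y. counit H y \<odot>\<^bsub>H\<^esub> x) h = h) \<and>
     (\<forall>h\<in>carrier H. sw K H H (\<lambda>x y. antipode H x \<otimes>\<^bsub>H\<^esub> y) h = counit H h \<odot>\<^bsub>H\<^esub> \<one>\<^bsub>H\<^esub>) \<and>
     (\<forall>h\<in>carrier H. sw K H H (\<lambda>x y. x \<otimes>\<^bsub>H\<^esub> antipode H y) h = counit H h \<odot>\<^bsub>H\<^esub> \<one>\<^bsub>H\<^esub>)"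

record ('k, 'h, 'a) comod_alg = "('k, 'a) module" +
  coact :: "'a \<Rightarrow> ('a, 'h) tens"

definition with_coact ::
  "('k, 'a, 'm) module_scheme \<Rightarrow> ('a \<Rightarrow> ('a, 'h) tens) \<Rightarrow> ('k, 'h, 'a) comod_alg" where
  "with_coact A d = \<lparr>carrier = carrier A, monoid.mult = monoid.mult A, monoid.one = monoid.one A,
     ring.zero = ring.zero A, ring.add = ring.add A, smult = smult A, coact = d\<rparr>"

definition comodule_algebra :: "'k ring \<Rightarrow> ('k, 'h) hopf \<Rightarrow> ('k, 'h, 'a) comod_alg \<Rightarrow> bool" where
  "comodule_algebra K H A \<longleftrightarrow>
     assoc_algebra K A \<and>
     coact A \<in> alg_hom K A (tensor K A H) \<and>
     (\<forall>a\<in>carrier A.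
        tensor_lift K A H (add_monoid (tensor K A (tensor K H H)))
          (\<lambda>x h. tens K A (tensor K H H) x (comult H h)) (coact A a) =
        tensor_lift K A H (add_monoid (tensor K A (tensor K H H)))
          (\<lambda>x h. tensor_lift K A H (add_monoid (tensor K A (tensor K H H)))
             (\<lambda>x0 x1. tens K A (tensor K H H) x0 (tens K H H x1 h)) (coact A x)) (coact A a)) \<and>
     (\<forall>a\<in>carrier A.
        tensor_lift K A H (add_monoid A) (\<lambda>x h. counit H h \<odot>\<^bsub>A\<^esub> x) (coact A a) = a)"

definition comod_alg_hom ::
  "'k ring \<Rightarrow> ('k, 'h) hopf \<Rightarrow> ('k, 'h, 'a) comod_alg \<Rightarrow> ('k, 'h, 'b) comod_alg \<Rightarrow> ('a \<Rightarrow> 'b) set"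
where
  "comod_alg_hom K H A B = {f \<in> alg_hom K A B. \<forall>a\<in>carrier A.
     coact B (f a) =
     tensor_lift K A H (add_monoid (tensor K B H)) (\<lambda>x h. tens K B H (f x) h) (coact A a)}"

definition comod_alg_iso ::
  "'k ring \<Rightarrow> ('k, 'h) hopf \<Rightarrow> ('k, 'h, 'a) comod_alg \<Rightarrow> ('k, 'h, 'b) comod_alg \<Rightarrow> ('a \<Rightarrow> 'b) set"
where
  "comod_alg_iso K H A B = {f. comodule_algebra K H A \<and> comodule_algebra K H B \<and>
     f \<in> comod_alg_hom K H A B \<and> bij_betw f (carrier A) (carrier B)}"


section \<open>Two-cocycles and twisted algebras\<close>

definition two_cocycle ::
  "'k ring \<Rightarrow> ('k, 'h) hopf \<Rightarrow> ('k, 'r) module \<Rightarrow> ('h \<Rightarrow> 'h \<Rightarrow> 'r) \<Rightarrow> bool" where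
  "two_cocycle K H R \<gamma> \<longleftrightarrow>
     \<gamma> \<in> bilin_map K H H R \<and>
     (\<forall>x\<in>carrier H. \<forall>y\<in>carrier H. \<forall>z\<in>carrier H.
        sw K H R (\<lambda>x1 x2. sw K H R (\<lambda>y1 y2. \<gamma> x1 y1 \<otimes>\<^bsub>R\<^esub> \<gamma> (x2 \<otimes>\<^bsub>H\<^esub> y2) z) y) x =
        sw K H R (\<lambda>y1 y2. sw K H R (\<lambda>z1 z2. \<gamma> y1 z1 \<otimes>\<^bsub>R\<^esub> \<gamma> x (y2 \<otimes>\<^bsub>H\<^esub> z2)) z) y)"

definition normalized_cocycle ::
  "('k, 'h) hopf \<Rightarrow> ('k, 'r) module \<Rightarrow> ('h \<Rightarrow> 'h \<Rightarrow> 'r) \<Rightarrow> bool" where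
  "normalized_cocycle H R \<gamma> \<longleftrightarrow> (\<forall>x\<in>carrier H.
     \<gamma> x \<one>\<^bsub>H\<^esub> = counit H x \<odot>\<^bsub>R\<^esub> \<one>\<^bsub>R\<^esub> \<and> \<gamma> \<one>\<^bsub>H\<^esub> x = counit H x \<odot>\<^bsub>R\<^esub> \<one>\<^bsub>R\<^esub>)"

text \<open>Convolution inverses in \<open>Hom (H \<otimes> H) R\<close>, whose elements are written as bilinear maps.\<close>

definition conv_inverse ::
  "'k ring \<Rightarrow> ('k, 'h) hopf \<Rightarrow> ('k, 'r) module \<Rightarrow> ('h \<Rightarrow> 'h \<Rightarrow> 'r) \<Rightarrow> ('h \<Rightarrow> 'h \<Rightarrow> 'r) \<Rightarrow> bool" where
  "conv_inverse K H R \<gamma> \<gamma>' \<longleftrightarrow>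
     \<gamma>' \<in> bilin_map K H H R \<and>
     (\<forall>x\<in>carrier H. \<forall>y\<in>carrier H.
        sw K H R (\<lambda>x1 x2. sw K H R (\<lambda>y1 y2. \<gamma> x1 y1 \<otimes>\<^bsub>R\<^esub> \<gamma>' x2 y2) y) x =
          (counit H x \<otimes>\<^bsub>K\<^esub> counit H y) \<odot>\<^bsub>R\<^esub> \<one>\<^bsub>R\<^esub> \<and>
        sw K H R (\<lambda>x1 x2. sw K H R (\<lambda>y1 y2. \<gamma>' x1 y1 \<otimes>\<^bsub>R\<^esub> \<gamma> x2 y2) y) x =
          (counit H x \<otimes>\<^bsub>K\<^esub> counit H y) \<odot>\<^bsub>R\<^esub> \<one>\<^bsub>R\<^esub>)"

definition conv_invertible ::
  "'k ring \<Rightarrow> ('k, 'h) hopf \<Rightarrow> ('k, 'r) module \<Rightarrow> ('h \<Rightarrow> 'h \<Rightarrow> 'r) \<Rightarrow> bool" where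
  "conv_invertible K H R \<gamma> \<longleftrightarrow> (\<exists>\<gamma>'. conv_inverse K H R \<gamma> \<gamma>')"

text \<open>\<open>R \<otimes>\<^sup>\<gamma> H\<close>. The argument \<open>u\<close> gives the unit \<open>u \<otimes> 1\<close>: it is \<open>1\<close> if \<open>\<gamma>\<close> is normalized, and
  \<open>\<gamma>(1,1)\<^sup>-\<^sup>1\<close> in general.\<close>

definition twisted_algebra ::
  "'k ring \<Rightarrow> ('k, 'h) hopf \<Rightarrow> ('k, 'r) module \<Rightarrow> ('h \<Rightarrow> 'h \<Rightarrow> 'r) \<Rightarrow> 'r
    \<Rightarrow> ('k, 'h, ('r, 'h) tens) comod_alg"
where
  "twisted_algebra K H R \<gamma> u = (let T = tensor K R H; TH = tensor K T H in
     with_coact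
       (T\<lparr>monoid.mult := (\<lambda>s t. tensor_lift K R H (add_monoid T)
            (\<lambda>b x. tensor_lift K R H (add_monoid T)
               (\<lambda>c y. sw K H T (\<lambda>x1 x2. sw K H T
                  (\<lambda>y1 y2. tens K R H (b \<otimes>\<^bsub>R\<^esub> c \<otimes>\<^bsub>R\<^esub> \<gamma> x1 y1) (x2 \<otimes>\<^bsub>H\<^esub> y2)) y) x) t) s),
          monoid.one := tens K R H u \<one>\<^bsub>H\<^esub>\<rparr>)
       (tensor_lift K R H (add_monoid TH)
          (\<lambda>b h. sw K H TH (\<lambda>h1 h2. tens K T H (tens K R H b h1) h2) h)))"

definition cocycle_algebra ::
  "'k ring \<Rightarrow> ('k, 'h) hopf \<Rightarrow> ('h \<Rightarrow> 'h \<Rightarrow> 'k) \<Rightarrow> ('k, 'h, ('k, 'h) tens) comod_alg" where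
  "cocycle_algebra K H \<alpha> = twisted_algebra K H (self_algebra K) \<alpha> \<one>\<^bsub>K\<^esub>"

definition nondegenerate :: "'k ring \<Rightarrow> ('k, 'h) hopf \<Rightarrow> ('h \<Rightarrow> 'h \<Rightarrow> 'k) \<Rightarrow> bool" where
  "nondegenerate K H \<alpha> \<longleftrightarrow>
     center (cocycle_algebra K H \<alpha>) =
       {c \<odot>\<^bsub>cocycle_algebra K H \<alpha>\<^esub> \<one>\<^bsub>cocycle_algebra K H \<alpha>\<^esub> | c. c \<in> carrier K}"


section \<open>Tensor algebras, symmetric algebras, fraction fields\<close>

text \<open>The free algebra on a set: finitely supported functions on words, with the product
  induced by concatenation.\<close>

definition free_algebra :: "'k ring \<Rightarrow> 'v set \<Rightarrow> ('k, 'v list \<Rightarrow> 'k) module" where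
  "free_algebra K X = \<lparr>carrier = {f. (\<forall>w. f w \<in> carrier K) \<and> (\<forall>w. w \<notin> lists X \<longrightarrow> f w = \<zero>\<^bsub>K\<^esub>) \<and>
        finite {w. f w \<noteq> \<zero>\<^bsub>K\<^esub>}},
     monoid.mult = (\<lambda>f g w. \<Oplus>\<^bsub>K\<^esub>i\<in>{..length w}. f (take i w) \<otimes>\<^bsub>K\<^esub> g (drop i w)),
     monoid.one = (\<lambda>w. if w = [] then \<one>\<^bsub>K\<^esub> else \<zero>\<^bsub>K\<^esub>),
     ring.zero = (\<lambda>w. \<zero>\<^bsub>K\<^esub>),
     ring.add = (\<lambda>f g w. f w \<oplus>\<^bsub>K\<^esub> g w),
     smult = (\<lambda>c f w. c \<otimes>\<^bsub>K\<^esub> f w)\<rparr>"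

definition free_var :: "'k ring \<Rightarrow> 'v \<Rightarrow> 'v list \<Rightarrow> 'k" where
  "free_var K v = (\<lambda>w. if w = [v] then \<one>\<^bsub>K\<^esub> else \<zero>\<^bsub>K\<^esub>)"

text \<open>The tensor algebra \<open>T(V)\<close> is the free algebra on the set \<open>V\<close> modulo the ideal that makes
  the generators \<open>X\<^sub>v\<close> depend linearly on \<open>v\<close>; \<open>S(V)\<close> is the quotient of \<open>T(V)\<close> by the commutators
  of the \<open>X\<^sub>v\<close>.\<close>

definition linearity_ideal :: "'k ring \<Rightarrow> ('k, 'v, 'm) module_scheme \<Rightarrow> ('v list \<Rightarrow> 'k) set" where
  "linearity_ideal K V = (let F = free_algebra K (carrier V) in
     Idl\<^bsub>F\<^esub>
      ({free_var K (u \<oplus>\<^bsub>V\<^esub> v) \<ominus>\<^bsub>F\<^esub> (free_var K u \<oplus>\<^bsub>F\<^esub> free_var K v) | u v.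
          u \<in> carrier V \<and> v \<in> carrier V} \<union>
       {free_var K (c \<odot>\<^bsub>V\<^esub> v) \<ominus>\<^bsub>F\<^esub> (c \<odot>\<^bsub>F\<^esub> free_var K v) | c v.
          c \<in> carrier K \<and> v \<in> carrier V}))"

definition tensor_algebra ::
  "'k ring \<Rightarrow> ('k, 'v, 'm) module_scheme \<Rightarrow> ('k, ('v list \<Rightarrow> 'k) set) module" where
  "tensor_algebra K V = quot_algebra (free_algebra K (carrier V)) (linearity_ideal K V)"

definition X_var ::
  "'k ring \<Rightarrow> ('k, 'v, 'm) module_scheme \<Rightarrow> 'v \<Rightarrow> ('v list \<Rightarrow> 'k) set" where
  "X_var K V v = linearity_ideal K V +>\<^bsub>free_algebra K (carrier V)\<^esub> free_var K v"

definition commutator_ideal ::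
  "'k ring \<Rightarrow> ('k, 'v, 'm) module_scheme \<Rightarrow> ('v list \<Rightarrow> 'k) set set" where
  "commutator_ideal K V = (let T = tensor_algebra K V in
     Idl\<^bsub>T\<^esub> {(X_var K V u \<otimes>\<^bsub>T\<^esub> X_var K V v) \<ominus>\<^bsub>T\<^esub> (X_var K V v \<otimes>\<^bsub>T\<^esub> X_var K V u) | u v.
        u \<in> carrier V \<and> v \<in> carrier V})"

definition symmetric_algebra ::
  "'k ring \<Rightarrow> ('k, 'v, 'm) module_scheme \<Rightarrow> ('k, ('v list \<Rightarrow> 'k) set set) module" where
  "symmetric_algebra K V = quot_algebra (tensor_algebra K V) (commutator_ideal K V)"

text \<open>The fraction \<open>a/s\<close> over a domain is the set of all equivalent pairs.\<close>

definition fraction :: "('a, 'm) ring_scheme \<Rightarrow> 'a \<Rightarrow> 'a \<Rightarrow> ('a \<times> 'a) set" where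
  "fraction R a s = {(b, u). b \<in> carrier R \<and> u \<in> carrier R - {\<zero>\<^bsub>R\<^esub>} \<and> a \<otimes>\<^bsub>R\<^esub> u = b \<otimes>\<^bsub>R\<^esub> s}"

definition fraction_field ::
  "('k, 'a, 'm) module_scheme \<Rightarrow> ('k, ('a \<times> 'a) set) module" where
  "fraction_field R = \<lparr>carrier = {fraction R a s | a s. a \<in> carrier R \<and> s \<in> carrier R - {\<zero>\<^bsub>R\<^esub>}},
     monoid.mult = (\<lambda>X Y. \<Union>(a, s)\<in>X. \<Union>(b, u)\<in>Y. fraction R (a \<otimes>\<^bsub>R\<^esub> b) (s \<otimes>\<^bsub>R\<^esub> u)),
     monoid.one = fraction R \<one>\<^bsub>R\<^esub> \<one>\<^bsub>R\<^esub>,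
     ring.zero = fraction R \<zero>\<^bsub>R\<^esub> \<one>\<^bsub>R\<^esub>,
     ring.add = (\<lambda>X Y. \<Union>(a, s)\<in>X. \<Union>(b, u)\<in>Y.
       fraction R ((a \<otimes>\<^bsub>R\<^esub> u) \<oplus>\<^bsub>R\<^esub> (b \<otimes>\<^bsub>R\<^esub> s)) (s \<otimes>\<^bsub>R\<^esub> u)),
     smult = (\<lambda>c X. \<Union>(a, s)\<in>X. fraction R (c \<odot>\<^bsub>R\<^esub> a) s)\<rparr>"


section \<open>The universal cocycle\<close>

type_synonym ('k, 'h) kh = "(('h list \<Rightarrow> 'k) set set \<times> ('h list \<Rightarrow> 'k) set set) set"

definition K_field :: "'k ring \<Rightarrow> ('k, 'h) hopf \<Rightarrow> ('k, ('k, 'h) kh) module" where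
  "K_field K H = fraction_field (symmetric_algebra K H)"

definition t_var :: "'k ring \<Rightarrow> ('k, 'h) hopf \<Rightarrow> 'h \<Rightarrow> ('k, 'h) kh" where
  "t_var K H h = fraction (symmetric_algebra K H)
     (commutator_ideal K H +>\<^bsub>tensor_algebra K H\<^esub> X_var K H h) \<one>\<^bsub>symmetric_algebra K H\<^esub>"

definition t_inv :: "'k ring \<Rightarrow> ('k, 'h) hopf \<Rightarrow> 'h \<Rightarrow> ('k, 'h) kh" where
  "t_inv K H = (SOME s. s \<in> lin_map K H (K_field K H) \<and> (\<forall>h\<in>carrier H.
     sw K H (K_field K H) (\<lambda>x y. t_var K H x \<otimes>\<^bsub>K_field K H\<^esub> s y) h =
       counit H h \<odot>\<^bsub>K_field K H\<^esub> \<one>\<^bsub>K_field K H\<^esub> \<and>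
     sw K H (K_field K H) (\<lambda>x y. s x \<otimes>\<^bsub>K_field K H\<^esub> t_var K H y) h =
       counit H h \<odot>\<^bsub>K_field K H\<^esub> \<one>\<^bsub>K_field K H\<^esub>))"

definition S_theta :: "'k ring \<Rightarrow> ('k, 'h) hopf \<Rightarrow> ('k, ('k, 'h) kh) module" where
  "S_theta K H = (K_field K H)\<lparr>carrier :=
     subalg_gen K (K_field K H) (t_var K H ` carrier H \<union> t_inv K H ` carrier H)\<rparr>"

definition cocycle_inv ::
  "'k ring \<Rightarrow> ('k, 'h) hopf \<Rightarrow> ('h \<Rightarrow> 'h \<Rightarrow> 'k) \<Rightarrow> 'h \<Rightarrow> 'h \<Rightarrow> 'k" where
  "cocycle_inv K H \<alpha> = (SOME \<alpha>'. conv_inverse K H (self_algebra K) \<alpha> \<alpha>')"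

definition sigma ::
  "'k ring \<Rightarrow> ('k, 'h) hopf \<Rightarrow> ('h \<Rightarrow> 'h \<Rightarrow> 'k) \<Rightarrow> 'h \<Rightarrow> 'h \<Rightarrow> ('k, 'h) kh" where
  "sigma K H \<alpha> x y = (let L = K_field K H in
     sw3 K H L (\<lambda>x1 x2 x3. sw3 K H L (\<lambda>y1 y2 y3.
       \<alpha> x2 y2 \<odot>\<^bsub>L\<^esub> (t_var K H x1 \<otimes>\<^bsub>L\<^esub> t_var K H y1 \<otimes>\<^bsub>L\<^esub> t_inv K H (x3 \<otimes>\<^bsub>H\<^esub> y3))) y) x)"

definition sigma_inv ::
  "'k ring \<Rightarrow> ('k, 'h) hopf \<Rightarrow> ('h \<Rightarrow> 'h \<Rightarrow> 'k) \<Rightarrow> 'h \<Rightarrow> 'h \<Rightarrow> ('k, 'h) kh" where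
  "sigma_inv K H \<alpha> x y = (let L = K_field K H in
     sw3 K H L (\<lambda>x1 x2 x3. sw3 K H L (\<lambda>y1 y2 y3.
       cocycle_inv K H \<alpha> x2 y2 \<odot>\<^bsub>L\<^esub>
         (t_var K H (x1 \<otimes>\<^bsub>H\<^esub> y1) \<otimes>\<^bsub>L\<^esub> t_inv K H x3 \<otimes>\<^bsub>L\<^esub> t_inv K H y3)) y) x)"

definition B_alg ::
  "'k ring \<Rightarrow> ('k, 'h) hopf \<Rightarrow> ('h \<Rightarrow> 'h \<Rightarrow> 'k) \<Rightarrow> ('k, ('k, 'h) kh) module" where
  "B_alg K H \<alpha> = (K_field K H)\<lparr>carrier := subalg_gen K (K_field K H)
     ({sigma K H \<alpha> x y | x y. x \<in> carrier H \<and> y \<in> carrier H} \<union>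
      {sigma_inv K H \<alpha> x y | x y. x \<in> carrier H \<and> y \<in> carrier H})\<rparr>"

definition A_alg ::
  "'k ring \<Rightarrow> ('k, 'h) hopf \<Rightarrow> ('h \<Rightarrow> 'h \<Rightarrow> 'k) \<Rightarrow> ('k, 'h, (('k, 'h) kh, 'h) tens) comod_alg" where
  "A_alg K H \<alpha> = twisted_algebra K H (B_alg K H \<alpha>) (sigma K H \<alpha>) (t_inv K H \<one>\<^bsub>H\<^esub>)"

definition S_theta_alpha ::
  "'k ring \<Rightarrow> ('k, 'h) hopf \<Rightarrow> ('h \<Rightarrow> 'h \<Rightarrow> 'k) \<Rightarrow> ('k, 'h, (('k, 'h) kh, 'h) tens) comod_alg" where
  "S_theta_alpha K H \<alpha> = twisted_algebra K H (S_theta K H)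
     (\<lambda>x y. \<alpha> x y \<odot>\<^bsub>S_theta K H\<^esub> \<one>\<^bsub>S_theta K H\<^esub>) \<one>\<^bsub>S_theta K H\<^esub>"

text \<open>The inverse of \<open>\<phi> : S(t\<^sub>H)\<^sub>\<Theta> \<otimes>\<^sup>\<sigma> H \<rightarrow> S(t\<^sub>H)\<^sub>\<Theta> \<otimes>\<^sup>\<alpha> H\<close>, \<open>\<phi>(b \<otimes> h) = \<Sum> b t\<^bsub>h(1)\<^esub> \<otimes> h\<^sub>(\<^sub>2\<^sub>)\<close>. Both
  twisted algebras have the underlying module \<open>S(t\<^sub>H)\<^sub>\<Theta> \<otimes> H\<close>.\<close>

definition phi_inv ::
  "'k ring \<Rightarrow> ('k, 'h) hopf \<Rightarrow> (('k, 'h) kh, 'h) tens \<Rightarrow> (('k, 'h) kh, 'h) tens" where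
  "phi_inv K H = (let L = S_theta K H; T = tensor K L H in
     tensor_lift K L H (add_monoid T)
       (\<lambda>b h. sw K H T (\<lambda>h1 h2. tens K L H (b \<otimes>\<^bsub>L\<^esub> t_inv K H h1) h2) h))"


section \<open>Identities\<close>

definition T_alg ::
  "'k ring \<Rightarrow> ('k, 'h) hopf \<Rightarrow> ('k, 'h, ('h list \<Rightarrow> 'k) set) comod_alg" where
  "T_alg K H = (let T = tensor_algebra K H; TH = tensor K T H in
     with_coact T (SOME d. d \<in> alg_hom K T TH \<and>
       (\<forall>h\<in>carrier H. d (X_var K H h) = sw K H TH (\<lambda>h1 h2. tens K T H (X_var K H h1) h2) h)))"

definition identities ::
  "'k ring \<Rightarrow> ('k, 'h) hopf \<Rightarrow> ('h \<Rightarrow> 'h \<Rightarrow> 'k) \<Rightarrow> ('h list \<Rightarrow> 'k) set set" where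
  "identities K H \<alpha> = {P \<in> carrier (T_alg K H).
     \<forall>\<mu> \<in> comod_alg_hom K H (T_alg K H) (cocycle_algebra K H \<alpha>). \<mu> P = \<zero>\<^bsub>cocycle_algebra K H \<alpha>\<^esub>}"

definition U_alg ::
  "'k ring \<Rightarrow> ('k, 'h) hopf \<Rightarrow> ('h \<Rightarrow> 'h \<Rightarrow> 'k) \<Rightarrow> ('k, 'h, ('h list \<Rightarrow> 'k) set set) comod_alg" where
  "U_alg K H \<alpha> =
    (let T = T_alg K H; I = identities K H \<alpha>; Q = quot_algebra T I; QH = tensor K Q H in
     with_coact Q (SOME d. d \<in> alg_hom K Q QH \<and>
       (\<forall>P\<in>carrier T. d (I +>\<^bsub>T\<^esub> P) =
          tensor_lift K T H (add_monoid QH) (\<lambda>P' h. tens K Q H (I +>\<^bsub>T\<^esub> P') h) (coact T P))))"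

text \<open>\<open>\<mu>\<^sub>\<alpha>\<close> and \<open>\<mu>\<^sub>\<sigma> = \<phi>\<^sup>-\<^sup>1 \<circ> \<mu>\<^sub>\<alpha>\<close>. The latter takes values in \<open>A\<close>, which is identified with its
  image under the map \<open>B \<otimes> H \<rightarrow> S(t\<^sub>H)\<^sub>\<Theta> \<otimes> H\<close> induced by the inclusion \<open>B \<subseteq> S(t\<^sub>H)\<^sub>\<Theta>\<close>.\<close>

definition mu_alpha ::
  "'k ring \<Rightarrow> ('k, 'h) hopf \<Rightarrow> ('h \<Rightarrow> 'h \<Rightarrow> 'k)
    \<Rightarrow> ('h list \<Rightarrow> 'k) set set \<Rightarrow> (('k, 'h) kh, 'h) tens"
where
  "mu_alpha K H \<alpha> = (SOME f. f \<in> alg_hom K (U_alg K H \<alpha>) (S_theta_alpha K H \<alpha>) \<and>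
     (\<forall>h\<in>carrier H. f (identities K H \<alpha> +>\<^bsub>T_alg K H\<^esub> X_var K H h) =
        sw K H (tensor K (S_theta K H) H) (\<lambda>h1 h2. tens K (S_theta K H) H (t_var K H h1) h2) h))"

definition A_incl ::
  "'k ring \<Rightarrow> ('k, 'h) hopf \<Rightarrow> ('h \<Rightarrow> 'h \<Rightarrow> 'k)
    \<Rightarrow> (('k, 'h) kh, 'h) tens \<Rightarrow> (('k, 'h) kh, 'h) tens"
where
  "A_incl K H \<alpha> = tensor_lift K (B_alg K H \<alpha>) H (add_monoid (tensor K (S_theta K H) H))
     (tens K (S_theta K H) H)"

definition mu_sigma ::
  "'k ring \<Rightarrow> ('k, 'h) hopf \<Rightarrow> ('h \<Rightarrow> 'h \<Rightarrow> 'k)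
    \<Rightarrow> ('h list \<Rightarrow> 'k) set set \<Rightarrow> (('k, 'h) kh, 'h) tens"
where
  "mu_sigma K H \<alpha> w = (THE a. a \<in> carrier (A_alg K H \<alpha>) \<and>
     A_incl K H \<alpha> a = phi_inv K H (mu_alpha K H \<alpha> w))"


section \<open>Nice cocycles and the tensor product over the center\<close>

text \<open>For nondegenerate \<open>\<alpha>\<close> and central \<open>z\<close>, \<open>mu_alpha_center\<close> sends \<open>z\<close> to the element \<open>b\<close> of \<open>B\<close>
  with \<open>\<mu>\<^sub>\<alpha>(z) = b \<otimes> 1\<close>.\<close>

definition mu_alpha_center ::
  "'k ring \<Rightarrow> ('k, 'h) hopf \<Rightarrow> ('h \<Rightarrow> 'h \<Rightarrow> 'k) \<Rightarrow> ('h list \<Rightarrow> 'k) set set \<Rightarrow> ('k, 'h) kh" where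
  "mu_alpha_center K H \<alpha> z = (THE b. b \<in> carrier (B_alg K H \<alpha>) \<and>
     mu_alpha K H \<alpha> z = tens K (S_theta K H) H b \<one>\<^bsub>H\<^esub>)"

definition nice :: "'k ring \<Rightarrow> ('k, 'h) hopf \<Rightarrow> ('h \<Rightarrow> 'h \<Rightarrow> 'k) \<Rightarrow> bool" where
  "nice K H \<alpha> \<longleftrightarrow> nondegenerate K H \<alpha> \<and>
     is_localization (B_alg K H \<alpha>) (mu_alpha_center K H \<alpha> ` center (U_alg K H \<alpha>))"

definition Z_ring ::
  "'k ring \<Rightarrow> ('k, 'h) hopf \<Rightarrow> ('h \<Rightarrow> 'h \<Rightarrow> 'k) \<Rightarrow> ('k, 'h, ('h list \<Rightarrow> 'k) set set) comod_alg" where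
  "Z_ring K H \<alpha> = (U_alg K H \<alpha>)\<lparr>carrier := center (U_alg K H \<alpha>)\<rparr>"

definition B_over_Z ::
  "'k ring \<Rightarrow> ('k, 'h) hopf \<Rightarrow> ('h \<Rightarrow> 'h \<Rightarrow> 'k)
    \<Rightarrow> (('h list \<Rightarrow> 'k) set set, ('k, 'h) kh) module"
where
  "B_over_Z K H \<alpha> =
     with_smult (B_alg K H \<alpha>) (\<lambda>z b. mu_alpha_center K H \<alpha> z \<otimes>\<^bsub>B_alg K H \<alpha>\<^esub> b)"

definition U_over_Z ::
  "'k ring \<Rightarrow> ('k, 'h) hopf \<Rightarrow> ('h \<Rightarrow> 'h \<Rightarrow> 'k)
    \<Rightarrow> (('h list \<Rightarrow> 'k) set set, ('h list \<Rightarrow> 'k) set set) module"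
where
  "U_over_Z K H \<alpha> = with_smult (U_alg K H \<alpha>) (monoid.mult (U_alg K H \<alpha>))"

definition BU_tens ::
  "'k ring \<Rightarrow> ('k, 'h) hopf \<Rightarrow> ('h \<Rightarrow> 'h \<Rightarrow> 'k) \<Rightarrow> ('k, 'h) kh \<Rightarrow> ('h list \<Rightarrow> 'k) set set
    \<Rightarrow> (('k, 'h) kh, ('h list \<Rightarrow> 'k) set set) tens"
where
  "BU_tens K H \<alpha> = tens (Z_ring K H \<alpha>) (B_over_Z K H \<alpha>) (U_over_Z K H \<alpha>)"

text \<open>\<open>B \<otimes>\<^sub>Z U\<close> as an algebra over the ground field (along \<open>c \<mapsto> c1 \<in> Z\<close>), with the coaction
  \<open>b \<otimes> w \<mapsto> \<Sum> (b \<otimes> w\<^sub>(\<^sub>0\<^sub>)) \<otimes> w\<^sub>(\<^sub>1\<^sub>)\<close>.\<close>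

definition BU_alg ::
  "'k ring \<Rightarrow> ('k, 'h) hopf \<Rightarrow> ('h \<Rightarrow> 'h \<Rightarrow> 'k)
    \<Rightarrow> ('k, 'h, (('k, 'h) kh, ('h list \<Rightarrow> 'k) set set) tens) comod_alg"
where
  "BU_alg K H \<alpha> =
    (let U = U_alg K H \<alpha>; T = tensor (Z_ring K H \<alpha>) (B_over_Z K H \<alpha>) (U_over_Z K H \<alpha>);
         TK = with_smult T (\<lambda>c s. (c \<odot>\<^bsub>U\<^esub> \<one>\<^bsub>U\<^esub>) \<odot>\<^bsub>T\<^esub> s); TKH = tensor K TK H in
     with_coact TK
       (tensor_lift (Z_ring K H \<alpha>) (B_over_Z K H \<alpha>) (U_over_Z K H \<alpha>) (add_monoid TKH)
          (\<lambda>b w. tensor_lift K U H (add_monoid TKH)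
             (\<lambda>w0 w1. tens K TK H (BU_tens K H \<alpha> b w0) w1) (coact U w))))"

text \<open>The left \<open>B\<close>-module structure \<open>b \<cdot> (c \<otimes> h) = bc \<otimes> h\<close> of \<open>A\<close>.\<close>

definition B_act ::
  "'k ring \<Rightarrow> ('k, 'h) hopf \<Rightarrow> ('h \<Rightarrow> 'h \<Rightarrow> 'k) \<Rightarrow> ('k, 'h) kh
    \<Rightarrow> (('k, 'h) kh, 'h) tens \<Rightarrow> (('k, 'h) kh, 'h) tens"
where
  "B_act K H \<alpha> b = tensor_lift K (B_alg K H \<alpha>) H (add_monoid (A_alg K H \<alpha>))
     (\<lambda>c h. tens K (B_alg K H \<alpha>) H (b \<otimes>\<^bsub>B_alg K H \<alpha>\<^esub> c) h)"

end

theory Submission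
  imports Defs "HOL-Algebra.UnivPoly"
begin

text \<open>Everything takes place in \<open>\<Omega> = S(t\<^sub>H)\<^sub>\<Theta> \<otimes>\<^sup>\<alpha> H\<close>. The elements \<open>\<tau>(h) = \<Sum> t\<^bsub>h(1)\<^esub> \<otimes> h\<^sub>(\<^sub>2\<^sub>)\<close>
  satisfy \<open>\<tau>(x) \<tau>(y) = \<Sum> \<sigma>(x\<^sub>(\<^sub>1\<^sub>), y\<^sub>(\<^sub>1\<^sub>)) \<tau>(x\<^sub>(\<^sub>2\<^sub>) y\<^sub>(\<^sub>2\<^sub>))\<close>, so \<open>b \<otimes> h \<mapsto> b \<tau>(h)\<close> is a morphism from \<open>A\<close>
  to \<open>\<Omega>\<close>; it is injective because \<open>b \<otimes> h \<mapsto> \<Sum> b t\<^sup>-\<^sup>1\<^bsub>h(1)\<^esub> \<otimes> h\<^sub>(\<^sub>2\<^sub>)\<close> inverts it. A polynomial over an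
  infinite field that vanishes at all linear functionals on \<open>H\<close> is zero, so an element of \<open>T(X\<^sub>H)\<close> is an
  identity iff the generic morphism \<open>X\<^sub>h \<mapsto> \<tau>(h)\<close> kills it. Hence \<open>U\<close> embeds into \<open>\<Omega>\<close>, with image in
  that of \<open>A\<close>.

  A central element of \<open>U\<close> commutes with all \<open>\<tau>(h)\<close>, which generate \<open>\<Omega>\<close> over \<open>S(t\<^sub>H)\<^sub>\<Theta>\<close>, and is therefore
  central in \<open>\<Omega>\<close>. Applying functionals of \<open>S(t\<^sub>H)\<^sub>\<Theta>\<close> yields central elements of \<open>\<^sup>\<alpha>H\<close>, so by nondegeneracy it
  has the form \<open>b \<otimes> 1\<close>. If \<open>B\<close> is a localization of \<open>Z\<close>, every element of \<open>B \<otimes>\<^sub>Z U\<close> is of the form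
  \<open>s\<^sup>-\<^sup>1 \<otimes> w\<close>, and \<open>s\<^sup>-\<^sup>1 \<mu>\<^sub>\<sigma>(w) = 0\<close> forces \<open>w = 0\<close>; surjectivity holds since the \<open>\<tau>(h)\<close> come from \<open>U\<close>. The
  comodule algebra axioms for \<open>A\<close>, \<open>U\<close> and \<open>B \<otimes>\<^sub>Z U\<close> are pulled back along these injections.\<close>

section \<open>Tensor products of modules\<close>

text \<open>Bases are avoided, as H may be infinite-dimensional: an element of M \<otimes> H is
  tested by the maps \<open>coef M \<kappa>\<close>, one for each functional \<kappa> of H, and
  Zorn's lemma supplies enough functionals.

  \<open>t_inv\<close> is a choice, so its existence has to be proved. Over the fraction field L the
  operator \<open>Tm\<close>, m \<otimes> h \<mapsto> \<Sum> m t_{h(2)} \<otimes> h(1), is L-linear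
  on L \<otimes> H. An L-linear \<psi> with \<psi>(\<open>Tm\<close> y) = (id \<otimes>
  \<epsilon>)(y) yields the left inverse h \<mapsto> \<psi>(1 \<otimes> h), and \<psi> exists once
  \<open>Tm\<close> is injective. Injectivity is proved for polynomials, by deforming along lines
  that start at the point \<epsilon>, where \<open>Tm\<close> becomes the identity.

  Product and coaction of B \<otimes>_Z U are nested choices of lifts. Their well-definedness is not
  verified directly: the additive bijection \<open>Phi\<close> onto A comes first, and the structure
  carried back through its inverse has the prescribed values on pure tensors, which identifies the
  lifts.\<close>

abbreviation "tlift R M N P f \<equiv> tensor_lift R M N (add_monoid P) f"
abbreviation "tmap R M N M' f \<equiv> tlift R M N (tensor R M' N) (\<lambda>x y. tens R M' N (f x) y)"

text \<open>The target is a mere group, so scalars can only be moved from one factor to the other;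
  linear targets enter through \<open>bilin_balanced\<close> and \<open>lin_lift\<close>.\<close>

definition balanced ::
  "('r, 'l) ring_scheme \<Rightarrow> ('r, 'a, 'm) module_scheme \<Rightarrow> ('r, 'b, 'n) module_scheme
    \<Rightarrow> ('c, 'p) monoid_scheme \<Rightarrow> ('a \<Rightarrow> 'b \<Rightarrow> 'c) \<Rightarrow> bool"
where
  "balanced R M N G f \<longleftrightarrow>
     (\<forall>x\<in>carrier M. \<forall>y\<in>carrier N. f x y \<in> carrier G) \<and>
     (\<forall>x\<in>carrier M. \<forall>x'\<in>carrier M. \<forall>y\<in>carrier N. f (x \<oplus>\<^bsub>M\<^esub> x') y = f x y \<otimes>\<^bsub>G\<^esub> f x' y) \<and>
     (\<forall>x\<in>carrier M. \<forall>y\<in>carrier N. \<forall>y'\<in>carrier N. f x (y \<oplus>\<^bsub>N\<^esub> y') = f x y \<otimes>\<^bsub>G\<^esub> f x y') \<and>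
     (\<forall>r\<in>carrier R. \<forall>x\<in>carrier M. \<forall>y\<in>carrier N. f (r \<odot>\<^bsub>M\<^esub> x) y = f x (r \<odot>\<^bsub>N\<^esub> y))"

lemma comm_group_add_monoid: "abelian_group A \<Longrightarrow> comm_group (add_monoid A)"
  by (simp add: abelian_group.a_comm_group)

context
  fixes R :: "('r, 'l) ring_scheme" and M :: "('r, 'a, 'm) module_scheme"
    and N :: "('r, 'b, 'n) module_scheme"
  assumes M: "module R M" and N: "module R N"
begin

interpretation M: module R M by (rule M)
interpretation N: module R N by (rule N)

abbreviation (input) tensor_free where "tensor_free \<equiv> free_Abelian_group (carrier M \<times> carrier N)"

lemma tensor_rels_subset: "tensor_rels R M N \<subseteq> carrier tensor_free"
proof -
  have *: "frag_of p - frag_of q \<in> carrier tensor_free"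
    if "p \<in> carrier M \<times> carrier N" "q \<in> carrier M \<times> carrier N" for p q
    using that keys_diff[of "frag_of p" "frag_of q"] by auto
  have **: "frag_of p - frag_of q - frag_of r \<in> carrier tensor_free"
    if "p \<in> carrier M \<times> carrier N" "q \<in> carrier M \<times> carrier N" "r \<in> carrier M \<times> carrier N" for p q r
    using *[OF that(1,2)] that(3) keys_diff[of "frag_of p - frag_of q" "frag_of r"] by auto
  show ?thesis
    unfolding tensor_rels_def
    by (intro Un_least subsetI; elim CollectE exE conjE; hypsubst; intro * **; simp)
qed

lemma tensor_ker_normal: "tensor_ker R M N \<lhd> tensor_free"
  unfolding tensor_ker_def
  by (rule comm_group.subgroup_imp_normal[OF abelian_free_Abelian_group
        group.generate_is_subgroup[OF group_free_Abelian_group tensor_rels_subset]])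

lemma tensor_group_comm: "comm_group (tensor_group R M N)"
  unfolding tensor_group_def
  by (simp add: abelian_free_Abelian_group comm_group.abelian_FactGroup
      normal_imp_subgroup tensor_ker_normal)

lemma tens_closed0: "x \<in> carrier M \<Longrightarrow> y \<in> carrier N \<Longrightarrow> tens R M N x y \<in> carrier (tensor_group R M N)"
  unfolding tens_def tensor_group_def carrier_FactGroup by auto

lemma tens_rel:
  assumes "c \<in> tensor_rels R M N" "c = a - b" "a \<in> carrier tensor_free" "b \<in> carrier tensor_free"
  shows "tensor_ker R M N #>\<^bsub>tensor_free\<^esub> a = tensor_ker R M N #>\<^bsub>tensor_free\<^esub> b"
proof -
  interpret N: normal "tensor_ker R M N" tensor_free by (rule tensor_ker_normal)
  have "c \<in> tensor_ker R M N" unfolding tensor_ker_def using assms(1) by (rule generate.incl)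
  then have "a \<in> tensor_ker R M N #>\<^bsub>tensor_free\<^esub> b"
    using assms(2) unfolding r_coset_def by (auto intro!: bexI[of _ c])
  then show ?thesis
    using assms(4) by (metis group.repr_independence group_free_Abelian_group normal_imp_subgroup tensor_ker_normal)
qed

lemma tens_add0:
  "x \<in> carrier M \<Longrightarrow> x' \<in> carrier M \<Longrightarrow> y \<in> carrier N \<Longrightarrow>
    tens R M N (x \<oplus>\<^bsub>M\<^esub> x') y = tens R M N x y \<otimes>\<^bsub>tensor_group R M N\<^esub> tens R M N x' y"
  "x \<in> carrier M \<Longrightarrow> y \<in> carrier N \<Longrightarrow> y' \<in> carrier N \<Longrightarrow>
    tens R M N x (y \<oplus>\<^bsub>N\<^esub> y') = tens R M N x y \<otimes>\<^bsub>tensor_group R M N\<^esub> tens R M N x y'"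
  "r \<in> carrier R \<Longrightarrow> x \<in> carrier M \<Longrightarrow> y \<in> carrier N \<Longrightarrow>
    tens R M N (r \<odot>\<^bsub>M\<^esub> x) y = tens R M N x (r \<odot>\<^bsub>N\<^esub> y)"
proof -
  interpret N: normal "tensor_ker R M N" tensor_free by (rule tensor_ker_normal)
  have fr: "frag_of p \<in> carrier tensor_free" if "p \<in> carrier M \<times> carrier N" for p
    using that by simp
  have sum: "tensor_ker R M N #>\<^bsub>tensor_free\<^esub> frag_of p =
      (tensor_ker R M N #>\<^bsub>tensor_free\<^esub> frag_of q) <#>\<^bsub>tensor_free\<^esub> (tensor_ker R M N #>\<^bsub>tensor_free\<^esub> frag_of q')"
    if "frag_of p - frag_of q - frag_of q' \<in> tensor_rels R M N"
      "p \<in> carrier M \<times> carrier N" "q \<in> carrier M \<times> carrier N" "q' \<in> carrier M \<times> carrier N" for p q q'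
  proof -
    have "frag_of q + frag_of q' \<in> carrier tensor_free"
      using fr[OF that(3)] fr[OF that(4)] keys_add[of "frag_of q" "frag_of q'"] by auto
    then have "tensor_ker R M N #>\<^bsub>tensor_free\<^esub> frag_of p = tensor_ker R M N #>\<^bsub>tensor_free\<^esub> (frag_of q + frag_of q')"
      using that fr by (intro tens_rel[OF that(1)]) (simp_all add: algebra_simps)
    then show ?thesis using N.rcos_sum[OF fr[OF that(3)] fr[OF that(4)]] by simp
  qed
  { assume *: "x \<in> carrier M" "x' \<in> carrier M" "y \<in> carrier N"
    then have "frag_of (x \<oplus>\<^bsub>M\<^esub> x', y) - frag_of (x, y) - frag_of (x', y) \<in> tensor_rels R M N"
      unfolding tensor_rels_def by blast
    from sum[OF this] * show "tens R M N (x \<oplus>\<^bsub>M\<^esub> x') y = tens R M N x y \<otimes>\<^bsub>tensor_group R M N\<^esub> tens R M N x' y"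
      unfolding tens_def tensor_group_def mult_FactGroup by simp }
  { assume *: "x \<in> carrier M" "y \<in> carrier N" "y' \<in> carrier N"
    then have "frag_of (x, y \<oplus>\<^bsub>N\<^esub> y') - frag_of (x, y) - frag_of (x, y') \<in> tensor_rels R M N"
      unfolding tensor_rels_def by blast
    from sum[OF this] * show "tens R M N x (y \<oplus>\<^bsub>N\<^esub> y') = tens R M N x y \<otimes>\<^bsub>tensor_group R M N\<^esub> tens R M N x y'"
      unfolding tens_def tensor_group_def mult_FactGroup by simp }
  { assume *: "r \<in> carrier R" "x \<in> carrier M" "y \<in> carrier N"
    then have "frag_of (r \<odot>\<^bsub>M\<^esub> x, y) - frag_of (x, r \<odot>\<^bsub>N\<^esub> y) \<in> tensor_rels R M N"
      unfolding tensor_rels_def by blast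
    then show "tens R M N (r \<odot>\<^bsub>M\<^esub> x) y = tens R M N x (r \<odot>\<^bsub>N\<^esub> y)"
      unfolding tens_def using * by (intro tens_rel) simp_all }
qed

text \<open>Negatives get no case of their own because -(x \<otimes> y) = (-x) \<otimes> y is again
  pure.\<close>

lemma tensor_group_induct:
  assumes "t \<in> carrier (tensor_group R M N)"
    and pure: "\<And>x y. x \<in> carrier M \<Longrightarrow> y \<in> carrier N \<Longrightarrow> P (tens R M N x y)"
    and add: "\<And>s t. s \<in> carrier (tensor_group R M N) \<Longrightarrow> t \<in> carrier (tensor_group R M N) \<Longrightarrow> P s \<Longrightarrow> P t
      \<Longrightarrow> P (s \<otimes>\<^bsub>tensor_group R M N\<^esub> t)"
  shows "P t"
proof -
  interpret N: normal "tensor_ker R M N" tensor_free by (rule tensor_ker_normal)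
  interpret T: comm_group "tensor_group R M N" by (rule tensor_group_comm)
  have inv_pure: "inv\<^bsub>tensor_group R M N\<^esub> tens R M N x y = tens R M N (\<ominus>\<^bsub>M\<^esub> x) y"
    if "x \<in> carrier M" "y \<in> carrier N" for x y
  proof -
    have z: "tens R M N \<zero>\<^bsub>M\<^esub> y = \<one>\<^bsub>tensor_group R M N\<^esub>"
      using tens_add0(1)[of "\<zero>\<^bsub>M\<^esub>" "\<zero>\<^bsub>M\<^esub>" y] that tens_closed0[of "\<zero>\<^bsub>M\<^esub>" y] by auto
    have "tens R M N (\<ominus>\<^bsub>M\<^esub> x) y \<otimes>\<^bsub>tensor_group R M N\<^esub> tens R M N x y = \<one>\<^bsub>tensor_group R M N\<^esub>"
      using tens_add0(1)[of "\<ominus>\<^bsub>M\<^esub> x" x y] that z by (simp add: M.M.l_neg)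
    then show ?thesis
      using that by (intro T.inv_equality) (simp_all add: tens_closed0)
  qed
  obtain u where u: "u \<in> carrier tensor_free" "t = tensor_ker R M N #>\<^bsub>tensor_free\<^esub> u"
    using assms(1) unfolding tensor_group_def carrier_FactGroup by auto
  let ?c = "\<lambda>u. tensor_ker R M N #>\<^bsub>tensor_free\<^esub> u"
  have cadd: "?c (a + b) = ?c a \<otimes>\<^bsub>tensor_group R M N\<^esub> ?c b" if "a \<in> carrier tensor_free" "b \<in> carrier tensor_free" for a b
    unfolding tensor_group_def mult_FactGroup using N.rcos_sum[OF that] by simp
  have cin: "?c a \<in> carrier (tensor_group R M N)" if "a \<in> carrier tensor_free" for a
    using that unfolding tensor_group_def carrier_FactGroup by auto
  have one: "tens R M N \<zero>\<^bsub>M\<^esub> \<zero>\<^bsub>N\<^esub> = \<one>\<^bsub>tensor_group R M N\<^esub>"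
    using tens_add0(1)[of "\<zero>\<^bsub>M\<^esub>" "\<zero>\<^bsub>M\<^esub>" "\<zero>\<^bsub>N\<^esub>"] tens_closed0[of "\<zero>\<^bsub>M\<^esub>" "\<zero>\<^bsub>N\<^esub>"] by auto
  have c0: "?c 0 = \<one>\<^bsub>tensor_group R M N\<^esub>"
    unfolding tensor_group_def one_FactGroup
    by (metis N.is_subgroup group.coset_mult_one group_free_Abelian_group one_free_Abelian_group subgroup.subset)
  have cneg: "?c (- b) = inv\<^bsub>tensor_group R M N\<^esub> ?c b" if "b \<in> carrier tensor_free" for b
    using cadd[of "-b" b] that cin[of b] cin[of "- b"] c0 by (intro T.inv_equality[symmetric]) auto
  \<comment> \<open>Induction on the free abelian group proceeds by subtraction, so \<open>P\<close>
    is carried for a coset and for its inverse at the same time.\<close>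
  have "P (?c u) \<and> P (inv\<^bsub>tensor_group R M N\<^esub> (?c u))"
  proof (rule free_Abelian_group_induct[OF u(1)[unfolded carrier_free_Abelian_group_iff]])
    show "P (?c 0) \<and> P (inv\<^bsub>tensor_group R M N\<^esub> ?c 0)"
      using pure[of "\<zero>\<^bsub>M\<^esub>" "\<zero>\<^bsub>N\<^esub>"] by (simp add: c0 one)
  next
    fix x y
    assume 2: "Poly_Mapping.keys x \<subseteq> carrier M \<times> carrier N" "Poly_Mapping.keys y \<subseteq> carrier M \<times> carrier N"
      "P (?c x) \<and> P (inv\<^bsub>tensor_group R M N\<^esub> ?c x)" "P (?c y) \<and> P (inv\<^bsub>tensor_group R M N\<^esub> ?c y)"
    then have eq: "?c (x - y) = ?c x \<otimes>\<^bsub>tensor_group R M N\<^esub> (inv\<^bsub>tensor_group R M N\<^esub> ?c y)"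
      using cadd[of x "- y"] cneg[of y] by simp
    moreover have "inv\<^bsub>tensor_group R M N\<^esub> ?c (x - y) =
        (inv\<^bsub>tensor_group R M N\<^esub> ?c x) \<otimes>\<^bsub>tensor_group R M N\<^esub> ?c y"
      using 2 cin[of x] cin[of y] unfolding eq by (simp add: T.inv_mult_group T.m_comm)
    ultimately show "P (?c (x - y)) \<and> P (inv\<^bsub>tensor_group R M N\<^esub> ?c (x - y))"
      using 2 cin[of x] cin[of y] by (auto intro!: add)
  next
    fix p assume "p \<in> carrier M \<times> carrier N"
    then show "P (?c (frag_of p)) \<and> P (inv\<^bsub>tensor_group R M N\<^esub> ?c (frag_of p))"
      using pure inv_pure by (cases p) (auto simp: tens_def[symmetric])
  qed
  with u show ?thesis by simp
qed

text \<open>The extension of \<open>f\<close> to the free abelian group kills each relation, hence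
  the subgroup they generate, and so factors through the quotient.\<close>

lemma tensor_lift_exists:
  fixes G :: "('c, 'p) monoid_scheme"
  assumes G: "comm_group G" and f: "balanced R M N G f"
  shows "\<exists>g \<in> hom (tensor_group R M N) G. \<forall>x\<in>carrier M. \<forall>y\<in>carrier N. g (tens R M N x y) = f x y"
proof -
  interpret G: comm_group G by (rule G)
  obtain h where h: "h \<in> hom tensor_free G" "\<And>p. p \<in> carrier M \<times> carrier N \<Longrightarrow> h (frag_of p) = case_prod f p"
    using G.free_Abelian_group_universal[of "case_prod f" "carrier M \<times> carrier N"] f
    unfolding balanced_def by (metis (no_types, lifting) SigmaE case_prod_conv image_subsetI)
  interpret h: group_hom tensor_free G h
    using h(1) by (simp add: group_hom_def group_hom_axioms_def)
  have hd: "h (a - b) = h a \<otimes>\<^bsub>G\<^esub> inv\<^bsub>G\<^esub> h b" if "a \<in> carrier tensor_free" "b \<in> carrier tensor_free" for a b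
    using h.hom_mult[of a "-b"] h.hom_inv[of b] that by simp
  have fr: "frag_of p \<in> carrier tensor_free" if "p \<in> carrier M \<times> carrier N" for p
    using that by simp
  have dcl: "a - b \<in> carrier tensor_free" if "a \<in> carrier tensor_free" "b \<in> carrier tensor_free" for a b
    using that keys_diff[of a b] by auto
  have cancel: "h (frag_of p - frag_of q - frag_of q') = \<one>\<^bsub>G\<^esub>"
    if "p \<in> carrier M \<times> carrier N" "q \<in> carrier M \<times> carrier N" "q' \<in> carrier M \<times> carrier N"
      "case_prod f p = case_prod f q \<otimes>\<^bsub>G\<^esub> case_prod f q'" for p q q'
  proof -
    have c: "h (frag_of q) \<in> carrier G" "h (frag_of q') \<in> carrier G"
      using that fr by (auto intro!: h.hom_closed simp del: carrier_free_Abelian_group_iff)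
    have "h (frag_of p - frag_of q - frag_of q') =
        (h (frag_of q') \<otimes>\<^bsub>G\<^esub> h (frag_of q)) \<otimes>\<^bsub>G\<^esub> inv\<^bsub>G\<^esub> h (frag_of q) \<otimes>\<^bsub>G\<^esub> inv\<^bsub>G\<^esub> h (frag_of q')"
      using that c G.m_comm[OF c] h(2) by (simp add: hd fr dcl del: carrier_free_Abelian_group_iff)
    also have "\<dots> = \<one>\<^bsub>G\<^esub>"
      using c by (simp add: G.m_assoc)
    finally show ?thesis .
  qed
  have "tensor_rels R M N \<subseteq> kernel tensor_free G h"
  proof
    fix c assume c: "c \<in> tensor_rels R M N"
    then have "h c = \<one>\<^bsub>G\<^esub>"
      unfolding tensor_rels_def
    proof (elim UnE CollectE exE conjE; hypsubst)
      fix x x' y assume "x \<in> carrier M" "x' \<in> carrier M" "y \<in> carrier N"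
      then show "h (frag_of (x \<oplus>\<^bsub>M\<^esub> x', y) - frag_of (x, y) - frag_of (x', y)) = \<one>\<^bsub>G\<^esub>"
        using f unfolding balanced_def by (intro cancel) auto
    next
      fix x y y' assume "x \<in> carrier M" "y \<in> carrier N" "y' \<in> carrier N"
      then show "h (frag_of (x, y \<oplus>\<^bsub>N\<^esub> y') - frag_of (x, y) - frag_of (x, y')) = \<one>\<^bsub>G\<^esub>"
        using f unfolding balanced_def by (intro cancel) auto
    next
      fix r x y assume "r \<in> carrier R" "x \<in> carrier M" "y \<in> carrier N"
      then show "h (frag_of (r \<odot>\<^bsub>M\<^esub> x, y) - frag_of (x, r \<odot>\<^bsub>N\<^esub> y)) = \<one>\<^bsub>G\<^esub>"
        using f hd[OF fr fr] h(2) unfolding balanced_def by simp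
    qed
    then show "c \<in> kernel tensor_free G h"
      using subsetD[OF tensor_rels_subset c] by (simp add: kernel_def)
  qed
  then have "tensor_ker R M N \<subseteq> kernel tensor_free G h"
    unfolding tensor_ker_def
    by (rule group.generate_subgroup_incl[OF group_free_Abelian_group _ h.subgroup_kernel])
  then obtain g where "g \<in> hom (tensor_free Mod tensor_ker R M N) G"
    "\<And>x. x \<in> carrier tensor_free \<Longrightarrow> g (tensor_ker R M N #>\<^bsub>tensor_free\<^esub> x) = h x"
    using h.FactGroup_universal_kernel[OF tensor_ker_normal] by blast
  then show ?thesis
    unfolding tensor_group_def tens_def using h(2) fr
    by (intro bexI[of _ g]) auto
qed

end

section \<open>Linear and bilinear maps, and the rules \<open>lin\<close> by which linearity of
  composite terms is proved\<close>

named_theorems lin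

lemma module_abelian: "module R M \<Longrightarrow> abelian_group M"
  by (simp add: module_def)

lemma lin_mapI:
  assumes "\<And>x. x \<in> carrier M \<Longrightarrow> f x \<in> carrier N"
    and "\<And>x y. x \<in> carrier M \<Longrightarrow> y \<in> carrier M \<Longrightarrow> f (x \<oplus>\<^bsub>M\<^esub> y) = f x \<oplus>\<^bsub>N\<^esub> f y"
    and "\<And>c x. c \<in> carrier R \<Longrightarrow> x \<in> carrier M \<Longrightarrow> f (c \<odot>\<^bsub>M\<^esub> x) = c \<odot>\<^bsub>N\<^esub> f x"
  shows "f \<in> lin_map R M N"
  using assms unfolding lin_map_def by blast

lemma lin_mapD:
  assumes "f \<in> lin_map R M N"
  shows "x \<in> carrier M \<Longrightarrow> f x \<in> carrier N"
    and "x \<in> carrier M \<Longrightarrow> y \<in> carrier M \<Longrightarrow> f (x \<oplus>\<^bsub>M\<^esub> y) = f x \<oplus>\<^bsub>N\<^esub> f y"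
    and "c \<in> carrier R \<Longrightarrow> x \<in> carrier M \<Longrightarrow> f (c \<odot>\<^bsub>M\<^esub> x) = c \<odot>\<^bsub>N\<^esub> f x"
  using assms unfolding lin_map_def by blast+

lemma bilin_mapI:
  assumes "\<And>x. x \<in> carrier M \<Longrightarrow> f x \<in> lin_map R N P"
    and "\<And>y. y \<in> carrier N \<Longrightarrow> (\<lambda>x. f x y) \<in> lin_map R M P"
  shows "f \<in> bilin_map R M N P"
  using assms unfolding bilin_map_def by blast

lemma bilin_mapD:
  assumes "f \<in> bilin_map R M N P"
  shows "x \<in> carrier M \<Longrightarrow> f x \<in> lin_map R N P"
    and "y \<in> carrier N \<Longrightarrow> (\<lambda>x. f x y) \<in> lin_map R M P"
    and "x \<in> carrier M \<Longrightarrow> y \<in> carrier N \<Longrightarrow> f x y \<in> carrier P"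
  using assms unfolding bilin_map_def lin_map_def by blast+

lemma lin_map_hom: "f \<in> lin_map R M N \<Longrightarrow> f \<in> hom (add_monoid M) (add_monoid N)"
  unfolding lin_map_def hom_def by auto

lemma lin_map_zero:
  assumes "f \<in> lin_map R M N" "abelian_group M" "abelian_group N"
  shows "f \<zero>\<^bsub>M\<^esub> = \<zero>\<^bsub>N\<^esub>"
  using group_hom.hom_one[of "add_monoid M" "add_monoid N" f] lin_map_hom[OF assms(1)]
    assms(2,3)[THEN abelian_group.a_group] by (simp add: group_hom_def group_hom_axioms_def)

lemma lin_map_inv:
  assumes "f \<in> lin_map R M N" "abelian_group M" "abelian_group N" "x \<in> carrier M"
  shows "f (\<ominus>\<^bsub>M\<^esub> x) = \<ominus>\<^bsub>N\<^esub> f x"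
  using group_hom.hom_inv[of "add_monoid M" "add_monoid N" f x] lin_map_hom[OF assms(1)]
    assms(2,3)[THEN abelian_group.a_group] assms(4)
  by (simp add: group_hom_def group_hom_axioms_def a_inv_def)

lemma lin_map_minus:
  assumes "f \<in> lin_map R M N" "abelian_group M" "abelian_group N" "x \<in> carrier M" "y \<in> carrier M"
  shows "f (x \<ominus>\<^bsub>M\<^esub> y) = f x \<ominus>\<^bsub>N\<^esub> f y"
  using assms by (simp add: a_minus_def lin_mapD lin_map_inv abelian_group.a_inv_closed)

lemma lin_map_inj:
  assumes "f \<in> lin_map R M N" "abelian_group M" "abelian_group N"
    and "\<And>x. x \<in> carrier M \<Longrightarrow> f x = \<zero>\<^bsub>N\<^esub> \<Longrightarrow> x = \<zero>\<^bsub>M\<^esub>"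
  shows "inj_on f (carrier M)"
proof (rule inj_onI)
  interpret M: abelian_group M by fact
  interpret N: abelian_group N by fact
  fix x y assume xy: "x \<in> carrier M" "y \<in> carrier M" "f x = f y"
  then have "f (x \<ominus>\<^bsub>M\<^esub> y) = \<zero>\<^bsub>N\<^esub>"
    using lin_map_minus[OF assms(1-3)] lin_mapD(1)[OF assms(1)] by (simp add: N.r_neg a_minus_def)
  then have "x \<ominus>\<^bsub>M\<^esub> y = \<zero>\<^bsub>M\<^esub>" using assms(4) xy by simp
  then show "x = y" using xy M.minus_equality[of x "\<ominus>\<^bsub>M\<^esub> y"] by (simp add: a_minus_def)
qed

lemma lin_comp: "g \<in> lin_map R N P \<Longrightarrow> f \<in> lin_map R M N \<Longrightarrow> (\<lambda>x. g (f x)) \<in> lin_map R M P"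
  unfolding lin_map_def by (simp add: Pi_iff)

lemma lin_id [lin]: "(\<lambda>x. x) \<in> lin_map R M M"
  unfolding lin_map_def by auto

lemma lin_add [lin]:
  assumes "module R N" "f \<in> lin_map R M N" "g \<in> lin_map R M N"
  shows "(\<lambda>x. f x \<oplus>\<^bsub>N\<^esub> g x) \<in> lin_map R M N"
proof -
  interpret N: module R N by fact
  show ?thesis
    using assms(2,3)[THEN lin_mapD(1)] assms(2,3)[THEN lin_mapD(2)] assms(2,3)[THEN lin_mapD(3)]
    by (intro lin_mapI) (simp_all add: N.a_ac N.smult_r_distr)
qed

lemma lin_const_smult [lin]:
  assumes "module R N" "f \<in> lin_map R M N" "c \<in> carrier R"
  shows "(\<lambda>x. c \<odot>\<^bsub>N\<^esub> f x) \<in> lin_map R M N"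
proof -
  interpret N: module R N by fact
  show ?thesis
    using assms(2)[THEN lin_mapD(1)] assms(2)[THEN lin_mapD(2)] assms(2)[THEN lin_mapD(3)] assms(3)
    by (intro lin_mapI) (simp_all add: N.smult_r_distr N.smult_assoc1[symmetric] N.R.m_comm)
qed

lemma lin_zero:
  assumes "module R N" shows "(\<lambda>x. \<zero>\<^bsub>N\<^esub>) \<in> lin_map R M N"
proof -
  interpret N: module R N by fact
  show ?thesis by (intro lin_mapI) simp_all
qed

lemma self_algebra_simps [simp]:
  "carrier (self_algebra R) = carrier R"
  "x \<oplus>\<^bsub>self_algebra R\<^esub> y = x \<oplus>\<^bsub>R\<^esub> y"
  "x \<otimes>\<^bsub>self_algebra R\<^esub> y = x \<otimes>\<^bsub>R\<^esub> y"
  "x \<odot>\<^bsub>self_algebra R\<^esub> y = x \<otimes>\<^bsub>R\<^esub> y"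
  "\<zero>\<^bsub>self_algebra R\<^esub> = \<zero>\<^bsub>R\<^esub>"
  "\<one>\<^bsub>self_algebra R\<^esub> = \<one>\<^bsub>R\<^esub>"
  by (simp_all add: self_algebra_def with_smult_def)

lemma lin_smult_const [lin]:
  assumes "module R N" "f \<in> lin_map R M (self_algebra R)" "y \<in> carrier N"
  shows "(\<lambda>x. f x \<odot>\<^bsub>N\<^esub> y) \<in> lin_map R M N"
proof -
  interpret N: module R N by fact
  show ?thesis
    using assms(2)[THEN lin_mapD(1)] assms(2)[THEN lin_mapD(2)] assms(2)[THEN lin_mapD(3)] assms(3)
    by (intro lin_mapI) (simp_all add: N.smult_l_distr N.smult_assoc1[symmetric])
qed

lemma bilin_balanced:
  assumes "module R P" "f \<in> bilin_map R M N P" shows "balanced R M N (add_monoid P) f"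
proof -
  show ?thesis
    using bilin_mapD(3)[OF assms(2)] bilin_mapD(1)[OF assms(2), THEN lin_mapD(2)]
      bilin_mapD(1)[OF assms(2), THEN lin_mapD(3)]
      bilin_mapD(2)[OF assms(2), THEN lin_mapD(2)] bilin_mapD(2)[OF assms(2), THEN lin_mapD(3)]
    unfolding balanced_def by simp
qed

section \<open>The tensor product as a module, and linear maps out of it\<close>

lemma carrier_tensor: "carrier (tensor R M N) = carrier (tensor_group R M N)"
  and add_tensor: "x \<oplus>\<^bsub>tensor R M N\<^esub> y = x \<otimes>\<^bsub>tensor_group R M N\<^esub> y"
  and zero_tensor: "\<zero>\<^bsub>tensor R M N\<^esub> = \<one>\<^bsub>tensor_group R M N\<^esub>"
  by (simp_all add: tensor_def)

lemma hom_add_monoid_tensor: "hom (add_monoid (tensor R M N)) G = hom (tensor_group R M N) G"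
  by (simp add: tensor_def hom_def)

lemma tensor_abelian [simp, intro]:
  assumes "module R M" "module R N" shows "abelian_group (tensor R M N)"
  using comm_groupE[OF tensor_group_comm[OF assms]]
  by (intro abelian_groupI) (auto simp: carrier_tensor add_tensor zero_tensor)

lemma tens_closed [simp, intro]:
  assumes "module R M" "module R N" "x \<in> carrier M" "y \<in> carrier N"
  shows "tens R M N x y \<in> carrier (tensor R M N)"
  using tens_closed0[OF assms] by (simp add: carrier_tensor)

lemma tens_add_l:
  assumes "module R M" "module R N" "x \<in> carrier M" "x' \<in> carrier M" "y \<in> carrier N"
  shows "tens R M N (x \<oplus>\<^bsub>M\<^esub> x') y = tens R M N x y \<oplus>\<^bsub>tensor R M N\<^esub> tens R M N x' y"
  using tens_add0(1)[OF assms] by (simp add: add_tensor)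

lemma tens_add_r:
  assumes "module R M" "module R N" "x \<in> carrier M" "y \<in> carrier N" "y' \<in> carrier N"
  shows "tens R M N x (y \<oplus>\<^bsub>N\<^esub> y') = tens R M N x y \<oplus>\<^bsub>tensor R M N\<^esub> tens R M N x y'"
  using tens_add0(2)[OF assms] by (simp add: add_tensor)

lemma tens_balanced:
  assumes "module R M" "module R N" "r \<in> carrier R" "x \<in> carrier M" "y \<in> carrier N"
  shows "tens R M N (r \<odot>\<^bsub>M\<^esub> x) y = tens R M N x (r \<odot>\<^bsub>N\<^esub> y)"
  using tens_add0(3)[OF assms] .

lemma tensor_induct [consumes 3, case_names pure add]:
  assumes "module R M" "module R N" "t \<in> carrier (tensor R M N)"
    and "\<And>x y. x \<in> carrier M \<Longrightarrow> y \<in> carrier N \<Longrightarrow> P (tens R M N x y)"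
    and "\<And>s t. s \<in> carrier (tensor R M N) \<Longrightarrow> t \<in> carrier (tensor R M N) \<Longrightarrow> P s \<Longrightarrow> P t
      \<Longrightarrow> P (s \<oplus>\<^bsub>tensor R M N\<^esub> t)"
  shows "P t"
  using tensor_group_induct[OF assms(1,2), of t P] assms(3-) by (simp add: carrier_tensor add_tensor)

lemma tensor_lift_ex:
  assumes "module R M" "module R N" "comm_group G" "balanced R M N G f"
  shows "tensor_lift R M N G f \<in> hom (tensor_group R M N) G \<and>
    (\<forall>x\<in>carrier M. \<forall>y\<in>carrier N. tensor_lift R M N G f (tens R M N x y) = f x y)"
proof -
  let ?P = "\<lambda>g. g \<in> hom (tensor_group R M N) G \<and>
      (\<forall>x\<in>carrier M. \<forall>y\<in>carrier N. g (tens R M N x y) = f x y)"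
  have "\<exists>g. ?P g"
    using tensor_lift_exists[OF assms] by blast
  then show ?thesis unfolding tensor_lift_def by (rule someI_ex[of ?P])
qed

lemma tensor_hom_unique:
  assumes "module R M" "module R N" "g \<in> hom (tensor_group R M N) G" "g' \<in> hom (tensor_group R M N) G"
    and "\<And>x y. x \<in> carrier M \<Longrightarrow> y \<in> carrier N \<Longrightarrow> g (tens R M N x y) = g' (tens R M N x y)"
    and "t \<in> carrier (tensor R M N)"
  shows "g t = g' t"
  using assms(1,2,6)
proof (induction t rule: tensor_induct)
  case (add s t) then show ?case using assms(3,4) by (simp add: hom_mult carrier_tensor add_tensor)
qed (use assms(5) in simp)

text \<open>A lift is a choice. One additive map with the prescribed values both shows that the
  choice succeeds and identifies its result; balancedness of \<open>f\<close> is then a consequence.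
  The product and the coaction on \<open>BUT\<close> are computed in this way.\<close>

lemma tensor_lift_eqI:
  assumes "module R M" "module R N" "g \<in> hom (tensor_group R M N) G"
    and "\<And>x y. x \<in> carrier M \<Longrightarrow> y \<in> carrier N \<Longrightarrow> g (tens R M N x y) = f x y"
    and "t \<in> carrier (tensor R M N)"
  shows "tensor_lift R M N G f t = g t"
proof -
  let ?h = "tensor_lift R M N G f"
  have h: "?h \<in> hom (tensor_group R M N) G \<and> (\<forall>x\<in>carrier M. \<forall>y\<in>carrier N. ?h (tens R M N x y) = f x y)"
    unfolding tensor_lift_def by (rule someI[of _ g]) (use assms(3,4) in blast)
  show ?thesis
    by (rule tensor_hom_unique[OF assms(1,2) _ assms(3) _ assms(5)]) (use h assms(4) in auto)
qed

lemma tensor_lift_cong: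
  assumes "\<And>x y. x \<in> carrier M \<Longrightarrow> y \<in> carrier N \<Longrightarrow> f x y = f' x y"
  shows "tensor_lift R M N G f = tensor_lift R M N G f'"
  unfolding tensor_lift_def using assms by (metis (no_types, lifting))

text \<open>A lift sees only the carrier and the addition of its target. Lifts into a twisted
  algebra therefore equal lifts into the underlying tensor product, and lifts into
  \<open>tensor_group\<close> equal lifts into \<open>tensor\<close>.\<close>

lemma tensor_lift_group_cong:
  assumes "carrier G = carrier G'" "monoid.mult G = monoid.mult G'"
  shows "tensor_lift R M N G f = tensor_lift R M N G' f"
proof -
  have "hom (tensor_group R M N) G = hom (tensor_group R M N) G'"
    using assms by (simp add: hom_def)
  then show ?thesis by (simp add: tensor_lift_def)
qed

lemma tensor_lift_tensor_group:
  "tensor_lift R M N (tensor_group R' M' N') f = tlift R M N (tensor R' M' N') f"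
  by (rule tensor_lift_group_cong) (simp_all add: tensor_def)

lemma tensor_lift_balanced:
  assumes "module R M" "module R N" "abelian_group P" "balanced R M N (add_monoid P) f"
  shows "x \<in> carrier M \<Longrightarrow> y \<in> carrier N \<Longrightarrow> tlift R M N P f (tens R M N x y) = f x y"
    and "t \<in> carrier (tensor R M N) \<Longrightarrow> tlift R M N P f t \<in> carrier P"
    and "s \<in> carrier (tensor R M N) \<Longrightarrow> t \<in> carrier (tensor R M N) \<Longrightarrow>
      tlift R M N P f (s \<oplus>\<^bsub>tensor R M N\<^esub> t) =
      tlift R M N P f s \<oplus>\<^bsub>P\<^esub> tlift R M N P f t"
  using tensor_lift_ex[OF assms(1,2) comm_group_add_monoid[OF assms(3)] assms(4)]
  by (auto simp: hom_def carrier_tensor add_tensor Pi_iff)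

lemma smult_tensor: "r \<odot>\<^bsub>tensor R M N\<^esub> t =
    tmap R M N M (\<lambda>x. r \<odot>\<^bsub>M\<^esub> x) t"
  unfolding tensor_lift_tensor_group[symmetric] by (simp add: tensor_def)

lemma smult_tensor_balanced:
  assumes "module R M" "module R N" "r \<in> carrier R"
  shows "balanced R M N (add_monoid (tensor R M N)) (\<lambda>x y. tens R M N (r \<odot>\<^bsub>M\<^esub> x) y)"
proof -
  interpret M: module R M by fact
  interpret N: module R N by fact
  show ?thesis
    using assms unfolding balanced_def
    by (simp add: M.smult_r_distr tens_add_l tens_add_r tens_balanced[symmetric]
        M.smult_assoc1[symmetric] M.R.m_comm)
qed

lemma smult_tens:
  assumes "module R M" "module R N" "r \<in> carrier R" "x \<in> carrier M" "y \<in> carrier N"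
  shows "r \<odot>\<^bsub>tensor R M N\<^esub> tens R M N x y = tens R M N (r \<odot>\<^bsub>M\<^esub> x) y"
  unfolding smult_tensor
  by (rule tensor_lift_balanced(1)) (use assms smult_tensor_balanced in auto)

lemma tensor_module [simp, intro]:
  assumes M: "module R M" and N: "module R N"
  shows "module R (tensor R M N)"
proof -
  interpret M: module R M by fact
  interpret N: module R N by fact
  interpret T: abelian_group "tensor R M N" using M N by simp
  note lift = tensor_lift_balanced[OF M N tensor_abelian[OF M N] smult_tensor_balanced[OF M N], folded smult_tensor]
  note pure = smult_tens[OF M N]
  note [simp] = tens_closed[OF M N]
  show ?thesis
  proof (intro module.intro module_axioms.intro)
    show "cring R" by (rule M.R.is_cring)
    show "abelian_group (tensor R M N)" using M N by simp
  next
    fix a x assume "a \<in> carrier R" "x \<in> carrier (tensor R M N)"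
    then show "a \<odot>\<^bsub>tensor R M N\<^esub> x \<in> carrier (tensor R M N)" by (rule lift(2))
  next
    fix a x y assume "a \<in> carrier R" "x \<in> carrier (tensor R M N)" "y \<in> carrier (tensor R M N)"
    then show "a \<odot>\<^bsub>tensor R M N\<^esub> (x \<oplus>\<^bsub>tensor R M N\<^esub> y) =
        a \<odot>\<^bsub>tensor R M N\<^esub> x \<oplus>\<^bsub>tensor R M N\<^esub> a \<odot>\<^bsub>tensor R M N\<^esub> y" by (rule lift(3))
  next
    fix a b x assume ab: "a \<in> carrier R" "b \<in> carrier R" and x: "x \<in> carrier (tensor R M N)"
    show "(a \<oplus>\<^bsub>R\<^esub> b) \<odot>\<^bsub>tensor R M N\<^esub> x = a \<odot>\<^bsub>tensor R M N\<^esub> x \<oplus>\<^bsub>tensor R M N\<^esub> b \<odot>\<^bsub>tensor R M N\<^esub> x"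
      using M N x
    proof (induction x rule: tensor_induct)
      case (add s t)
      then show ?case using ab lift(2) by (simp add: lift(3) T.a_ac)
    qed (use ab in \<open>simp add: pure M.smult_l_distr tens_add_l[OF M N]\<close>)
    show "(a \<otimes>\<^bsub>R\<^esub> b) \<odot>\<^bsub>tensor R M N\<^esub> x = a \<odot>\<^bsub>tensor R M N\<^esub> (b \<odot>\<^bsub>tensor R M N\<^esub> x)"
      using M N x
    proof (induction x rule: tensor_induct)
      case (add s t)
      then show ?case using ab lift(2) by (simp add: lift(3))
    qed (use ab in \<open>simp add: pure M.smult_assoc1\<close>)
  next
    fix x assume x: "x \<in> carrier (tensor R M N)"
    show "\<one>\<^bsub>R\<^esub> \<odot>\<^bsub>tensor R M N\<^esub> x = x"
      using M N x by (induction x rule: tensor_induct) (simp_all add: pure lift(3))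
  qed
qed

lemma lin_tens_l [lin]:
  assumes "module R M" "module R N" "f \<in> lin_map R Q M" "y \<in> carrier N"
  shows "(\<lambda>x. tens R M N (f x) y) \<in> lin_map R Q (tensor R M N)"
  using assms(1,2,4) lin_mapD[OF assms(3)] by (intro lin_mapI) (simp_all add: tens_add_l smult_tens)

lemma lin_tens_r [lin]:
  assumes "module R M" "module R N" "f \<in> lin_map R Q N" "x \<in> carrier M"
  shows "(\<lambda>y. tens R M N x (f y)) \<in> lin_map R Q (tensor R M N)"
  using assms(1,2,4) lin_mapD[OF assms(3)]
  by (intro lin_mapI) (simp_all add: tens_add_r smult_tens tens_balanced)

lemma bilin_tens: "module R M \<Longrightarrow> module R N \<Longrightarrow> tens R M N \<in> bilin_map R M N (tensor R M N)"
  by (intro bilin_mapI lin)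

lemma lift_tens [simp]:
  assumes "module R M" "module R N" "module R P" "f \<in> bilin_map R M N P" "x \<in> carrier M" "y \<in> carrier N"
  shows "tlift R M N P f (tens R M N x y) = f x y"
  using tensor_lift_balanced(1)[OF assms(1,2) _ bilin_balanced[OF assms(3,4)]] assms module_abelian by auto

lemma lin_lift [lin]:
  assumes "module R M" "module R N" "module R P" "f \<in> bilin_map R M N P"
  shows "tlift R M N P f \<in> lin_map R (tensor R M N) P"
proof -
  interpret P: module R P by fact
  interpret T: module R "tensor R M N" using assms by simp
  note lift = tensor_lift_balanced[OF assms(1,2) P.abelian_group_axioms bilin_balanced[OF assms(3,4)]]
  show ?thesis
  proof (intro lin_mapI lift(2,3))
    fix c t assume c: "c \<in> carrier R" and t: "t \<in> carrier (tensor R M N)"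
    show "tlift R M N P f (c \<odot>\<^bsub>tensor R M N\<^esub> t) = c \<odot>\<^bsub>P\<^esub> tlift R M N P f t"
      using assms(1,2) t
    proof (induction t rule: tensor_induct)
      case (pure x y)
      then show ?case using c assms lin_mapD(3)[OF bilin_mapD(2)[OF assms(4)]]
        by (simp add: smult_tens module.smult_closed)
    next
      case (add s t)
      then show ?case using c lift(2) by (simp add: lift(3) T.smult_r_distr P.smult_r_distr)
    qed
  qed
qed

lemma lin_lift_arg [lin]:
  assumes "module R M" "module R N" "module R P" "f \<in> bilin_map R M N P" "g \<in> lin_map R Q (tensor R M N)"
  shows "(\<lambda>x. tlift R M N P f (g x)) \<in> lin_map R Q P"
  using lin_comp[OF lin_lift[OF assms(1-4)] assms(5)] .

lemma lift_closed:
  assumes "module R M" "module R N" "module R P" "f \<in> bilin_map R M N P" "t \<in> carrier (tensor R M N)"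
  shows "tlift R M N P f t \<in> carrier P"
  using lin_mapD(1)[OF lin_lift[OF assms(1-4)] assms(5)] .

lemma lin_eq_tensor:
  assumes "module R M" "module R N" "f \<in> lin_map R (tensor R M N) P" "g \<in> lin_map R (tensor R M N) P"
    and "\<And>x y. x \<in> carrier M \<Longrightarrow> y \<in> carrier N \<Longrightarrow> f (tens R M N x y) = g (tens R M N x y)"
    and "t \<in> carrier (tensor R M N)"
  shows "f t = g t"
  using assms(1,2,6)
  by (induction t rule: tensor_induct) (simp_all add: assms(5) lin_mapD(2)[OF assms(3)] lin_mapD(2)[OF assms(4)])

lemma lift_eqI:
  assumes "module R M" "module R N" "f \<in> lin_map R (tensor R M N) P"
    and "\<And>x y. x \<in> carrier M \<Longrightarrow> y \<in> carrier N \<Longrightarrow> f (tens R M N x y) = g x y"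
    and "t \<in> carrier (tensor R M N)"
  shows "tlift R M N P g t = f t"
proof (rule tensor_lift_eqI[of R M N f "add_monoid P" g, OF assms(1,2) _ assms(4,5)])
  show "f \<in> hom (tensor_group R M N) (add_monoid P)"
    using lin_map_hom[OF assms(3)] by (simp add: hom_add_monoid_tensor)
qed

text \<open>For a parameter inside the lifted function: the two sides of additivity (and of
  homogeneity) are linear in \<open>t\<close> and have the same values on pure tensors, so
  \<open>lift_eqI\<close> identifies them.\<close>

lemma lin_lift_body [lin]:
  assumes "module R M" "module R N" "module R P" "t \<in> carrier (tensor R M N)"
    and f: "\<And>q. q \<in> carrier Q \<Longrightarrow> f q \<in> bilin_map R M N P"
    and l: "\<And>x y. x \<in> carrier M \<Longrightarrow> y \<in> carrier N \<Longrightarrow> (\<lambda>q. f q x y) \<in> lin_map R Q P"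
  shows "(\<lambda>q. tlift R M N P (f q) t) \<in> lin_map R Q P"
proof -
  interpret P: module R P by fact
  interpret M: module R M by fact
  note L = lin_mapD[OF lin_lift[OF assms(1-3) f]]
  note T = lin_mapD[OF l]
  have ab: "tlift R M N P (f (q \<oplus>\<^bsub>Q\<^esub> q')) t =
      tlift R M N P (f q) t \<oplus>\<^bsub>P\<^esub> tlift R M N P (f q') t"
    if "q \<in> carrier Q" "q' \<in> carrier Q" for q q'
  proof (rule lift_eqI[OF assms(1,2) _ _ assms(4)])
    show "(\<lambda>t. tlift R M N P (f q) t \<oplus>\<^bsub>P\<^esub> tlift R M N P (f q') t)
      \<in> lin_map R (tensor R M N) P"
      using that by (intro lin_add lin_lift assms f)
  qed (use that f assms T in simp)
  have sc: "tlift R M N P (f (c \<odot>\<^bsub>Q\<^esub> q)) t =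
      c \<odot>\<^bsub>P\<^esub> tlift R M N P (f q) t"
    if "q \<in> carrier Q" "c \<in> carrier R" for q c
  proof (rule lift_eqI[OF assms(1,2) _ _ assms(4)])
    show "(\<lambda>t. c \<odot>\<^bsub>P\<^esub> tlift R M N P (f q) t) \<in> lin_map R (tensor R M N) P"
      using that by (intro lin_const_smult lin_lift assms f)
  qed (use that f assms T in simp)
  show ?thesis
    by (intro lin_mapI ab sc L(1)) (use assms(4) in auto)
qed

lemma lift_map:
  assumes "module R M" "module R N" "module R P" "g \<in> lin_map R P Q" "f \<in> bilin_map R M N P"
    and "t \<in> carrier (tensor R M N)"
  shows "g (tlift R M N P f t) = tlift R M N Q (\<lambda>x y. g (f x y)) t"
  using lin_comp[OF assms(4) lin_lift[OF assms(1-3,5)]] assms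
  by (intro lift_eqI[symmetric]) simp_all

text \<open>Fubini for lifts: both iterated lifts are linear in \<open>s\<close>, and at a pure
  tensor both become the single lift of \<open>f x y\<close>.\<close>

lemma lift_swap:
  assumes M: "module R M" "module R N" and M': "module R M'" "module R N'" and "module R P"
    and "s \<in> carrier (tensor R M N)" "t \<in> carrier (tensor R M' N')"
    and f: "\<And>x y. x \<in> carrier M \<Longrightarrow> y \<in> carrier N \<Longrightarrow> f x y \<in> bilin_map R M' N' P"
    and f': "\<And>x' y'. x' \<in> carrier M' \<Longrightarrow> y' \<in> carrier N' \<Longrightarrow> (\<lambda>x y. f x y x' y') \<in> bilin_map R M N P"
  shows "tlift R M N P (\<lambda>x y. tlift R M' N' P (f x y) t) s =
    tlift R M' N' P (\<lambda>x' y'. tlift R M N P (\<lambda>x y. f x y x' y') s) t"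
proof (rule lift_eqI[OF M _ _ assms(6)])
  show "(\<lambda>s. tlift R M' N' P (\<lambda>x' y'. tlift R M N P (\<lambda>x y. f x y x' y') s) t)
     \<in> lin_map R (tensor R M N) P"
  proof (intro lin_lift_body M' assms(5,7))
    fix q assume q: "q \<in> carrier (tensor R M N)"
    show "(\<lambda>x' y'. tlift R M N P (\<lambda>x y. f x y x' y') q) \<in> bilin_map R M' N' P"
      using bilin_mapD(1)[OF f] bilin_mapD(2)[OF f]
      by (intro bilin_mapI lin_lift_body M assms(5) q f') auto
  qed (intro lin_lift M assms(5) f')
  fix x y assume "x \<in> carrier M" "y \<in> carrier N"
  then have "tlift R M N P (\<lambda>x y. f x y x' y') (tens R M N x y) = f x y x' y'"
    if "x' \<in> carrier M'" "y' \<in> carrier N'" for x' y'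
    using lift_tens[OF M assms(5) f'[OF that]] by simp
  then have "tlift R M' N' P (\<lambda>x' y'. tlift R M N P (\<lambda>x y. f x y x' y')
            (tens R M N x y)) = tlift R M' N' P (f x y)"
    by (rule tensor_lift_cong)
  then show "tlift R M' N' P (\<lambda>x' y'. tlift R M N P (\<lambda>x y. f x y x' y')
            (tens R M N x y)) t = tlift R M' N' P (f x y) t"
    by (rule fun_cong)
qed

section \<open>Associative algebras, their morphisms and their tensor products\<close>

lemma assoc_algebra_module: "assoc_algebra R A \<Longrightarrow> module R A"
  by (simp add: assoc_algebra_def)

lemma assoc_algebra_ring: "assoc_algebra R A \<Longrightarrow> ring A"
  by (simp add: assoc_algebra_def)

lemma assoc_algebra_abelian: "assoc_algebra R A \<Longrightarrow> abelian_group A"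
  by (simp add: assoc_algebra_def ring_def)

lemma lin_mult_l [lin]:
  assumes "assoc_algebra R A" "f \<in> lin_map R Q A" "a \<in> carrier A"
  shows "(\<lambda>x. f x \<otimes>\<^bsub>A\<^esub> a) \<in> lin_map R Q A"
proof -
  interpret assoc_algebra R A by fact
  show ?thesis using lin_mapD[OF assms(2)] assms(3)
    by (intro lin_mapI) (simp_all add: A.l_distr smult_mult_left)
qed

lemma lin_mult_r [lin]:
  assumes "assoc_algebra R A" "f \<in> lin_map R Q A" "a \<in> carrier A"
  shows "(\<lambda>x. a \<otimes>\<^bsub>A\<^esub> f x) \<in> lin_map R Q A"
proof -
  interpret assoc_algebra R A by fact
  show ?thesis using lin_mapD[OF assms(2)] assms(3)
    by (intro lin_mapI) (simp_all add: A.r_distr smult_mult_right)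
qed

lemma assoc_algebraI:
  assumes "module R A" and mult: "monoid.mult A \<in> bilin_map R A A A" and "\<one>\<^bsub>A\<^esub> \<in> carrier A"
    and "\<And>x y z. x \<in> carrier A \<Longrightarrow> y \<in> carrier A \<Longrightarrow> z \<in> carrier A \<Longrightarrow>
      (x \<otimes>\<^bsub>A\<^esub> y) \<otimes>\<^bsub>A\<^esub> z = x \<otimes>\<^bsub>A\<^esub> (y \<otimes>\<^bsub>A\<^esub> z)"
    and "\<And>x. x \<in> carrier A \<Longrightarrow> \<one>\<^bsub>A\<^esub> \<otimes>\<^bsub>A\<^esub> x = x"
    and "\<And>x. x \<in> carrier A \<Longrightarrow> x \<otimes>\<^bsub>A\<^esub> \<one>\<^bsub>A\<^esub> = x"
  shows "assoc_algebra R A"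
proof -
  interpret module R A by fact
  note m = bilin_mapD[OF mult]
  have "ring A"
    using assms(3-) m(3) lin_mapD(2)[OF m(1)] lin_mapD(2)[OF m(2)]
    by (intro ringI abelian_group_axioms monoidI) simp_all
  then show ?thesis
    using assms(1) lin_mapD(3)[OF m(1)] lin_mapD(3)[OF m(2)]
    by (simp add: assoc_algebra_def assoc_algebra_axioms_def)
qed

lemma alg_homI:
  assumes "f \<in> lin_map R A B"
    and "\<And>x y. x \<in> carrier A \<Longrightarrow> y \<in> carrier A \<Longrightarrow> f (x \<otimes>\<^bsub>A\<^esub> y) = f x \<otimes>\<^bsub>B\<^esub> f y"
    and "f \<one>\<^bsub>A\<^esub> = \<one>\<^bsub>B\<^esub>"
  shows "f \<in> alg_hom R A B"
  using assms lin_mapD[OF assms(1)] by (simp add: alg_hom_def ring_hom_def Pi_iff)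

lemma alg_homD:
  assumes "f \<in> alg_hom R A B"
  shows "f \<in> lin_map R A B"
    and "x \<in> carrier A \<Longrightarrow> f x \<in> carrier B"
    and "x \<in> carrier A \<Longrightarrow> y \<in> carrier A \<Longrightarrow> f (x \<otimes>\<^bsub>A\<^esub> y) = f x \<otimes>\<^bsub>B\<^esub> f y"
    and "f \<one>\<^bsub>A\<^esub> = \<one>\<^bsub>B\<^esub>"
    and "x \<in> carrier A \<Longrightarrow> y \<in> carrier A \<Longrightarrow> f (x \<oplus>\<^bsub>A\<^esub> y) = f x \<oplus>\<^bsub>B\<^esub> f y"
    and "c \<in> carrier R \<Longrightarrow> x \<in> carrier A \<Longrightarrow> f (c \<odot>\<^bsub>A\<^esub> x) = c \<odot>\<^bsub>B\<^esub> f x"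
  using assms by (auto simp: alg_hom_def ring_hom_def lin_map_def)

lemma alg_hom_comp: "g \<in> alg_hom R B C \<Longrightarrow> f \<in> alg_hom R A B \<Longrightarrow> (\<lambda>x. g (f x)) \<in> alg_hom R A C"
  by (intro alg_homI lin_comp[of g R B C f A]) (simp_all add: alg_homD)

lemma self_assoc_algebra [simp]:
  assumes "cring R" shows "assoc_algebra R (self_algebra R)"
proof -
  interpret cring R by fact
  have ab: "abelian_group (self_algebra R)"
    by (intro abelian_groupI) (auto simp: a_ac intro: exI[of _ "\<ominus>\<^bsub>R\<^esub> x" for x] l_neg)
  have m: "module R (self_algebra R)"
    using ab by (intro module.intro module_axioms.intro is_cring) (simp_all add: l_distr r_distr m_ac)
  show ?thesis
    by (intro assoc_algebraI m bilin_mapI lin_mapI) (simp_all add: l_distr r_distr m_ac)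
qed

lemma tensor_mult: "s \<otimes>\<^bsub>tensor R M N\<^esub> t = tlift R M N (tensor R M N)
    (\<lambda>x y. tlift R M N (tensor R M N)
      (\<lambda>x' y'. tens R M N (x \<otimes>\<^bsub>M\<^esub> x') (y \<otimes>\<^bsub>N\<^esub> y')) t) s"
  unfolding tensor_lift_tensor_group[symmetric] by (simp add: tensor_def)

lemma tensor_one: "\<one>\<^bsub>tensor R M N\<^esub> = tens R M N \<one>\<^bsub>M\<^esub> \<one>\<^bsub>N\<^esub>"
  by (simp add: tensor_def)

context
  fixes R :: "('r, 'l) ring_scheme" and A :: "('r, 'a, 'm) module_scheme"
    and B :: "('r, 'b, 'n) module_scheme"
  assumes A: "assoc_algebra R A" and B: "assoc_algebra R B"
begin

interpretation A: assoc_algebra R A by (rule A)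
interpretation B: assoc_algebra R B by (rule B)

lemma tensor_mult_bilin_aux:
  "x \<in> carrier A \<Longrightarrow> y \<in> carrier B \<Longrightarrow>
    (\<lambda>x' y'. tens R A B (x \<otimes>\<^bsub>A\<^esub> x') (y \<otimes>\<^bsub>B\<^esub> y')) \<in> bilin_map R A B (tensor R A B)"
  by (intro bilin_mapI lin A.module_axioms B.module_axioms A B) simp_all

lemma tensor_mult_bilin_aux2:
  assumes "t \<in> carrier (tensor R A B)"
  shows "(\<lambda>x y. tlift R A B (tensor R A B)
      (\<lambda>x' y'. tens R A B (x \<otimes>\<^bsub>A\<^esub> x') (y \<otimes>\<^bsub>B\<^esub> y')) t) \<in> bilin_map R A B (tensor R A B)"
  by (intro bilin_mapI lin A.module_axioms B.module_axioms A B tensor_module assms)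
    (simp_all add: A.module_axioms B.module_axioms)

lemma tens_mult_tens:
  assumes "x \<in> carrier A" "y \<in> carrier B" "x' \<in> carrier A" "y' \<in> carrier B"
  shows "tens R A B x y \<otimes>\<^bsub>tensor R A B\<^esub> tens R A B x' y' = tens R A B (x \<otimes>\<^bsub>A\<^esub> x') (y \<otimes>\<^bsub>B\<^esub> y')"
  unfolding tensor_mult
  using assms by (simp add: A.module_axioms B.module_axioms tensor_mult_bilin_aux tensor_mult_bilin_aux2)

lemma tensor_mult_bilin: "monoid.mult (tensor R A B) \<in> bilin_map R (tensor R A B) (tensor R A B) (tensor R A B)"
  unfolding tensor_mult
  by (intro bilin_mapI lin_lift lin_lift_body A.module_axioms B.module_axioms A B tensor_module
      tensor_mult_bilin_aux tensor_mult_bilin_aux2)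

lemma tensor_assoc_algebra: "assoc_algebra R (tensor R A B)"
proof -
  have mA: "module R A" and mB: "module R B" by (rule A.module_axioms, rule B.module_axioms)
  note m = bilin_mapD[OF tensor_mult_bilin]
  note l = lin_mapD(2)[OF m(1)] lin_mapD(2)[OF m(2)]
  let ?T = "tensor R A B"
  show ?thesis
  proof (rule assoc_algebraI)
    show "module R ?T" using mA mB by simp
    show "monoid.mult ?T \<in> bilin_map R ?T ?T ?T" by (rule tensor_mult_bilin)
    show "\<one>\<^bsub>?T\<^esub> \<in> carrier ?T" using mA mB by (simp add: tensor_one)
    fix x assume x: "x \<in> carrier ?T"
    show "\<one>\<^bsub>?T\<^esub> \<otimes>\<^bsub>?T\<^esub> x = x" using mA mB x
      by (induction x rule: tensor_induct) (simp_all add: tensor_one tens_mult_tens l mA mB)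
    show "x \<otimes>\<^bsub>?T\<^esub> \<one>\<^bsub>?T\<^esub> = x" using mA mB x
      by (induction x rule: tensor_induct) (simp_all add: tensor_one tens_mult_tens l mA mB)
    fix y z assume y: "y \<in> carrier ?T" and z: "z \<in> carrier ?T"
    show "(x \<otimes>\<^bsub>?T\<^esub> y) \<otimes>\<^bsub>?T\<^esub> z = x \<otimes>\<^bsub>?T\<^esub> (y \<otimes>\<^bsub>?T\<^esub> z)"
      using mA mB x
    proof (induction x rule: tensor_induct)
      case p1: (pure x1 x2)
      show ?case using mA mB y
      proof (induction y rule: tensor_induct)
        case p2: (pure y1 y2)
        show ?case using mA mB z
        proof (induction z rule: tensor_induct)
          case (pure z1 z2)
          then show ?case using p1 p2
            by (simp add: tens_mult_tens A.A.m_assoc B.A.m_assoc)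
        qed (use p1 p2 mA mB m(3) in \<open>simp add: l\<close>)
      qed (use p1 z mA mB m(3) in \<open>simp add: l\<close>)
    qed (use y z mA mB m(3) in \<open>simp add: l\<close>)
  qed
qed

end

lemma lin_tmap:
  assumes "module R M" "module R M'" "module R N" "f \<in> lin_map R M M'"
  shows "tmap R M N M' f
    \<in> lin_map R (tensor R M N) (tensor R M' N)"
  using assms lin_mapD(1)[OF assms(4)] by (intro lin bilin_mapI) auto

lemma bilin_tmap:
  assumes "module R M" "module R M'" "module R N" "f \<in> lin_map R M M'"
  shows "(\<lambda>x h. tens R M' N (f x) h) \<in> bilin_map R M N (tensor R M' N)"
  using assms lin_mapD(1)[OF assms(4)] by (intro lin bilin_mapI) auto

lemma alg_hom_tmap:
  assumes "assoc_algebra R A" "assoc_algebra R A'" "assoc_algebra R B" "f \<in> alg_hom R A A'"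
  shows "tmap R A B A' f
    \<in> alg_hom R (tensor R A B) (tensor R A' B)" (is "?F \<in> _")
proof -
  note f = alg_homD[OF assms(4)]
  note m = assms(1-3)[THEN assoc_algebra_module]
  interpret A: assoc_algebra R A by fact
  interpret B: assoc_algebra R B by fact
  have l: "?F \<in> lin_map R (tensor R A B) (tensor R A' B)"
    by (rule lin_tmap[OF m(1,2,3) f(1)])
  have p: "?F (tens R A B x y) = tens R A' B (f x) y" if "x \<in> carrier A" "y \<in> carrier B" for x y
    using that m bilin_tmap[OF m(1,2,3) f(1)] by simp
  note b = bilin_mapD[OF tensor_mult_bilin[OF assms(1,3)]]
  note b' = bilin_mapD[OF tensor_mult_bilin[OF assms(2,3)]]
  show ?thesis
  proof (rule alg_homI[OF l])
    show "?F \<one>\<^bsub>tensor R A B\<^esub> = \<one>\<^bsub>tensor R A' B\<^esub>"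
      by (simp add: tensor_one p f(4))
    fix s t assume s: "s \<in> carrier (tensor R A B)" and t: "t \<in> carrier (tensor R A B)"
    show "?F (s \<otimes>\<^bsub>tensor R A B\<^esub> t) = ?F s \<otimes>\<^bsub>tensor R A' B\<^esub> ?F t"
      using m(1,3) s
    proof (induction s rule: tensor_induct)
      case p1: (pure x y)
      show ?case using m(1,3) t
      proof (induction t rule: tensor_induct)
        case (pure x' y')
        then show ?case using p1 f
          by (simp add: tens_mult_tens[OF assms(1,3)] tens_mult_tens[OF assms(2,3)] p)
      next
        case (add s' t')
        then show ?case using p1 m f lin_mapD(1)[OF l] b(3)
          by (simp add: lin_mapD(2)[OF b(1)] lin_mapD(2)[OF b'(1)] lin_mapD(2)[OF l])
      qed
    next
      case (add s1 s2)
      then show ?case using t m f lin_mapD(1)[OF l] b(3)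
        by (simp add: lin_mapD(2)[OF b(2)] lin_mapD(2)[OF b'(2)] lin_mapD(2)[OF l])
    qed
  qed
qed

section \<open>Sweedler calculus\<close>

locale hopf =
  fixes K :: "'k ring" and H :: "('k, 'h) hopf" (structure)
  assumes K: "field K" and hopf: "hopf_algebra K H"
begin

sublocale K: field K by (rule K)

lemma H_alg [simp]: "assoc_algebra K H"
  using hopf by (simp add: hopf_algebra_def)

sublocale H: assoc_algebra K H by (rule H_alg)

lemma H_mod [simp]: "module K H" by (rule H.module_axioms)

lemma K_alg [simp]: "assoc_algebra K (self_algebra K)"
  by (rule self_assoc_algebra) (rule K.is_cring)

lemma K_mod [simp]: "module K (self_algebra K)"
  by (rule assoc_algebra_module) simp

lemma comult_hom: "comult H \<in> alg_hom K H (tensor K H H)"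
  and counit_hom: "counit H \<in> alg_hom K H (self_algebra K)"
  using hopf by (simp_all add: hopf_algebra_def)

lemma comult_lin: "comult H \<in> lin_map K H (tensor K H H)"
  using comult_hom by (rule alg_homD)

lemma comult_closed [simp]: "h \<in> carrier H \<Longrightarrow> comult H h \<in> carrier (tensor K H H)"
  using comult_lin by (rule lin_mapD)

lemma lin_comult [lin]: "f \<in> lin_map K Q H \<Longrightarrow> (\<lambda>x. comult H (f x)) \<in> lin_map K Q (tensor K H H)"
  by (rule lin_comp[OF comult_lin])

lemma lin_counit [lin]: "f \<in> lin_map K Q H \<Longrightarrow> (\<lambda>x. counit H (f x)) \<in> lin_map K Q (self_algebra K)"
  by (rule lin_comp[OF alg_homD(1)[OF counit_hom]])

lemma counit_closed [simp]: "h \<in> carrier H \<Longrightarrow> counit H h \<in> carrier K"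
  using alg_homD(2)[OF counit_hom] by simp

lemma counit_one [simp]: "counit H \<one> = \<one>\<^bsub>K\<^esub>"
  using alg_homD(4)[OF counit_hom] by simp

lemma counit_mult [simp]:
  "x \<in> carrier H \<Longrightarrow> y \<in> carrier H \<Longrightarrow> counit H (x \<otimes> y) = counit H x \<otimes>\<^bsub>K\<^esub> counit H y"
  using alg_homD(3)[OF counit_hom] by simp

lemma lin_sw_arg [lin]:
  "module K P \<Longrightarrow> f \<in> bilin_map K H H P \<Longrightarrow> g \<in> lin_map K Q H \<Longrightarrow> (\<lambda>x. sw K H P f (g x)) \<in> lin_map K Q P"
  unfolding sw_def by (intro lin_lift_arg lin_comult) simp_all

lemma lin_sw_body [lin]:
  assumes "module K P" "h \<in> carrier H"
    and "\<And>q. q \<in> carrier Q \<Longrightarrow> f q \<in> bilin_map K H H P"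
    and "\<And>x y. x \<in> carrier H \<Longrightarrow> y \<in> carrier H \<Longrightarrow> (\<lambda>q. f q x y) \<in> lin_map K Q P"
  shows "(\<lambda>q. sw K H P (f q) h) \<in> lin_map K Q P"
  unfolding sw_def using assms by (intro lin_lift_body) simp_all

lemma sw_lin: "module K P \<Longrightarrow> f \<in> bilin_map K H H P \<Longrightarrow> sw K H P f \<in> lin_map K H P"
  using lin_sw_arg[of P f "\<lambda>x. x" H] by (simp add: lin_id)

lemma sw_closed: "module K P \<Longrightarrow> f \<in> bilin_map K H H P \<Longrightarrow> h \<in> carrier H \<Longrightarrow> sw K H P f h \<in> carrier P"
  by (rule lin_mapD(1)[OF sw_lin])

lemma sw_cong:
  "(\<And>x y. x \<in> carrier H \<Longrightarrow> y \<in> carrier H \<Longrightarrow> f x y = g x y) \<Longrightarrow> sw K H P f h = sw K H P g h"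
  unfolding sw_def by (intro fun_cong[OF tensor_lift_cong])

lemma sw_map:
  assumes "module K P" "g \<in> lin_map K P Q" "f \<in> bilin_map K H H P" "h \<in> carrier H"
  shows "g (sw K H P f h) = sw K H Q (\<lambda>x y. g (f x y)) h"
  unfolding sw_def using assms by (intro lift_map) simp_all

lemma sw_swap:
  assumes "module K P" "x \<in> carrier H" "y \<in> carrier H"
    and "\<And>x1 x2. x1 \<in> carrier H \<Longrightarrow> x2 \<in> carrier H \<Longrightarrow> f x1 x2 \<in> bilin_map K H H P"
    and "\<And>y1 y2. y1 \<in> carrier H \<Longrightarrow> y2 \<in> carrier H \<Longrightarrow> (\<lambda>x1 x2. f x1 x2 y1 y2) \<in> bilin_map K H H P"
  shows "sw K H P (\<lambda>x1 x2. sw K H P (f x1 x2) y) x =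
    sw K H P (\<lambda>y1 y2. sw K H P (\<lambda>x1 x2. f x1 x2 y1 y2) x) y"
  unfolding sw_def using assms by (intro lift_swap) simp_all

text \<open>In \<open>hopf_algebra\<close> coassociativity is an equation in H \<otimes> (H
  \<otimes> H). A trilinear \<open>f\<close> induces a linear map \<open>?F\<close> on that module,
  and applying \<open>?F\<close> to the equation gives the Sweedler form.\<close>

lemma sw_assoc:
  assumes P: "module K P" and h: "h \<in> carrier H"
    and f1: "\<And>x. x \<in> carrier H \<Longrightarrow> f x \<in> bilin_map K H H P"
    and f2: "\<And>y z. y \<in> carrier H \<Longrightarrow> z \<in> carrier H \<Longrightarrow> (\<lambda>x. f x y z) \<in> lin_map K H P"
  shows "sw K H P (\<lambda>x y. sw K H P (f x) y) h = sw K H P (\<lambda>x y. sw K H P (\<lambda>x1 x2. f x1 x2 y) x) h"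
proof -
  let ?T2 = "tensor K H H" let ?T3 = "tensor K H (tensor K H H)"
  let ?G = "\<lambda>x t. tlift K H H P (f x) t"
  let ?F = "tlift K H ?T2 P ?G"
  have b: "?G \<in> bilin_map K H ?T2 P"
    by (intro bilin_mapI lin_lift lin_lift_body H_mod P f1 f2)
  have F: "?F \<in> lin_map K ?T3 P"
    by (intro lin_lift P b) simp_all
  have Fp: "?F (tens K H ?T2 x t) = ?G x t" if "x \<in> carrier H" "t \<in> carrier ?T2" for x t
    using that b P by simp
  have b1: "(\<lambda>x y. tens K H ?T2 x (comult H y)) \<in> bilin_map K H H ?T3"
    by (intro bilin_mapI lin) simp_all
  have b2: "(\<lambda>x1 x2. tens K H ?T2 x1 (tens K H H x2 y)) \<in> bilin_map K H H ?T3" if "y \<in> carrier H" for y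
    using that by (intro bilin_mapI lin) simp_all
  have b3: "(\<lambda>x y. sw K H ?T3 (\<lambda>x1 x2. tens K H ?T2 x1 (tens K H H x2 y)) x) \<in> bilin_map K H H ?T3"
    by (intro bilin_mapI lin b2) simp_all
  have "sw K H ?T3 (\<lambda>x y. tens K H ?T2 x (comult H y)) h =
      sw K H ?T3 (\<lambda>x y. sw K H ?T3 (\<lambda>x1 x2. tens K H ?T2 x1 (tens K H H x2 y)) x) h"
    using hopf h by (simp add: hopf_algebra_def)
  then have "sw K H P (\<lambda>x y. ?F (tens K H ?T2 x (comult H y))) h =
     sw K H P (\<lambda>x y. ?F (sw K H ?T3 (\<lambda>x1 x2. tens K H ?T2 x1 (tens K H H x2 y)) x)) h"
    using sw_map[OF _ F b1 h] sw_map[OF _ F b3 h] by simp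
  also have "sw K H P (\<lambda>x y. ?F (tens K H ?T2 x (comult H y))) h = sw K H P (\<lambda>x y. sw K H P (f x) y) h"
    by (rule sw_cong) (simp add: Fp sw_def)
  also have "sw K H P (\<lambda>x y. ?F (sw K H ?T3 (\<lambda>x1 x2. tens K H ?T2 x1 (tens K H H x2 y)) x)) h =
     sw K H P (\<lambda>x y. sw K H P (\<lambda>x1 x2. f x1 x2 y) x) h"
  proof (rule sw_cong)
    fix x y assume xy: "x \<in> carrier H" "y \<in> carrier H"
    have "?F (sw K H ?T3 (\<lambda>x1 x2. tens K H ?T2 x1 (tens K H H x2 y)) x) =
        sw K H P (\<lambda>x1 x2. ?F (tens K H ?T2 x1 (tens K H H x2 y))) x"
      using xy by (intro sw_map F b2) simp_all
    also have "\<dots> = sw K H P (\<lambda>x1 x2. f x1 x2 y) x"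
      using xy by (intro sw_cong) (simp add: Fp P f1)
    finally show "?F (sw K H ?T3 (\<lambda>x1 x2. tens K H ?T2 x1 (tens K H H x2 y)) x) =
       sw K H P (\<lambda>x1 x2. f x1 x2 y) x" .
  qed
  finally show ?thesis .
qed

lemma sw_counit_l:
  assumes "module K P" "f \<in> lin_map K H P" "h \<in> carrier H"
  shows "sw K H P (\<lambda>x y. counit H x \<odot>\<^bsub>P\<^esub> f y) h = f h"
proof -
  have "f (sw K H H (\<lambda>x y. counit H x \<odot> y) h) = sw K H P (\<lambda>x y. f (counit H x \<odot> y)) h"
    using assms by (intro sw_map bilin_mapI lin) simp_all
  then show ?thesis
    using hopf assms(3) by (simp add: hopf_algebra_def lin_mapD(3)[OF assms(2)] cong: sw_cong)
qed

lemma sw_counit_r: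
  assumes "module K P" "f \<in> lin_map K H P" "h \<in> carrier H"
  shows "sw K H P (\<lambda>x y. counit H y \<odot>\<^bsub>P\<^esub> f x) h = f h"
proof -
  have "f (sw K H H (\<lambda>x y. counit H y \<odot> x) h) = sw K H P (\<lambda>x y. f (counit H y \<odot> x)) h"
    using assms by (intro sw_map bilin_mapI lin) simp_all
  then show ?thesis
    using hopf assms(3) by (simp add: hopf_algebra_def lin_mapD(3)[OF assms(2)] cong: sw_cong)
qed

lemma sw_one:
  assumes "module K P" "f \<in> bilin_map K H H P"
  shows "sw K H P f \<one> = f \<one> \<one>"
  unfolding sw_def using alg_homD(4)[OF comult_hom] assms by (simp add: tensor_one)

text \<open>Multiplicativity of \<Delta> in Sweedler form. It is proved for arbitrary tensors
  \<open>s\<close>, \<open>t\<close> in place of \<Delta>(x), \<Delta>(y), because there it may be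
  checked on pure tensors.\<close>

lemma sw_mult:
  assumes P: "module K P" and f: "f \<in> bilin_map K H H P" and "x \<in> carrier H" "y \<in> carrier H"
  shows "sw K H P f (x \<otimes> y) =
    sw K H P (\<lambda>x1 x2. sw K H P (\<lambda>y1 y2. f (x1 \<otimes> y1) (x2 \<otimes> y2)) y) x"
proof -
  let ?T = "tensor K H H" let ?F = "tlift K H H P f"
  have bf: "(\<lambda>y1 y2. f (x1 \<otimes> y1) (x2 \<otimes> y2)) \<in> bilin_map K H H P"
    if "x1 \<in> carrier H" "x2 \<in> carrier H" for x1 x2
    using that lin_comp[OF bilin_mapD(1)[OF f] lin_mult_r[OF H_alg lin_id]]
      lin_comp[OF bilin_mapD(2)[OF f] lin_mult_r[OF H_alg lin_id]]
    by (intro bilin_mapI) simp_all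
  have bf2: "(\<lambda>x1 x2. f (x1 \<otimes> y1) (x2 \<otimes> y2)) \<in> bilin_map K H H P"
    if "y1 \<in> carrier H" "y2 \<in> carrier H" for y1 y2
    using that lin_comp[OF bilin_mapD(1)[OF f] lin_mult_l[OF H_alg lin_id]]
      lin_comp[OF bilin_mapD(2)[OF f] lin_mult_l[OF H_alg lin_id]]
    by (intro bilin_mapI) simp_all
  have bf3: "(\<lambda>x1 x2. tlift K H H P (\<lambda>y1 y2. f (x1 \<otimes> y1) (x2 \<otimes> y2)) t)
     \<in> bilin_map K H H P" if "t \<in> carrier ?T" for t
    using that P bilin_mapD(1)[OF bf2] bilin_mapD(2)[OF bf2]
    by (intro bilin_mapI lin_lift_body bf) simp_all
  note b = bilin_mapD[OF tensor_mult_bilin[OF H_alg H_alg]]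
  have *: "?F (s \<otimes>\<^bsub>?T\<^esub> t) = tlift K H H P
      (\<lambda>x1 x2. tlift K H H P (\<lambda>y1 y2. f (x1 \<otimes> y1) (x2 \<otimes> y2)) t) s"
    if s: "s \<in> carrier ?T" and t: "t \<in> carrier ?T" for s t
  proof (rule lin_eq_tensor[OF H_mod H_mod _ _ _ s])
    show "(\<lambda>s. ?F (s \<otimes>\<^bsub>?T\<^esub> t)) \<in> lin_map K ?T P"
      using t P f by (intro lin_lift_arg lin_mult_l lin_id tensor_assoc_algebra) simp_all
    show "tlift K H H P
      (\<lambda>x1 x2. tlift K H H P (\<lambda>y1 y2. f (x1 \<otimes> y1) (x2 \<otimes> y2)) t) \<in> lin_map K ?T P"
      by (intro lin_lift H_mod P bf3 t)
    fix x1 x2 assume x: "x1 \<in> carrier H" "x2 \<in> carrier H"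
    have "?F (tens K H H x1 x2 \<otimes>\<^bsub>?T\<^esub> t) =
      tlift K H H P (\<lambda>y1 y2. f (x1 \<otimes> y1) (x2 \<otimes> y2)) t"
    proof (rule lin_eq_tensor[OF H_mod H_mod _ _ _ t])
      show "(\<lambda>t. ?F (tens K H H x1 x2 \<otimes>\<^bsub>?T\<^esub> t)) \<in> lin_map K ?T P"
        using x P f by (intro lin_lift_arg lin_mult_r lin_id tensor_assoc_algebra) simp_all
      show "tlift K H H P (\<lambda>y1 y2. f (x1 \<otimes> y1) (x2 \<otimes> y2)) \<in> lin_map K ?T P"
        by (intro lin_lift H_mod P bf x)
    qed (use x P f bf in \<open>simp add: tens_mult_tens\<close>)
    then show "?F (tens K H H x1 x2 \<otimes>\<^bsub>?T\<^esub> t) = tlift K H H P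
      (\<lambda>x1 x2. tlift K H H P (\<lambda>y1 y2. f (x1 \<otimes> y1) (x2 \<otimes> y2)) t) (tens K H H x1 x2)"
      using x P bf3[OF t] by simp
  qed
  show ?thesis
    unfolding sw_def using alg_homD(3)[OF comult_hom assms(3,4)] *[of "comult H x" "comult H y"] assms(3,4)
    by simp
qed

end

context hopf
begin

text \<open>Coassociativity of the coalgebra H \<otimes> H. The sums over x and over y are
  disentangled by \<open>sw_swap\<close>, rebracketed one at a time, and interleaved again.\<close>

lemma sw_assoc2:
  assumes P [simp]: "module K P" and [simp]: "x \<in> carrier H" "y \<in> carrier H"
    and g: "\<And>y1 x2 y2 x3 y3. \<lbrakk>y1 \<in> carrier H; x2 \<in> carrier H; y2 \<in> carrier H; x3 \<in> carrier H; y3 \<in> carrier H\<rbrakk>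
        \<Longrightarrow> (\<lambda>x1. g x1 y1 x2 y2 x3 y3) \<in> lin_map K H P"
      "\<And>x1 x2 y2 x3 y3. \<lbrakk>x1 \<in> carrier H; x2 \<in> carrier H; y2 \<in> carrier H; x3 \<in> carrier H; y3 \<in> carrier H\<rbrakk>
        \<Longrightarrow> (\<lambda>y1. g x1 y1 x2 y2 x3 y3) \<in> lin_map K H P"
      "\<And>x1 y1 y2 x3 y3. \<lbrakk>x1 \<in> carrier H; y1 \<in> carrier H; y2 \<in> carrier H; x3 \<in> carrier H; y3 \<in> carrier H\<rbrakk>
        \<Longrightarrow> (\<lambda>x2. g x1 y1 x2 y2 x3 y3) \<in> lin_map K H P"
      "\<And>x1 y1 x2 x3 y3. \<lbrakk>x1 \<in> carrier H; y1 \<in> carrier H; x2 \<in> carrier H; x3 \<in> carrier H; y3 \<in> carrier H\<rbrakk>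
        \<Longrightarrow> (\<lambda>y2. g x1 y1 x2 y2 x3 y3) \<in> lin_map K H P"
      "\<And>x1 y1 x2 y2 y3. \<lbrakk>x1 \<in> carrier H; y1 \<in> carrier H; x2 \<in> carrier H; y2 \<in> carrier H; y3 \<in> carrier H\<rbrakk>
        \<Longrightarrow> (\<lambda>x3. g x1 y1 x2 y2 x3 y3) \<in> lin_map K H P"
      "\<And>x1 y1 x2 y2 x3. \<lbrakk>x1 \<in> carrier H; y1 \<in> carrier H; x2 \<in> carrier H; y2 \<in> carrier H; x3 \<in> carrier H\<rbrakk>
        \<Longrightarrow> g x1 y1 x2 y2 x3 \<in> lin_map K H P"
  shows "sw K H P (\<lambda>x1 x'. sw K H P (\<lambda>y1 y'. sw K H P (\<lambda>x2 x3. sw K H P (\<lambda>y2 y3.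
      g x1 y1 x2 y2 x3 y3) y') x') y) x =
    sw K H P (\<lambda>x' x3. sw K H P (\<lambda>y' y3. sw K H P (\<lambda>x1 x2. sw K H P (\<lambda>y1 y2.
      g x1 y1 x2 y2 x3 y3) y') x') y) x"
proof -
  note rules = bilin_mapI lin_sw_body lin_sw_arg lin_id g
  have "sw K H P (\<lambda>x1 x'. sw K H P (\<lambda>y1 y'. sw K H P (\<lambda>x2 x3. sw K H P (\<lambda>y2 y3.
      g x1 y1 x2 y2 x3 y3) y') x') y) x =
    sw K H P (\<lambda>x1 x'. sw K H P (\<lambda>x2 x3. sw K H P (\<lambda>y1 y'. sw K H P (\<lambda>y2 y3.
      g x1 y1 x2 y2 x3 y3) y') y) x') x"
    by (intro sw_cong sw_swap; (intro rules)?; simp)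
  also have "\<dots> = sw K H P (\<lambda>x1 x'. sw K H P (\<lambda>x2 x3. sw K H P (\<lambda>y' y3. sw K H P (\<lambda>y1 y2.
      g x1 y1 x2 y2 x3 y3) y') y) x') x"
    by (intro sw_cong sw_assoc; (intro rules)?; simp)
  also have "\<dots> = sw K H P (\<lambda>x' x3. sw K H P (\<lambda>x1 x2. sw K H P (\<lambda>y' y3. sw K H P (\<lambda>y1 y2.
      g x1 y1 x2 y2 x3 y3) y') y) x') x"
    by (rule sw_assoc; (intro rules)?; simp)
  also have "\<dots> = sw K H P (\<lambda>x' x3. sw K H P (\<lambda>y' y3. sw K H P (\<lambda>x1 x2. sw K H P (\<lambda>y1 y2.
      g x1 y1 x2 y2 x3 y3) y') x') y) x"
    by (intro sw_cong sw_swap; (intro rules)?; simp)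
  finally show ?thesis .
qed

end

section \<open>Twisted algebras: product, units and associativity\<close>

lemma tensor_group_cong:
  assumes "carrier M = carrier M'" "ring.add M = ring.add M'" "smult M = smult M'"
  shows "tensor_group R M N = tensor_group R M' N" "tens R M N = tens R M' N"
proof -
  have "tensor_ker R M N = tensor_ker R M' N"
    unfolding tensor_ker_def tensor_rels_def using assms by simp
  then show "tensor_group R M N = tensor_group R M' N" "tens R M N = tens R M' N"
    using assms by (simp_all add: tensor_group_def tens_def fun_eq_iff)
qed

lemma tensor_lift_left_cong:
  assumes "carrier M = carrier M'" "ring.add M = ring.add M'" "smult M = smult M'"
  shows "tensor_lift R M N G f = tensor_lift R M' N G f"
  unfolding tensor_lift_def using tensor_group_cong[OF assms, of R N] assms(1) by simp

text \<open>Serves pairs of records with the same module structure but different product, unit or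
  coaction: \<open>W\<close> and \<open>T\<close>, \<open>T_alg\<close> and
  \<open>tensor_algebra\<close>, \<open>U_alg\<close> and its quotient algebra, \<open>BU\<close>
  and \<open>TK\<close>.\<close>

lemma tensor_left_cong:
  assumes "carrier M = carrier M'" "ring.add M = ring.add M'" "smult M = smult M'"
  shows "carrier (tensor R M N) = carrier (tensor R M' N)"
    and "ring.add (tensor R M N) = ring.add (tensor R M' N)"
    and "smult (tensor R M N) = smult (tensor R M' N)"
    and "\<zero>\<^bsub>tensor R M N\<^esub> = \<zero>\<^bsub>tensor R M' N\<^esub>"
    and "tens R M N = tens R M' N"
  using tensor_group_cong[OF assms, of R N] tensor_lift_left_cong[OF assms, of R N "tensor_group R M' N"] assms
  by (simp_all add: tensor_def)

lemma lin_map_cong: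
  assumes "carrier M = carrier M'" "ring.add M = ring.add M'" "smult M = smult M'"
  shows "lin_map R M N = lin_map R M' N" "lin_map R N M = lin_map R N M'"
  using assms by (simp_all add: lin_map_def)

lemma module_cong:
  assumes "carrier M = carrier M'" "ring.add M = ring.add M'" "smult M = smult M'" "\<zero>\<^bsub>M\<^esub> = \<zero>\<^bsub>M'\<^esub>"
    and "module R M'"
  shows "module R M"
proof -
  interpret M: module R M' by fact
  have "abelian_group M"
  proof (rule abelian_groupI)
    fix x assume "x \<in> carrier M"
    then show "\<exists>y\<in>carrier M. y \<oplus>\<^bsub>M\<^esub> x = \<zero>\<^bsub>M\<^esub>"
      unfolding assms(1-4) by (intro bexI[of _ "\<ominus>\<^bsub>M'\<^esub> x"]) (simp_all add: M.M.l_neg)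
  qed (simp_all add: assms(1-4) M.M.a_ac)
  then show ?thesis
    by (intro module.intro module_axioms.intro M.is_cring)
      (simp_all add: assms(1-4) M.smult_l_distr M.smult_r_distr M.smult_assoc1)
qed

text \<open>The cocycle condition enters lemma by lemma. For the algebras twisted by \<alpha> it
  yields associativity; the axioms of A, twisted by \<sigma>, are obtained from the embedding
  \<open>psi\<close>. The unit parameter is 1 in the first case and t^{-1}_1 in the second.\<close>

locale twisted = hopf K H for K :: "'k ring" and H :: "('k, 'h) hopf" (structure) +
  fixes R :: "('k, 'r) module" and \<gamma> :: "'h \<Rightarrow> 'h \<Rightarrow> 'r" and u :: 'r
  assumes R_alg [simp]: "assoc_algebra K R" and R_cring: "cring R"
    and \<gamma>_bilin: "\<gamma> \<in> bilin_map K H H R" and u_closed [simp]: "u \<in> carrier R"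
begin

sublocale R: assoc_algebra K R by (rule R_alg)
sublocale RC: cring R by (rule R_cring)

abbreviation W where "W \<equiv> twisted_algebra K H R \<gamma> u"
abbreviation T where "T \<equiv> tensor K R H"
abbreviation multR (infixl "\<cdot>" 70) where "b \<cdot> c \<equiv> b \<otimes>\<^bsub>R\<^esub> c"
abbreviation multW (infixl "\<star>" 70) where "s \<star> t \<equiv> s \<otimes>\<^bsub>W\<^esub> t"

lemma R_mod [simp]: "module K R" by (rule R.module_axioms)

lemma \<gamma>_closed [simp]: "x \<in> carrier H \<Longrightarrow> y \<in> carrier H \<Longrightarrow> \<gamma> x y \<in> carrier R"
  by (rule bilin_mapD(3)[OF \<gamma>_bilin])

lemma lin_\<gamma> [lin]:
  "f \<in> lin_map K Q H \<Longrightarrow> y \<in> carrier H \<Longrightarrow> (\<lambda>x. \<gamma> (f x) y) \<in> lin_map K Q R"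
  "f \<in> lin_map K Q H \<Longrightarrow> x \<in> carrier H \<Longrightarrow> (\<lambda>y. \<gamma> x (f y)) \<in> lin_map K Q R"
  using lin_comp[OF bilin_mapD(2)[OF \<gamma>_bilin]] lin_comp[OF bilin_mapD(1)[OF \<gamma>_bilin]] by blast+

lemma W_simps [simp]:
  "carrier W = carrier T" "ring.add W = ring.add T" "smult W = smult T"
  "\<zero>\<^bsub>W\<^esub> = \<zero>\<^bsub>T\<^esub>" "\<one>\<^bsub>W\<^esub> = tens K R H u \<one>"
  by (simp_all add: twisted_algebra_def with_coact_def Let_def)

lemma W_lin [simp]: "lin_map K W N = lin_map K T N" "lin_map K N W = lin_map K N T"
  by (simp_all add: lin_map_def)

lemma tensor_W [simp]:
  "carrier (tensor K W N) = carrier (tensor K T N)"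
  "ring.add (tensor K W N) = ring.add (tensor K T N)"
  "smult (tensor K W N) = smult (tensor K T N)"
  "\<zero>\<^bsub>tensor K W N\<^esub> = \<zero>\<^bsub>tensor K T N\<^esub>"
  "tens K W N = tens K T N"
  by (rule tensor_left_cong; simp)+

lemma W_mod [simp]: "module K W"
  by (rule module_cong[of _ T]) simp_all

definition mul where
  "mul b x c y = sw K H T (\<lambda>x1 x2. sw K H T (\<lambda>y1 y2.
     tens K R H (b \<cdot> c \<cdot> \<gamma> x1 y1) (x2 \<otimes> y2)) y) x"

lemma mult_W: "s \<star> t = tlift K R H T
    (\<lambda>b x. tlift K R H T (\<lambda>c y. mul b x c y) t) s"
  by (simp add: twisted_algebra_def with_coact_def Let_def mul_def)

lemma lin_mul [lin]:
  "f \<in> lin_map K Q R \<Longrightarrow> x \<in> carrier H \<Longrightarrow> c \<in> carrier R \<Longrightarrow> y \<in> carrier H \<Longrightarrow> (\<lambda>q. mul (f q) x c y) \<in> lin_map K Q T"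
  "g \<in> lin_map K Q H \<Longrightarrow> b \<in> carrier R \<Longrightarrow> c \<in> carrier R \<Longrightarrow> y \<in> carrier H \<Longrightarrow> (\<lambda>q. mul b (g q) c y) \<in> lin_map K Q T"
  "f \<in> lin_map K Q R \<Longrightarrow> b \<in> carrier R \<Longrightarrow> x \<in> carrier H \<Longrightarrow> y \<in> carrier H \<Longrightarrow> (\<lambda>q. mul b x (f q) y) \<in> lin_map K Q T"
  "g \<in> lin_map K Q H \<Longrightarrow> b \<in> carrier R \<Longrightarrow> x \<in> carrier H \<Longrightarrow> c \<in> carrier R \<Longrightarrow> (\<lambda>q. mul b x c (g q)) \<in> lin_map K Q T"
  unfolding mul_def by (intro bilin_mapI lin; simp add: lin_mapD)+

lemma mul_bilin: "b \<in> carrier R \<Longrightarrow> x \<in> carrier H \<Longrightarrow> (\<lambda>c y. mul b x c y) \<in> bilin_map K R H T"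
  by (intro bilin_mapI lin)

lemma mul_bilin2: "t \<in> carrier T \<Longrightarrow>
    (\<lambda>b x. tlift K R H T (\<lambda>c y. mul b x c y) t) \<in> bilin_map K R H T"
  by (intro bilin_mapI lin_lift_body lin mul_bilin; simp)

lemma W_mult_bilin: "monoid.mult W \<in> bilin_map K T T T"
  unfolding mult_W by (intro bilin_mapI lin_lift_body lin_lift mul_bilin mul_bilin2 lin; simp)

lemma mult_closed: "s \<in> carrier T \<Longrightarrow> t \<in> carrier T \<Longrightarrow> s \<star> t \<in> carrier T"
  by (rule bilin_mapD(3)[OF W_mult_bilin])

lemma lin_W_mult [lin]:
  "f \<in> lin_map K Q T \<Longrightarrow> t \<in> carrier T \<Longrightarrow> (\<lambda>q. f q \<star> t) \<in> lin_map K Q T"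
  "f \<in> lin_map K Q T \<Longrightarrow> s \<in> carrier T \<Longrightarrow> (\<lambda>q. s \<star> f q) \<in> lin_map K Q T"
  using lin_comp[OF bilin_mapD(2)[OF W_mult_bilin]] lin_comp[OF bilin_mapD(1)[OF W_mult_bilin]] by blast+

lemma mult_pure:
  "b \<in> carrier R \<Longrightarrow> x \<in> carrier H \<Longrightarrow> c \<in> carrier R \<Longrightarrow> y \<in> carrier H \<Longrightarrow>
    tens K R H b x \<star> tens K R H c y = mul b x c y"
  unfolding mult_W by (simp add: mul_bilin mul_bilin2)

lemma mul_tens_bilin:
  assumes "b \<in> carrier R" "c \<in> carrier R" "y \<in> carrier H"
  shows "(\<lambda>x1 x2. sw K H T (\<lambda>y1 y2.
     tens K R H (b \<cdot> c \<cdot> \<gamma> x1 y1) (x2 \<otimes> y2)) y) \<in> bilin_map K H H T"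
  using assms by (intro bilin_mapI lin; simp)

text \<open>The entry point for every map out of a twisted algebra: a linear map passes through both
  Sweedler sums of a product of pure tensors.\<close>

lemma mul_map:
  assumes "module K P" "F \<in> lin_map K T P" "b \<in> carrier R" "x \<in> carrier H" "c \<in> carrier R" "y \<in> carrier H"
  shows "F (mul b x c y) = sw K H P (\<lambda>x1 x2. sw K H P (\<lambda>y1 y2.
     F (tens K R H (b \<cdot> c \<cdot> \<gamma> x1 y1) (x2 \<otimes> y2))) y) x"
proof -
  have "F (mul b x c y) = sw K H P (\<lambda>x1 x2. F (sw K H T (\<lambda>y1 y2.
     tens K R H (b \<cdot> c \<cdot> \<gamma> x1 y1) (x2 \<otimes> y2)) y)) x"
    unfolding mul_def using assms by (intro sw_map mul_tens_bilin; simp)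
  also have "\<dots> = sw K H P (\<lambda>x1 x2. sw K H P (\<lambda>y1 y2.
     F (tens K R H (b \<cdot> c \<cdot> \<gamma> x1 y1) (x2 \<otimes> y2))) y) x"
    using assms by (intro sw_cong sw_map bilin_mapI lin; simp)
  finally show ?thesis .
qed

text \<open>Coassociativity gathers the first legs, so that either bracketing becomes the sum of bcd
  E(x(1), y(1), z(1)) \<otimes> x(2) y(2) z(2). Here E is one side of the cocycle identity for the
  left bracketing and the other side for the right one.\<close>

lemma mul_assoc:
  assumes co: "two_cocycle K H R \<gamma>"
    and [simp]: "b \<in> carrier R" "x \<in> carrier H" "c \<in> carrier R" "y \<in> carrier H" "d \<in> carrier R" "z \<in> carrier H"
  shows "mul b x c y \<star> tens K R H d z = tens K R H b x \<star> mul c y d z"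
proof -
  define E where "E x y z = sw K H R (\<lambda>x1 x2. sw K H R (\<lambda>y1 y2. \<gamma> x1 y1 \<cdot> \<gamma> (x2 \<otimes> y2) z) y) x" for x y z
  have E2: "E x y z = sw K H R (\<lambda>y1 y2. sw K H R (\<lambda>z1 z2. \<gamma> y1 z1 \<cdot> \<gamma> x (y2 \<otimes> z2)) z) y"
    if "x \<in> carrier H" "y \<in> carrier H" "z \<in> carrier H" for x y z
    using co that unfolding two_cocycle_def E_def by blast
  let ?L = "\<lambda>e h. tens K R H (b \<cdot> c \<cdot> d \<cdot> e) h"
  let ?S = "sw K H T"
  have "mul b x c y \<star> tens K R H d z =
    ?S (\<lambda>x1 x'. ?S (\<lambda>y1 y'. tens K R H (b \<cdot> c \<cdot> \<gamma> x1 y1) (x' \<otimes> y') \<star> tens K R H d z) y) x"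
    by (rule mul_map[of T "\<lambda>t. t \<star> tens K R H d z"]; (intro lin)?; simp)
  also have "\<dots> = ?S (\<lambda>x1 x'. ?S (\<lambda>y1 y'. ?S (\<lambda>x2 x3. ?S (\<lambda>y2 y3. ?S (\<lambda>z1 z2.
      ?L (\<gamma> x1 y1 \<cdot> \<gamma> (x2 \<otimes> y2) z1) (x3 \<otimes> y3 \<otimes> z2)) z) y') x') y) x"
  proof (intro sw_cong)
    fix x1 x' y1 y' assume [simp]: "x1 \<in> carrier H" "x' \<in> carrier H" "y1 \<in> carrier H" "y' \<in> carrier H"
    have "tens K R H (b \<cdot> c \<cdot> \<gamma> x1 y1) (x' \<otimes> y') \<star> tens K R H d z =
       ?S (\<lambda>p q. ?S (\<lambda>z1 z2. tens K R H (b \<cdot> c \<cdot> \<gamma> x1 y1 \<cdot> d \<cdot> \<gamma> p z1) (q \<otimes> z2)) z) (x' \<otimes> y')"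
      by (simp add: mult_pure mul_def)
    also have "\<dots> = ?S (\<lambda>x2 x3. ?S (\<lambda>y2 y3. ?S (\<lambda>z1 z2. tens K R H (b \<cdot> c \<cdot> \<gamma> x1 y1 \<cdot> d
        \<cdot> \<gamma> (x2 \<otimes> y2) z1) (x3 \<otimes> y3 \<otimes> z2)) z) y') x'"
      by (intro sw_mult bilin_mapI lin; simp)
    also have "\<dots> = ?S (\<lambda>x2 x3. ?S (\<lambda>y2 y3. ?S (\<lambda>z1 z2.
      ?L (\<gamma> x1 y1 \<cdot> \<gamma> (x2 \<otimes> y2) z1) (x3 \<otimes> y3 \<otimes> z2)) z) y') x'"
      by (intro sw_cong) (simp add: RC.m_ac)
    finally show "tens K R H (b \<cdot> c \<cdot> \<gamma> x1 y1) (x' \<otimes> y') \<star> tens K R H d z = \<dots>" .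
  qed
  also have "\<dots> = ?S (\<lambda>x' x3. ?S (\<lambda>y' y3. ?S (\<lambda>x1 x2. ?S (\<lambda>y1 y2. ?S (\<lambda>z1 z2.
      ?L (\<gamma> x1 y1 \<cdot> \<gamma> (x2 \<otimes> y2) z1) (x3 \<otimes> y3 \<otimes> z2)) z) y') x') y) x"
    by (rule sw_assoc2; (intro bilin_mapI lin)?; simp)
  also have "\<dots> = ?S (\<lambda>x' x3. ?S (\<lambda>y' y3. ?S (\<lambda>z1 z2. ?L (E x' y' z1) (x3 \<otimes> y3 \<otimes> z2)) z) y) x"
  proof (intro sw_cong)
    fix x' x3 y' y3 assume [simp]: "x3 \<in> carrier H" "x' \<in> carrier H" "y3 \<in> carrier H" "y' \<in> carrier H"
    have "?S (\<lambda>x1 x2. ?S (\<lambda>y1 y2. ?S (\<lambda>z1 z2.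
      ?L (\<gamma> x1 y1 \<cdot> \<gamma> (x2 \<otimes> y2) z1) (x3 \<otimes> y3 \<otimes> z2)) z) y') x' =
      ?S (\<lambda>x1 x2. ?S (\<lambda>z1 z2. ?S (\<lambda>y1 y2.
      ?L (\<gamma> x1 y1 \<cdot> \<gamma> (x2 \<otimes> y2) z1) (x3 \<otimes> y3 \<otimes> z2)) y') z) x'"
      by (intro sw_cong sw_swap; (intro bilin_mapI lin)?; simp)
    also have "\<dots> = ?S (\<lambda>z1 z2. ?S (\<lambda>x1 x2. ?S (\<lambda>y1 y2.
      ?L (\<gamma> x1 y1 \<cdot> \<gamma> (x2 \<otimes> y2) z1) (x3 \<otimes> y3 \<otimes> z2)) y') x') z"
      by (rule sw_swap; (intro bilin_mapI lin)?; simp)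
    also have "\<dots> = ?S (\<lambda>z1 z2. ?L (E x' y' z1) (x3 \<otimes> y3 \<otimes> z2)) z"
    proof (intro sw_cong)
      fix z1 z2 assume [simp]: "z1 \<in> carrier H" "z2 \<in> carrier H"
      let ?h = "x3 \<otimes> y3 \<otimes> z2"
      have "?L (E x' y' z1) ?h = ?S (\<lambda>x1 x2. ?L (sw K H R (\<lambda>y1 y2. \<gamma> x1 y1 \<cdot> \<gamma> (x2 \<otimes> y2) z1) y') ?h) x'"
        unfolding E_def
        by (rule sw_map[of R "\<lambda>e. ?L e ?h"]; (intro bilin_mapI lin)?; simp)
      also have "\<dots> = ?S (\<lambda>x1 x2. ?S (\<lambda>y1 y2. ?L (\<gamma> x1 y1 \<cdot> \<gamma> (x2 \<otimes> y2) z1) ?h) y') x'"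
        by (intro sw_cong sw_map[of R "\<lambda>e. ?L e ?h"]; (intro bilin_mapI lin)?; simp)
      finally show "?S (\<lambda>x1 x2. ?S (\<lambda>y1 y2. ?L (\<gamma> x1 y1 \<cdot> \<gamma> (x2 \<otimes> y2) z1) ?h) y') x' = ?L (E x' y' z1) ?h"
        by simp
    qed
    finally show "?S (\<lambda>x1 x2. ?S (\<lambda>y1 y2. ?S (\<lambda>z1 z2.
      ?L (\<gamma> x1 y1 \<cdot> \<gamma> (x2 \<otimes> y2) z1) (x3 \<otimes> y3 \<otimes> z2)) z) y') x' = \<dots>" .
  qed
  \<comment> \<open>The common normal form. The other bracketing is brought to the same shape below,
    with \<open>E\<close> read through \<open>E2\<close>.\<close>
  finally have lhs: "mul b x c y \<star> tens K R H d z =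
    ?S (\<lambda>x' x3. ?S (\<lambda>y' y3. ?S (\<lambda>z1 z2. ?L (E x' y' z1) (x3 \<otimes> y3 \<otimes> z2)) z) y) x" .
  have "tens K R H b x \<star> mul c y d z =
    ?S (\<lambda>y1 y'. ?S (\<lambda>z1 z'. tens K R H b x \<star> tens K R H (c \<cdot> d \<cdot> \<gamma> y1 z1) (y' \<otimes> z')) z) y"
    by (rule mul_map[of T "\<lambda>t. tens K R H b x \<star> t"]; (intro lin)?; simp)
  also have "\<dots> = ?S (\<lambda>y1 y'. ?S (\<lambda>z1 z'. ?S (\<lambda>x1 x2. ?S (\<lambda>y2 y3. ?S (\<lambda>z2 z3.
      ?L (\<gamma> y1 z1 \<cdot> \<gamma> x1 (y2 \<otimes> z2)) (x2 \<otimes> y3 \<otimes> z3)) z') y') x) z) y"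
  proof (intro sw_cong)
    fix z1 z' y1 y' assume [simp]: "z1 \<in> carrier H" "z' \<in> carrier H" "y1 \<in> carrier H" "y' \<in> carrier H"
    have "tens K R H b x \<star> tens K R H (c \<cdot> d \<cdot> \<gamma> y1 z1) (y' \<otimes> z') =
       ?S (\<lambda>x1 x2. ?S (\<lambda>p q. tens K R H (b \<cdot> (c \<cdot> d \<cdot> \<gamma> y1 z1) \<cdot> \<gamma> x1 p) (x2 \<otimes> q)) (y' \<otimes> z')) x"
      by (simp add: mult_pure mul_def)
    also have "\<dots> = ?S (\<lambda>x1 x2. ?S (\<lambda>y2 y3. ?S (\<lambda>z2 z3. tens K R H (b \<cdot> (c \<cdot> d \<cdot> \<gamma> y1 z1) \<otimes>\<^bsub>R\<^esub>
        \<gamma> x1 (y2 \<otimes> z2)) (x2 \<otimes> (y3 \<otimes> z3))) z') y') x"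
      by (intro sw_cong sw_mult bilin_mapI lin; simp)
    also have "\<dots> = ?S (\<lambda>x1 x2. ?S (\<lambda>y2 y3. ?S (\<lambda>z2 z3.
      ?L (\<gamma> y1 z1 \<cdot> \<gamma> x1 (y2 \<otimes> z2)) (x2 \<otimes> y3 \<otimes> z3)) z') y') x"
      by (intro sw_cong) (simp add: RC.m_ac H.A.m_assoc)
    finally show "tens K R H b x \<star> tens K R H (c \<cdot> d \<cdot> \<gamma> y1 z1) (y' \<otimes> z') = \<dots>" .
  qed
  also have "\<dots> = ?S (\<lambda>y1 y'. ?S (\<lambda>x1 x2. ?S (\<lambda>z1 z'. ?S (\<lambda>y2 y3. ?S (\<lambda>z2 z3.
      ?L (\<gamma> y1 z1 \<cdot> \<gamma> x1 (y2 \<otimes> z2)) (x2 \<otimes> y3 \<otimes> z3)) z') y') z) x) y"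
    by (intro sw_cong sw_swap; (intro bilin_mapI lin)?; simp)
  also have "\<dots> = ?S (\<lambda>x1 x2. ?S (\<lambda>y1 y'. ?S (\<lambda>z1 z'. ?S (\<lambda>y2 y3. ?S (\<lambda>z2 z3.
      ?L (\<gamma> y1 z1 \<cdot> \<gamma> x1 (y2 \<otimes> z2)) (x2 \<otimes> y3 \<otimes> z3)) z') y') z) y) x"
    by (rule sw_swap; (intro bilin_mapI lin)?; simp)
  also have "\<dots> = ?S (\<lambda>x1 x2. ?S (\<lambda>y' y3. ?S (\<lambda>z' z3. ?S (\<lambda>y1 y2. ?S (\<lambda>z1 z2.
      ?L (\<gamma> y1 z1 \<cdot> \<gamma> x1 (y2 \<otimes> z2)) (x2 \<otimes> y3 \<otimes> z3)) z') y') z) y) x"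
    by (intro sw_cong sw_assoc2; (intro bilin_mapI lin)?; simp)
  also have "\<dots> = ?S (\<lambda>x1 x2. ?S (\<lambda>y' y3. ?S (\<lambda>z' z3. ?L (E x1 y' z') (x2 \<otimes> y3 \<otimes> z3)) z) y) x"
  proof (intro sw_cong)
    fix x1 x2 y' y3 z' z3
    assume [simp]: "x1 \<in> carrier H" "x2 \<in> carrier H" "y' \<in> carrier H" "y3 \<in> carrier H" "z' \<in> carrier H" "z3 \<in> carrier H"
    let ?h = "x2 \<otimes> y3 \<otimes> z3"
    have "?L (E x1 y' z') ?h = ?L (sw K H R (\<lambda>y1 y2. sw K H R (\<lambda>z1 z2. \<gamma> y1 z1 \<cdot> \<gamma> x1 (y2 \<otimes> z2)) z') y') ?h"
      by (simp add: E2)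
    also have "\<dots> = ?S (\<lambda>y1 y2. ?L (sw K H R (\<lambda>z1 z2. \<gamma> y1 z1 \<cdot> \<gamma> x1 (y2 \<otimes> z2)) z') ?h) y'"
      by (rule sw_map[of R "\<lambda>e. ?L e ?h"]; (intro bilin_mapI lin)?; simp)
    also have "\<dots> = ?S (\<lambda>y1 y2. ?S (\<lambda>z1 z2. ?L (\<gamma> y1 z1 \<cdot> \<gamma> x1 (y2 \<otimes> z2)) ?h) z') y'"
      by (intro sw_cong sw_map[of R "\<lambda>e. ?L e ?h"]; (intro bilin_mapI lin)?; simp)
    finally show "?S (\<lambda>y1 y2. ?S (\<lambda>z1 z2. ?L (\<gamma> y1 z1 \<cdot> \<gamma> x1 (y2 \<otimes> z2)) ?h) z') y' = ?L (E x1 y' z') ?h"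
      by simp
  qed
  finally show ?thesis using lhs by simp
qed

end

context twisted
begin

lemma unit_l:
  assumes n: "normalized_cocycle H R \<gamma>" and u: "u = \<one>\<^bsub>R\<^esub>" and [simp]: "c \<in> carrier R" "y \<in> carrier H"
  shows "mul u \<one> c y = tens K R H c y"
proof -
  have "mul u \<one> c y = sw K H T (\<lambda>y1 y2. tens K R H (u \<cdot> c \<cdot> \<gamma> \<one> y1) (\<one> \<otimes> y2)) y"
    unfolding mul_def by (rule sw_one[OF _ mul_tens_bilin]) simp_all
  also have "\<dots> = sw K H T (\<lambda>y1 y2. counit H y1 \<odot>\<^bsub>T\<^esub> tens K R H c y2) y"
    using n by (intro sw_cong) (simp add: u normalized_cocycle_def R.smult_mult_right smult_tens)
  also have "\<dots> = tens K R H c y"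
    by (rule sw_counit_l; (intro lin)?; simp)
  finally show ?thesis .
qed

lemma unit_r:
  assumes n: "normalized_cocycle H R \<gamma>" and u: "u = \<one>\<^bsub>R\<^esub>" and [simp]: "b \<in> carrier R" "x \<in> carrier H"
  shows "mul b x u \<one> = tens K R H b x"
proof -
  have "mul b x u \<one> = sw K H T (\<lambda>x1 x2. tens K R H (b \<cdot> u \<cdot> \<gamma> x1 \<one>) (x2 \<otimes> \<one>)) x"
    unfolding mul_def by (intro sw_cong sw_one bilin_mapI lin; simp)
  also have "\<dots> = sw K H T (\<lambda>x1 x2. counit H x1 \<odot>\<^bsub>T\<^esub> tens K R H b x2) x"
    using n by (intro sw_cong) (simp add: u normalized_cocycle_def R.smult_mult_right smult_tens)
  also have "\<dots> = tens K R H b x"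
    by (rule sw_counit_l; (intro lin)?; simp)
  finally show ?thesis .
qed

lemma W_assoc_algebra:
  assumes co: "two_cocycle K H R \<gamma>" and n: "normalized_cocycle H R \<gamma>" and u: "u = \<one>\<^bsub>R\<^esub>"
  shows "assoc_algebra K W"
proof -
  note m = bilin_mapD[OF W_mult_bilin]
  note l = lin_mapD(2)[OF m(1)] lin_mapD(2)[OF m(2)]
  show ?thesis
  proof (rule assoc_algebraI)
    show "monoid.mult W \<in> bilin_map K W W W"
      using W_mult_bilin by (simp add: bilin_map_def)
    fix x assume x: "x \<in> carrier W"
    show "\<one>\<^bsub>W\<^esub> \<star> x = x" using R_mod H_mod x[unfolded W_simps]
      by (induction x rule: tensor_induct) (simp_all add: mult_pure unit_l[OF n u] l)
    show "x \<star> \<one>\<^bsub>W\<^esub> = x" using R_mod H_mod x[unfolded W_simps]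
      by (induction x rule: tensor_induct) (simp_all add: mult_pure unit_r[OF n u] l)
    fix y z assume y: "y \<in> carrier W" and z: "z \<in> carrier W"
    show "(x \<star> y) \<star> z = x \<star> (y \<star> z)"
      using R_mod H_mod x[unfolded W_simps]
    proof (induction x rule: tensor_induct)
      case p1: (pure x1 x2)
      show ?case using R_mod H_mod y[unfolded W_simps]
      proof (induction y rule: tensor_induct)
        case p2: (pure y1 y2)
        show ?case using R_mod H_mod z[unfolded W_simps]
        proof (induction z rule: tensor_induct)
          case (pure z1 z2)
          then show ?case using p1 p2
            by (simp add: mult_pure mul_assoc[OF co])
        qed (use p1 p2 m(3) in \<open>simp add: l\<close>)
      qed (use p1 z m(3) in \<open>simp add: l\<close>)
    qed (use y z m(3) in \<open>simp add: l\<close>)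
  qed simp_all
qed

section \<open>The coaction of a twisted algebra\<close>

abbreviation TH where "TH \<equiv> tensor K T H"

definition dpure where
  "dpure b h = sw K H TH (\<lambda>h1 h2. tens K T H (tens K R H b h1) h2) h"

lemma coact_W: "coact W t = tlift K R H TH dpure t"
  by (simp add: twisted_algebra_def with_coact_def Let_def dpure_def[abs_def])

lemma dpure_bilin: "dpure \<in> bilin_map K R H TH"
  unfolding dpure_def by (intro bilin_mapI lin; simp)

lemma coact_lin: "coact W \<in> lin_map K T TH"
  unfolding coact_W by (intro lin_lift dpure_bilin; simp)

lemma lin_coact [lin]: "f \<in> lin_map K Q T \<Longrightarrow> (\<lambda>x. coact W (f x)) \<in> lin_map K Q TH"
  by (rule lin_comp[OF coact_lin])

lemma coact_closed: "t \<in> carrier T \<Longrightarrow> coact W t \<in> carrier TH"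
  by (rule lin_mapD(1)[OF coact_lin])

lemma coact_pure: "b \<in> carrier R \<Longrightarrow> h \<in> carrier H \<Longrightarrow> coact W (tens K R H b h) = dpure b h"
  unfolding coact_W by (simp add: dpure_bilin)

lemma dpure_map:
  assumes "module K P" "F \<in> lin_map K TH P" "b \<in> carrier R" "h \<in> carrier H"
  shows "F (dpure b h) = sw K H P (\<lambda>h1 h2. F (tens K T H (tens K R H b h1) h2)) h"
  unfolding dpure_def using assms by (intro sw_map bilin_mapI lin; simp)

lemma tensor_lift_W: "tensor_lift K W N G f = tensor_lift K T N G f"
  by (rule tensor_lift_left_cong; simp)

lemma tensor_lift_W_group:
  "tlift R' M N (tensor K W N') f = tlift R' M N (tensor K T N') f"
  "tlift R' M N W g = tlift R' M N T g"
  by (rule tensor_lift_group_cong; simp)+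

lemma comult_sw: "h \<in> carrier H \<Longrightarrow> comult H h = sw K H (tensor K H H) (tens K H H) h"
  unfolding sw_def by (rule lift_eqI[symmetric, where f = "\<lambda>x. x"]; (intro lin)?; simp)

text \<open>The coaction is id \<otimes> \<Delta>, so its coassociativity and counit law are those
  of H in the right factor. Its multiplicativity comes down, on pure tensors, to multiplicativity of
  \<Delta> after a regrouping of legs (\<open>mult_pp\<close>).\<close>

lemma W_comodule_algebra:
  assumes co: "two_cocycle K H R \<gamma>" and n: "normalized_cocycle H R \<gamma>" and u: "u = \<one>\<^bsub>R\<^esub>"
  shows "comodule_algebra K H W"
proof -
  have W: "assoc_algebra K W" by (rule W_assoc_algebra[OF assms])
  interpret W: assoc_algebra K W by (rule W)
  have WH: "assoc_algebra K (tensor K W H)" by (intro tensor_assoc_algebra W H_alg)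
  note m = bilin_mapD[OF W_mult_bilin]
  note l = lin_mapD(2)[OF m(1)] lin_mapD(2)[OF m(2)]
  \<comment> \<open>\<open>tensor K W H\<close> and \<open>TH\<close> share their module structure;
    the rules for multiplication in the former are restated for the latter, in which the sums are
    formed.\<close>
  note lWH = lin_mult_l[OF WH, unfolded lin_map_cong[OF tensor_W(1-3)] tensor_W]
    lin_mult_r[OF WH, unfolded lin_map_cong[OF tensor_W(1-3)] tensor_W]
  note cl = lin_mapD(2)[OF coact_lin]
  let ?HH = "tensor K H H"
  have HH [simp]: "module K ?HH" by simp
  have mult_pp: "dpure b x \<otimes>\<^bsub>tensor K W H\<^esub> dpure c y = coact W (mul b x c y)"
    if [simp]: "b \<in> carrier R" "x \<in> carrier H" "c \<in> carrier R" "y \<in> carrier H" for b x c y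
  proof -
    let ?S = "sw K H TH"
    have dc: "dpure c y \<in> carrier TH"
      using bilin_mapD(3)[OF dpure_bilin] by simp
    have "dpure b x \<otimes>\<^bsub>tensor K W H\<^esub> dpure c y =
       ?S (\<lambda>x' x3. tens K T H (tens K R H b x') x3 \<otimes>\<^bsub>tensor K W H\<^esub> dpure c y) x"
      by (rule dpure_map[of TH "\<lambda>s. s \<otimes>\<^bsub>tensor K W H\<^esub> dpure c y"]; (intro lWH lin_id dc)?; simp)
    also have "\<dots> = ?S (\<lambda>x' x3. ?S (\<lambda>y' y3. tens K T H (tens K R H b x') x3 \<otimes>\<^bsub>tensor K W H\<^esub>
        tens K T H (tens K R H c y') y3) y) x"
      by (intro sw_cong dpure_map; (intro lWH lin_id)?; simp)
    also have "\<dots> = ?S (\<lambda>x' x3. ?S (\<lambda>y' y3. ?S (\<lambda>x1 x2. ?S (\<lambda>y1 y2.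
        tens K T H (tens K R H (b \<cdot> c \<cdot> \<gamma> x1 y1) (x2 \<otimes> y2)) (x3 \<otimes> y3)) y') x') y) x"
    proof (intro sw_cong)
      fix x' x3 y' y3 assume [simp]: "x' \<in> carrier H" "x3 \<in> carrier H" "y' \<in> carrier H" "y3 \<in> carrier H"
      have "tens K T H (tens K R H b x') x3 \<otimes>\<^bsub>tensor K W H\<^esub> tens K T H (tens K R H c y') y3 =
          tens K T H (mul b x' c y') (x3 \<otimes> y3)"
        using tens_mult_tens[OF W H_alg, of "tens K R H b x'" x3 "tens K R H c y'" y3]
        by (simp add: mult_pure)
      also have "\<dots> = ?S (\<lambda>x1 x2. ?S (\<lambda>y1 y2.
        tens K T H (tens K R H (b \<cdot> c \<cdot> \<gamma> x1 y1) (x2 \<otimes> y2)) (x3 \<otimes> y3)) y') x'"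
        by (rule mul_map[of TH "\<lambda>t. tens K T H t (x3 \<otimes> y3)"]; (intro lin)?; simp)
      finally show "tens K T H (tens K R H b x') x3 \<otimes>\<^bsub>tensor K W H\<^esub> tens K T H (tens K R H c y') y3 = \<dots>" .
    qed
    \<comment> \<open>The second and third legs are put together again, so that they become the two
      legs of the coproduct of x(2) y(2).\<close>
    also have "\<dots> = ?S (\<lambda>x1 x'. ?S (\<lambda>y1 y'. ?S (\<lambda>x2 x3. ?S (\<lambda>y2 y3.
        tens K T H (tens K R H (b \<cdot> c \<cdot> \<gamma> x1 y1) (x2 \<otimes> y2)) (x3 \<otimes> y3)) y') x') y) x"
      by (rule sw_assoc2[symmetric]; (intro bilin_mapI lin)?; simp)
    also have "\<dots> = ?S (\<lambda>x1 x'. ?S (\<lambda>y1 y'. coact W (tens K R H (b \<cdot> c \<cdot> \<gamma> x1 y1) (x' \<otimes> y'))) y) x"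
    proof (intro sw_cong)
      fix x1 x' y1 y' assume [simp]: "x' \<in> carrier H" "x1 \<in> carrier H" "y' \<in> carrier H" "y1 \<in> carrier H"
      show "?S (\<lambda>x2 x3. ?S (\<lambda>y2 y3. tens K T H (tens K R H (b \<cdot> c \<cdot> \<gamma> x1 y1) (x2 \<otimes> y2)) (x3 \<otimes> y3)) y') x'
        = coact W (tens K R H (b \<cdot> c \<cdot> \<gamma> x1 y1) (x' \<otimes> y'))"
        by (simp add: coact_pure dpure_def)
          (rule sw_mult[symmetric]; (intro bilin_mapI lin)?; simp)
    qed
    also have "\<dots> = coact W (mul b x c y)"
      by (rule mul_map[symmetric]; (intro lin coact_lin)?; simp)
    finally show ?thesis .
  qed
  have mult: "coact W (s \<star> t) = coact W s \<otimes>\<^bsub>tensor K W H\<^esub> coact W t" if "s \<in> carrier T" "t \<in> carrier T" for s t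
  proof (rule lin_eq_tensor[OF R_mod H_mod _ _ _ that(1), of _ TH])
    show "(\<lambda>s. coact W (s \<star> t)) \<in> lin_map K T TH"
      using that by (intro lin)
    show "(\<lambda>s. coact W s \<otimes>\<^bsub>tensor K W H\<^esub> coact W t) \<in> lin_map K T TH"
      using that coact_closed by (intro lWH lin)
    fix b x assume bx: "b \<in> carrier R" "x \<in> carrier H"
    show "coact W (tens K R H b x \<star> t) = coact W (tens K R H b x) \<otimes>\<^bsub>tensor K W H\<^esub> coact W t"
    proof (rule lin_eq_tensor[OF R_mod H_mod _ _ _ that(2), of _ TH])
      show "(\<lambda>t. coact W (tens K R H b x \<star> t)) \<in> lin_map K T TH"
        using bx by (intro lin; simp)
      show "(\<lambda>t. coact W (tens K R H b x) \<otimes>\<^bsub>tensor K W H\<^esub> coact W t) \<in> lin_map K T TH"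
        using bx coact_closed by (intro lWH lin; simp)
    qed (use bx in \<open>simp add: coact_pure mult_pp mult_pure\<close>)
  qed
  have hom: "coact W \<in> alg_hom K W (tensor K W H)"
  proof (rule alg_homI)
    show "coact W \<in> lin_map K W (tensor K W H)"
      using coact_lin by (simp add: lin_map_cong[OF tensor_W(1-3)])
    show "coact W \<one>\<^bsub>W\<^esub> = \<one>\<^bsub>tensor K W H\<^esub>"
      unfolding tensor_one by (simp add: coact_pure dpure_def, rule sw_one; (intro bilin_mapI lin)?; simp)
  qed (simp add: mult)
  let ?P = "tensor K T ?HH"
  have b1: "(\<lambda>x h. tens K T ?HH x (comult H h)) \<in> bilin_map K T H ?P"
    by (intro bilin_mapI lin; simp)
  have b2: "(\<lambda>x0 x1. tens K T ?HH x0 (tens K H H x1 h)) \<in> bilin_map K T H ?P" if "h \<in> carrier H" for h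
    using that by (intro bilin_mapI lin; simp)
  have b3: "(\<lambda>x h. tlift K T H ?P (\<lambda>x0 x1. tens K T ?HH x0 (tens K H H x1 h)) (coact W x))
    \<in> bilin_map K T H ?P"
    by (intro bilin_mapI lin_lift_body lin b2; simp add: coact_closed)
  have coassoc: "tlift K T H ?P (\<lambda>x h. tens K T ?HH x (comult H h)) (coact W a) =
    tlift K T H ?P (\<lambda>x h. tlift K T H ?P
       (\<lambda>x0 x1. tens K T ?HH x0 (tens K H H x1 h)) (coact W x)) (coact W a)"
    if "a \<in> carrier T" for a
  proof (rule lin_eq_tensor[OF R_mod H_mod _ _ _ that, of _ ?P])
    fix b h assume [simp]: "b \<in> carrier R" "h \<in> carrier H"
    have "tlift K T H ?P (\<lambda>x h. tens K T ?HH x (comult H h)) (coact W (tens K R H b h)) =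
      sw K H ?P (\<lambda>h1 h2. tens K T ?HH (tens K R H b h1) (comult H h2)) h"
      unfolding coact_pure[OF \<open>b \<in> carrier R\<close> \<open>h \<in> carrier H\<close>]
      by (subst dpure_map[OF _ lin_lift[OF _ _ _ b1]]; (intro sw_cong)?; simp add: b1)
    also have "\<dots> = sw K H ?P (\<lambda>h1 h2. sw K H ?P (\<lambda>p q. tens K T ?HH (tens K R H b h1) (tens K H H p q)) h2) h"
      by (intro sw_cong, subst comult_sw, simp, rule sw_map; (intro lin bilin_tens)?; simp)
    also have "\<dots> = sw K H ?P (\<lambda>h1 h2. sw K H ?P (\<lambda>p q. tens K T ?HH (tens K R H b p) (tens K H H q h2)) h1) h"
      by (rule sw_assoc; (intro bilin_mapI lin)?; simp)
    also have "\<dots> = sw K H ?P (\<lambda>h1 h2. tlift K T H ?P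
       (\<lambda>x0 x1. tens K T ?HH x0 (tens K H H x1 h2)) (coact W (tens K R H b h1))) h"
      by (intro sw_cong, simp add: coact_pure, subst dpure_map[OF _ lin_lift[OF _ _ _ b2]]; (intro sw_cong)?; simp add: b2)
    also have "\<dots> = tlift K T H ?P (\<lambda>x h. tlift K T H ?P
       (\<lambda>x0 x1. tens K T ?HH x0 (tens K H H x1 h)) (coact W x)) (coact W (tens K R H b h))"
      unfolding coact_pure[OF \<open>b \<in> carrier R\<close> \<open>h \<in> carrier H\<close>]
      by (subst dpure_map[OF _ lin_lift[OF _ _ _ b3]]; (intro sw_cong)?; simp add: b3)
    finally show "tlift K T H ?P (\<lambda>x h. tens K T ?HH x (comult H h)) (coact W (tens K R H b h)) =
      tlift K T H ?P (\<lambda>x h. tlift K T H ?P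
       (\<lambda>x0 x1. tens K T ?HH x0 (tens K H H x1 h)) (coact W x)) (coact W (tens K R H b h))" .
  qed (intro lin lin_lift_arg b1 b3; simp)+
  have b4: "(\<lambda>x h. counit H h \<odot>\<^bsub>T\<^esub> x) \<in> bilin_map K T H T"
    by (intro bilin_mapI lin; simp)
  have counit: "tlift K T H T (\<lambda>x h. counit H h \<odot>\<^bsub>T\<^esub> x) (coact W a) = a"
    if "a \<in> carrier T" for a
  proof (rule lin_eq_tensor[OF R_mod H_mod _ _ _ that, of _ T])
    fix b h assume [simp]: "b \<in> carrier R" "h \<in> carrier H"
    have "tlift K T H T (\<lambda>x h. counit H h \<odot>\<^bsub>T\<^esub> x) (coact W (tens K R H b h)) =
       sw K H T (\<lambda>h1 h2. counit H h2 \<odot>\<^bsub>T\<^esub> tens K R H b h1) h"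
      unfolding coact_pure[OF \<open>b \<in> carrier R\<close> \<open>h \<in> carrier H\<close>]
      by (subst dpure_map[OF _ lin_lift[OF _ _ _ b4]]; (intro sw_cong)?; simp add: b4)
    also have "\<dots> = tens K R H b h"
      by (rule sw_counit_r; (intro lin)?; simp)
    finally show "tlift K T H T (\<lambda>x h. counit H h \<odot>\<^bsub>T\<^esub> x) (coact W (tens K R H b h)) = tens K R H b h" .
  qed (intro lin lin_lift_arg b4; simp)+
  show ?thesis
    unfolding comodule_algebra_def tensor_lift_W tensor_lift_W_group
    using W hom coassoc counit by simp
qed

end

section \<open>Linear functionals\<close>

definition lin_subspace :: "('k, 'l) ring_scheme \<Rightarrow> ('k, 'v, 'm) module_scheme \<Rightarrow> 'v set \<Rightarrow> bool" where
  "lin_subspace K V W \<longleftrightarrow> W \<subseteq> carrier V \<and> \<zero>\<^bsub>V\<^esub> \<in> W \<and> (\<forall>x\<in>W. \<forall>y\<in>W. x \<oplus>\<^bsub>V\<^esub> y \<in> W) \<and>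
     (\<forall>c\<in>carrier K. \<forall>x\<in>W. c \<odot>\<^bsub>V\<^esub> x \<in> W)"

context
  fixes K :: "('k, 'l) ring_scheme" and V :: "('k, 'v, 'm) module_scheme" (structure)
  assumes K: "field K" and V: "module K V"
begin

interpretation K: field K by (rule K)
interpretation V: module K V by (rule V)

lemma smult_cancel_inv:
  assumes "a \<in> carrier K" "a \<noteq> \<zero>\<^bsub>K\<^esub>" "x \<in> carrier V"
  shows "inv\<^bsub>K\<^esub> a \<in> carrier K" "inv\<^bsub>K\<^esub> a \<odot> (a \<odot> x) = x" "inv\<^bsub>K\<^esub> a \<otimes>\<^bsub>K\<^esub> a = \<one>\<^bsub>K\<^esub>"
proof -
  have u: "a \<in> Units K" using assms K.field_Units by auto
  then show "inv\<^bsub>K\<^esub> a \<in> carrier K" "inv\<^bsub>K\<^esub> a \<otimes>\<^bsub>K\<^esub> a = \<one>\<^bsub>K\<^esub>" by simp_all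
  then show "inv\<^bsub>K\<^esub> a \<odot> (a \<odot> x) = x"
    using assms by (simp add: V.smult_assoc1[symmetric])
qed

lemma subspace_uminus:
  assumes "lin_subspace K V W" "x \<in> W" shows "\<ominus> x \<in> W"
proof -
  have x: "x \<in> carrier V" using assms by (auto simp: lin_subspace_def)
  have "\<ominus> x = (\<ominus>\<^bsub>K\<^esub> \<one>\<^bsub>K\<^esub>) \<odot> x" using x V.smult_l_minus by simp
  also have "\<dots> \<in> W" using assms unfolding lin_subspace_def by blast
  finally show ?thesis .
qed

lemma subspace_sum:
  assumes U: "lin_subspace K V U" and v: "v \<in> carrier V"
  shows "lin_subspace K V {m \<oplus> a \<odot> v | m a. m \<in> U \<and> a \<in> carrier K}" (is "lin_subspace K V ?S")
proof -
  have Uc: "U \<subseteq> carrier V" using U by (simp add: lin_subspace_def)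
  show ?thesis
    unfolding lin_subspace_def
  proof (intro conjI ballI)
    show "?S \<subseteq> carrier V" using Uc v by auto
    show "\<zero> \<in> ?S"
      using U v by (intro CollectI exI[of _ "\<zero>"] exI[of _ "\<zero>\<^bsub>K\<^esub>"]) (auto simp: lin_subspace_def)
  next
    fix x y assume "x \<in> ?S" "y \<in> ?S"
    then obtain m a m' a' where *: "x = m \<oplus> a \<odot> v" "y = m' \<oplus> a' \<odot> v" "m \<in> U" "m' \<in> U"
      "a \<in> carrier K" "a' \<in> carrier K" by blast
    moreover have "m \<in> carrier V" "m' \<in> carrier V" using * Uc by auto
    ultimately have "x \<oplus> y = (m \<oplus> m') \<oplus> (a \<oplus>\<^bsub>K\<^esub> a') \<odot> v"
      using v by (simp add: V.smult_l_distr V.M.a_ac)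
    moreover have "m \<oplus> m' \<in> U" using U * by (simp add: lin_subspace_def)
    ultimately show "x \<oplus> y \<in> ?S" using * by blast
  next
    fix c x assume c: "c \<in> carrier K" and "x \<in> ?S"
    then obtain m a where *: "x = m \<oplus> a \<odot> v" "m \<in> U" "a \<in> carrier K" by blast
    moreover have "m \<in> carrier V" using * Uc by auto
    ultimately have "c \<odot> x = c \<odot> m \<oplus> (c \<otimes>\<^bsub>K\<^esub> a) \<odot> v"
      using v c by (simp add: V.smult_r_distr V.smult_assoc1)
    moreover have "c \<odot> m \<in> U" using U * c by (simp add: lin_subspace_def)
    ultimately show "c \<odot> x \<in> ?S" using * c by blast
  qed
qed

text \<open>Zorn's lemma gives a subspace M that is maximal among those containing W and avoiding h.
  Then V is the direct sum of M and the line through h, and the functional is the coordinate along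
  h.\<close>

lemma functional_separates:
  assumes W: "lin_subspace K V W" and h: "h \<in> carrier V" "h \<notin> W"
  shows "\<exists>\<kappa> \<in> lin_map K V (self_algebra K). (\<forall>w\<in>W. \<kappa> w = \<zero>\<^bsub>K\<^esub>) \<and> \<kappa> h = \<one>\<^bsub>K\<^esub>"
proof -
  let ?C = "{U. lin_subspace K V U \<and> W \<subseteq> U \<and> h \<notin> U}"
  have "\<exists>M\<in>?C. \<forall>X\<in>?C. M \<subseteq> X \<longrightarrow> X = M"
  proof (rule subset_Zorn_nonempty)
    show "?C \<noteq> {}" using W h by auto
    fix \<C> assume ne: "\<C> \<noteq> {}" and ch: "subset.chain ?C \<C>"
    have el: "lin_subspace K V U" "W \<subseteq> U" "h \<notin> U" if "U \<in> \<C>" for U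
      using ch that by (auto simp: subset.chain_def)
    have tot: "U \<subseteq> U' \<or> U' \<subseteq> U" if "U \<in> \<C>" "U' \<in> \<C>" for U U'
      using ch that unfolding subset.chain_def by blast
    have "lin_subspace K V (\<Union>\<C>)"
      unfolding lin_subspace_def
    proof (intro conjI ballI)
      show "\<Union>\<C> \<subseteq> carrier V" using el(1) unfolding lin_subspace_def by blast
      show "\<zero> \<in> \<Union>\<C>" using el(1) ne by (auto simp: lin_subspace_def)
      fix x y assume "x \<in> \<Union>\<C>" "y \<in> \<Union>\<C>"
      then obtain U where "U \<in> \<C>" "x \<in> U" "y \<in> U" using tot by blast
      then show "x \<oplus> y \<in> \<Union>\<C>" using el(1)[of U] by (auto simp: lin_subspace_def)
    next
      fix c x assume "c \<in> carrier K" "x \<in> \<Union>\<C>"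
      then show "c \<odot> x \<in> \<Union>\<C>" using el(1)[unfolded lin_subspace_def] by (meson UnionE UnionI)
    qed
    then show "\<Union>\<C> \<in> ?C" using el ne by blast
  qed
  then obtain M where MC: "M \<in> ?C" and maxC: "\<forall>X\<in>?C. M \<subseteq> X \<longrightarrow> X = M" ..
  have M: "lin_subspace K V M" "W \<subseteq> M" "h \<notin> M" using MC by simp_all
  have max: "X = M" if "lin_subspace K V X" "W \<subseteq> X" "h \<notin> X" "M \<subseteq> X" for X
    using maxC that by simp
  have Mc: "M \<subseteq> carrier V" and M0: "\<zero> \<in> M"
    and Ma: "\<And>x y. x \<in> M \<Longrightarrow> y \<in> M \<Longrightarrow> x \<oplus> y \<in> M"
    and Ms: "\<And>c x. c \<in> carrier K \<Longrightarrow> x \<in> M \<Longrightarrow> c \<odot> x \<in> M"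
    using M(1) by (auto simp: lin_subspace_def)
  \<comment> \<open>\<open>P v c\<close> says that \<open>c\<close> is the coordinate of
    \<open>v\<close> along \<open>h\<close> modulo M.\<close>
  define P where "P v c \<longleftrightarrow> c \<in> carrier K \<and> (\<exists>m\<in>M. v = m \<oplus> c \<odot> h)" for v c
  have ex: "\<exists>c. P v c" if v: "v \<in> carrier V" for v
  proof (cases "v \<in> M")
    case True
    then show ?thesis using v h unfolding P_def by (intro exI[of _ "\<zero>\<^bsub>K\<^esub>"] conjI bexI[of _ v]) simp_all
  next
    case False
    let ?S = "{m \<oplus> a \<odot> v | m a. m \<in> M \<and> a \<in> carrier K}"
    have S: "lin_subspace K V ?S" by (rule subspace_sum[OF M(1) v])
    have MS: "M \<subseteq> ?S"
    proof
      fix m assume m: "m \<in> M"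
      then have "m = m \<oplus> \<zero>\<^bsub>K\<^esub> \<odot> v" using v Mc by auto
      then show "m \<in> ?S" using m by blast
    qed
    have "v = \<zero> \<oplus> \<one>\<^bsub>K\<^esub> \<odot> v" using v by simp
    then have "v \<in> ?S" using M0 by blast
    \<comment> \<open>Otherwise the strictly larger subspace M + Kv would still avoid h, against
      maximality. Solving the resulting equation for v gives its coordinate.\<close>
    then have "h \<in> ?S" using max[OF S _ _ MS] M(2) MS False by blast
    then obtain m a where ma: "m \<in> M" "a \<in> carrier K" "h = m \<oplus> a \<odot> v" by blast
    have mc: "m \<in> carrier V" using ma Mc by auto
    have a: "a \<noteq> \<zero>\<^bsub>K\<^esub>" using ma M(3) v mc by auto
    note i = smult_cancel_inv[OF ma(2) a]
    have "v = inv\<^bsub>K\<^esub> a \<odot> (\<ominus> m \<oplus> h)"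
      using ma v mc i by (simp add: V.M.r_neg1)
    also have "\<dots> = inv\<^bsub>K\<^esub> a \<odot> (\<ominus> m) \<oplus> inv\<^bsub>K\<^esub> a \<odot> h"
      using mc h i(1)[OF v] by (simp add: V.smult_r_distr)
    finally show ?thesis
      unfolding P_def using i(1)[OF v] Ms[OF i(1)[OF v] subspace_uminus[OF M(1) ma(1)]] by blast
  qed
  have uniq: "c = c'" if u: "P v c" "P v c'" for v c c'
  proof (rule ccontr)
    assume ne: "c \<noteq> c'"
    obtain m m' where mm: "m \<in> M" "m' \<in> M" "c \<in> carrier K" "c' \<in> carrier K"
      and eq: "m \<oplus> c \<odot> h = m' \<oplus> c' \<odot> h" using u unfolding P_def by metis
    have mc: "m \<in> carrier V" "m' \<in> carrier V" using mm Mc by auto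
    have "(c \<ominus>\<^bsub>K\<^esub> c') \<odot> h = \<ominus> m \<oplus> (m \<oplus> c \<odot> h) \<oplus> \<ominus> (c' \<odot> h)"
      using mm mc h by (simp add: a_minus_def V.smult_l_distr V.smult_l_minus V.M.r_neg1)
    also have "\<dots> = \<ominus> m \<oplus> m'"
      unfolding eq using mm mc h by (simp add: V.M.a_assoc V.M.r_neg)
    also have "\<dots> \<in> M" using Ma subspace_uminus[OF M(1)] mm by blast
    finally have *: "(c \<ominus>\<^bsub>K\<^esub> c') \<odot> h \<in> M" .
    have d: "c \<ominus>\<^bsub>K\<^esub> c' \<in> carrier K" "c \<ominus>\<^bsub>K\<^esub> c' \<noteq> \<zero>\<^bsub>K\<^esub>"
      using mm ne by (auto simp: K.r_right_minus_eq)
    then have "h \<in> M" using Ms[OF smult_cancel_inv(1)[OF d h(1)] *] smult_cancel_inv(2)[OF d h(1)] by simp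
    then show False using M(3) by simp
  qed
  define \<kappa> where "\<kappa> v = (THE c. P v c)" for v
  have \<kappa>: "\<kappa> v = c" if "P v c" for v c
    unfolding \<kappa>_def using that uniq by blast
  have P\<kappa>: "P v (\<kappa> v)" if "v \<in> carrier V" for v
    using ex[OF that] \<kappa> by metis
  have "\<kappa> \<in> lin_map K V (self_algebra K)"
  proof (rule lin_mapI)
    fix x y assume xy: "x \<in> carrier V" "y \<in> carrier V"
    then show "\<kappa> x \<in> carrier (self_algebra K)" using P\<kappa>[of x] by (simp add: P_def)
    obtain m m' where mm: "m \<in> M" "m' \<in> M" "x = m \<oplus> \<kappa> x \<odot> h" "y = m' \<oplus> \<kappa> y \<odot> h"
      "\<kappa> x \<in> carrier K" "\<kappa> y \<in> carrier K" using P\<kappa> xy unfolding P_def by metis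
    have mc: "m \<in> carrier V" "m' \<in> carrier V" using mm Mc by auto
    have "(m \<oplus> \<kappa> x \<odot> h) \<oplus> (m' \<oplus> \<kappa> y \<odot> h) = (m \<oplus> m') \<oplus> (\<kappa> x \<oplus>\<^bsub>K\<^esub> \<kappa> y) \<odot> h"
      using mm(5,6) mc h by (simp add: V.smult_l_distr V.M.a_ac)
    then have "x \<oplus> y = (m \<oplus> m') \<oplus> (\<kappa> x \<oplus>\<^bsub>K\<^esub> \<kappa> y) \<odot> h"
      using mm(3,4) by simp
    then have "P (x \<oplus> y) (\<kappa> x \<oplus>\<^bsub>K\<^esub> \<kappa> y)"
      unfolding P_def using mm Ma by blast
    then show "\<kappa> (x \<oplus> y) = \<kappa> x \<oplus>\<^bsub>self_algebra K\<^esub> \<kappa> y" by (simp add: \<kappa>)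
  next
    fix c x assume cx: "c \<in> carrier K" "x \<in> carrier V"
    obtain m where mm: "m \<in> M" "x = m \<oplus> \<kappa> x \<odot> h" "\<kappa> x \<in> carrier K"
      using P\<kappa> cx unfolding P_def by metis
    have mc: "m \<in> carrier V" using mm Mc by auto
    have "c \<odot> (m \<oplus> \<kappa> x \<odot> h) = c \<odot> m \<oplus> (c \<otimes>\<^bsub>K\<^esub> \<kappa> x) \<odot> h"
      using mm(3) mc h cx by (simp add: V.smult_r_distr V.smult_assoc1)
    then have "P (c \<odot> x) (c \<otimes>\<^bsub>K\<^esub> \<kappa> x)"
      unfolding P_def using mm Ms cx by (metis K.m_closed)
    then show "\<kappa> (c \<odot> x) = c \<odot>\<^bsub>self_algebra K\<^esub> \<kappa> x" by (simp add: \<kappa>)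
  qed
  moreover have "\<kappa> w = \<zero>\<^bsub>K\<^esub>" if "w \<in> W" for w
  proof -
    have "w \<in> M" using that M(2) by auto
    moreover have "w = w \<oplus> \<zero>\<^bsub>K\<^esub> \<odot> h" using \<open>w \<in> M\<close> Mc h by auto
    ultimately have "P w \<zero>\<^bsub>K\<^esub>" unfolding P_def by blast
    then show ?thesis by (rule \<kappa>)
  qed
  moreover have "P h \<one>\<^bsub>K\<^esub>" unfolding P_def using M0 h by (auto intro!: bexI[of _ "\<zero>"])
  then have "\<kappa> h = \<one>\<^bsub>K\<^esub>" by (rule \<kappa>)
  ultimately show ?thesis by blast
qed

lemma functionals_separate_points:
  assumes "v \<in> carrier V" "\<And>\<kappa>. \<kappa> \<in> lin_map K V (self_algebra K) \<Longrightarrow> \<kappa> v = \<zero>\<^bsub>K\<^esub>"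
  shows "v = \<zero>"
proof (rule ccontr)
  assume "v \<noteq> \<zero>"
  moreover have "lin_subspace K V {\<zero>}" by (simp add: lin_subspace_def)
  ultimately obtain \<kappa> where "\<kappa> \<in> lin_map K V (self_algebra K)" "\<kappa> v = \<one>\<^bsub>K\<^esub>"
    using functional_separates[of "{\<zero>}" v] assms(1) by blast
  then show False using assms(2)[of \<kappa>] K.one_not_zero by simp
qed

text \<open>For nonzero \<phi> pick v with \<phi>(v) = 1. Injectivity keeps T v outside the subspace
  T(ker \<phi>), and a functional that separates the two restricts to \<phi>, because X = ker \<phi>
  + Kv.\<close>

lemma functional_extension:
  fixes X :: "('k, 'x, 'n) module_scheme"
  assumes X: "module K X" and T: "T \<in> lin_map K X V" and inj: "inj_on T (carrier X)"
    and \<phi>: "\<phi> \<in> lin_map K X (self_algebra K)"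
  shows "\<exists>\<psi> \<in> lin_map K V (self_algebra K). \<forall>x\<in>carrier X. \<psi> (T x) = \<phi> x"
proof (cases "\<forall>x\<in>carrier X. \<phi> x = \<zero>\<^bsub>K\<^esub>")
  case True
  then show ?thesis by (intro bexI[of _ "\<lambda>_. \<zero>\<^bsub>K\<^esub>"] lin_mapI) auto
next
  case False
  interpret X: module K X by (rule X)
  obtain x0 where x0: "x0 \<in> carrier X" "\<phi> x0 \<noteq> \<zero>\<^bsub>K\<^esub>" using False by blast
  have p0: "\<phi> x0 \<in> carrier K" using lin_mapD(1)[OF \<phi> x0(1)] by simp
  note i = smult_cancel_inv[OF p0 x0(2) V.M.zero_closed]
  let ?v = "inv\<^bsub>K\<^esub> \<phi> x0 \<odot>\<^bsub>X\<^esub> x0"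
  have v: "?v \<in> carrier X" "\<phi> ?v = \<one>\<^bsub>K\<^esub>"
    using x0 i lin_mapD(3)[OF \<phi>] by simp_all
  note Tl = lin_mapD[OF T] and pl = lin_mapD[OF \<phi>, simplified]
  have z: "\<phi> \<zero>\<^bsub>X\<^esub> = \<zero>\<^bsub>K\<^esub>" "T \<zero>\<^bsub>X\<^esub> = \<zero>"
    using lin_map_zero[OF \<phi>] lin_map_zero[OF T] module_abelian[OF self_assoc_algebra[OF K.is_cring, THEN assoc_algebra_module]]
    by (simp_all add: X.abelian_group_axioms V.abelian_group_axioms)
  let ?N = "T ` {x \<in> carrier X. \<phi> x = \<zero>\<^bsub>K\<^esub>}"
  have N: "lin_subspace K V ?N"
    unfolding lin_subspace_def
  proof (intro conjI ballI)
    show "?N \<subseteq> carrier V" using Tl(1) by auto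
    show "\<zero> \<in> ?N" using z by (intro image_eqI[of _ _ "\<zero>\<^bsub>X\<^esub>"]) auto
    fix x y assume "x \<in> ?N" "y \<in> ?N"
    then obtain a b where "a \<in> carrier X" "b \<in> carrier X" "\<phi> a = \<zero>\<^bsub>K\<^esub>" "\<phi> b = \<zero>\<^bsub>K\<^esub>" "x = T a" "y = T b" by blast
    then show "x \<oplus> y \<in> ?N" using Tl pl by (intro image_eqI[of _ _ "a \<oplus>\<^bsub>X\<^esub> b"]) auto
  next
    fix c x assume "c \<in> carrier K" "x \<in> ?N"
    moreover from this obtain a where "a \<in> carrier X" "\<phi> a = \<zero>\<^bsub>K\<^esub>" "x = T a" by blast
    ultimately show "c \<odot> x \<in> ?N" using Tl pl by (intro image_eqI[of _ _ "c \<odot>\<^bsub>X\<^esub> a"]) auto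
  qed
  have nN: "T ?v \<notin> ?N"
  proof
    assume "T ?v \<in> ?N"
    then obtain a where "a \<in> carrier X" "\<phi> a = \<zero>\<^bsub>K\<^esub>" "T ?v = T a" by blast
    then show False using inj_onD[OF inj \<open>T ?v = T a\<close> v(1)] v(2) K.one_not_zero by auto
  qed
  obtain \<psi> where \<psi>: "\<psi> \<in> lin_map K V (self_algebra K)" "\<And>w. w \<in> ?N \<Longrightarrow> \<psi> w = \<zero>\<^bsub>K\<^esub>" "\<psi> (T ?v) = \<one>\<^bsub>K\<^esub>"
    using functional_separates[OF N Tl(1)[OF v(1)] nN] by blast
  note sl = lin_mapD[OF \<psi>(1), simplified]
  have "\<psi> (T x) = \<phi> x" if x: "x \<in> carrier X" for x
  proof -
    \<comment> \<open>The component of \<open>x\<close> in ker \<phi> with respect to v; \<psi>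
      kills its image.\<close>
    let ?y = "x \<oplus>\<^bsub>X\<^esub> (\<ominus>\<^bsub>K\<^esub> \<phi> x) \<odot>\<^bsub>X\<^esub> ?v"
    have "\<phi> ?y = \<zero>\<^bsub>K\<^esub>" using x v pl by (simp add: K.r_neg)
    then have "\<psi> (T ?y) = \<zero>\<^bsub>K\<^esub>" using x v pl by (intro \<psi>(2)) auto
    moreover have "\<psi> (T ?y) = \<psi> (T x) \<oplus>\<^bsub>K\<^esub> (\<ominus>\<^bsub>K\<^esub> \<phi> x)"
      using x v pl(1)[OF x] Tl(1)[OF x] Tl(1)[OF v(1)] Tl(2)[OF x, of "(\<ominus>\<^bsub>K\<^esub> \<phi> x) \<odot>\<^bsub>X\<^esub> ?v"]
        Tl(3)[OF _ v(1), of "\<ominus>\<^bsub>K\<^esub> \<phi> x"] \<psi>(3) sl(2)[OF Tl(1)[OF x], of "(\<ominus>\<^bsub>K\<^esub> \<phi> x) \<odot> T ?v"]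
        sl(3)[of "\<ominus>\<^bsub>K\<^esub> \<phi> x" "T ?v"]
      by simp
    ultimately show ?thesis
      using K.minus_equality[of "\<psi> (T x)" "\<ominus>\<^bsub>K\<^esub> \<phi> x"] pl(1)[OF x] sl(1)[OF Tl(1)[OF x]] by simp
  qed
  then show ?thesis using \<psi>(1) by blast
qed

section \<open>Testing elements of a tensor product by functionals of the right factor\<close>

fun tlist :: "('k, 'a, 'n) module_scheme \<Rightarrow> ('a \<times> 'v) list \<Rightarrow> ('a, 'v) tens" where
  "tlist M [] = \<zero>\<^bsub>tensor K M V\<^esub>"
| "tlist M (p # ps) = tens K M V (fst p) (snd p) \<oplus>\<^bsub>tensor K M V\<^esub> tlist M ps"

text \<open>Recursion along the list exposes one generator at a time, the form used by the
  inductions here and in \<open>gen_span\<close>.\<close>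

fun lspan :: "'v list \<Rightarrow> 'v set" where
  "lspan [] = {\<zero>}"
| "lspan (g # gs) = {w \<oplus> c \<odot> g | w c. w \<in> lspan gs \<and> c \<in> carrier K}"

lemma lspan_subspace: "set gs \<subseteq> carrier V \<Longrightarrow> lin_subspace K V (lspan gs)"
proof (induction gs)
  case (Cons g gs) then show ?case using subspace_sum[of "lspan gs" g] by simp
qed (simp add: lin_subspace_def)

lemma lspan_mem: "set gs \<subseteq> carrier V \<Longrightarrow> g \<in> set gs \<Longrightarrow> g \<in> lspan gs"
proof (induction gs)
  case (Cons a gs)
  have s: "lin_subspace K V (lspan gs)" using Cons by (intro lspan_subspace) auto
  show ?case
  proof (cases "g = a")
    case True
    have "a = \<zero> \<oplus> \<one>\<^bsub>K\<^esub> \<odot> a" using Cons by simp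
    then show ?thesis using s True unfolding lin_subspace_def lspan.simps by blast
  next
    case False
    then have "g \<in> lspan gs" using Cons by auto
    moreover have "g = g \<oplus> \<zero>\<^bsub>K\<^esub> \<odot> a" using Cons by auto
    ultimately show ?thesis by (auto intro!: exI)
  qed
qed simp

context
  fixes M :: "('k, 'a, 'n) module_scheme"
  assumes M: "module K M"
begin

interpretation M: module K M by (rule M)
interpretation TT: module K "tensor K M V" by (rule tensor_module[OF M V])

lemma tlist_closed: "set ps \<subseteq> carrier M \<times> carrier V \<Longrightarrow> tlist M ps \<in> carrier (tensor K M V)"
  by (induction ps) (auto intro!: tens_closed M V)

lemma tlist_append:
  "set ps \<subseteq> carrier M \<times> carrier V \<Longrightarrow> set qs \<subseteq> carrier M \<times> carrier V \<Longrightarrow>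
    tlist M (ps @ qs) = tlist M ps \<oplus>\<^bsub>tensor K M V\<^esub> tlist M qs"
proof (induction ps)
  case (Cons p ps)
  then have "tens K M V (fst p) (snd p) \<in> carrier (tensor K M V)" "tlist M ps \<in> carrier (tensor K M V)"
     "tlist M qs \<in> carrier (tensor K M V)" by (auto intro!: tens_closed M V tlist_closed)
  then show ?case using Cons by (simp add: TT.a_assoc)
qed (simp add: tlist_closed)

lemma tlist_ex: "y \<in> carrier (tensor K M V) \<Longrightarrow> \<exists>ps. set ps \<subseteq> carrier M \<times> carrier V \<and> y = tlist M ps"
  using M V
proof (induction y rule: tensor_induct)
  case (pure x y)
  then show ?case by (intro exI[of _ "[(x, y)]"]) (simp add: tens_closed M V)
next
  case (add s t)
  then obtain ps qs where "set ps \<subseteq> carrier M \<times> carrier V" "s = tlist M ps"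
    "set qs \<subseteq> carrier M \<times> carrier V" "t = tlist M qs" by blast
  then show ?case by (intro exI[of _ "ps @ qs"]) (simp add: tlist_append)
qed

text \<open>A right factor that depends on the others is expanded, and its left factor is
  distributed over the existing summands. The number of summands does not grow, which is what the
  induction in \<open>tensor_eq_zeroI\<close> consumes.\<close>

lemma tlist_absorb:
  "set ps \<subseteq> carrier M \<times> carrier V \<Longrightarrow> h \<in> lspan (map snd ps) \<Longrightarrow> m \<in> carrier M \<Longrightarrow>
    \<exists>qs. set qs \<subseteq> carrier M \<times> carrier V \<and> length qs = length ps \<and>
      tens K M V m h \<oplus>\<^bsub>tensor K M V\<^esub> tlist M ps = tlist M qs"
proof (induction ps arbitrary: h)
  case Nil
  have "tens K M V m \<zero> = \<zero>\<^bsub>tensor K M V\<^esub>"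
    by (rule lin_map_zero[OF lin_tens_r[OF M V lin_id Nil(3)]]) (simp_all add: V.abelian_group_axioms TT.abelian_group_axioms)
  then show ?case using Nil by auto
next
  case (Cons p ps)
  obtain m' g where p: "p = (m', g)" by (cases p)
  obtain w c where h: "h = w \<oplus> c \<odot> g" "w \<in> lspan (map snd ps)" "c \<in> carrier K"
    using Cons(3) p by auto
  obtain qs where qs: "set qs \<subseteq> carrier M \<times> carrier V" "length qs = length ps"
    "tens K M V m w \<oplus>\<^bsub>tensor K M V\<^esub> tlist M ps = tlist M qs"
    using Cons(1)[OF _ h(2) Cons(4)] Cons(2) by auto
  have c: "m' \<in> carrier M" "g \<in> carrier V" using Cons p by auto
  have w: "w \<in> carrier V"
  proof -
    have "set (map snd ps) \<subseteq> carrier V" using Cons(2) by auto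
    from lspan_subspace[OF this] show ?thesis using h(2) unfolding lin_subspace_def by blast
  qed
  have tl: "tlist M ps \<in> carrier (tensor K M V)" using Cons by (intro tlist_closed) auto
  have t: "tens K M V x y \<in> carrier (tensor K M V)" if "x \<in> carrier M" "y \<in> carrier V" for x y
    using that M V by simp
  have "tens K M V m h = tens K M V m w \<oplus>\<^bsub>tensor K M V\<^esub> tens K M V (c \<odot>\<^bsub>M\<^esub> m) g"
    unfolding h(1) using c w h(3) Cons(4) by (simp add: tens_add_r[OF M V] tens_balanced[OF M V])
  then have "tens K M V m h \<oplus>\<^bsub>tensor K M V\<^esub> tlist M (p # ps) = tlist M ((c \<odot>\<^bsub>M\<^esub> m \<oplus>\<^bsub>M\<^esub> m', g) # qs)"
    using qs(3)[symmetric] p c w h(3) Cons(4) tl t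
    by (simp add: tens_add_l[OF M V] TT.a_ac)
  then show ?case using qs c h(3) Cons(4) by (intro exI[of _ "(c \<odot>\<^bsub>M\<^esub> m \<oplus>\<^bsub>M\<^esub> m', g) # qs"]) simp
qed

lemma functional_bilin:
  assumes "\<kappa> \<in> lin_map K V (self_algebra K)"
  shows "(\<lambda>m h. \<kappa> h \<odot>\<^bsub>M\<^esub> m) \<in> bilin_map K M V M"
  using lin_mapD(1)[OF assms] by (intro bilin_mapI lin M assms) auto

text \<open>Stands in for comparing coefficients with respect to a basis of V. Induction on the
  number of summands: if the first right factor h depends on the others, its summand is absorbed; if
  not, a functional that is 1 at h and 0 on the others reads off the left factor m, so m = 0 and the
  summand disappears.\<close>

lemma tensor_eq_zeroI:
  assumes y: "y \<in> carrier (tensor K M V)"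
    and 0: "\<And>\<kappa>. \<kappa> \<in> lin_map K V (self_algebra K) \<Longrightarrow>
      tlift K M V M (\<lambda>m h. \<kappa> h \<odot>\<^bsub>M\<^esub> m) y = \<zero>\<^bsub>M\<^esub>"
  shows "y = \<zero>\<^bsub>tensor K M V\<^esub>"
proof -
  let ?c = "\<lambda>\<kappa>. tlift K M V M (\<lambda>m h. \<kappa> h \<odot>\<^bsub>M\<^esub> m)"
  note cl = lin_lift[OF M V M functional_bilin]
  note cp = lift_tens[OF M V M functional_bilin]
  have cz: "?c \<kappa> (tlist M ps) = \<zero>\<^bsub>M\<^esub>" if "\<kappa> \<in> lin_map K V (self_algebra K)"
    "set ps \<subseteq> carrier M \<times> carrier V" "\<And>h. h \<in> set (map snd ps) \<Longrightarrow> \<kappa> h = \<zero>\<^bsub>K\<^esub>" for \<kappa> ps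
    using that(2,3)
  proof (induction ps)
    case Nil then show ?case
      using lin_map_zero[OF cl[OF that(1)]] by (simp add: TT.abelian_group_axioms M.abelian_group_axioms)
  next
    case (Cons p ps) then show ?case
      using lin_mapD(2)[OF cl[OF that(1)]] tlist_closed[of ps] cp[OF that(1)] M V by (auto simp: tens_closed)
  qed
  have "tlist M ps = \<zero>\<^bsub>tensor K M V\<^esub>" if "set ps \<subseteq> carrier M \<times> carrier V"
    "\<And>\<kappa>. \<kappa> \<in> lin_map K V (self_algebra K) \<Longrightarrow> ?c \<kappa> (tlist M ps) = \<zero>\<^bsub>M\<^esub>" for ps
    using that
  proof (induction "length ps" arbitrary: ps)
    case (Suc n)
    then obtain m h qs where ps: "ps = (m, h) # qs" by (cases ps) auto
    have mh: "m \<in> carrier M" "h \<in> carrier V" "set qs \<subseteq> carrier M \<times> carrier V" using Suc(3) ps by auto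
    show ?case
    proof (cases "h \<in> lspan (map snd qs)")
      case True
      then obtain rs where rs: "set rs \<subseteq> carrier M \<times> carrier V" "length rs = length qs" "tlist M ps = tlist M rs"
        using tlist_absorb[OF mh(3) True mh(1)] ps by auto
      show ?thesis using Suc(1)[of rs] Suc(2,4) rs ps by simp
    next
      case False
      have "set (map snd qs) \<subseteq> carrier V" using mh by auto
      then obtain \<kappa> where \<kappa>: "\<kappa> \<in> lin_map K V (self_algebra K)" "\<And>w. w \<in> lspan (map snd qs) \<Longrightarrow> \<kappa> w = \<zero>\<^bsub>K\<^esub>" "\<kappa> h = \<one>\<^bsub>K\<^esub>"
        using functional_separates[OF lspan_subspace mh(2) False] by blast
      have "?c \<kappa> (tlist M qs) = \<zero>\<^bsub>M\<^esub>"
        using \<kappa>(2) lspan_mem \<open>set (map snd qs) \<subseteq> carrier V\<close> by (intro cz[OF \<kappa>(1) mh(3)]) blast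
      then have "?c \<kappa> (tlist M ps) = m"
        using ps mh \<kappa>(3) lin_mapD(2)[OF cl[OF \<kappa>(1)]] tlist_closed[OF mh(3)] cp[OF \<kappa>(1)] M V
        by (simp add: tens_closed)
      then have m0: "m = \<zero>\<^bsub>M\<^esub>" using Suc(4)[OF \<kappa>(1)] by simp
      have "tens K M V \<zero>\<^bsub>M\<^esub> h = \<zero>\<^bsub>tensor K M V\<^esub>"
        by (rule lin_map_zero[OF lin_tens_l[OF M V lin_id mh(2)]]) (simp_all add: M.abelian_group_axioms TT.abelian_group_axioms)
      then have "tlist M ps = tlist M qs" using ps m0 tlist_closed[OF mh(3)] by simp
      then show ?thesis using Suc(1)[of qs] Suc(2,4) mh ps by simp
    qed
  qed simp
  then show ?thesis using tlist_ex[OF y] 0 by blast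
qed

end

text \<open>Flatness over a field. Contraction with a functional of V commutes with f, so every
  coefficient of a kernel element is killed by the injective f and the zero test applies.\<close>

lemma tmap_inj:
  fixes M :: "('k, 'a, 'n) module_scheme" and N :: "('k, 'b, 'p) module_scheme"
  assumes M: "module K M" and N: "module K N" and f: "f \<in> lin_map K M N" and inj: "inj_on f (carrier M)"
  shows "inj_on (tmap K M V N f) (carrier (tensor K M V))"
    (is "inj_on ?F _")
proof (rule lin_map_inj)
  have ab: "abelian_group M" "abelian_group N" using M N module_abelian by auto
  show F: "?F \<in> lin_map K (tensor K M V) (tensor K N V)" by (rule lin_tmap[OF M N V f])
  show ab2: "abelian_group (tensor K M V)" "abelian_group (tensor K N V)" using M N V by auto
  fix y assume y: "y \<in> carrier (tensor K M V)" and 0: "?F y = \<zero>\<^bsub>tensor K N V\<^esub>"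
  show "y = \<zero>\<^bsub>tensor K M V\<^esub>"
  proof (rule tensor_eq_zeroI[OF M y])
    fix \<kappa> assume \<kappa>: "\<kappa> \<in> lin_map K V (self_algebra K)"
    let ?c = "tlift K M V M (\<lambda>m h. \<kappa> h \<odot>\<^bsub>M\<^esub> m)"
    let ?d = "tlift K N V N (\<lambda>m h. \<kappa> h \<odot>\<^bsub>N\<^esub> m)"
    note b = functional_bilin[OF M \<kappa>] and b' = functional_bilin[OF N \<kappa>]
    have "f (?c y) = ?d (?F y)"
    proof (rule lin_eq_tensor[OF M V _ _ _ y])
      show "(\<lambda>y. f (?c y)) \<in> lin_map K (tensor K M V) N" by (rule lin_comp[OF f lin_lift[OF M V M b]])
      show "(\<lambda>y. ?d (?F y)) \<in> lin_map K (tensor K M V) N" by (rule lin_comp[OF lin_lift[OF N V N b'] F])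
    next
      fix x v assume xv: "x \<in> carrier M" "v \<in> carrier V"
      then have "\<kappa> v \<in> carrier K" using lin_mapD(1)[OF \<kappa>] by simp
      then show "f (?c (tens K M V x v)) = ?d (?F (tens K M V x v))"
        using xv lin_mapD[OF f] lift_tens[OF M V M b] lift_tens[OF N V N b']
          lift_tens[OF M V _ bilin_tmap[OF M N V f]] N V by simp
    qed
    also have "\<dots> = \<zero>\<^bsub>N\<^esub>" unfolding 0 by (rule lin_map_zero[OF lin_lift[OF N V N b'] ab2(2) ab(2)])
    also have "\<dots> = f \<zero>\<^bsub>M\<^esub>" by (rule lin_map_zero[OF f ab, symmetric])
    finally show "?c y = \<zero>\<^bsub>M\<^esub>"
      using inj_onD[OF inj] lin_mapD(1)[OF lin_lift[OF M V M b] y] abelian_groupE(2)[OF ab(1)] by blast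
  qed
qed

end

section \<open>Transport of comodule algebra structures along injective maps\<close>

lemma lift_natural:
  assumes M: "module R M" and M': "module R M'" and N: "module R N" and P: "module R P" and P': "module R P'"
    and f: "f \<in> lin_map R M M'" and g: "g \<in> lin_map R P P'"
    and b: "b \<in> bilin_map R M N P" and b': "b' \<in> bilin_map R M' N P'"
    and e: "\<And>x h. x \<in> carrier M \<Longrightarrow> h \<in> carrier N \<Longrightarrow> g (b x h) = b' (f x) h"
    and t: "t \<in> carrier (tensor R M N)"
  shows "g (tlift R M N P b t) = tlift R M' N P' b'
    (tmap R M N M' f t)"
proof (rule lin_eq_tensor[OF M N _ _ _ t])
  show "(\<lambda>t. g (tlift R M N P b t)) \<in> lin_map R (tensor R M N) P'"
    by (rule lin_comp[OF g lin_lift[OF M N P b]])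
  show "(\<lambda>t. tlift R M' N P' b'
    (tmap R M N M' f t)) \<in> lin_map R (tensor R M N) P'"
    by (rule lin_comp[OF lin_lift[OF M' N P' b'] lin_tmap[OF M M' N f]])
qed (use e lin_mapD(1)[OF f] M M' N P P' b b' bilin_tmap[OF M M' N f] in simp)

context hopf
begin

lemma comodule_algebraD:
  assumes "comodule_algebra K H A"
  shows "assoc_algebra K A" "module K A" "coact A \<in> alg_hom K A (tensor K A H)"
    "coact A \<in> lin_map K A (tensor K A H)"
  using assms assoc_algebra_module alg_homD(1) by (auto simp: comodule_algebra_def)

text \<open>Each axiom is an equation in X, in X \<otimes> H or in X \<otimes> (H \<otimes> H). The
  maps f, f \<otimes> id and f \<otimes> id remain injective there by \<open>tmap_inj\<close>, so
  the equation may be checked after mapping to A, where it holds. \<open>lift_natural\<close> moves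
  the iterated lifts across.\<close>

lemma comodule_algebra_transport:
  fixes X :: "('k, 'h, 'x) comod_alg" and A :: "('k, 'h, 'b) comod_alg"
  assumes A: "comodule_algebra K H A" and X [simp]: "module K X"
    and f: "f \<in> lin_map K X A" and inj: "inj_on f (carrier X)"
    and mc: "\<And>x y. x \<in> carrier X \<Longrightarrow> y \<in> carrier X \<Longrightarrow> x \<otimes>\<^bsub>X\<^esub> y \<in> carrier X"
    and fm: "\<And>x y. x \<in> carrier X \<Longrightarrow> y \<in> carrier X \<Longrightarrow> f (x \<otimes>\<^bsub>X\<^esub> y) = f x \<otimes>\<^bsub>A\<^esub> f y"
    and one: "\<one>\<^bsub>X\<^esub> \<in> carrier X" "f \<one>\<^bsub>X\<^esub> = \<one>\<^bsub>A\<^esub>"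
    and co: "coact X \<in> lin_map K X (tensor K X H)"
    and fc: "\<And>x. x \<in> carrier X \<Longrightarrow>
      tmap K X H A f (coact X x) = coact A (f x)"
  shows "comodule_algebra K H X"
proof -
  interpret X: module K X by (rule X)
  interpret A: assoc_algebra K A using comodule_algebraD[OF A] by simp
  have A' [simp]: "assoc_algebra K A" "module K A" by (rule A.assoc_algebra_axioms, rule A.module_axioms)
  note fl = lin_mapD[OF f]
  have eq: "x = y" if "f x = f y" "x \<in> carrier X" "y \<in> carrier X" for x y
    using inj_onD[OF inj] that by blast
  have XA [simp]: "assoc_algebra K X"
  proof (rule assoc_algebraI)
    show "monoid.mult X \<in> bilin_map K X X X"
      by (intro bilin_mapI lin_mapI; (rule eq)?; simp add: mc fm fl A.A.l_distr A.A.r_distr A.smult_mult_left A.smult_mult_right)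
  next
    fix x y z assume "x \<in> carrier X" "y \<in> carrier X" "z \<in> carrier X"
    then show "x \<otimes>\<^bsub>X\<^esub> y \<otimes>\<^bsub>X\<^esub> z = x \<otimes>\<^bsub>X\<^esub> (y \<otimes>\<^bsub>X\<^esub> z)"
      by (intro eq) (simp_all add: mc fm fl A.A.m_assoc)
  qed (rule eq | simp add: one mc fm fl)+
  let ?F = "tmap K X H A f"
  have fa: "f \<in> alg_hom K X A" by (intro alg_homI f fm one)
  note Fa = alg_homD[OF alg_hom_tmap[OF XA A'(1) H_alg fa]]
  have Fi: "inj_on ?F (carrier (tensor K X H))" by (rule tmap_inj[OF K H_mod X A'(2) f inj])
  note ca = alg_homD[OF comodule_algebraD(3)[OF A]]
  note cX = lin_mapD[OF co]
  interpret XH: assoc_algebra K "tensor K X H" by (intro tensor_assoc_algebra XA H_alg)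
  let ?HH = "tensor K H H"
  have HH: "module K ?HH" by simp
  have chom: "coact X \<in> alg_hom K X (tensor K X H)"
  proof (intro alg_homI co)
    fix x y assume xy: "x \<in> carrier X" "y \<in> carrier X"
    show "coact X (x \<otimes>\<^bsub>X\<^esub> y) = coact X x \<otimes>\<^bsub>tensor K X H\<^esub> coact X y"
      using xy by (intro inj_onD[OF Fi]) (simp_all add: fc mc fm fl cX Fa ca)
  next
    show "coact X \<one>\<^bsub>X\<^esub> = \<one>\<^bsub>tensor K X H\<^esub>"
      by (intro inj_onD[OF Fi]) (simp_all add: fc one cX Fa ca)
  qed
  have b1: "(\<lambda>x h. tens K Y ?HH x (comult H h)) \<in> bilin_map K Y H (tensor K Y ?HH)" if "module K Y"
    for Y :: "('k, 'h, 'y) comod_alg"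
    using that by (intro bilin_mapI lin; simp)
  have b2: "(\<lambda>x0 x1. tens K Y ?HH x0 (tens K H H x1 h)) \<in> bilin_map K Y H (tensor K Y ?HH)"
    if "module K Y" "h \<in> carrier H" for h and Y :: "('k, 'h, 'y) comod_alg"
    using that by (intro bilin_mapI lin; simp)
  have b3: "(\<lambda>x h. tlift K Y H (tensor K Y ?HH) (\<lambda>x0 x1. tens K Y ?HH x0 (tens K H H x1 h)) (coact Y x))
    \<in> bilin_map K Y H (tensor K Y ?HH)" if Y: "module K Y" "coact Y \<in> lin_map K Y (tensor K Y H)"
    for Y :: "('k, 'h, 'y) comod_alg"
    using Y lin_mapD(1)[OF Y(2)] by (intro bilin_mapI lin_lift_body lin_lift_arg Y(2) lin b2; simp)
  have b4: "(\<lambda>x h. counit H h \<odot>\<^bsub>Y\<^esub> x) \<in> bilin_map K Y H Y" if "module K Y"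
    for Y :: "('k, 'h, 'y) comod_alg"
    using that by (intro bilin_mapI lin; simp)
  let ?G = "tmap K X ?HH A f"
  have G: "?G \<in> lin_map K (tensor K X ?HH) (tensor K A ?HH)" by (rule lin_tmap[OF X A'(2) HH f])
  have Gi: "inj_on ?G (carrier (tensor K X ?HH))" by (rule tmap_inj[OF K HH X A'(2) f inj])
  have Gp: "?G (tens K X ?HH x t) = tens K A ?HH (f x) t" if "x \<in> carrier X" "t \<in> carrier ?HH" for x t
    using that bilin_tmap[OF X A'(2) HH f] by simp
  note cA = comodule_algebraD(4)[OF A]
  have coassoc: "tlift K X H (tensor K X ?HH) (\<lambda>x h. tens K X ?HH x (comult H h)) (coact X a) =
    tlift K X H (tensor K X ?HH) (\<lambda>x h. tlift K X H (tensor K X ?HH)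
       (\<lambda>x0 x1. tens K X ?HH x0 (tens K H H x1 h)) (coact X x)) (coact X a)" (is "?l = ?r") if a: "a \<in> carrier X" for a
  proof (rule inj_onD[OF Gi])
    have "?G ?l = tlift K A H (tensor K A ?HH) (\<lambda>x h. tens K A ?HH x (comult H h)) (?F (coact X a))"
      by (rule lift_natural[OF X A'(2) H_mod _ _ f G b1[OF X] b1[OF A'(2)]]) (simp_all add: HH Gp cX a)
    also have "\<dots> = tlift K A H (tensor K A ?HH) (\<lambda>x h. tlift K A H (tensor K A ?HH)
       (\<lambda>x0 x1. tens K A ?HH x0 (tens K H H x1 h)) (coact A x)) (?F (coact X a))"
      using A fl(1)[OF a] unfolding fc[OF a] comodule_algebra_def by blast
    also have "\<dots> = ?G ?r"
    proof (rule lift_natural[symmetric, OF X A'(2) H_mod _ _ f G b3[OF X co] b3[OF A'(2) cA]])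
      fix x h assume xh: "x \<in> carrier X" "h \<in> carrier H"
      show "?G (tlift K X H (tensor K X ?HH) (\<lambda>x0 x1. tens K X ?HH x0 (tens K H H x1 h)) (coact X x)) =
        tlift K A H (tensor K A ?HH) (\<lambda>x0 x1. tens K A ?HH x0 (tens K H H x1 h)) (coact A (f x))"
        unfolding fc[OF xh(1), symmetric]
        by (rule lift_natural[OF X A'(2) H_mod _ _ f G b2[OF X xh(2)] b2[OF A'(2) xh(2)]]) (simp_all add: HH Gp cX xh)
    qed (simp_all add: HH cX a)
    finally show "?G ?l = ?G ?r" .
    show "?l \<in> carrier (tensor K X ?HH)"
      by (rule lift_closed[OF X H_mod _ b1[OF X]]) (simp_all add: cX a)
    show "?r \<in> carrier (tensor K X ?HH)"
      by (rule lift_closed[OF X H_mod _ b3[OF X co]]) (simp_all add: cX a)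
  qed
  have counit: "tlift K X H X (\<lambda>x h. counit H h \<odot>\<^bsub>X\<^esub> x) (coact X a) = a" (is "?l = a") if a: "a \<in> carrier X" for a
  proof (rule eq[OF _ _ a])
    have "f ?l = tlift K A H A (\<lambda>x h. counit H h \<odot>\<^bsub>A\<^esub> x) (?F (coact X a))"
      by (rule lift_natural[OF X A'(2) H_mod X A'(2) f f b4[OF X] b4[OF A'(2)]]) (simp_all add: fl cX a)
    also have "\<dots> = f a"
      using A fl(1)[OF a] unfolding fc[OF a] comodule_algebra_def by blast
    finally show "f ?l = f a" .
    show "?l \<in> carrier X" by (rule lift_closed[OF X H_mod X b4[OF X]]) (simp add: cX a)
  qed
  show ?thesis
    unfolding comodule_algebra_def using XA chom coassoc counit by blast
qed

end

section \<open>Quotients of algebras\<close>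

lemma quot_algebra_simps:
  "carrier (quot_algebra A I) = carrier (A Quot I)"
  "x \<oplus>\<^bsub>quot_algebra A I\<^esub> y = x \<oplus>\<^bsub>A Quot I\<^esub> y"
  "x \<otimes>\<^bsub>quot_algebra A I\<^esub> y = x \<otimes>\<^bsub>A Quot I\<^esub> y"
  "\<zero>\<^bsub>quot_algebra A I\<^esub> = \<zero>\<^bsub>A Quot I\<^esub>"
  "\<one>\<^bsub>quot_algebra A I\<^esub> = \<one>\<^bsub>A Quot I\<^esub>"
  "c \<odot>\<^bsub>quot_algebra A I\<^esub> C = (\<Union>a\<in>C. I +>\<^bsub>A\<^esub> (c \<odot>\<^bsub>A\<^esub> a))"
  by (simp_all add: quot_algebra_def with_smult_def)

context
  fixes R :: "('r, 'l) ring_scheme" and A :: "('r, 'a, 'm) module_scheme" and I :: "'a set"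
  assumes A: "assoc_algebra R A" and I: "ideal I A"
begin

interpretation A: assoc_algebra R A by (rule A)
interpretation I: ideal I A by (rule I)

lemma ideal_smult_closed:
  assumes "c \<in> carrier R" "x \<in> I" shows "c \<odot>\<^bsub>A\<^esub> x \<in> I"
proof -
  have x: "x \<in> carrier A" using assms by (simp add: I.Icarr)
  have "c \<odot>\<^bsub>A\<^esub> x = (c \<odot>\<^bsub>A\<^esub> \<one>\<^bsub>A\<^esub>) \<otimes>\<^bsub>A\<^esub> x"
    using assms x by (simp add: A.smult_mult_left)
  then show ?thesis using assms I.I_l_closed by simp
qed

lemma coset_eq_iff:
  assumes "x \<in> carrier A" "y \<in> carrier A"
  shows "I +>\<^bsub>A\<^esub> x = I +>\<^bsub>A\<^esub> y \<longleftrightarrow> x \<ominus>\<^bsub>A\<^esub> y \<in> I"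
  using A.A.quotient_eq_iff_same_a_r_cos[OF I assms] by auto

lemma quot_carrier: "carrier (quot_algebra A I) = {I +>\<^bsub>A\<^esub> x | x. x \<in> carrier A}"
  by (auto simp: quot_algebra_simps FactRing_simps)

lemma quot_cases:
  assumes "X \<in> carrier (quot_algebra A I)"
  obtains x where "x \<in> carrier A" "X = I +>\<^bsub>A\<^esub> x"
  using assms by (auto simp: quot_carrier)

lemma coset_closed: "x \<in> carrier A \<Longrightarrow> I +>\<^bsub>A\<^esub> x \<in> carrier (quot_algebra A I)"
  by (auto simp: quot_carrier)

lemma coset_add:
  "x \<in> carrier A \<Longrightarrow> y \<in> carrier A \<Longrightarrow>
    (I +>\<^bsub>A\<^esub> x) \<oplus>\<^bsub>quot_algebra A I\<^esub> (I +>\<^bsub>A\<^esub> y) = I +>\<^bsub>A\<^esub> (x \<oplus>\<^bsub>A\<^esub> y)"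
  and coset_mult:
  "x \<in> carrier A \<Longrightarrow> y \<in> carrier A \<Longrightarrow>
    (I +>\<^bsub>A\<^esub> x) \<otimes>\<^bsub>quot_algebra A I\<^esub> (I +>\<^bsub>A\<^esub> y) = I +>\<^bsub>A\<^esub> (x \<otimes>\<^bsub>A\<^esub> y)"
  using ring_hom_memE[OF I.rcos_ring_hom] by (simp_all add: quot_algebra_simps)

lemma coset_one: "\<one>\<^bsub>quot_algebra A I\<^esub> = I +>\<^bsub>A\<^esub> \<one>\<^bsub>A\<^esub>"
  and coset_zero: "\<zero>\<^bsub>quot_algebra A I\<^esub> = I +>\<^bsub>A\<^esub> \<zero>\<^bsub>A\<^esub>"
  by (simp_all add: quot_algebra_simps FactRing_def I.a_rcos_const)

lemmas coset_ops = coset_closed coset_add coset_mult coset_one coset_zero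

text \<open>Scalar multiplication in \<open>quot_algebra\<close> is a union over all
  representatives. An ideal is closed under scalars, since c x = (c 1) x, so all cosets in that
  union coincide.\<close>

lemma coset_smult:
  assumes c: "c \<in> carrier R" and x: "x \<in> carrier A"
  shows "c \<odot>\<^bsub>quot_algebra A I\<^esub> (I +>\<^bsub>A\<^esub> x) = I +>\<^bsub>A\<^esub> (c \<odot>\<^bsub>A\<^esub> x)"
proof -
  have "I +>\<^bsub>A\<^esub> (c \<odot>\<^bsub>A\<^esub> a) = I +>\<^bsub>A\<^esub> (c \<odot>\<^bsub>A\<^esub> x)" if a: "a \<in> I +>\<^bsub>A\<^esub> x" for a
  proof -
    obtain i where i: "i \<in> I" "a = i \<oplus>\<^bsub>A\<^esub> x" using a by (auto simp: a_r_coset_def' )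
    have ic: "i \<in> carrier A" using i by (simp add: I.Icarr)
    have "c \<odot>\<^bsub>A\<^esub> a \<ominus>\<^bsub>A\<^esub> c \<odot>\<^bsub>A\<^esub> x = c \<odot>\<^bsub>A\<^esub> i"
      using i ic c x by (simp add: A.smult_r_distr a_minus_def A.M.a_assoc A.M.r_neg)
    then show ?thesis
      using coset_eq_iff[of "c \<odot>\<^bsub>A\<^esub> a" "c \<odot>\<^bsub>A\<^esub> x"] i ic c x ideal_smult_closed by simp
  qed
  moreover have "x \<in> I +>\<^bsub>A\<^esub> x" by (rule I.a_rcos_self[OF x])
  ultimately show ?thesis unfolding quot_algebra_simps by blast
qed

lemma quot_assoc_algebra: "assoc_algebra R (quot_algebra A I)"
proof -
  let ?Q = "quot_algebra A I"
  interpret Q: ring "A Quot I" by (rule I.quotient_is_ring)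
  have ab: "abelian_group ?Q"
  proof (rule abelian_groupI)
    fix x assume "x \<in> carrier ?Q"
    then show "\<exists>y\<in>carrier ?Q. y \<oplus>\<^bsub>?Q\<^esub> x = \<zero>\<^bsub>?Q\<^esub>"
      using Q.l_neg Q.a_inv_closed unfolding quot_algebra_simps by blast
  qed (simp_all add: quot_algebra_simps Q.a_ac)
  have m: "module R ?Q"
    by (intro module.intro module_axioms.intro ab A.is_cring; (elim quot_cases)?;
      simp add: coset_ops coset_smult A.smult_l_distr A.smult_r_distr A.smult_assoc1)
  show ?thesis
  proof (rule assoc_algebraI[OF m])
    show "monoid.mult ?Q \<in> bilin_map R ?Q ?Q ?Q"
      by (intro bilin_mapI lin_mapI; elim quot_cases;
        simp add: coset_ops coset_smult A.A.l_distr A.A.r_distr A.smult_mult_left A.smult_mult_right)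
  qed (simp_all add: quot_algebra_simps Q.m_assoc)
qed

lemma coset_hom: "(\<lambda>x. I +>\<^bsub>A\<^esub> x) \<in> alg_hom R A (quot_algebra A I)"
  by (intro alg_homI lin_mapI) (simp_all add: coset_ops coset_smult)

text \<open>The map induced by \<open>f\<close> on cosets is \<open>C \<mapsto> f c\<close> for any \<open>c \<in> C\<close>.\<close>

lemma quot_universal:
  assumes f: "f \<in> lin_map R A M" and M: "module R M" and 0: "\<And>x. x \<in> I \<Longrightarrow> f x = \<zero>\<^bsub>M\<^esub>"
  shows "\<exists>g \<in> lin_map R (quot_algebra A I) M. \<forall>x\<in>carrier A. g (I +>\<^bsub>A\<^esub> x) = f x"
proof -
  interpret M: module R M by (rule M)
  define g where "g C = f (SOME c. c \<in> C \<and> c \<in> carrier A)" for C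
  have g: "g (I +>\<^bsub>A\<^esub> x) = f x" if x: "x \<in> carrier A" for x
  proof -
    let ?c = "SOME c. c \<in> I +>\<^bsub>A\<^esub> x \<and> c \<in> carrier A"
    have c: "?c \<in> I +>\<^bsub>A\<^esub> x \<and> ?c \<in> carrier A"
      by (rule someI[of _ x]) (use x I.a_rcos_self in auto)
    then obtain i where i: "i \<in> I" "?c = i \<oplus>\<^bsub>A\<^esub> x" by (auto simp: a_r_coset_def')
    then show ?thesis
      unfolding g_def using x lin_mapD(1,2)[OF f] 0[of i] I.Icarr[of i] by simp
  qed
  have "g \<in> lin_map R (quot_algebra A I) M"
    using lin_mapD[OF f]
    by (intro lin_mapI; elim quot_cases; simp add: coset_ops coset_smult g)
  then show ?thesis using g by blast
qed

end

lemma alg_hom_genideal: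
  assumes A: "assoc_algebra R A" and B: "assoc_algebra R B" and f: "f \<in> alg_hom R A B"
    and S: "S \<subseteq> carrier A" and 0: "\<And>s. s \<in> S \<Longrightarrow> f s = \<zero>\<^bsub>B\<^esub>" and x: "x \<in> Idl\<^bsub>A\<^esub> S"
  shows "f x = \<zero>\<^bsub>B\<^esub>"
proof -
  have rA: "ring A" and rB: "ring B" using A B by (auto intro: assoc_algebra_ring)
  have "f \<in> ring_hom A B" using f unfolding alg_hom_def by (rule IntD1)
  then have "ring_hom_ring A B f" by (rule ring_hom_ringI2[OF rA rB])
  then have "ideal (a_kernel A B f) A" by (rule ring_hom_ring.kernel_is_ideal)
  moreover have "S \<subseteq> a_kernel A B f"
  proof
    fix s assume "s \<in> S"
    then show "s \<in> a_kernel A B f" using S 0[of s] unfolding a_kernel_def' by blast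
  qed
  ultimately have "Idl\<^bsub>A\<^esub> S \<subseteq> a_kernel A B f" by (rule ring.genideal_minimal[OF rA])
  then show ?thesis using x unfolding a_kernel_def' by blast
qed

lemma genideal_ideal: "assoc_algebra R A \<Longrightarrow> S \<subseteq> carrier A \<Longrightarrow> ideal (Idl\<^bsub>A\<^esub> S) A"
  by (rule ring.genideal_ideal[OF assoc_algebra_ring])

lemma genideal_self: "assoc_algebra R A \<Longrightarrow> S \<subseteq> carrier A \<Longrightarrow> S \<subseteq> Idl\<^bsub>A\<^esub> S"
  by (rule ring.genideal_self[OF assoc_algebra_ring])

lemma quot_universal_alg:
  assumes A: "assoc_algebra R A" and I: "ideal I A" and B: "assoc_algebra R B"
    and f: "f \<in> alg_hom R A B" and 0: "\<And>x. x \<in> I \<Longrightarrow> f x = \<zero>\<^bsub>B\<^esub>"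
  shows "\<exists>g \<in> alg_hom R (quot_algebra A I) B. \<forall>x\<in>carrier A. g (I +>\<^bsub>A\<^esub> x) = f x"
proof -
  interpret A: assoc_algebra R A by fact
  note h = alg_homD[OF f]
  obtain g where g: "g \<in> lin_map R (quot_algebra A I) B" "\<And>x. x \<in> carrier A \<Longrightarrow> g (I +>\<^bsub>A\<^esub> x) = f x"
    using quot_universal[OF A I h(1) assoc_algebra_module[OF B] 0] by blast
  have "g \<in> alg_hom R (quot_algebra A I) B"
    by (rule alg_homI[OF g(1)]; (elim quot_cases[OF A I])?; simp add: coset_ops[OF A I] g h)
  then show ?thesis using g by blast
qed

section \<open>Free algebras\<close>

context
  fixes K :: "'k ring" (structure) and X :: "'v set"
  assumes K: "cring K"
begin

interpretation K: cring K by (rule K)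

text \<open>The product of the free algebra, detached from the record so that its laws can be proved
  pointwise by induction on the word.\<close>

definition conv :: "('v list \<Rightarrow> 'k) \<Rightarrow> ('v list \<Rightarrow> 'k) \<Rightarrow> 'v list \<Rightarrow> 'k" where
  "conv f g w = (\<Oplus>i\<in>{..length w}. f (take i w) \<otimes> g (drop i w))"

lemma rangeD: "range f \<subseteq> carrier K \<Longrightarrow> f w \<in> carrier K"
  by auto

lemma conv_closed: "range f \<subseteq> carrier K \<Longrightarrow> range g \<subseteq> carrier K \<Longrightarrow> conv f g w \<in> carrier K"
  unfolding conv_def by (intro K.finsum_closed funcsetI K.m_closed rangeD)

lemma conv_Nil: "range f \<subseteq> carrier K \<Longrightarrow> range g \<subseteq> carrier K \<Longrightarrow> conv f g [] = f [] \<otimes> g []"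
  unfolding conv_def by (simp add: K.finsum_insert image_subset_iff)

text \<open>A word is cut either before its first letter or somewhere after it. This recursion
  drives the inductions on words below.\<close>

lemma conv_Cons:
  assumes "range f \<subseteq> carrier K" "range g \<subseteq> carrier K"
  shows "conv f g (a # w) = f [] \<otimes> g (a # w) \<oplus> conv (\<lambda>u. f (a # u)) g w"
proof -
  have c: "(\<lambda>i. f (take i (a # w)) \<otimes> g (drop i (a # w))) \<in> {..Suc (length w)} \<rightarrow> carrier K"
    using assms by (intro funcsetI K.m_closed rangeD)
  have "conv f g (a # w) = (\<Oplus>i\<in>{..length w}. f (take (Suc i) (a # w)) \<otimes> g (drop (Suc i) (a # w)))
      \<oplus> f (take 0 (a # w)) \<otimes> g (drop 0 (a # w))"
    unfolding conv_def using K.finsum_Suc2[OF c] by simp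
  also have "\<dots> = conv (\<lambda>u. f (a # u)) g w \<oplus> f [] \<otimes> g (a # w)"
    by (simp add: conv_def)
  also have "\<dots> = f [] \<otimes> g (a # w) \<oplus> conv (\<lambda>u. f (a # u)) g w"
    using assms by (intro K.a_comm conv_closed K.m_closed) auto
  finally show ?thesis .
qed

lemma range_Cons: "range f \<subseteq> carrier K \<Longrightarrow> range (\<lambda>u. f (a # u)) \<subseteq> carrier K"
  by auto

lemma conv_add_l:
  "range f \<subseteq> carrier K \<Longrightarrow> range f' \<subseteq> carrier K \<Longrightarrow> range g \<subseteq> carrier K \<Longrightarrow>
    conv (\<lambda>u. f u \<oplus> f' u) g w = conv f g w \<oplus> conv f' g w"
proof (induction w arbitrary: f f')
  case Nil then show ?case by (subst (1 2 3) conv_Nil) (auto simp: K.l_distr rangeD)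
next
  case (Cons a w)
  have r: "range (\<lambda>u. f u \<oplus> f' u) \<subseteq> carrier K" using Cons by (auto simp: rangeD)
  note c = conv_closed[OF range_Cons[OF Cons(2)] Cons(4)] conv_closed[OF range_Cons[OF Cons(3)] Cons(4)]
  show ?case
    unfolding conv_Cons[OF r Cons(4)] conv_Cons[OF Cons(2,4)] conv_Cons[OF Cons(3,4)]
    using Cons.IH[OF range_Cons range_Cons, of f f' a a] Cons(2-4) c
    by (simp add: rangeD K.l_distr K.a_ac)
qed

lemma conv_smult_l:
  "range f \<subseteq> carrier K \<Longrightarrow> range g \<subseteq> carrier K \<Longrightarrow> c \<in> carrier K \<Longrightarrow>
    conv (\<lambda>u. c \<otimes> f u) g w = c \<otimes> conv f g w"
proof (induction w arbitrary: f)
  case Nil then show ?case by (subst (1 2) conv_Nil) (auto simp: K.m_assoc rangeD)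
next
  case (Cons a w)
  have r: "range (\<lambda>u. c \<otimes> f u) \<subseteq> carrier K" using Cons by (auto simp: rangeD)
  show ?case
    unfolding conv_Cons[OF r Cons(3)] conv_Cons[OF Cons(2,3)]
    using Cons.IH[OF range_Cons, of f a] Cons(2-4) conv_closed[OF range_Cons[OF Cons(2)] Cons(3)]
    by (simp add: rangeD K.r_distr K.m_assoc)
qed

lemma conv_add_r:
  "range f \<subseteq> carrier K \<Longrightarrow> range g \<subseteq> carrier K \<Longrightarrow> range g' \<subseteq> carrier K \<Longrightarrow>
    conv f (\<lambda>u. g u \<oplus> g' u) w = conv f g w \<oplus> conv f g' w"
proof (induction w arbitrary: f)
  case Nil then show ?case by (subst (1 2 3) conv_Nil) (auto simp: K.r_distr rangeD)
next
  case (Cons a w)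
  have r: "range (\<lambda>u. g u \<oplus> g' u) \<subseteq> carrier K" using Cons by (auto simp: rangeD)
  note c = conv_closed[OF range_Cons[OF Cons(2)] Cons(3)] conv_closed[OF range_Cons[OF Cons(2)] Cons(4)]
  show ?case
    unfolding conv_Cons[OF Cons(2) r] conv_Cons[OF Cons(2,3)] conv_Cons[OF Cons(2,4)]
    using Cons.IH[OF range_Cons, of f a] Cons(2-4) c
    by (simp add: rangeD K.r_distr K.a_ac)
qed

lemma conv_smult_r:
  "range f \<subseteq> carrier K \<Longrightarrow> range g \<subseteq> carrier K \<Longrightarrow> c \<in> carrier K \<Longrightarrow>
    conv f (\<lambda>u. c \<otimes> g u) w = c \<otimes> conv f g w"
proof (induction w arbitrary: f)
  case Nil then show ?case by (subst (1 2) conv_Nil) (auto simp: K.m_lcomm rangeD)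
next
  case (Cons a w)
  have r: "range (\<lambda>u. c \<otimes> g u) \<subseteq> carrier K" using Cons by (auto simp: rangeD)
  show ?case
    unfolding conv_Cons[OF Cons(2) r] conv_Cons[OF Cons(2,3)]
    using Cons.IH[OF range_Cons, of f a] Cons(2-4) conv_closed[OF range_Cons[OF Cons(2)] Cons(3)]
    by (simp add: rangeD K.r_distr K.m_lcomm)
qed

lemma conv_zero:
  assumes "range f \<subseteq> carrier K" "range g \<subseteq> carrier K"
    "\<And>u v. w = u @ v \<Longrightarrow> f u = \<zero> \<or> g v = \<zero>"
  shows "conv f g w = \<zero>"
  unfolding conv_def
proof (rule K.add.finprod_one_eqI)
  fix i
  have "f (take i w) = \<zero> \<or> g (drop i w) = \<zero>" by (rule assms(3)) simp
  then show "f (take i w) \<otimes> g (drop i w) = \<zero>" using assms(1,2) by (auto simp: rangeD)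
qed

lemma conv_assoc:
  "range f \<subseteq> carrier K \<Longrightarrow> range g \<subseteq> carrier K \<Longrightarrow> range h \<subseteq> carrier K \<Longrightarrow>
    conv (conv f g) h w = conv f (conv g h) w"
proof (induction w arbitrary: f)
  case Nil
  have r: "range (conv f g) \<subseteq> carrier K" "range (conv g h) \<subseteq> carrier K"
    using Nil by (auto intro: conv_closed)
  show ?case unfolding conv_Nil[OF r(1) Nil(3)] conv_Nil[OF Nil(1) r(2)] conv_Nil[OF Nil(1,2)] conv_Nil[OF Nil(2,3)]
    using Nil by (simp add: K.m_assoc rangeD)
next
  case (Cons a w)
  note r = Cons(2-4)
  have r': "range (conv f g) \<subseteq> carrier K" "range (conv g h) \<subseteq> carrier K"
    using r by (auto intro: conv_closed)
  note rc = range_Cons[OF r(1), of a] range_Cons[OF r(2), of a]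
  have r2: "range (\<lambda>u. f [] \<otimes> g (a # u)) \<subseteq> carrier K" using r by (auto simp: rangeD)
  have r3: "range (conv (\<lambda>u. f (a # u)) g) \<subseteq> carrier K" using conv_closed[OF rc(1) r(2)] by auto
  have "conv (conv f g) h (a # w) = f [] \<otimes> g [] \<otimes> h (a # w) \<oplus>
     conv (\<lambda>u. f [] \<otimes> g (a # u) \<oplus> conv (\<lambda>u. f (a # u)) g u) h w"
    unfolding conv_Cons[OF r'(1) r(3)] conv_Nil[OF r(1,2)] conv_Cons[OF r(1,2)] by simp
  also have "conv (\<lambda>u. f [] \<otimes> g (a # u) \<oplus> conv (\<lambda>u. f (a # u)) g u) h w =
     f [] \<otimes> conv (\<lambda>u. g (a # u)) h w \<oplus> conv (\<lambda>u. f (a # u)) (conv g h) w"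
    unfolding conv_add_l[OF r2 r3 r(3)] conv_smult_l[OF rc(2) r(3) rangeD[OF r(1)]] Cons.IH[OF rc(1) r(2,3)] ..
  also have "f [] \<otimes> g [] \<otimes> h (a # w) \<oplus>
      (f [] \<otimes> conv (\<lambda>u. g (a # u)) h w \<oplus> conv (\<lambda>u. f (a # u)) (conv g h) w) =
      f [] \<otimes> (g [] \<otimes> h (a # w) \<oplus> conv (\<lambda>u. g (a # u)) h w) \<oplus> conv (\<lambda>u. f (a # u)) (conv g h) w"
    using r conv_closed[OF rc(2) r(3), of w] conv_closed[OF rc(1) r'(2), of w]
    by (simp add: rangeD K.r_distr K.m_assoc K.a_assoc)
  also have "\<dots> = conv f (conv g h) (a # w)"
    unfolding conv_Cons[OF r(1) r'(2)] conv_Cons[OF r(2,3)] ..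
  finally show ?case .
qed

lemma conv_one_l: "range g \<subseteq> carrier K \<Longrightarrow> conv (\<lambda>w. if w = [] then \<one> else \<zero>) g w = g w"
proof (cases w)
  case Nil
  assume "range g \<subseteq> carrier K"
  then show ?thesis unfolding Nil by (subst conv_Nil) (auto simp: rangeD)
next
  case (Cons a v)
  assume g: "range g \<subseteq> carrier K"
  then show ?thesis unfolding Cons
    by (subst conv_Cons) (auto simp: rangeD conv_zero)
qed

lemma conv_one_r: "range f \<subseteq> carrier K \<Longrightarrow> conv f (\<lambda>w. if w = [] then \<one> else \<zero>) w = f w"
proof (induction w arbitrary: f)
  case Nil then show ?case by (subst conv_Nil) (auto simp: rangeD)
next
  case (Cons a w) then show ?case using Cons.IH[OF range_Cons, of f a]
    by (subst conv_Cons) (auto simp: rangeD)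
qed

abbreviation (input) "FA \<equiv> free_algebra K X"

lemma FA_simps:
  "f \<oplus>\<^bsub>FA\<^esub> g = (\<lambda>w. f w \<oplus> g w)" "f \<otimes>\<^bsub>FA\<^esub> g = conv f g" "\<zero>\<^bsub>FA\<^esub> = (\<lambda>w. \<zero>)"
  "\<one>\<^bsub>FA\<^esub> = (\<lambda>w. if w = [] then \<one> else \<zero>)" "c \<odot>\<^bsub>FA\<^esub> f = (\<lambda>w. c \<otimes> f w)"
  by (simp_all add: free_algebra_def conv_def fun_eq_iff)

lemma FA_carrier: "f \<in> carrier FA \<longleftrightarrow> range f \<subseteq> carrier K \<and> (\<forall>w. w \<notin> lists X \<longrightarrow> f w = \<zero>) \<and>
    finite {w. f w \<noteq> \<zero>}"
  by (auto simp: free_algebra_def)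

lemma FA_range: "f \<in> carrier FA \<Longrightarrow> range f \<subseteq> carrier K"
  by (simp add: FA_carrier)

lemma FA_add_closed: "f \<in> carrier FA \<Longrightarrow> g \<in> carrier FA \<Longrightarrow> (\<lambda>w. f w \<oplus> g w) \<in> carrier FA"
  unfolding FA_carrier
  by (auto simp: rangeD intro: finite_subset[of _ "{w. f w \<noteq> \<zero>} \<union> {w. g w \<noteq> \<zero>}"])

lemma FA_smult_closed: "c \<in> carrier K \<Longrightarrow> f \<in> carrier FA \<Longrightarrow> (\<lambda>w. c \<otimes> f w) \<in> carrier FA"
  unfolding FA_carrier
  by (auto simp: rangeD intro: finite_subset[of _ "{w. f w \<noteq> \<zero>}"])

text \<open>The support of a product lies in the set of concatenations of words from the two
  supports, which is finite.\<close>

lemma FA_conv_closed: 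
  assumes f: "f \<in> carrier FA" and g: "g \<in> carrier FA" shows "conv f g \<in> carrier FA"
proof -
  note r = f[unfolded FA_carrier] g[unfolded FA_carrier]
  have s: "\<exists>u v. w = u @ v \<and> f u \<noteq> \<zero> \<and> g v \<noteq> \<zero>" if "conv f g w \<noteq> \<zero>" for w
    using conv_zero[of f g w] r that by metis
  have "{w. conv f g w \<noteq> \<zero>} \<subseteq> (\<lambda>(u, v). u @ v) ` ({w. f w \<noteq> \<zero>} \<times> {w. g w \<noteq> \<zero>})"
    using s by force
  then have "finite {w. conv f g w \<noteq> \<zero>}" using r by (meson finite_SigmaI finite_imageI finite_subset)
  moreover have "conv f g w = \<zero>" if "w \<notin> lists X" for w
    using s[of w] r that by (metis append_in_lists_conv)
  moreover have "range (conv f g) \<subseteq> carrier K" using conv_closed r by auto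
  ultimately show ?thesis
    unfolding FA_carrier by simp
qed

lemma FA_assoc_algebra: "assoc_algebra K FA"
proof -
  have ab: "abelian_group FA"
  proof (rule abelian_groupI)
    fix f assume f: "f \<in> carrier FA"
    show "\<exists>g\<in>carrier FA. g \<oplus>\<^bsub>FA\<^esub> f = \<zero>\<^bsub>FA\<^esub>"
    proof (intro bexI[of _ "\<lambda>w. (\<ominus> \<one>) \<otimes> f w"] FA_smult_closed f)
      have "f w \<in> carrier K" for w using f by (auto simp: FA_carrier)
      then show "(\<lambda>w. (\<ominus> \<one>) \<otimes> f w) \<oplus>\<^bsub>FA\<^esub> f = \<zero>\<^bsub>FA\<^esub>"
        by (simp add: FA_simps K.l_minus K.l_neg)
    qed simp
  next
    fix f g assume "f \<in> carrier FA" "g \<in> carrier FA"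
    then show "f \<oplus>\<^bsub>FA\<^esub> g \<in> carrier FA" by (simp add: FA_simps FA_add_closed)
  qed (auto simp: FA_simps FA_carrier rangeD K.a_ac)
  have m: "module K FA"
  proof (intro module.intro module_axioms.intro ab K)
    fix c f assume "c \<in> carrier K" "f \<in> carrier FA"
    then show "c \<odot>\<^bsub>FA\<^esub> f \<in> carrier FA" by (simp add: FA_simps FA_smult_closed)
  qed (auto simp: FA_simps FA_carrier rangeD K.l_distr K.r_distr K.m_assoc)
  show ?thesis
  proof (rule assoc_algebraI[OF m])
    show "monoid.mult FA \<in> bilin_map K FA FA FA"
      by (intro bilin_mapI lin_mapI)
        (simp_all add: FA_simps FA_conv_closed conv_add_l conv_add_r conv_smult_l conv_smult_r FA_range fun_eq_iff)
    show "\<one>\<^bsub>FA\<^esub> \<in> carrier FA"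
      by (auto simp: FA_simps FA_carrier)
  qed (simp_all add: FA_simps fun_eq_iff conv_assoc conv_one_l conv_one_r FA_range)
qed

definition mono :: "'k \<Rightarrow> 'v list \<Rightarrow> 'v list \<Rightarrow> 'k" where
  "mono c u = (\<lambda>w. if w = u then c else \<zero>)"

lemma mono_range: "c \<in> carrier K \<Longrightarrow> range (mono c u) \<subseteq> carrier K"
  by (auto simp: mono_def)

lemma conv_mono: "c \<in> carrier K \<Longrightarrow> d \<in> carrier K \<Longrightarrow> conv (mono c u) (mono d v) w = mono (c \<otimes> d) (u @ v) w"
proof (induction w arbitrary: u)
  case Nil
  show ?case unfolding conv_Nil[OF mono_range[OF Nil(1)] mono_range[OF Nil(2)]]
    using Nil by (auto simp: mono_def)
next
  case (Cons a w)
  have z: "conv (\<lambda>w. \<zero>) (mono d v) w = \<zero>"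
    by (intro conv_zero mono_range Cons(3)) auto
  show ?case
  proof (cases u)
    case Nil
    have "(\<lambda>w. mono c [] (a # w)) = (\<lambda>w. \<zero>)" by (simp add: mono_def)
    then show ?thesis unfolding conv_Cons[OF mono_range[OF Cons(2)] mono_range[OF Cons(3)]] Nil
      using z Cons(2,3) by (simp, simp add: mono_def)
  next
    case u: (Cons b u')
    have "(\<lambda>w. mono c u (a # w)) = (if a = b then mono c u' else (\<lambda>w. \<zero>))"
      by (auto simp: u mono_def fun_eq_iff)
    moreover have "mono c u [] = \<zero>" by (simp add: u mono_def)
    moreover have "mono d v (a # w) \<in> carrier K" using Cons(3) by (simp add: mono_def)
    moreover have "mono (c \<otimes> d) (u' @ v) w \<in> carrier K" using Cons(2,3) by (simp add: mono_def)
    ultimately show ?thesis unfolding conv_Cons[OF mono_range[OF Cons(2)] mono_range[OF Cons(3)]]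
      using z Cons by (auto simp: u) (auto simp: mono_def)
  qed
qed

lemma mono_closed: "c \<in> carrier K \<Longrightarrow> w \<in> lists X \<Longrightarrow> mono c w \<in> carrier FA"
  by (auto simp: FA_carrier mono_def)

lemma free_var_mono: "free_var K x = mono \<one> [x]"
  by (simp add: free_var_def mono_def)

lemma free_var_closed: "x \<in> X \<Longrightarrow> free_var K x \<in> carrier FA"
  by (simp add: free_var_mono mono_closed)

text \<open>Induction on a finite set that contains the support: one word is split off as a
  monomial, and the remainder has support in the smaller set.\<close>

lemma FA_mono_induct:
  assumes f: "f \<in> carrier FA"
    and mono: "\<And>c w. c \<in> carrier K \<Longrightarrow> w \<in> lists X \<Longrightarrow> P (mono c w)"
    and add: "\<And>f g. f \<in> carrier FA \<Longrightarrow> g \<in> carrier FA \<Longrightarrow> P f \<Longrightarrow> P g \<Longrightarrow> P (f \<oplus>\<^bsub>FA\<^esub> g)"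
  shows "P f"
proof -
  have "\<forall>f\<in>carrier FA. {w. f w \<noteq> \<zero>} \<subseteq> S \<longrightarrow> P f" if "finite S" "S \<subseteq> lists X" for S
    using that
  proof (induction S)
    case empty
    show ?case
    proof (intro ballI impI)
      fix f assume "f \<in> carrier FA" "{w. f w \<noteq> \<zero>} \<subseteq> {}"
      then have "f = mono \<zero> []" by (auto simp: mono_def)
      then show "P f" using mono by simp
    qed
  next
    case (insert w S)
    show ?case
    proof (intro ballI impI)
      fix f assume f: "f \<in> carrier FA" and s: "{w. f w \<noteq> \<zero>} \<subseteq> insert w S"
      let ?g = "f(w := \<zero>)"
      have fw: "f v \<in> carrier K" for v using f by (auto simp: FA_carrier)
      have g: "?g \<in> carrier FA" using f
        by (auto simp: FA_carrier intro: finite_subset[of _ "{w. f w \<noteq> \<zero>}"])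
      moreover have "{v. ?g v \<noteq> \<zero>} \<subseteq> S" using s by auto
      ultimately have "P ?g" using insert by auto
      moreover have "f = mono (f w) w \<oplus>\<^bsub>FA\<^esub> ?g" using fw by (auto simp: FA_simps mono_def fun_eq_iff)
      ultimately show "P f" using add[OF mono_closed g] mono fw insert.prems by (metis insert_subset)
    qed
  qed
  moreover have "finite {w. f w \<noteq> \<zero>}" "{w. f w \<noteq> \<zero>} \<subseteq> lists X"
    using f unfolding FA_carrier by auto
  ultimately show ?thesis using f by simp
qed

lemma free_algebra_induct [consumes 1, case_names scal var add]:
  assumes f: "f \<in> carrier FA"
    and scal: "\<And>c. c \<in> carrier K \<Longrightarrow> P (c \<odot>\<^bsub>FA\<^esub> \<one>\<^bsub>FA\<^esub>)"
    and var: "\<And>x f. x \<in> X \<Longrightarrow> f \<in> carrier FA \<Longrightarrow> P f \<Longrightarrow> P (free_var K x \<otimes>\<^bsub>FA\<^esub> f)"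
    and add: "\<And>f g. f \<in> carrier FA \<Longrightarrow> g \<in> carrier FA \<Longrightarrow> P f \<Longrightarrow> P g \<Longrightarrow> P (f \<oplus>\<^bsub>FA\<^esub> g)"
  shows "P f"
proof (rule FA_mono_induct[of f P])
  show "f \<in> carrier FA" by (rule f)
  show "P (f \<oplus>\<^bsub>FA\<^esub> g)" if "f \<in> carrier FA" "g \<in> carrier FA" "P f" "P g" for f g
    by (rule add[OF that])
  fix c w assume c: "c \<in> carrier K" and "w \<in> lists X"
  from this(2) show "P (mono c w)"
  proof (induction w)
    case Nil
    have "mono c [] = c \<odot>\<^bsub>FA\<^esub> \<one>\<^bsub>FA\<^esub>" using c by (auto simp: FA_simps mono_def)
    then show ?case using scal[OF c] by simp
  next
    case (Cons a w)
    have "mono c (a # w) = free_var K a \<otimes>\<^bsub>FA\<^esub> mono c w"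
      using c by (simp add: FA_simps free_var_mono conv_mono fun_eq_iff)
    then show ?case using var[OF _ mono_closed[OF c]] Cons by auto
  qed
qed

context
  fixes A :: "('k, 'a, 'm) module_scheme" and \<phi> :: "'v \<Rightarrow> 'a"
  assumes A: "assoc_algebra K A" and \<phi>: "\<And>x. x \<in> X \<Longrightarrow> \<phi> x \<in> carrier A"
begin

interpretation A: assoc_algebra K A by (rule A)

definition word_val :: "'v list \<Rightarrow> 'a" where
  "word_val w = foldr (\<lambda>x a. \<phi> x \<otimes>\<^bsub>A\<^esub> a) w \<one>\<^bsub>A\<^esub>"

lemma word_val_closed: "w \<in> lists X \<Longrightarrow> word_val w \<in> carrier A"
  by (induction w) (auto simp: word_val_def \<phi>)

lemma word_val_append: "u \<in> lists X \<Longrightarrow> v \<in> lists X \<Longrightarrow> word_val (u @ v) = word_val u \<otimes>\<^bsub>A\<^esub> word_val v"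
  using word_val_closed by (induction u) (auto simp: word_val_def \<phi> A.A.m_assoc)

definition free_ev :: "('v list \<Rightarrow> 'k) \<Rightarrow> 'a" where
  "free_ev f = (\<Oplus>\<^bsub>A\<^esub>w\<in>{w. f w \<noteq> \<zero>}. f w \<odot>\<^bsub>A\<^esub> word_val w)"

lemma free_ev_mono: 
  assumes c: "c \<in> carrier K" and w: "w \<in> lists X" shows "free_ev (mono c w) = c \<odot>\<^bsub>A\<^esub> word_val w"
proof (cases "c = \<zero>")
  case True
  then have "{v. mono c w v \<noteq> \<zero>} = {}" by (auto simp: mono_def)
  then show ?thesis using True word_val_closed[OF w] by (simp add: free_ev_def)
next
  case False
  then have "{v. mono c w v \<noteq> \<zero>} = {w}" by (auto simp: mono_def)
  then show ?thesis using c word_val_closed[OF w] by (simp add: free_ev_def) (simp add: mono_def)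
qed

text \<open>Enlarging the index set is harmless and lets the sums for f, g and f + g run over one
  common set.\<close>

lemma free_ev_support:
  assumes f: "f \<in> carrier FA" and S: "finite S" "{w. f w \<noteq> \<zero>} \<subseteq> S" "S \<subseteq> lists X"
  shows "free_ev f = (\<Oplus>\<^bsub>A\<^esub>w\<in>S. f w \<odot>\<^bsub>A\<^esub> word_val w)"
  unfolding free_ev_def
proof (rule A.add.finprod_mono_neutral_cong_left[OF S(1,2)])
  have c: "f w \<in> carrier K" for w using f by (auto simp: FA_carrier)
  show "\<And>i. i \<in> S - {w. f w \<noteq> \<zero>} \<Longrightarrow> f i \<odot>\<^bsub>A\<^esub> word_val i = \<zero>\<^bsub>A\<^esub>"
    using A.smult_l_null[OF word_val_closed] S(3) by fastforce
  show "(\<lambda>w. f w \<odot>\<^bsub>A\<^esub> word_val w) \<in> S \<rightarrow> carrier A"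
    using c S(3) word_val_closed by (intro funcsetI A.smult_closed) blast+
qed simp

lemma free_ev_add:
  assumes f: "f \<in> carrier FA" and g: "g \<in> carrier FA"
  shows "free_ev (f \<oplus>\<^bsub>FA\<^esub> g) = free_ev f \<oplus>\<^bsub>A\<^esub> free_ev g" "free_ev f \<in> carrier A"
proof -
  let ?S = "{w. f w \<noteq> \<zero>} \<union> {w. g w \<noteq> \<zero>}"
  have S: "finite ?S" "?S \<subseteq> lists X" using f g unfolding FA_carrier by auto
  have c: "f w \<in> carrier K" "g w \<in> carrier K" for w using f g by (auto simp: FA_carrier)
  have wv: "word_val w \<in> carrier A" if "w \<in> ?S" for w using that S word_val_closed by blast
  have s: "{w. (f \<oplus>\<^bsub>FA\<^esub> g) w \<noteq> \<zero>} \<subseteq> ?S" by (auto simp: FA_simps)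
  have "f \<oplus>\<^bsub>FA\<^esub> g \<in> carrier FA" using FA_add_closed[OF f g] by (simp add: FA_simps)
  then have "free_ev (f \<oplus>\<^bsub>FA\<^esub> g) = (\<Oplus>\<^bsub>A\<^esub>w\<in>?S. (f \<oplus>\<^bsub>FA\<^esub> g) w \<odot>\<^bsub>A\<^esub> word_val w)"
    by (rule free_ev_support[OF _ S(1) s S(2)])
  also have "\<dots> = (\<Oplus>\<^bsub>A\<^esub>w\<in>?S. f w \<odot>\<^bsub>A\<^esub> word_val w \<oplus>\<^bsub>A\<^esub> g w \<odot>\<^bsub>A\<^esub> word_val w)"
    using c wv by (intro A.M.finsum_cong') (auto simp: FA_simps A.smult_l_distr)
  also have "\<dots> = (\<Oplus>\<^bsub>A\<^esub>w\<in>?S. f w \<odot>\<^bsub>A\<^esub> word_val w) \<oplus>\<^bsub>A\<^esub> (\<Oplus>\<^bsub>A\<^esub>w\<in>?S. g w \<odot>\<^bsub>A\<^esub> word_val w)"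
    using c wv by (intro A.M.finsum_addf) auto
  also have "\<dots> = free_ev f \<oplus>\<^bsub>A\<^esub> free_ev g"
    using free_ev_support[OF f S(1) _ S(2)] free_ev_support[OF g S(1) _ S(2)] by simp
  finally show "free_ev (f \<oplus>\<^bsub>FA\<^esub> g) = free_ev f \<oplus>\<^bsub>A\<^esub> free_ev g" .
  show "free_ev f \<in> carrier A"
    unfolding free_ev_def using c wv by (intro A.M.finsum_closed) auto
qed

lemma free_ev_hom: "free_ev \<in> alg_hom K FA A"
proof -
  interpret FA: assoc_algebra K FA by (rule FA_assoc_algebra)
  note a = free_ev_add
  have sm: "free_ev (c \<odot>\<^bsub>FA\<^esub> f) = c \<odot>\<^bsub>A\<^esub> free_ev f" if c: "c \<in> carrier K" and f: "f \<in> carrier FA" for c f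
  proof (rule FA_mono_induct[OF f])
    fix d w assume d: "d \<in> carrier K" "w \<in> lists X"
    have "c \<odot>\<^bsub>FA\<^esub> mono d w = mono (c \<otimes> d) w" using c by (auto simp: FA_simps mono_def fun_eq_iff)
    then show "free_ev (c \<odot>\<^bsub>FA\<^esub> mono d w) = c \<odot>\<^bsub>A\<^esub> free_ev (mono d w)"
      using c d word_val_closed by (simp add: free_ev_mono A.smult_assoc1)
  qed (use c a in \<open>simp add: FA.smult_r_distr A.smult_r_distr\<close>)
  have m: "free_ev (f \<otimes>\<^bsub>FA\<^esub> g) = free_ev f \<otimes>\<^bsub>A\<^esub> free_ev g" if f: "f \<in> carrier FA" and g: "g \<in> carrier FA" for f g
  proof (rule FA_mono_induct[OF f])
    fix c u assume c: "c \<in> carrier K" "u \<in> lists X"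
    note cu = mono_closed[OF c]
    show "free_ev (mono c u \<otimes>\<^bsub>FA\<^esub> g) = free_ev (mono c u) \<otimes>\<^bsub>A\<^esub> free_ev g"
    proof (rule FA_mono_induct[OF g])
      fix d v assume d: "d \<in> carrier K" "v \<in> lists X"
      have "mono c u \<otimes>\<^bsub>FA\<^esub> mono d v = mono (c \<otimes> d) (u @ v)"
        using c d by (simp add: FA_simps conv_mono fun_eq_iff)
      then show "free_ev (mono c u \<otimes>\<^bsub>FA\<^esub> mono d v) = free_ev (mono c u) \<otimes>\<^bsub>A\<^esub> free_ev (mono d v)"
        using c d word_val_closed
        by (simp add: free_ev_mono word_val_append A.smult_mult_left A.smult_mult_right A.smult_assoc1[symmetric] K.m_comm)
    qed (use cu a in \<open>simp add: FA.A.r_distr A.A.r_distr\<close>)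
  qed (use g a in \<open>simp add: FA.A.l_distr A.A.l_distr\<close>)
  have "\<one>\<^bsub>FA\<^esub> = mono \<one> []" by (auto simp: FA_simps mono_def)
  then have "free_ev \<one>\<^bsub>FA\<^esub> = \<one>\<^bsub>A\<^esub>" by (simp add: free_ev_mono word_val_def)
  then show ?thesis
    by (intro alg_homI lin_mapI m sm a) simp_all
qed

lemma free_ev_var: "x \<in> X \<Longrightarrow> free_ev (free_var K x) = \<phi> x"
  by (simp add: free_var_mono free_ev_mono word_val_def \<phi>)

end

lemma free_universal:
  assumes "assoc_algebra K A" "\<And>x. x \<in> X \<Longrightarrow> \<phi> x \<in> carrier A"
  shows "\<exists>f \<in> alg_hom K FA A. \<forall>x\<in>X. f (free_var K x) = \<phi> x"
  using free_ev_hom[of A \<phi>] free_ev_var[of A \<phi>] assms by blast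

end

section \<open>Tensor and symmetric algebras\<close>

locale vspace =
  fixes K :: "'k ring" (structure) and V :: "('k, 'v, 'm) module_scheme"
  assumes K_field: "field K" and V_module: "module K V"
begin

sublocale KF: field K by (rule K_field)
sublocale V: module K V by (rule V_module)

abbreviation FA where "FA \<equiv> free_algebra K (carrier V)"
abbreviation TA where "TA \<equiv> tensor_algebra K V"
abbreviation SA where "SA \<equiv> symmetric_algebra K V"
abbreviation XV where "XV \<equiv> X_var K V"

lemma FA_alg: "assoc_algebra K FA"
  by (rule FA_assoc_algebra) (rule KF.is_cring)

interpretation FA: assoc_algebra K FA by (rule FA_alg)

lemma fv: "v \<in> carrier V \<Longrightarrow> free_var K v \<in> carrier FA"
  by (rule free_var_closed[OF KF.is_cring])

definition lin_rels where
  "lin_rels = {free_var K (u \<oplus>\<^bsub>V\<^esub> v) \<ominus>\<^bsub>FA\<^esub> (free_var K u \<oplus>\<^bsub>FA\<^esub> free_var K v) | u v.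
          u \<in> carrier V \<and> v \<in> carrier V} \<union>
       {free_var K (c \<odot>\<^bsub>V\<^esub> v) \<ominus>\<^bsub>FA\<^esub> (c \<odot>\<^bsub>FA\<^esub> free_var K v) | c v.
          c \<in> carrier K \<and> v \<in> carrier V}"

lemma lin_rels: "lin_rels \<subseteq> carrier FA" "linearity_ideal K V = Idl\<^bsub>FA\<^esub> lin_rels"
  by (auto simp: lin_rels_def linearity_ideal_def Let_def fv)

lemma lin_ideal: "ideal (linearity_ideal K V) FA"
  unfolding lin_rels(2) by (rule genideal_ideal[OF FA_alg lin_rels(1)])

lemma TA_alg: "assoc_algebra K TA"
  unfolding tensor_algebra_def by (rule quot_assoc_algebra[OF FA_alg lin_ideal])

sublocale TA: assoc_algebra K TA by (rule TA_alg)

lemmas co = coset_ops[OF FA_alg lin_ideal, folded tensor_algebra_def]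
  coset_smult[OF FA_alg lin_ideal, folded tensor_algebra_def]

lemma XV_closed [simp]: "v \<in> carrier V \<Longrightarrow> XV v \<in> carrier TA"
  unfolding X_var_def by (intro co fv)

lemma XV_lin: "XV \<in> lin_map K V TA"
proof (rule lin_mapI)
  note e = coset_eq_iff[OF FA_alg lin_ideal]
  note g = genideal_self[OF FA_alg lin_rels(1), folded lin_rels(2), THEN subsetD]
  fix u v assume uv: "u \<in> carrier V" "v \<in> carrier V"
  then have "free_var K (u \<oplus>\<^bsub>V\<^esub> v) \<ominus>\<^bsub>FA\<^esub> (free_var K u \<oplus>\<^bsub>FA\<^esub> free_var K v) \<in> lin_rels"
    unfolding lin_rels_def by blast
  then show "XV (u \<oplus>\<^bsub>V\<^esub> v) = XV u \<oplus>\<^bsub>TA\<^esub> XV v"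
    using uv unfolding X_var_def by (simp add: co fv e g)
next
  note e = coset_eq_iff[OF FA_alg lin_ideal]
  note g = genideal_self[OF FA_alg lin_rels(1), folded lin_rels(2), THEN subsetD]
  fix c v assume cv: "c \<in> carrier K" "v \<in> carrier V"
  then have "free_var K (c \<odot>\<^bsub>V\<^esub> v) \<ominus>\<^bsub>FA\<^esub> (c \<odot>\<^bsub>FA\<^esub> free_var K v) \<in> lin_rels"
    unfolding lin_rels_def by blast
  then show "XV (c \<odot>\<^bsub>V\<^esub> v) = c \<odot>\<^bsub>TA\<^esub> XV v"
    using cv unfolding X_var_def by (simp add: co fv e g)
qed simp

lemma TA_universal:
  assumes A: "assoc_algebra K A" and \<phi>: "\<phi> \<in> lin_map K V A"
  shows "\<exists>f \<in> alg_hom K TA A. \<forall>v\<in>carrier V. f (XV v) = \<phi> v"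
proof -
  interpret A: assoc_algebra K A by (rule A)
  note p = lin_mapD[OF \<phi>]
  obtain f where f: "f \<in> alg_hom K FA A" "\<And>v. v \<in> carrier V \<Longrightarrow> f (free_var K v) = \<phi> v"
    using free_universal[OF KF.is_cring A, of "carrier V" \<phi>] p(1) by blast
  note h = alg_homD[OF f(1)]
  note hm = lin_map_minus[OF h(1) FA.M.abelian_group_axioms A.M.abelian_group_axioms]
  have minus_self: "x \<ominus>\<^bsub>A\<^esub> x = \<zero>\<^bsub>A\<^esub>" if "x \<in> carrier A" for x
    using that by (simp add: a_minus_def A.M.r_neg)
  have "f s = \<zero>\<^bsub>A\<^esub>" if "s \<in> lin_rels" for s
    using that unfolding lin_rels_def
    by (elim UnE CollectE exE conjE; hypsubst) (simp_all add: hm h f(2) fv p minus_self)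
  then have 0: "f x = \<zero>\<^bsub>A\<^esub>" if "x \<in> linearity_ideal K V" for x
    using that unfolding lin_rels(2) by (rule alg_hom_genideal[OF FA_alg A f(1) lin_rels(1)])
  obtain g where g: "g \<in> alg_hom K TA A" "\<And>x. x \<in> carrier FA \<Longrightarrow> g (linearity_ideal K V +>\<^bsub>FA\<^esub> x) = f x"
    using quot_universal_alg[OF FA_alg lin_ideal A f(1) 0] unfolding tensor_algebra_def by blast
  then show ?thesis
    by (intro bexI[OF _ g(1)] ballI) (simp add: X_var_def f(2) fv)
qed

lemma TA_induct [consumes 1, case_names scal var add]:
  assumes t: "t \<in> carrier TA"
    and scal: "\<And>c. c \<in> carrier K \<Longrightarrow> P (c \<odot>\<^bsub>TA\<^esub> \<one>\<^bsub>TA\<^esub>)"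
    and var: "\<And>v t. v \<in> carrier V \<Longrightarrow> t \<in> carrier TA \<Longrightarrow> P t \<Longrightarrow> P (XV v \<otimes>\<^bsub>TA\<^esub> t)"
    and add: "\<And>s t. s \<in> carrier TA \<Longrightarrow> t \<in> carrier TA \<Longrightarrow> P s \<Longrightarrow> P t \<Longrightarrow> P (s \<oplus>\<^bsub>TA\<^esub> t)"
  shows "P t"
proof -
  let ?q = "\<lambda>x. linearity_ideal K V +>\<^bsub>FA\<^esub> x"
  obtain x where x: "x \<in> carrier FA" "t = ?q x"
    using t unfolding tensor_algebra_def by (rule quot_cases[OF FA_alg lin_ideal])
  have "P (?q x)" using x(1)
  proof (induction x rule: free_algebra_induct[OF KF.is_cring, consumes 1, case_names scal var add])
    case (scal c) then show ?case using assms(2)[of c] by (simp add: co)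
  next
    case (var v f) then show ?case using assms(3)[of v "?q f"] by (simp add: co fv X_var_def)
  next
    case (add f g) then show ?case using assms(4)[of "?q f" "?q g"] by (simp add: co)
  qed
  then show ?thesis using x by simp
qed

lemma TA_hom_unique:
  assumes "assoc_algebra K A" "f \<in> alg_hom K TA A" "g \<in> alg_hom K TA A"
    and "\<And>v. v \<in> carrier V \<Longrightarrow> f (XV v) = g (XV v)" and "t \<in> carrier TA"
  shows "f t = g t"
  using assms(5)
  by (induction t rule: TA_induct) (simp_all add: alg_homD[OF assms(2)] alg_homD[OF assms(3)] assms(4))

section \<open>The symmetric algebra and its universal property\<close>

definition comm_rels where
  "comm_rels = {(XV u \<otimes>\<^bsub>TA\<^esub> XV v) \<ominus>\<^bsub>TA\<^esub> (XV v \<otimes>\<^bsub>TA\<^esub> XV u) | u v. u \<in> carrier V \<and> v \<in> carrier V}"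

lemma comm_rels: "comm_rels \<subseteq> carrier TA" "commutator_ideal K V = Idl\<^bsub>TA\<^esub> comm_rels"
  by (auto simp: comm_rels_def commutator_ideal_def Let_def)

lemma comm_ideal: "ideal (commutator_ideal K V) TA"
  unfolding comm_rels(2) by (rule genideal_ideal[OF TA_alg comm_rels(1)])

lemma SA_alg: "assoc_algebra K SA"
  unfolding symmetric_algebra_def by (rule quot_assoc_algebra[OF TA_alg comm_ideal])

sublocale SA: assoc_algebra K SA by (rule SA_alg)

definition sv where "sv v = commutator_ideal K V +>\<^bsub>TA\<^esub> XV v"

lemmas cs = coset_ops[OF TA_alg comm_ideal, folded symmetric_algebra_def]
  coset_smult[OF TA_alg comm_ideal, folded symmetric_algebra_def]

lemma sv_closed [simp]: "v \<in> carrier V \<Longrightarrow> sv v \<in> carrier SA"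
  unfolding sv_def by (intro cs XV_closed)

lemma sv_lin: "sv \<in> lin_map K V SA"
  using lin_comp[OF alg_homD(1)[OF coset_hom[OF TA_alg comm_ideal]] XV_lin]
  unfolding sv_def[abs_def] symmetric_algebra_def .

lemma SA_induct [consumes 1, case_names scal var add]:
  assumes t: "t \<in> carrier SA"
    and scal: "\<And>c. c \<in> carrier K \<Longrightarrow> P (c \<odot>\<^bsub>SA\<^esub> \<one>\<^bsub>SA\<^esub>)"
    and var: "\<And>v t. v \<in> carrier V \<Longrightarrow> t \<in> carrier SA \<Longrightarrow> P t \<Longrightarrow> P (sv v \<otimes>\<^bsub>SA\<^esub> t)"
    and add: "\<And>s t. s \<in> carrier SA \<Longrightarrow> t \<in> carrier SA \<Longrightarrow> P s \<Longrightarrow> P t \<Longrightarrow> P (s \<oplus>\<^bsub>SA\<^esub> t)"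
  shows "P t"
proof -
  let ?q = "\<lambda>x. commutator_ideal K V +>\<^bsub>TA\<^esub> x"
  obtain x where x: "x \<in> carrier TA" "t = ?q x"
    using t unfolding symmetric_algebra_def by (rule quot_cases[OF TA_alg comm_ideal])
  have "P (?q x)" using x(1)
  proof (induction x rule: TA_induct)
    case (scal c) then show ?case using assms(2)[of c] by (simp add: cs)
  next
    case (var v f) then show ?case using assms(3)[of v "?q f"] by (simp add: cs sv_def)
  next
    case (add f g) then show ?case using assms(4)[of "?q f" "?q g"] by (simp add: cs)
  qed
  then show ?thesis using x by simp
qed

lemma sv_comm: "u \<in> carrier V \<Longrightarrow> v \<in> carrier V \<Longrightarrow> sv u \<otimes>\<^bsub>SA\<^esub> sv v = sv v \<otimes>\<^bsub>SA\<^esub> sv u"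
proof -
  assume uv: "u \<in> carrier V" "v \<in> carrier V"
  then have "(XV u \<otimes>\<^bsub>TA\<^esub> XV v) \<ominus>\<^bsub>TA\<^esub> (XV v \<otimes>\<^bsub>TA\<^esub> XV u) \<in> comm_rels" unfolding comm_rels_def by blast
  then show ?thesis
    using uv genideal_self[OF TA_alg comm_rels(1), folded comm_rels(2), THEN subsetD]
    unfolding sv_def by (simp add: cs coset_eq_iff[OF TA_alg comm_ideal])
qed

text \<open>The relations make generators commute with one another. One induction extends this to a
  generator and an arbitrary element, a second one to two arbitrary elements.\<close>

lemma SA_comm: 
  assumes s: "s \<in> carrier SA" and t: "t \<in> carrier SA" shows "s \<otimes>\<^bsub>SA\<^esub> t = t \<otimes>\<^bsub>SA\<^esub> s"
proof -
  have 1: "sv v \<otimes>\<^bsub>SA\<^esub> t = t \<otimes>\<^bsub>SA\<^esub> sv v" if "v \<in> carrier V" "t \<in> carrier SA" for v t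
    using that(2)
  proof (induction t rule: SA_induct)
    case (var u t)
    have "sv v \<otimes>\<^bsub>SA\<^esub> (sv u \<otimes>\<^bsub>SA\<^esub> t) = (sv u \<otimes>\<^bsub>SA\<^esub> sv v) \<otimes>\<^bsub>SA\<^esub> t"
      using var that(1) by (simp add: sv_comm[of u v] SA.A.m_assoc[symmetric])
    also have "\<dots> = sv u \<otimes>\<^bsub>SA\<^esub> t \<otimes>\<^bsub>SA\<^esub> sv v"
      using var that(1) by (simp add: SA.A.m_assoc)
    finally show ?case .
  qed (use that(1) in \<open>simp_all add: SA.smult_mult_left SA.smult_mult_right SA.A.l_distr SA.A.r_distr\<close>)
  show ?thesis using s
  proof (induction s rule: SA_induct)
    case (var v s)
    have "sv v \<otimes>\<^bsub>SA\<^esub> s \<otimes>\<^bsub>SA\<^esub> t = (sv v \<otimes>\<^bsub>SA\<^esub> t) \<otimes>\<^bsub>SA\<^esub> s"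
      using var t by (simp add: SA.A.m_assoc)
    also have "\<dots> = t \<otimes>\<^bsub>SA\<^esub> (sv v \<otimes>\<^bsub>SA\<^esub> s)"
      using var t by (simp add: 1[of v t] SA.A.m_assoc)
    finally show ?case .
  qed (use t in \<open>simp_all add: SA.smult_mult_left SA.smult_mult_right SA.A.l_distr SA.A.r_distr\<close>)
qed

lemma SA_cring: "cring SA"
  by (intro cring.intro SA.A.ring_axioms comm_monoid.intro SA.A.monoid_axioms comm_monoid_axioms.intro SA_comm)

sublocale SC: cring SA by (rule SA_cring)

lemma SA_universal:
  assumes A: "assoc_algebra K A" and comm: "cring A" and \<phi>: "\<phi> \<in> lin_map K V A"
  shows "\<exists>f \<in> alg_hom K SA A. \<forall>v\<in>carrier V. f (sv v) = \<phi> v"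
proof -
  interpret A: assoc_algebra K A by (rule A)
  interpret C: cring A by (rule comm)
  obtain f where f: "f \<in> alg_hom K TA A" "\<And>v. v \<in> carrier V \<Longrightarrow> f (XV v) = \<phi> v"
    using TA_universal[OF A \<phi>] by blast
  note h = alg_homD[OF f(1)]
  note hm = lin_map_minus[OF h(1) TA.M.abelian_group_axioms A.M.abelian_group_axioms]
  have minus_self: "x \<ominus>\<^bsub>A\<^esub> x = \<zero>\<^bsub>A\<^esub>" if "x \<in> carrier A" for x
    using that by (simp add: a_minus_def A.M.r_neg)
  have "f s = \<zero>\<^bsub>A\<^esub>" if "s \<in> comm_rels" for s
    using that lin_mapD(1)[OF \<phi>] unfolding comm_rels_def
    by (elim CollectE exE conjE; hypsubst) (simp add: hm h f(2) C.m_comm minus_self)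
  then have 0: "f x = \<zero>\<^bsub>A\<^esub>" if "x \<in> commutator_ideal K V" for x
    using that unfolding comm_rels(2) by (rule alg_hom_genideal[OF TA_alg A f(1) comm_rels(1)])
  obtain g where g: "g \<in> alg_hom K SA A" "\<And>x. x \<in> carrier TA \<Longrightarrow> g (commutator_ideal K V +>\<^bsub>TA\<^esub> x) = f x"
    using quot_universal_alg[OF TA_alg comm_ideal A f(1) 0] unfolding symmetric_algebra_def by blast
  then show ?thesis
    using f(2) unfolding sv_def by (intro bexI[of _ g]) auto
qed

lemma SA_hom_unique:
  assumes "assoc_algebra K A" "f \<in> alg_hom K SA A" "g \<in> alg_hom K SA A"
    and "\<And>v. v \<in> carrier V \<Longrightarrow> f (sv v) = g (sv v)" and "t \<in> carrier SA"
  shows "f t = g t"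
  using assms(5)
  by (induction t rule: SA_induct) (simp_all add: alg_homD[OF assms(2)] alg_homD[OF assms(3)] assms(4))

section \<open>Polynomial functions\<close>

abbreviation KA where "KA \<equiv> self_algebra K"
abbreviation dual where "dual \<equiv> lin_map K V KA"

lemma KA_alg: "assoc_algebra K KA"
  by (rule self_assoc_algebra) (rule KF.is_cring)

lemma KA_mod: "module K KA"
  by (rule assoc_algebra_module) (rule KA_alg)

lemma KA_cring: "cring KA"
  using KF.m_comm
  by (intro cring.intro assoc_algebra_ring[OF KA_alg] comm_monoid.intro comm_monoid_axioms.intro
      ring.is_monoid[OF assoc_algebra_ring[OF KA_alg]]) simp

text \<open>Functionals on V are the points at which elements of S(V) are evaluated.\<close>

definition ev where
  "ev l = (SOME f. f \<in> alg_hom K SA KA \<and> (\<forall>v\<in>carrier V. f (sv v) = l v))"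

lemma ev:
  assumes "l \<in> dual"
  shows "ev l \<in> alg_hom K SA KA" "v \<in> carrier V \<Longrightarrow> ev l (sv v) = l v"
proof -
  let ?P = "\<lambda>f. f \<in> alg_hom K SA KA \<and> (\<forall>v\<in>carrier V. f (sv v) = l v)"
  have "\<exists>f. ?P f" using SA_universal[OF KA_alg KA_cring assms] by blast
  then have "?P (ev l)" unfolding ev_def by (rule someI_ex[of ?P])
  then show "ev l \<in> alg_hom K SA KA" "v \<in> carrier V \<Longrightarrow> ev l (sv v) = l v" by blast+
qed

lemmas evD = alg_homD[OF ev(1), simplified]

abbreviation PK where "PK \<equiv> UP K"

sublocale UPd: UP_domain K PK by unfold_locales simp

lemma P_alg: "assoc_algebra K PK"
proof -
  have 1: "(c \<odot>\<^bsub>PK\<^esub> x) \<otimes>\<^bsub>PK\<^esub> y = c \<odot>\<^bsub>PK\<^esub> (x \<otimes>\<^bsub>PK\<^esub> y)"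
    if "c \<in> carrier K" "x \<in> carrier PK" "y \<in> carrier PK" for c x y
    using that by (rule UPd.UP_smult_assoc2)
  have "x \<otimes>\<^bsub>PK\<^esub> (c \<odot>\<^bsub>PK\<^esub> y) = c \<odot>\<^bsub>PK\<^esub> (x \<otimes>\<^bsub>PK\<^esub> y)"
    if "c \<in> carrier K" "x \<in> carrier PK" "y \<in> carrier PK" for c x y
    using 1[of c y x] UPd.P.m_comm[of x "c \<odot>\<^bsub>PK\<^esub> y"] UPd.P.m_comm[of x y] that by simp
  then show ?thesis
    using algebra.axioms(1)[OF UPd.UP_algebra] 1
    by (intro assoc_algebra.intro UPd.P.ring_axioms assoc_algebra_axioms.intro)
qed

definition pev where "pev c = eval K K id c"

lemma pev_hom: assumes c: "c \<in> carrier K" shows "pev c \<in> alg_hom K PK KA"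
proof -
  interpret U: UP_pre_univ_prop K K id PK
    by (intro UP_pre_univ_propI KF.is_cring) (simp_all add: id_ring_hom)
  have r: "pev c \<in> ring_hom PK K" unfolding pev_def using U.eval_ring_hom[OF c] .
  note h = ring_hom_memE[OF r]
  have "pev c (a \<odot>\<^bsub>PK\<^esub> p) = a \<otimes> pev c p" if "a \<in> carrier K" "p \<in> carrier PK" for a p
    using that h U.eval_const[OF c, of a] by (simp add: UPd.monom_mult_is_smult[symmetric] pev_def)
  then show ?thesis
    by (intro alg_homI lin_mapI) (simp_all add: h)
qed

lemma pev_monom: "c \<in> carrier K \<Longrightarrow> a \<in> carrier K \<Longrightarrow> pev c (monom PK a n) = a \<otimes> c [^] n"
proof -
  assume ca: "c \<in> carrier K" "a \<in> carrier K"
  interpret U: UP_pre_univ_prop K K id PK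
    by (intro UP_pre_univ_propI KF.is_cring) (simp_all add: id_ring_hom)
  show ?thesis unfolding pev_def using U.eval_monom[OF ca(2,1)] by simp
qed

text \<open>Induction on the degree: a root a splits off the factor X - a, and any other root is a
  root of the cofactor.\<close>

lemma finite_roots:
  assumes "f \<in> carrier PK" "f \<noteq> \<zero>\<^bsub>PK\<^esub>"
  shows "finite {a \<in> carrier K. pev a f = \<zero>}"
  using assms
proof (induction "deg K f" arbitrary: f rule: less_induct)
  case less
  show ?case
  proof (cases "\<exists>a\<in>carrier K. pev a f = \<zero>")
    case True
    then obtain a where a: "a \<in> carrier K" "pev a f = \<zero>" by blast
    have nt: "carrier K \<noteq> {\<zero>}" using KF.one_not_zero KF.one_closed by blast
    let ?g = "monom PK \<one> 1 \<ominus>\<^bsub>PK\<^esub> monom PK a 0"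
    obtain q r where qr: "q \<in> carrier PK" "r \<in> carrier PK" "f = ?g \<otimes>\<^bsub>PK\<^esub> q \<oplus>\<^bsub>PK\<^esub> r" "deg K r = 0"
      using UPd.remainder_theorem_exist[OF less(2) a(1) nt] by blast
    have "r = monom PK (pev a f) 0"
      unfolding pev_def by (rule UPd.remainder_theorem_expression[OF less(2) a(1) qr(1,2) nt qr(3,4)])
    then have f: "f = ?g \<otimes>\<^bsub>PK\<^esub> q" using qr a by simp
    have gc: "?g \<in> carrier PK" using a by simp
    have dg: "deg K ?g = 1" using UPd.deg_minus_monom[OF a(1) nt] by simp
    have q0: "q \<noteq> \<zero>\<^bsub>PK\<^esub>" using less(3) f gc by auto
    have g0: "?g \<noteq> \<zero>\<^bsub>PK\<^esub>" using dg UPd.deg_zero by (metis zero_neq_one)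
    have "deg K f = 1 + deg K q" using UPd.deg_mult[OF g0 q0 gc qr(1)] f dg by simp
    then have "finite {a \<in> carrier K. pev a q = \<zero>}" using less(1)[of q] qr(1) q0 by simp
    moreover have "b = a \<or> pev b q = \<zero>" if b: "b \<in> carrier K" "pev b f = \<zero>" for b
    proof -
      note h = alg_homD[OF pev_hom[OF b(1)], simplified]
      have "pev b ?g = b \<ominus> a"
        using lin_map_minus[OF h(1) _ _ UPd.monom_closed UPd.monom_closed, of "\<one>" a 1 0] a b
          module_abelian[OF KA_mod] UPd.P.abelian_group_axioms lin_map_inv[OF lin_id[of K KA]]
        by (simp add: pev_monom a_minus_def self_algebra_simps a_inv_def m_inv_def)
      then show ?thesis
        using h(3)[OF gc qr(1)] h(2)[OF qr(1)] f b a KF.integral[of "b \<ominus> a" "pev b q"]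
        by (auto simp: KF.r_right_minus_eq)
    qed
    ultimately show ?thesis
      by (auto intro: finite_subset[of _ "insert a {a \<in> carrier K. pev a q = \<zero>}"])
  next
    case False
    then have "{a \<in> carrier K. pev a f = \<zero>} = {}" by blast
    then show ?thesis by (metis finite.emptyI)
  qed
qed

text \<open>Restriction to the affine line l + X d: a polynomial on V becomes a polynomial in one
  variable. Questions about S(V) are settled in this way in the domain K[X].\<close>

definition line where
  "line l d = (SOME f. f \<in> alg_hom K SA PK \<and>
     (\<forall>v\<in>carrier V. f (sv v) = monom PK (l v) 0 \<oplus>\<^bsub>PK\<^esub> monom PK (d v) 1))"

lemma line:
  assumes "l \<in> dual" "d \<in> dual"
  shows "line l d \<in> alg_hom K SA PK"
    "v \<in> carrier V \<Longrightarrow> line l d (sv v) = monom PK (l v) 0 \<oplus>\<^bsub>PK\<^esub> monom PK (d v) 1"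
proof -
  let ?P = "\<lambda>f. f \<in> alg_hom K SA PK \<and>
     (\<forall>v\<in>carrier V. f (sv v) = monom PK (l v) 0 \<oplus>\<^bsub>PK\<^esub> monom PK (d v) 1)"
  have m: "(\<lambda>v. monom PK (e v) n) \<in> lin_map K V PK" if "e \<in> dual" for e n
    using lin_mapD[OF that] by (intro lin_mapI) (simp_all add: UPd.monom_mult_smult)
  have "(\<lambda>v. monom PK (l v) 0 \<oplus>\<^bsub>PK\<^esub> monom PK (d v) 1) \<in> lin_map K V PK"
    by (intro lin_add m assms assoc_algebra_module[OF P_alg])
  then have "\<exists>f. ?P f" using SA_universal[OF P_alg UPd.UP_cring] by blast
  then have "?P (line l d)" unfolding line_def by (rule someI_ex[of ?P])
  then show "line l d \<in> alg_hom K SA PK"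
    "v \<in> carrier V \<Longrightarrow> line l d (sv v) = monom PK (l v) 0 \<oplus>\<^bsub>PK\<^esub> monom PK (d v) 1" by blast+
qed

lemma dual_shift: "l \<in> dual \<Longrightarrow> d \<in> dual \<Longrightarrow> c \<in> carrier K \<Longrightarrow> (\<lambda>v. l v \<oplus> c \<otimes> d v) \<in> dual"
  using lin_add[OF KA_mod _ lin_const_smult[OF KA_mod], of l V d c] by simp

lemma pev_line:
  assumes l: "l \<in> dual" and d: "d \<in> dual" and c: "c \<in> carrier K" and t: "t \<in> carrier SA"
  shows "pev c (line l d t) = ev (\<lambda>v. l v \<oplus> c \<otimes> d v) t"
proof (rule SA_hom_unique[OF KA_alg alg_hom_comp[OF pev_hom[OF c] line(1)[OF l d]] ev(1)[OF dual_shift[OF l d c]] _ t])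
  fix v assume v: "v \<in> carrier V"
  then show "pev c (line l d (sv v)) = ev (\<lambda>v. l v \<oplus> c \<otimes> d v) (sv v)"
    using lin_mapD(1)[OF l v] lin_mapD(1)[OF d v] c
    by (simp add: line[OF l d] ev[OF dual_shift[OF l d c]] alg_homD[OF pev_hom[OF c]] pev_monom KF.m_comm)
qed

lemma pev_line_zero:
  assumes l: "l \<in> dual" and d: "d \<in> dual" and t: "t \<in> carrier SA"
  shows "pev \<zero> (line l d t) = ev l t"
proof (rule SA_hom_unique[OF KA_alg alg_hom_comp[OF pev_hom[OF KF.zero_closed] line(1)[OF l d]] ev(1)[OF l] _ t])
  fix v assume v: "v \<in> carrier V"
  then show "pev \<zero> (line l d (sv v)) = ev l (sv v)"
    using lin_mapD(1)[OF l v] lin_mapD(1)[OF d v]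
    by (simp add: line[OF l d] ev[OF l] alg_homD[OF pev_hom] pev_monom)
qed

text \<open>\<open>gen [h\<^sub>1, \<dots>, h\<^sub>n]\<close> is the subalgebra generated by the \<open>sv h\<^sub>i\<close>, in iterated Horner form.\<close>

inductive horner :: "('v list \<Rightarrow> 'k) set set set \<Rightarrow> ('v list \<Rightarrow> 'k) set set \<Rightarrow> ('v list \<Rightarrow> 'k) set set \<Rightarrow> bool"
  for G h where
  base: "p \<in> G \<Longrightarrow> horner G h p"
| step: "p \<in> G \<Longrightarrow> horner G h g \<Longrightarrow> horner G h (p \<oplus>\<^bsub>SA\<^esub> h \<otimes>\<^bsub>SA\<^esub> g)"

fun gen :: "'v list \<Rightarrow> ('v list \<Rightarrow> 'k) set set set" where
  "gen [] = {c \<odot>\<^bsub>SA\<^esub> \<one>\<^bsub>SA\<^esub> | c. c \<in> carrier K}"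
| "gen (h # hs) = {f. horner (gen hs) (sv h) f}"

lemma gen_mono: "gen hs \<subseteq> gen (h # hs)"
  by (auto intro: horner.base)

lemma gen_zero: "\<zero>\<^bsub>SA\<^esub> \<in> gen hs"
proof (induction hs)
  case Nil
  show ?case unfolding gen.simps by (intro CollectI exI[of _ "\<zero>"]) simp
next
  case (Cons h hs) then show ?case using gen_mono by blast
qed

lemma gen_closed: "set hs \<subseteq> carrier V \<Longrightarrow> f \<in> gen hs \<Longrightarrow> f \<in> carrier SA"
proof (induction hs arbitrary: f)
  case (Cons h hs)
  from Cons(3) have "horner (gen hs) (sv h) f" by simp
  then show ?case using Cons(1,2) by induction auto
qed auto

lemma horner_carrier: "set (h # hs) \<subseteq> carrier V \<Longrightarrow> horner (gen hs) (sv h) f \<Longrightarrow> f \<in> carrier SA"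
  using gen_closed[of "h # hs" f] by simp

lemma gen_add: "set hs \<subseteq> carrier V \<Longrightarrow> f \<in> gen hs \<Longrightarrow> g \<in> gen hs \<Longrightarrow> f \<oplus>\<^bsub>SA\<^esub> g \<in> gen hs"
proof (induction hs arbitrary: f g)
  case Nil
  then obtain c d where "f = c \<odot>\<^bsub>SA\<^esub> \<one>\<^bsub>SA\<^esub>" "g = d \<odot>\<^bsub>SA\<^esub> \<one>\<^bsub>SA\<^esub>" "c \<in> carrier K" "d \<in> carrier K" by auto
  then have "f \<oplus>\<^bsub>SA\<^esub> g = (c \<oplus> d) \<odot>\<^bsub>SA\<^esub> \<one>\<^bsub>SA\<^esub>" "c \<oplus> d \<in> carrier K" by (auto simp: SA.smult_l_distr)
  then show ?case by auto
next
  case (Cons h hs)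
  have hs: "set hs \<subseteq> carrier V" and h: "sv h \<in> carrier SA" using Cons by auto
  note cl = gen_closed[OF hs] horner_carrier[OF Cons(2)]
  from Cons(3) have "horner (gen hs) (sv h) f" by simp
  then show ?case using Cons(4)
  proof (induction arbitrary: g)
    case (base p)
    from base(2) have "horner (gen hs) (sv h) g" by simp
    then show ?case
    proof cases
      case base' : base then show ?thesis using Cons.IH[OF hs base(1)] by (auto intro: horner.base)
    next
      case (step p' g')
      have "p \<oplus>\<^bsub>SA\<^esub> g = (p \<oplus>\<^bsub>SA\<^esub> p') \<oplus>\<^bsub>SA\<^esub> sv h \<otimes>\<^bsub>SA\<^esub> g'"
        using step base(1) cl h by (simp add: SA.M.a_assoc)
      then show ?thesis using step Cons.IH[OF hs base(1)] by (auto intro: horner.step)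
    qed
  next
    case (step p f')
    from step(4) have "horner (gen hs) (sv h) g" by simp
    then show ?case
    proof cases
      case base
      have "(p \<oplus>\<^bsub>SA\<^esub> sv h \<otimes>\<^bsub>SA\<^esub> f') \<oplus>\<^bsub>SA\<^esub> g = (p \<oplus>\<^bsub>SA\<^esub> g) \<oplus>\<^bsub>SA\<^esub> sv h \<otimes>\<^bsub>SA\<^esub> f'"
        using step base cl h by (simp add: SA.M.a_ac)
      then show ?thesis using step(1,2) base Cons.IH[OF hs step(1)] by (auto intro: horner.step)
    next
      case (step p' g')
      have "(p \<oplus>\<^bsub>SA\<^esub> sv h \<otimes>\<^bsub>SA\<^esub> f') \<oplus>\<^bsub>SA\<^esub> g = (p \<oplus>\<^bsub>SA\<^esub> p') \<oplus>\<^bsub>SA\<^esub> sv h \<otimes>\<^bsub>SA\<^esub> (f' \<oplus>\<^bsub>SA\<^esub> g')"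
        using step \<open>p \<in> gen hs\<close> \<open>horner (gen hs) (sv h) f'\<close> cl h by (simp add: SA.M.a_ac SA.A.r_distr)
      moreover have "f' \<oplus>\<^bsub>SA\<^esub> g' \<in> gen (h # hs)" using \<open>horner (gen hs) (sv h) f'\<close> step.IH step(3)
        by (simp add: \<open>\<And>g. g \<in> gen (h # hs) \<Longrightarrow> f' \<oplus>\<^bsub>SA\<^esub> g \<in> gen (h # hs)\<close>)
      ultimately show ?thesis using step(2) Cons.IH[OF hs \<open>p \<in> gen hs\<close>] by (auto intro: horner.step)
    qed
  qed
qed

lemma gen_smult: "set hs \<subseteq> carrier V \<Longrightarrow> f \<in> gen hs \<Longrightarrow> c \<in> carrier K \<Longrightarrow> c \<odot>\<^bsub>SA\<^esub> f \<in> gen hs"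
proof (induction hs arbitrary: f)
  case Nil
  then obtain d where "f = d \<odot>\<^bsub>SA\<^esub> \<one>\<^bsub>SA\<^esub>" "d \<in> carrier K" by auto
  then have "c \<odot>\<^bsub>SA\<^esub> f = (c \<otimes> d) \<odot>\<^bsub>SA\<^esub> \<one>\<^bsub>SA\<^esub>" "c \<otimes> d \<in> carrier K" using Nil by (auto simp: SA.smult_assoc1)
  then show ?case by auto
next
  case (Cons h hs)
  have hs: "set hs \<subseteq> carrier V" and h: "sv h \<in> carrier SA" using Cons by auto
  note cl = gen_closed[OF hs] horner_carrier[OF Cons(2)]
  from Cons(3) have "horner (gen hs) (sv h) f" by simp
  then show ?case
  proof induction
    case (base p) then show ?case using Cons.IH[OF hs _ Cons(4)] by (auto intro: horner.base)
  next
    case (step p g)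
    have "c \<odot>\<^bsub>SA\<^esub> (p \<oplus>\<^bsub>SA\<^esub> sv h \<otimes>\<^bsub>SA\<^esub> g) = c \<odot>\<^bsub>SA\<^esub> p \<oplus>\<^bsub>SA\<^esub> sv h \<otimes>\<^bsub>SA\<^esub> (c \<odot>\<^bsub>SA\<^esub> g)"
      using step cl h Cons(4) by (simp add: SA.smult_r_distr SA.smult_mult_right)
    then show ?case using step Cons.IH[OF hs _ Cons(4)] by (auto intro: horner.step)
  qed
qed

lemma gen_var: "set hs \<subseteq> carrier V \<Longrightarrow> f \<in> gen hs \<Longrightarrow> v \<in> set hs \<Longrightarrow> sv v \<otimes>\<^bsub>SA\<^esub> f \<in> gen hs"
proof (induction hs arbitrary: f)
  case (Cons h hs)
  have hs: "set hs \<subseteq> carrier V" and h: "sv h \<in> carrier SA" and v: "sv v \<in> carrier SA" using Cons by auto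
  note cl = gen_closed[OF hs] horner_carrier[OF Cons(2)]
  from Cons(3) have f: "horner (gen hs) (sv h) f" by simp
  show ?case
  proof (cases "v = h")
    case True
    have "sv h \<otimes>\<^bsub>SA\<^esub> f = \<zero>\<^bsub>SA\<^esub> \<oplus>\<^bsub>SA\<^esub> sv h \<otimes>\<^bsub>SA\<^esub> f" using cl(2)[OF f] h by simp
    moreover have "horner (gen hs) (sv h) (\<zero>\<^bsub>SA\<^esub> \<oplus>\<^bsub>SA\<^esub> sv h \<otimes>\<^bsub>SA\<^esub> f)"
      by (rule horner.step[OF gen_zero f])
    ultimately show ?thesis using True by (metis gen.simps(2) mem_Collect_eq)
  next
    case False
    then have vs: "v \<in> set hs" using Cons by simp
    show ?thesis using f
    proof induction
      case (base p) then show ?case using Cons.IH[OF hs _ vs] by (auto intro: horner.base)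
    next
      case (step p g)
      have "sv v \<otimes>\<^bsub>SA\<^esub> (p \<oplus>\<^bsub>SA\<^esub> sv h \<otimes>\<^bsub>SA\<^esub> g) = sv v \<otimes>\<^bsub>SA\<^esub> p \<oplus>\<^bsub>SA\<^esub> sv h \<otimes>\<^bsub>SA\<^esub> (sv v \<otimes>\<^bsub>SA\<^esub> g)"
        using step cl h v by (simp add: SA.A.r_distr SC.m_lcomm)
      then show ?case using step Cons.IH[OF hs _ vs] by (auto intro: horner.step)
    qed
  qed
qed simp

text \<open>Since \<open>sv\<close> is linear, a vector in the span of the listed generators
  multiplies the subalgebra \<open>gen hs\<close> into itself.\<close>

lemma gen_span:
  assumes hs: "set hs \<subseteq> carrier V" and f: "f \<in> gen hs" and v: "v \<in> lspan K V hs"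
  shows "sv v \<otimes>\<^bsub>SA\<^esub> f \<in> gen hs"
proof -
  have "sv v \<otimes>\<^bsub>SA\<^esub> f \<in> gen hs \<and> v \<in> carrier V" if "set gs \<subseteq> set hs" "v \<in> lspan K V gs" for gs v
    using that
  proof (induction gs arbitrary: v)
    case Nil
    have "sv \<zero>\<^bsub>V\<^esub> = \<zero>\<^bsub>SA\<^esub>" by (rule lin_map_zero[OF sv_lin V.M.abelian_group_axioms SA.M.abelian_group_axioms])
    then show ?case using Nil gen_zero gen_closed[OF hs f] by (simp add: lspan.simps[OF K_field V_module])
  next
    case (Cons g gs)
    obtain w c where w: "v = w \<oplus>\<^bsub>V\<^esub> c \<odot>\<^bsub>V\<^esub> g" "w \<in> lspan K V gs" "c \<in> carrier K"
      using Cons(3) by (auto simp: lspan.simps[OF K_field V_module])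
    have g: "g \<in> carrier V" "g \<in> set hs" using Cons hs by auto
    have i: "sv w \<otimes>\<^bsub>SA\<^esub> f \<in> gen hs" "w \<in> carrier V" using Cons w by auto
    have "sv v \<otimes>\<^bsub>SA\<^esub> f = sv w \<otimes>\<^bsub>SA\<^esub> f \<oplus>\<^bsub>SA\<^esub> c \<odot>\<^bsub>SA\<^esub> (sv g \<otimes>\<^bsub>SA\<^esub> f)"
      using w g i gen_closed[OF hs f] lin_mapD[OF sv_lin] by (simp add: SA.A.l_distr SA.smult_mult_left)
    then show ?case using w g i gen_add[OF hs i(1) gen_smult[OF hs gen_var[OF hs f g(2)] w(3)]] by simp
  qed
  then show ?thesis using v by blast
qed

lemma gen_append: "set hs \<subseteq> carrier V \<Longrightarrow> set gs \<subseteq> carrier V \<Longrightarrow> gen hs \<subseteq> gen (hs @ gs) \<and> gen gs \<subseteq> gen (hs @ gs)"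
proof (induction hs)
  case Nil
  have "gen [] \<subseteq> gen gs"
  proof (induction gs)
    case (Cons a gs) then show ?case using gen_mono by blast
  qed simp
  then show ?case by simp
next
  case (Cons h hs)
  have "horner (gen (hs @ gs)) (sv h) f" if "horner (gen hs) (sv h) f" for f
    using that by induction (use Cons in \<open>auto intro: horner.intros\<close>)
  then show ?case using Cons gen_mono[of "hs @ gs" h] by auto
qed

lemma gen_all: "f \<in> carrier SA \<Longrightarrow> \<exists>hs. set hs \<subseteq> carrier V \<and> f \<in> gen hs"
proof (induction f rule: SA_induct)
  case (scal c) then show ?case by (intro exI[of _ "[]"]) auto
next
  case (var v t)
  then obtain hs where hs: "set hs \<subseteq> carrier V" "t \<in> gen hs" by blast
  have "t \<in> gen (v # hs)" using hs gen_mono by blast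
  then have "sv v \<otimes>\<^bsub>SA\<^esub> t \<in> gen (v # hs)" using gen_var[of "v # hs" t v] hs var by simp
  then show ?case using hs var by (intro exI[of _ "v # hs"]) simp
next
  case (add s t)
  then obtain hs gs where "set hs \<subseteq> carrier V" "s \<in> gen hs" "set gs \<subseteq> carrier V" "t \<in> gen gs" by blast
  then show ?case using gen_append[of hs gs] by (intro exI[of _ "hs @ gs"] conjI gen_add) auto
qed

text \<open>A direction that vanishes on all generators involved does not change their values, so
  the restricted polynomial is constant.\<close>

lemma line_const:
  assumes l: "l \<in> dual" and d: "d \<in> dual"
  shows "set hs \<subseteq> carrier V \<Longrightarrow> (\<And>h. h \<in> set hs \<Longrightarrow> d h = \<zero>) \<Longrightarrow> f \<in> gen hs \<Longrightarrow>
    line l d f = monom PK (ev l f) 0"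
proof (induction hs arbitrary: f)
  case Nil
  note hL = alg_homD[OF line(1)[OF l d]] and hE = evD[OF l]
  from Nil show ?case
    using lin_mapD(1)[OF l] by (auto simp: hL hE UPd.monom_one[symmetric] UPd.monom_mult_smult[symmetric] simp del: UPd.monom_one)
next
  case (Cons h hs)
  note hL = alg_homD[OF line(1)[OF l d]] and hE = evD[OF l]
  have hs: "set hs \<subseteq> carrier V" and h: "h \<in> carrier V" "sv h \<in> carrier SA" using Cons by auto
  note cl = gen_closed[OF hs] horner_carrier[OF Cons(2)]
  have i: "line l d p = monom PK (ev l p) 0" if "p \<in> gen hs" for p using Cons that by auto
  have lh: "l h \<in> carrier K" using lin_mapD(1)[OF l h(1)] by simp
  have lv: "line l d (sv h) = monom PK (l h) 0" using Cons(3)[of h] h lh by (simp add: line[OF l d])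
  from Cons(4) have "horner (gen hs) (sv h) f" by simp
  then show ?case
  proof induction
    case (step p g)
    then show ?case using i[OF step(1)] cl h lv lh
      by (simp add: hL hE ev[OF l] UPd.monom_mult[symmetric])
  qed (rule i)
qed

text \<open>Outer induction on the list of generators, inner induction on the Horner form f = p + h
  g. A generator h that depends on the others is dropped. Otherwise some direction \<kappa> has
  \<kappa>(h) = 1 and vanishes on the others, and along it f becomes p(l) + (l(h) + X) g_l(X). This
  polynomial has infinitely many zeros, hence is 0; the root of the linear factor gives p(l) = 0,
  and cancelling that factor gives g_l = 0. As l is arbitrary, both induction hypotheses
  apply.\<close>

lemma SA_eq_zeroI:
  assumes inf: "infinite (carrier K)" and f: "f \<in> carrier SA"
    and 0: "\<And>l. l \<in> dual \<Longrightarrow> ev l f = \<zero>"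
  shows "f = \<zero>\<^bsub>SA\<^esub>"
proof -
  have zd: "(\<lambda>v. \<zero>) \<in> dual" using lin_zero[OF KA_mod] by simp
  have "f = \<zero>\<^bsub>SA\<^esub>" if "set hs \<subseteq> carrier V" "f \<in> gen hs" "\<And>l. l \<in> dual \<Longrightarrow> ev l f = \<zero>" for hs f
    using that
  proof (induction hs arbitrary: f)
    case Nil
    then obtain c where c: "f = c \<odot>\<^bsub>SA\<^esub> \<one>\<^bsub>SA\<^esub>" "c \<in> carrier K" by auto
    then have "c = \<zero>" using Nil(3)[OF zd] evD[OF zd] by simp
    then show ?case using c by simp
  next
    case (Cons h hs)
    have hs: "set hs \<subseteq> carrier V" and h: "h \<in> carrier V" "sv h \<in> carrier SA" using Cons by auto
    note cl = gen_closed[OF hs] horner_carrier[OF Cons(2)]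
    have f: "horner (gen hs) (sv h) f" using Cons(3) by simp
    show ?case
    proof (cases "h \<in> lspan K V hs")
      case True
      \<comment> \<open>A dependent generator adds nothing to the subalgebra, so f is already in the
        one for the shorter list.\<close>
      have "f \<in> gen hs" using f
        by induction (use gen_span[OF hs _ True] gen_add[OF hs] in auto)
      then show ?thesis using Cons.IH[OF hs] Cons(4) by blast
    next
      case False
      obtain \<kappa> where \<kappa>: "\<kappa> \<in> dual" "\<And>w. w \<in> lspan K V hs \<Longrightarrow> \<kappa> w = \<zero>" "\<kappa> h = \<one>"
        using functional_separates[OF K_field V_module lspan_subspace[OF K_field V_module hs] h(1) False] by blast
      have \<kappa>hs: "\<kappa> w = \<zero>" if "w \<in> set hs" for w
        using \<kappa>(2) lspan_mem[OF K_field V_module hs that] by blast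
      show ?thesis using f Cons(4)
      proof induction
        case (base p) then show ?case using Cons.IH[OF hs] by blast
      next
        case (step p g)
        have pc: "p \<in> carrier SA" and gc: "g \<in> carrier SA" using step cl by auto
        have key: "ev l p = \<zero> \<and> line l \<kappa> g = \<zero>\<^bsub>PK\<^esub>" if l: "l \<in> dual" for l
        proof -
          let ?L = "line l \<kappa>"
          note hL = alg_homD[OF line(1)[OF l \<kappa>(1)]]
          have lh: "l h \<in> carrier K" using lin_mapD(1)[OF l h(1)] by simp
          \<comment> \<open>The value of the restricted polynomial at c is the value of f at the
            point l + c \<kappa>, which is 0 by assumption.\<close>
          have z: "pev c (?L (p \<oplus>\<^bsub>SA\<^esub> sv h \<otimes>\<^bsub>SA\<^esub> g)) = \<zero>" if "c \<in> carrier K" for c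
            using step(4)[OF dual_shift[OF l \<kappa>(1) that]] pc gc h by (simp add: pev_line[OF l \<kappa>(1) that])
          have "?L (p \<oplus>\<^bsub>SA\<^esub> sv h \<otimes>\<^bsub>SA\<^esub> g) \<in> carrier PK" using pc gc h hL(2) by simp
          then have LP: "?L (p \<oplus>\<^bsub>SA\<^esub> sv h \<otimes>\<^bsub>SA\<^esub> g) \<in> carrier PK" .
          have L0: "?L (p \<oplus>\<^bsub>SA\<^esub> sv h \<otimes>\<^bsub>SA\<^esub> g) = \<zero>\<^bsub>PK\<^esub>"
          proof (rule ccontr)
            assume "?L (p \<oplus>\<^bsub>SA\<^esub> sv h \<otimes>\<^bsub>SA\<^esub> g) \<noteq> \<zero>\<^bsub>PK\<^esub>"
            then have "finite {a \<in> carrier K. pev a (?L (p \<oplus>\<^bsub>SA\<^esub> sv h \<otimes>\<^bsub>SA\<^esub> g)) = \<zero>}"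
              by (rule finite_roots[OF LP])
            moreover have "{a \<in> carrier K. pev a (?L (p \<oplus>\<^bsub>SA\<^esub> sv h \<otimes>\<^bsub>SA\<^esub> g)) = \<zero>} = carrier K"
              using z by blast
            ultimately show False using inf by metis
          qed
          have Lp: "?L p = monom PK (ev l p) 0"
            by (rule line_const[OF l \<kappa>(1) hs \<kappa>hs step(1)])
          have epc: "ev l p \<in> carrier K" using evD(2)[OF l pc] .
          let ?q = "monom PK (l h) 0 \<oplus>\<^bsub>PK\<^esub> monom PK \<one> 1"
          have qc: "?q \<in> carrier PK" using lh by simp
          have Lh: "?L (sv h) = ?q" using h \<kappa>(3) by (simp add: line[OF l \<kappa>(1)])
          have eq: "monom PK (ev l p) 0 \<oplus>\<^bsub>PK\<^esub> ?q \<otimes>\<^bsub>PK\<^esub> ?L g = \<zero>\<^bsub>PK\<^esub>"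
            using L0 pc gc h hL Lp Lh by simp
          \<comment> \<open>The root of the linear factor l(h) + X, at which only p(l)
            survives.\<close>
          let ?c = "\<ominus> l h"
          note hp = alg_homD[OF pev_hom, of ?c, simplified]
          have "pev ?c ?q = \<zero>" using lh hp by (simp add: pev_monom KF.r_neg)
          moreover have "pev ?c (monom PK (ev l p) 0 \<oplus>\<^bsub>PK\<^esub> ?q \<otimes>\<^bsub>PK\<^esub> ?L g) = \<zero>"
            unfolding eq using lin_map_zero[OF hp(1)] lh module_abelian[OF KA_mod] UPd.P.abelian_group_axioms by simp
          ultimately have e0: "ev l p = \<zero>"
            using lh hp hL(2)[OF gc] epc qc by (simp add: pev_monom)
          then have "?q \<otimes>\<^bsub>PK\<^esub> ?L g = \<zero>\<^bsub>PK\<^esub>" using eq hL(2)[OF gc] qc by simp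
          moreover have "coeff PK ?q 1 = \<one>" using lh by simp
          then have "?q \<noteq> \<zero>\<^bsub>PK\<^esub>" using KF.one_not_zero by (metis UPd.coeff_zero)
          ultimately have "?L g = \<zero>\<^bsub>PK\<^esub>" using UPd.UP_integral[OF _ qc hL(2)[OF gc]] by blast
          then show ?thesis using e0 by simp
        qed
        have p0: "p = \<zero>\<^bsub>SA\<^esub>" using Cons.IH[OF hs step(1)] key by blast
        have "ev l g = \<zero>" if l: "l \<in> dual" for l
        proof -
          \<comment> \<open>The line passes through l at parameter 0, so the vanishing of g along it
            covers its value at l.\<close>
          have "ev l g = pev \<zero> (line l \<kappa> g)" by (rule pev_line_zero[OF l \<kappa>(1) gc, symmetric])
          also have "\<dots> = \<zero>" using key[OF l] alg_homD(1)[OF pev_hom[OF KF.zero_closed]]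
              lin_map_zero module_abelian[OF KA_mod] UPd.P.abelian_group_axioms by fastforce
          finally show ?thesis .
        qed
        then have "g = \<zero>\<^bsub>SA\<^esub>" using step(3) by blast
        then show ?case using p0 h by simp
      qed
    qed
  qed
  then show ?thesis using gen_all[OF f] 0 by blast
qed

text \<open>If a does not vanish at l and b does not vanish at m, both restrict to nonzero
  polynomials on the line through l and m. Their product is then nonzero, because K[X] is a
  domain.\<close>

lemma SA_domain:
  assumes inf: "infinite (carrier K)" shows "domain SA"
proof (rule domain.intro[OF SA_cring], rule domain_axioms.intro)
  have zd: "(\<lambda>v. \<zero>) \<in> dual" using lin_zero[OF KA_mod] by simp
  have ez: "ev l \<zero>\<^bsub>SA\<^esub> = \<zero>" if "l \<in> dual" for l
    using lin_map_zero[OF alg_homD(1)[OF ev(1)[OF that]]] SA.M.abelian_group_axioms module_abelian[OF KA_mod] by simp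
  show "\<one>\<^bsub>SA\<^esub> \<noteq> \<zero>\<^bsub>SA\<^esub>"
    using evD(4)[OF zd] ez[OF zd] KF.one_not_zero by metis
  fix a b assume ab: "a \<otimes>\<^bsub>SA\<^esub> b = \<zero>\<^bsub>SA\<^esub>" "a \<in> carrier SA" "b \<in> carrier SA"
  show "a = \<zero>\<^bsub>SA\<^esub> \<or> b = \<zero>\<^bsub>SA\<^esub>"
  proof (rule ccontr)
    assume "\<not> ?thesis"
    then obtain l m where l: "l \<in> dual" "ev l a \<noteq> \<zero>" and m: "m \<in> dual" "ev m b \<noteq> \<zero>"
      using SA_eq_zeroI[OF inf ab(2)] SA_eq_zeroI[OF inf ab(3)] by blast
    \<comment> \<open>The direction m - l: the line meets l at parameter 0 and m at parameter
      1.\<close>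
    let ?d = "\<lambda>v. m v \<oplus> (\<ominus> \<one>) \<otimes> l v"
    have d: "?d \<in> dual" by (rule dual_shift[OF m(1) l(1)]) simp
    note hL = alg_homD[OF line(1)[OF l(1) d]]
    have pz: "pev c \<zero>\<^bsub>PK\<^esub> = \<zero>" if "c \<in> carrier K" for c
      using lin_map_zero[OF alg_homD(1)[OF pev_hom[OF that]]] UPd.P.abelian_group_axioms module_abelian[OF KA_mod] by simp
    have "line l ?d a \<noteq> \<zero>\<^bsub>PK\<^esub>"
      using pev_line_zero[OF l(1) d ab(2)] l(2) pz by auto
    moreover have "line l ?d b \<noteq> \<zero>\<^bsub>PK\<^esub>"
    proof -
      have lm: "l v \<in> carrier K" "m v \<in> carrier K" if "v \<in> carrier V" for v
        using lin_mapD(1)[OF l(1) that] lin_mapD(1)[OF m(1) that] by simp_all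
      have "pev \<one> (line l ?d b) = ev (\<lambda>v. l v \<oplus> \<one> \<otimes> ?d v) b"
        by (rule pev_line[OF l(1) d _ ab(3)]) simp
      also have "\<dots> = ev m b"
      proof (rule SA_hom_unique[OF KA_alg ev(1)[OF dual_shift[OF l(1) d]] ev(1)[OF m(1)] _ ab(3)])
        fix v assume v: "v \<in> carrier V"
        have "l v \<oplus> (m v \<oplus> \<ominus> l v) = m v"
          using KF.a_lcomm[of "l v" "m v" "\<ominus> l v"] lm[OF v] by (simp add: KF.r_neg)
        then show "ev (\<lambda>v. l v \<oplus> \<one> \<otimes> ?d v) (sv v) = ev m (sv v)"
          using v lm[OF v] ev(2)[OF dual_shift[OF l(1) d KF.one_closed] v] ev(2)[OF m(1) v]
          by (simp add: KF.l_minus)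
      qed simp
      finally show ?thesis using m(2) pz[of "\<one>"] by auto
    qed
    moreover have "line l ?d a \<otimes>\<^bsub>PK\<^esub> line l ?d b = \<zero>\<^bsub>PK\<^esub>"
      using hL(3)[OF ab(2,3)] ab(1) lin_map_zero[OF hL(1) SA.M.abelian_group_axioms UPd.P.abelian_group_axioms] by simp
    ultimately show False using UPd.UP_integral hL(2) ab by blast
  qed
qed

end

section \<open>The field of fractions\<close>

locale frac =
  fixes K :: "'k ring" and R :: "('k, 'a, 'm) module_scheme" (structure)
  assumes R_alg: "assoc_algebra K R" and R_dom: "domain R"
begin

sublocale R: domain R by (rule R_dom)
sublocale RA: assoc_algebra K R by (rule R_alg)

abbreviation fr where "fr \<equiv> fraction R"
abbreviation FF where "FF \<equiv> fraction_field R"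
abbreviation nz where "nz \<equiv> carrier R - {\<zero>}"

lemma nz_mult: "s \<in> nz \<Longrightarrow> u \<in> nz \<Longrightarrow> s \<otimes> u \<in> nz"
  using R.integral by auto

lemma fr_mem: "(b, u) \<in> fr a s \<longleftrightarrow> b \<in> carrier R \<and> u \<in> nz \<and> a \<otimes> u = b \<otimes> s"
  by (simp add: fraction_def)

text \<open>A fraction is a full equivalence class. One inclusion, by cancelling s in a domain,
  gives equality, since its hypothesis is symmetric in the two pairs.\<close>

lemma fr_eq_iff:
  assumes a: "a \<in> carrier R" "s \<in> nz" and b: "b \<in> carrier R" "u \<in> nz"
  shows "fr a s = fr b u \<longleftrightarrow> a \<otimes> u = b \<otimes> s"
proof
  assume "fr a s = fr b u"
  moreover have "(a, s) \<in> fr a s" using a by (simp add: fr_mem)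
  ultimately have "b \<otimes> s = a \<otimes> u" by (simp add: fr_mem)
  then show "a \<otimes> u = b \<otimes> s" by simp
next
  have *: "fr a s \<subseteq> fr b u" if a: "a \<in> carrier R" "s \<in> nz" and b: "b \<in> carrier R" "u \<in> nz"
    and e: "a \<otimes> u = b \<otimes> s" for a s b u
  proof (rule subrelI)
    fix c v assume "(c, v) \<in> fr a s"
    then have c: "c \<in> carrier R" "v \<in> nz" "a \<otimes> v = c \<otimes> s" by (simp_all add: fr_mem)
    have "s \<otimes> (b \<otimes> v) = (b \<otimes> s) \<otimes> v" using a b c(1,2) by (simp add: R.m_ac)
    also have "\<dots> = (a \<otimes> v) \<otimes> u" unfolding e[symmetric] using a b c(1,2) by (simp add: R.m_ac)
    also have "\<dots> = s \<otimes> (c \<otimes> u)" unfolding c(3) using a b c(1,2) by (simp add: R.m_ac)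
    finally have "b \<otimes> v = c \<otimes> u" using a b c R.m_lcancel[of s "b \<otimes> v" "c \<otimes> u"] by simp
    then show "(c, v) \<in> fr b u" using c b by (simp add: fr_mem)
  qed
  assume e: "a \<otimes> u = b \<otimes> s"
  show "fr a s = fr b u"
    by (rule subset_antisym[OF *[OF a b e] *[OF b a e[symmetric]]])
qed

lemma fr_self: "a \<in> carrier R \<Longrightarrow> s \<in> nz \<Longrightarrow> (a, s) \<in> fr a s"
  by (simp add: fr_mem)

lemma FF_carrier: "carrier FF = {fr a s | a s. a \<in> carrier R \<and> s \<in> nz}"
  by (simp add: fraction_field_def)

lemma FF_cases:
  assumes "x \<in> carrier FF" obtains a s where "a \<in> carrier R" "s \<in> carrier R" "s \<noteq> \<zero>" "x = fr a s"
  using assms unfolding FF_carrier by auto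

lemma fr_closed [simp]: "a \<in> carrier R \<Longrightarrow> s \<in> carrier R \<Longrightarrow> s \<noteq> \<zero> \<Longrightarrow> fr a s \<in> carrier FF"
  unfolding FF_carrier by auto

text \<open>The operations on fractions are unions over all representatives; they collapse as soon
  as every choice of representatives yields the same set.\<close>

lemma UN_const:
  assumes "(a, s) \<in> X" "\<And>a' s'. (a', s') \<in> X \<Longrightarrow> f a' s' = C"
  shows "(\<Union>(a, s)\<in>X. f a s) = C"
  using assms by (fastforce simp: set_eq_iff)

lemma FF_ops:
  "X \<otimes>\<^bsub>FF\<^esub> Y = (\<Union>(a, s)\<in>X. \<Union>(b, u)\<in>Y. fr (a \<otimes> b) (s \<otimes> u))"
  "X \<oplus>\<^bsub>FF\<^esub> Y = (\<Union>(a, s)\<in>X. \<Union>(b, u)\<in>Y. fr ((a \<otimes> u) \<oplus> (b \<otimes> s)) (s \<otimes> u))"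
  "c \<odot>\<^bsub>FF\<^esub> X = (\<Union>(a, s)\<in>X. fr (c \<odot> a) s)"
  by (simp_all add: fraction_field_def)

lemma fr_mult:
  assumes a: "a \<in> carrier R" "s \<in> nz" and b: "b \<in> carrier R" "u \<in> nz"
  shows "fr a s \<otimes>\<^bsub>FF\<^esub> fr b u = fr (a \<otimes> b) (s \<otimes> u)"
proof -
  have "fr (a' \<otimes> b') (s' \<otimes> u') = fr (a \<otimes> b) (s \<otimes> u)"
    if "(a', s') \<in> fr a s" "(b', u') \<in> fr b u" for a' s' b' u'
  proof (subst fr_eq_iff)
    have c: "a' \<in> carrier R" "s' \<in> carrier R" "b' \<in> carrier R" "u' \<in> carrier R" "a \<otimes> s' = a' \<otimes> s" "b \<otimes> u' = b' \<otimes> u"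
      using that by (simp_all add: fr_mem)
    have "a' \<otimes> b' \<otimes> (s \<otimes> u) = (a' \<otimes> s) \<otimes> (b' \<otimes> u)" using a b c(1-4) by (simp add: R.m_ac)
    also have "\<dots> = (a \<otimes> s') \<otimes> (b \<otimes> u')" using c(5,6) by simp
    also have "\<dots> = a \<otimes> b \<otimes> (s' \<otimes> u')" using a b c(1-4) by (simp add: R.m_ac)
    finally show "a' \<otimes> b' \<otimes> (s \<otimes> u) = a \<otimes> b \<otimes> (s' \<otimes> u')" .
  qed (use that a b in \<open>auto simp: fr_mem intro: nz_mult dest: R.integral\<close>)
  then show ?thesis
    unfolding FF_ops by (intro UN_const[OF fr_self[OF a]] UN_const[OF fr_self[OF b]])
qed

lemma fr_add:
  assumes a: "a \<in> carrier R" "s \<in> nz" and b: "b \<in> carrier R" "u \<in> nz"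
  shows "fr a s \<oplus>\<^bsub>FF\<^esub> fr b u = fr (a \<otimes> u \<oplus> b \<otimes> s) (s \<otimes> u)"
proof -
  have "fr (a' \<otimes> u' \<oplus> b' \<otimes> s') (s' \<otimes> u') = fr (a \<otimes> u \<oplus> b \<otimes> s) (s \<otimes> u)"
    if "(a', s') \<in> fr a s" "(b', u') \<in> fr b u" for a' s' b' u'
  proof (subst fr_eq_iff)
    have c: "a' \<in> carrier R" "s' \<in> carrier R" "b' \<in> carrier R" "u' \<in> carrier R" "a \<otimes> s' = a' \<otimes> s" "b \<otimes> u' = b' \<otimes> u"
      using that by (simp_all add: fr_mem)
    have "(a' \<otimes> u' \<oplus> b' \<otimes> s') \<otimes> (s \<otimes> u) =
        (a' \<otimes> s) \<otimes> (u \<otimes> u') \<oplus> (b' \<otimes> u) \<otimes> (s \<otimes> s')"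
      using a b c(1-4) by (simp add: R.m_ac R.l_distr R.r_distr)
    also have "\<dots> = (a \<otimes> s') \<otimes> (u \<otimes> u') \<oplus> (b \<otimes> u') \<otimes> (s \<otimes> s')" using c(5,6) by simp
    also have "\<dots> = (a \<otimes> u \<oplus> b \<otimes> s) \<otimes> (s' \<otimes> u')" using a b c(1-4) by (simp add: R.m_ac R.l_distr R.r_distr)
    finally show "(a' \<otimes> u' \<oplus> b' \<otimes> s') \<otimes> (s \<otimes> u) = (a \<otimes> u \<oplus> b \<otimes> s) \<otimes> (s' \<otimes> u')" .
  qed (use that a b in \<open>auto simp: fr_mem intro: nz_mult dest: R.integral\<close>)
  then show ?thesis
    unfolding FF_ops by (intro UN_const[OF fr_self[OF a]] UN_const[OF fr_self[OF b]])
qed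

lemma fr_smult:
  assumes c: "c \<in> carrier K" and a: "a \<in> carrier R" "s \<in> nz"
  shows "c \<odot>\<^bsub>FF\<^esub> fr a s = fr (c \<odot> a) s"
proof -
  have "fr (c \<odot> a') s' = fr (c \<odot> a) s" if "(a', s') \<in> fr a s" for a' s'
    using that a c by (subst fr_eq_iff) (auto simp: fr_mem RA.smult_mult_left)
  then show ?thesis
    unfolding FF_ops by (intro UN_const[OF fr_self[OF a]])
qed

lemma FF_one: "\<one>\<^bsub>FF\<^esub> = fr \<one> \<one>" and FF_zero: "\<zero>\<^bsub>FF\<^esub> = fr \<zero> \<one>"
  by (simp_all add: fraction_field_def)

lemma prod_nz: "s \<in> carrier R \<Longrightarrow> u \<in> carrier R \<Longrightarrow> s \<noteq> \<zero> \<Longrightarrow> u \<noteq> \<zero> \<Longrightarrow> s \<otimes> u \<noteq> \<zero>"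
  using R.integral by blast

lemmas fr_simps = fr_mult fr_add fr_smult FF_one FF_zero fr_eq_iff prod_nz

lemma FF_cring: "cring FF"
proof (rule cringI)
  show "abelian_group FF"
  proof (rule abelian_groupI)
    fix x assume "x \<in> carrier FF"
    then obtain a s where x: "a \<in> carrier R" "s \<in> carrier R" "s \<noteq> \<zero>" "x = fr a s" by (rule FF_cases)
    then have "fr (\<ominus> a) s \<oplus>\<^bsub>FF\<^esub> x = \<zero>\<^bsub>FF\<^esub>"
      by (simp add: fr_simps R.l_minus R.l_neg)
    then show "\<exists>y\<in>carrier FF. y \<oplus>\<^bsub>FF\<^esub> x = \<zero>\<^bsub>FF\<^esub>" using x by (intro bexI[of _ "fr (\<ominus> a) s"]) simp_all
  qed (elim FF_cases, simp add: fr_simps R.m_ac R.l_distr R.r_distr R.a_ac | simp add: FF_zero)+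
  show "comm_monoid FF"
    by (rule comm_monoidI) (elim FF_cases, simp add: fr_simps R.m_ac | simp add: FF_one)+
  fix x y z assume "x \<in> carrier FF" "y \<in> carrier FF" "z \<in> carrier FF"
  then show "(x \<oplus>\<^bsub>FF\<^esub> y) \<otimes>\<^bsub>FF\<^esub> z = x \<otimes>\<^bsub>FF\<^esub> z \<oplus>\<^bsub>FF\<^esub> y \<otimes>\<^bsub>FF\<^esub> z"
    by (elim FF_cases) (simp add: fr_simps R.m_ac R.l_distr R.r_distr R.a_ac)
qed

sublocale FC: cring FF by (rule FF_cring)

lemma FF_field: "field FF"
proof (rule FC.cring_fieldI2)
  show "\<zero>\<^bsub>FF\<^esub> \<noteq> \<one>\<^bsub>FF\<^esub>" by (simp add: fr_simps)
  fix x assume "x \<in> carrier FF" "x \<noteq> \<zero>\<^bsub>FF\<^esub>"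
  moreover from this obtain a s where x: "a \<in> carrier R" "s \<in> carrier R" "s \<noteq> \<zero>" "x = fr a s" using FF_cases by metis
  ultimately have "a \<noteq> \<zero>" by (auto simp: fr_simps)
  then show "\<exists>b\<in>carrier FF. x \<otimes>\<^bsub>FF\<^esub> b = \<one>\<^bsub>FF\<^esub>"
    using x by (intro bexI[of _ "fr s a"]) (simp_all add: fr_simps R.m_ac)
qed

lemma FF_alg: "assoc_algebra K FF"
proof -
  have m: "module K FF"
    by (intro module.intro module_axioms.intro RA.is_cring FC.abelian_group_axioms; (elim FF_cases)?)
      (simp_all add: fr_simps RA.smult_l_distr RA.smult_r_distr RA.smult_assoc1 RA.smult_mult_left RA.smult_mult_right
        R.m_ac R.l_distr R.r_distr)
  show ?thesis
    by (intro assoc_algebra.intro m FC.ring_axioms assoc_algebra_axioms.intro; elim FF_cases)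
      (simp_all add: fr_simps RA.smult_mult_left RA.smult_mult_right)
qed

definition emb where "emb a = fr a \<one>"

lemma emb_hom: "emb \<in> alg_hom K R FF"
  by (intro alg_homI lin_mapI) (simp_all add: emb_def fr_simps R.m_ac R.l_distr)

lemma emb_inj: "inj_on emb (carrier R)"
  by (rule inj_onI) (simp add: emb_def fr_simps)

lemma emb_denom: "a \<in> carrier R \<Longrightarrow> s \<in> carrier R \<Longrightarrow> s \<noteq> \<zero> \<Longrightarrow> emb s \<otimes>\<^bsub>FF\<^esub> fr a s = emb a"
  by (simp add: emb_def fr_simps R.m_ac)

lemma emb_zero_iff: "a \<in> carrier R \<Longrightarrow> emb a = \<zero>\<^bsub>FF\<^esub> \<longleftrightarrow> a = \<zero>"
  by (simp add: emb_def fr_simps)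

end

section \<open>The convolution inverse of \<open>t\<close>\<close>

lemma lift_add:
  assumes "module R M" "module R N" "module R P" "f \<in> bilin_map R M N P" "g \<in> bilin_map R M N P"
    "t \<in> carrier (tensor R M N)"
  shows "tlift R M N P (\<lambda>x y. f x y \<oplus>\<^bsub>P\<^esub> g x y) t =
    tlift R M N P f t \<oplus>\<^bsub>P\<^esub> tlift R M N P g t"
  by (rule lift_eqI[OF assms(1,2) _ _ assms(6)]) (use assms in \<open>auto intro!: lin_add lin_lift\<close>)

context vspace
begin

lemma ev_cong:
  assumes "l \<in> dual" "m \<in> dual" "\<And>v. v \<in> carrier V \<Longrightarrow> l v = m v" "t \<in> carrier SA"
  shows "ev l t = ev m t"
  by (rule SA_hom_unique[OF KA_alg ev(1)[OF assms(1)] ev(1)[OF assms(2)] _ assms(4)])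
    (simp add: ev[OF assms(1)] ev[OF assms(2)] assms(3))

end

section \<open>Coefficients and left multiplication on R \<otimes> H\<close>

context hopf
begin

abbreviation dual where "dual \<equiv> lin_map K H (self_algebra K)"

lemma counit_dual: "counit H \<in> dual"
  by (rule alg_homD(1)[OF counit_hom])

text \<open>Contraction of the right tensor factor with \<kappa>. The family of all these maps plays
  the role of coordinates on M \<otimes> H.\<close>

abbreviation coef where
  "coef M \<kappa> \<equiv> tlift K M H M (\<lambda>m h. \<kappa> h \<odot>\<^bsub>M\<^esub> m)"

lemma coef_bilin: "module K M \<Longrightarrow> \<kappa> \<in> dual \<Longrightarrow> (\<lambda>m h. \<kappa> h \<odot>\<^bsub>M\<^esub> m) \<in> bilin_map K M H M"
  by (rule functional_bilin[OF K H_mod])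

lemma coef_lin: "module K M \<Longrightarrow> \<kappa> \<in> dual \<Longrightarrow> coef M \<kappa> \<in> lin_map K (tensor K M H) M"
  by (intro lin_lift H_mod coef_bilin)

lemma coef_pure: "module K M \<Longrightarrow> \<kappa> \<in> dual \<Longrightarrow> m \<in> carrier M \<Longrightarrow> h \<in> carrier H \<Longrightarrow> coef M \<kappa> (tens K M H m h) = \<kappa> h \<odot>\<^bsub>M\<^esub> m"
  by (simp add: coef_bilin)

text \<open>The left R-module structure of R \<otimes> H, as a K-linear operator for each element of
  R.\<close>

definition act where
  "act R a = tmap K R H R (\<lambda>m. a \<otimes>\<^bsub>R\<^esub> m)"

lemma act_lin: "assoc_algebra K R \<Longrightarrow> a \<in> carrier R \<Longrightarrow> act R a \<in> lin_map K (tensor K R H) (tensor K R H)"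
  unfolding act_def by (rule lin_tmap) (auto intro!: lin_mult_r lin_id assoc_algebra_module)

lemma act_pure: "assoc_algebra K R \<Longrightarrow> a \<in> carrier R \<Longrightarrow> m \<in> carrier R \<Longrightarrow> h \<in> carrier H \<Longrightarrow>
    act R a (tens K R H m h) = tens K R H (a \<otimes>\<^bsub>R\<^esub> m) h"
  unfolding act_def
  by (rule lift_tens[OF _ _ _ bilin_tmap]) (simp_all add: lin_mult_r lin_id assoc_algebra_module)

lemma act_lin_l: 
  assumes R: "assoc_algebra K R" and y: "y \<in> carrier (tensor K R H)"
  shows "(\<lambda>a. act R a y) \<in> lin_map K R (tensor K R H)"
proof -
  interpret R: assoc_algebra K R by (rule R)
  have m [simp]: "module K R" by (rule R.module_axioms)
  show ?thesis
    unfolding act_def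
    by (intro lin_lift_body bilin_mapI lin R y; simp)
qed

lemma act_mult:
  assumes R: "assoc_algebra K R" and ab: "a \<in> carrier R" "b \<in> carrier R" and y: "y \<in> carrier (tensor K R H)"
  shows "act R a (act R b y) = act R (a \<otimes>\<^bsub>R\<^esub> b) y"
proof -
  interpret R: assoc_algebra K R by (rule R)
  show ?thesis
    by (rule lin_eq_tensor[OF R.module_axioms H_mod lin_comp[OF act_lin[OF R ab(1)] act_lin[OF R ab(2)]] act_lin[OF R] _ y])
      (simp_all add: act_pure[OF R] ab R.A.m_assoc)
qed

lemma act_one:
  assumes R: "assoc_algebra K R" and y: "y \<in> carrier (tensor K R H)"
  shows "act R \<one>\<^bsub>R\<^esub> y = y"
proof -
  interpret R: assoc_algebra K R by (rule R)
  show ?thesis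
    by (rule lin_eq_tensor[OF R.module_axioms H_mod act_lin[OF R] lin_id _ y]) (simp_all add: act_pure[OF R])
qed

lemma act_smult:
  assumes R: "assoc_algebra K R" and c: "c \<in> carrier K" and y: "y \<in> carrier (tensor K R H)"
  shows "act R (c \<odot>\<^bsub>R\<^esub> \<one>\<^bsub>R\<^esub>) y = c \<odot>\<^bsub>tensor K R H\<^esub> y"
proof -
  interpret R: assoc_algebra K R by (rule R)
  show ?thesis
    using lin_mapD(3)[OF act_lin_l[OF R y] c R.A.one_closed] act_one[OF R y] by simp
qed

lemma coef_act:
  assumes R: "assoc_algebra K R" and \<kappa>: "\<kappa> \<in> dual" and a: "a \<in> carrier R" and y: "y \<in> carrier (tensor K R H)"
  shows "coef R \<kappa> (act R a y) = a \<otimes>\<^bsub>R\<^esub> coef R \<kappa> y"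
proof -
  interpret R: assoc_algebra K R by (rule R)
  note m = R.module_axioms
  show ?thesis
    by (rule lin_eq_tensor[OF m H_mod lin_comp[OF coef_lin[OF m \<kappa>] act_lin[OF R a]] lin_mult_r[OF R coef_lin[OF m \<kappa>] a] _ y])
      (use lin_mapD(1)[OF \<kappa>] in \<open>simp add: act_pure[OF R] a coef_pure[OF m \<kappa>] R.smult_mult_right\<close>)
qed

end

section \<open>The field K_H, the elements t_h, and the operator \<open>Tm\<close>\<close>

locale hopf_inf = hopf K H for K :: "'k ring" and H :: "('k, 'h) hopf" (structure) +
  assumes inf: "infinite (carrier K)"
begin

sublocale VH: vspace K H
  by (intro vspace.intro K H_mod)

abbreviation S where "S \<equiv> symmetric_algebra K H"
abbreviation L where "L \<equiv> K_field K H"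
abbreviation tv where "tv \<equiv> t_var K H"

sublocale Fr: frac K S
  by (intro frac.intro VH.SA_alg VH.SA_domain inf)

lemma S_alg [simp]: "assoc_algebra K S" by (rule VH.SA_alg)
lemma S_mod [simp]: "module K S" by (rule assoc_algebra_module) simp
lemma L_alg [simp]: "assoc_algebra K L" unfolding K_field_def by (rule Fr.FF_alg)
lemma L_mod [simp]: "module K L" by (rule assoc_algebra_module) simp
lemma L_field: "field L" unfolding K_field_def by (rule Fr.FF_field)

sublocale LF: field L by (rule L_field)
sublocale LA: assoc_algebra K L by (rule L_alg)

abbreviation emb where "emb \<equiv> Fr.emb"

lemma emb_hom: "emb \<in> alg_hom K S L" unfolding K_field_def by (rule Fr.emb_hom)

lemmas embD = alg_homD[OF emb_hom]

lemma tv_emb: "tv h = emb (VH.sv h)"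
  by (simp add: t_var_def Fr.emb_def VH.sv_def)

lemma tv_lin: "tv \<in> lin_map K H L"
  unfolding tv_emb[abs_def] by (rule lin_comp[OF embD(1) VH.sv_lin])

lemma lin_tv [lin]: "f \<in> lin_map K Q H \<Longrightarrow> (\<lambda>x. tv (f x)) \<in> lin_map K Q L"
  by (rule lin_comp[OF tv_lin])

lemma tv_closed [simp]: "h \<in> carrier H \<Longrightarrow> tv h \<in> carrier L"
  by (rule lin_mapD(1)[OF tv_lin])

lemma lin_sv [lin]: "f \<in> lin_map K Q H \<Longrightarrow> (\<lambda>x. VH.sv (f x)) \<in> lin_map K Q S"
  by (rule lin_comp[OF VH.sv_lin])

text \<open>L \<otimes> H as a vector space over L, because the functional to be extended in
  \<open>conv_inverse_exists\<close> is L-linear.\<close>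

definition LH where "LH = with_smult (tensor K L H) (act L)"

lemma LH_simps [simp]: "carrier LH = carrier (tensor K L H)" "ring.add LH = ring.add (tensor K L H)"
  "\<zero>\<^bsub>LH\<^esub> = \<zero>\<^bsub>tensor K L H\<^esub>" "smult LH = act L"
  by (simp_all add: LH_def with_smult_def)

lemma LH_module: "module L LH"
proof -
  interpret T: module K "tensor K L H" by simp
  have "abelian_group LH"
  proof (rule abelian_groupI)
    fix x assume "x \<in> carrier LH"
    then show "\<exists>y\<in>carrier LH. y \<oplus>\<^bsub>LH\<^esub> x = \<zero>\<^bsub>LH\<^esub>"
      by (intro bexI[of _ "\<ominus>\<^bsub>tensor K L H\<^esub> x"]) (simp_all add: T.M.l_neg)
  qed (simp_all add: T.M.a_ac)
  then show ?thesis
    by (intro module.intro module_axioms.intro LF.is_cring)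
      (simp_all add: act_mult[OF L_alg] act_one[OF L_alg] lin_mapD[OF act_lin[OF L_alg]] lin_mapD(2)[OF act_lin_l[OF L_alg]])
qed

context
  fixes \<Gamma> :: "'h \<Rightarrow> ('h, 'h) tens"
  assumes \<Gamma>: "\<Gamma> \<in> lin_map K H (tensor K H H)"
    and \<Gamma>_counit: "\<And>h. h \<in> carrier H \<Longrightarrow> tlift K H H H (\<lambda>a b. counit H b \<odot> a) (\<Gamma> h) = h"
begin

lemma \<Gamma>_closed [simp]: "h \<in> carrier H \<Longrightarrow> \<Gamma> h \<in> carrier (tensor K H H)"
  by (rule lin_mapD(1)[OF \<Gamma>])

text \<open>Here \<Gamma> is \<Delta> or its flip, so that one argument serves for left and right
  convolution inverses. With \<Gamma> = \<Delta> this is m \<otimes> h \<mapsto> \<Sum> m t_{h(2)}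
  \<otimes> h(1).\<close>

definition Tm where
  "Tm = tlift K L H (tensor K L H) (\<lambda>m h.
     tlift K H H (tensor K L H) (\<lambda>p q. tens K L H (m \<otimes>\<^bsub>L\<^esub> tv q) p) (\<Gamma> h))"

text \<open>The \<kappa>-coefficient of \<open>Tm\<close>, written over an arbitrary algebra. Over L
  it is literally that coefficient (\<open>coef_Tm\<close>); over S it is the version without
  denominators, which can be evaluated at points.\<close>

definition Gm where
  "Gm R \<tau> \<kappa> = tlift K R H R (\<lambda>m h.
     tlift K H H R (\<lambda>p q. \<kappa> p \<odot>\<^bsub>R\<^esub> (m \<otimes>\<^bsub>R\<^esub> \<tau> q)) (\<Gamma> h))"

lemma Tm_inner: "m \<in> carrier L \<Longrightarrow> (\<lambda>p q. tens K L H (m \<otimes>\<^bsub>L\<^esub> tv q) p) \<in> bilin_map K H H (tensor K L H)"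
  by (intro bilin_mapI lin; simp)

lemma Tm_bilin: "(\<lambda>m h. tlift K H H (tensor K L H) (\<lambda>p q. tens K L H (m \<otimes>\<^bsub>L\<^esub> tv q) p) (\<Gamma> h))
    \<in> bilin_map K L H (tensor K L H)"
  by (intro bilin_mapI lin_lift_arg lin_lift_body Tm_inner \<Gamma> lin; simp)

lemma Tm_lin: "Tm \<in> lin_map K (tensor K L H) (tensor K L H)"
  unfolding Tm_def by (intro lin_lift Tm_bilin; simp)

lemma Tm_pure: "m \<in> carrier L \<Longrightarrow> h \<in> carrier H \<Longrightarrow> Tm (tens K L H m h) =
    tlift K H H (tensor K L H) (\<lambda>p q. tens K L H (m \<otimes>\<^bsub>L\<^esub> tv q) p) (\<Gamma> h)"
  unfolding Tm_def by (simp add: Tm_bilin)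

lemma Tm_act:
  assumes a: "a \<in> carrier L" and y: "y \<in> carrier (tensor K L H)"
  shows "Tm (act L a y) = act L a (Tm y)"
proof (rule lin_eq_tensor[OF L_mod H_mod lin_comp[OF Tm_lin act_lin[OF L_alg a]] lin_comp[OF act_lin[OF L_alg a] Tm_lin] _ y])
  fix m h assume mh: "m \<in> carrier L" "h \<in> carrier H"
  have "act L a (Tm (tens K L H m h)) = tlift K H H (tensor K L H)
      (\<lambda>p q. act L a (tens K L H (m \<otimes>\<^bsub>L\<^esub> tv q) p)) (\<Gamma> h)"
    unfolding Tm_pure[OF mh] using mh
    by (intro lift_map[OF H_mod H_mod _ act_lin[OF L_alg a] Tm_inner]) simp_all
  also have "\<dots> = tlift K H H (tensor K L H) (\<lambda>p q. tens K L H (a \<otimes>\<^bsub>L\<^esub> m \<otimes>\<^bsub>L\<^esub> tv q) p) (\<Gamma> h)"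
    using a mh by (intro fun_cong[OF tensor_lift_cong]) (simp add: act_pure[OF L_alg] LF.m_assoc)
  finally show "Tm (act L a (tens K L H m h)) = act L a (Tm (tens K L H m h))"
    using a mh by (simp add: act_pure[OF L_alg] Tm_pure)
qed

context
  fixes R :: "('k, 'r, 'x) module_scheme" and \<tau> :: "'h \<Rightarrow> 'r"
  assumes R: "assoc_algebra K R" and \<tau>: "\<tau> \<in> lin_map K H R"
begin

lemma Gm_inner:
  assumes "\<kappa> \<in> dual" "m \<in> carrier R"
  shows "(\<lambda>p q. \<kappa> p \<odot>\<^bsub>R\<^esub> (m \<otimes>\<^bsub>R\<^esub> \<tau> q)) \<in> bilin_map K H H R"
proof -
  interpret R: assoc_algebra K R by (rule R)
  show ?thesis
    using assms lin_mapD(1)[OF \<tau>] lin_mapD(1)[OF assms(1)]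
    by (intro bilin_mapI lin_const_smult lin_smult_const lin_mult_r R \<tau> R.module_axioms) simp_all
qed

lemma Gm_bilin:
  assumes "\<kappa> \<in> dual"
  shows "(\<lambda>m h. tlift K H H R (\<lambda>p q. \<kappa> p \<odot>\<^bsub>R\<^esub> (m \<otimes>\<^bsub>R\<^esub> \<tau> q)) (\<Gamma> h)) \<in> bilin_map K R H R"
proof -
  interpret R: assoc_algebra K R by (rule R)
  show ?thesis
    using lin_mapD(1)[OF \<tau>] lin_mapD(1)[OF assms(1)]
    by (intro bilin_mapI lin_lift_arg lin_lift_body Gm_inner assms \<Gamma> R.module_axioms lin_const_smult lin_mult_l R lin_id H_mod) simp_all
qed

lemma Gm_lin: "\<kappa> \<in> dual \<Longrightarrow> Gm R \<tau> \<kappa> \<in> lin_map K (tensor K R H) R"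
  unfolding Gm_def by (intro lin_lift Gm_bilin assoc_algebra_module[OF R] H_mod)

lemma Gm_pure: "\<kappa> \<in> dual \<Longrightarrow> m \<in> carrier R \<Longrightarrow> h \<in> carrier H \<Longrightarrow> Gm R \<tau> \<kappa> (tens K R H m h) =
    tlift K H H R (\<lambda>p q. \<kappa> p \<odot>\<^bsub>R\<^esub> (m \<otimes>\<^bsub>R\<^esub> \<tau> q)) (\<Gamma> h)"
  unfolding Gm_def by (simp add: Gm_bilin assoc_algebra_module[OF R])

lemma Gm_act:
  assumes \<kappa>: "\<kappa> \<in> dual" and a: "a \<in> carrier R" and y: "y \<in> carrier (tensor K R H)"
  shows "Gm R \<tau> \<kappa> (act R a y) = a \<otimes>\<^bsub>R\<^esub> Gm R \<tau> \<kappa> y"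
proof -
  interpret R: assoc_algebra K R by (rule R)
  note m = R.module_axioms
  show ?thesis
  proof (rule lin_eq_tensor[OF m H_mod lin_comp[OF Gm_lin[OF \<kappa>] act_lin[OF R a]] lin_mult_r[OF R Gm_lin[OF \<kappa>] a] _ y])
    fix x h assume xh: "x \<in> carrier R" "h \<in> carrier H"
    have "a \<otimes>\<^bsub>R\<^esub> Gm R \<tau> \<kappa> (tens K R H x h) = tlift K H H R (\<lambda>p q. a \<otimes>\<^bsub>R\<^esub> (\<kappa> p \<odot>\<^bsub>R\<^esub> (x \<otimes>\<^bsub>R\<^esub> \<tau> q))) (\<Gamma> h)"
      unfolding Gm_pure[OF \<kappa> xh] using xh
      by (intro lift_map[OF H_mod H_mod m lin_mult_r[OF R lin_id a] Gm_inner[OF \<kappa>]]) simp_all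
    also have "\<dots> = tlift K H H R (\<lambda>p q. \<kappa> p \<odot>\<^bsub>R\<^esub> (a \<otimes>\<^bsub>R\<^esub> x \<otimes>\<^bsub>R\<^esub> \<tau> q)) (\<Gamma> h)"
      using a xh lin_mapD(1)[OF \<tau>] lin_mapD(1)[OF \<kappa>]
      by (intro fun_cong[OF tensor_lift_cong]) (simp add: R.smult_mult_right R.A.m_assoc)
    finally show "Gm R \<tau> \<kappa> (act R a (tens K R H x h)) = a \<otimes>\<^bsub>R\<^esub> Gm R \<tau> \<kappa> (tens K R H x h)"
      using a xh by (simp add: act_pure[OF R] Gm_pure[OF \<kappa>])
  qed
qed

end

lemma coef_Tm:
  assumes \<kappa>: "\<kappa> \<in> dual" and y: "y \<in> carrier (tensor K L H)"
  shows "coef L \<kappa> (Tm y) = Gm L tv \<kappa> y"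
proof (rule lin_eq_tensor[OF L_mod H_mod lin_comp[OF coef_lin[OF L_mod \<kappa>] Tm_lin] Gm_lin[OF L_alg tv_lin \<kappa>] _ y])
  fix m h assume mh: "m \<in> carrier L" "h \<in> carrier H"
  have "coef L \<kappa> (Tm (tens K L H m h)) = tlift K H H L (\<lambda>p q. coef L \<kappa> (tens K L H (m \<otimes>\<^bsub>L\<^esub> tv q) p)) (\<Gamma> h)"
    unfolding Tm_pure[OF mh] using mh
    by (intro lift_map[OF H_mod H_mod _ coef_lin[OF L_mod \<kappa>] Tm_inner]) simp_all
  also have "\<dots> = Gm L tv \<kappa> (tens K L H m h)"
    unfolding Gm_pure[OF L_alg tv_lin \<kappa> mh] using mh
    by (intro fun_cong[OF tensor_lift_cong]) (simp add: coef_pure[OF L_mod \<kappa>])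
  finally show "coef L \<kappa> (Tm (tens K L H m h)) = Gm L tv \<kappa> (tens K L H m h)" .
qed

text \<open>A tensor is a finite sum, so one denominator serves it as a whole, and hence all
  functionals \<kappa> simultaneously. Two summands are joined by cross-multiplication.\<close>

lemma common_denominator:
  assumes "y \<in> carrier (tensor K L H)"
  shows "\<exists>a\<in>carrier S. a \<noteq> \<zero>\<^bsub>S\<^esub> \<and> (\<exists>y'\<in>carrier (tensor K S H). \<forall>\<kappa>\<in>dual.
    emb a \<otimes>\<^bsub>L\<^esub> coef L \<kappa> y = emb (coef S \<kappa> y') \<and> emb a \<otimes>\<^bsub>L\<^esub> Gm L tv \<kappa> y = emb (Gm S VH.sv \<kappa> y'))"
  using L_mod H_mod assms
proof (induction y rule: tensor_induct)
  case (pure m h)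
  obtain b s where m: "b \<in> carrier S" "s \<in> carrier S" "s \<noteq> \<zero>\<^bsub>S\<^esub>" "m = fraction S b s"
    using Fr.FF_cases pure(1) unfolding K_field_def by blast
  have e: "emb s \<otimes>\<^bsub>L\<^esub> m = emb b"
    unfolding m(4) K_field_def by (rule Fr.emb_denom[OF m(1-3)])
  have sm: "emb s \<otimes>\<^bsub>L\<^esub> (c \<odot>\<^bsub>L\<^esub> m) = emb (c \<odot>\<^bsub>S\<^esub> b)" if "c \<in> carrier K" for c
    using that m(1,2) pure(1) e embD(2)[of s] embD(6)[of c b] by (simp add: LA.smult_mult_right)
  show ?case
  proof (intro bexI[of _ s] conjI bexI[of _ "tens K S H b h"] ballI)
    fix \<kappa> assume \<kappa>: "\<kappa> \<in> dual"
    have k: "\<kappa> h \<in> carrier K" if "h \<in> carrier H" for h using lin_mapD(1)[OF \<kappa> that] by simp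
    show "emb s \<otimes>\<^bsub>L\<^esub> coef L \<kappa> (tens K L H m h) = emb (coef S \<kappa> (tens K S H b h))"
      using pure m(1) k by (simp add: coef_pure[OF _ \<kappa>] sm)
    have "emb s \<otimes>\<^bsub>L\<^esub> Gm L tv \<kappa> (tens K L H m h) =
       tlift K H H L (\<lambda>p q. emb s \<otimes>\<^bsub>L\<^esub> (\<kappa> p \<odot>\<^bsub>L\<^esub> (m \<otimes>\<^bsub>L\<^esub> tv q))) (\<Gamma> h)"
      unfolding Gm_pure[OF L_alg tv_lin \<kappa> pure] using pure m(2) embD(2)
      by (intro lift_map[OF H_mod H_mod L_mod lin_mult_r[OF L_alg lin_id] Gm_inner[OF L_alg tv_lin \<kappa>]]) simp_all
    also have "\<dots> = tlift K H H L (\<lambda>p q. emb (\<kappa> p \<odot>\<^bsub>S\<^esub> (b \<otimes>\<^bsub>S\<^esub> VH.sv q))) (\<Gamma> h)"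
    proof (intro fun_cong[OF tensor_lift_cong])
      fix p q assume pq: "p \<in> carrier H" "q \<in> carrier H"
      have "emb s \<otimes>\<^bsub>L\<^esub> (\<kappa> p \<odot>\<^bsub>L\<^esub> (m \<otimes>\<^bsub>L\<^esub> tv q)) = \<kappa> p \<odot>\<^bsub>L\<^esub> ((emb s \<otimes>\<^bsub>L\<^esub> m) \<otimes>\<^bsub>L\<^esub> tv q)"
        using pq k pure(1) m(2) embD(2) by (simp add: LA.smult_mult_right LF.m_assoc)
      also have "\<dots> = emb (\<kappa> p \<odot>\<^bsub>S\<^esub> (b \<otimes>\<^bsub>S\<^esub> VH.sv q))"
        unfolding e using pq k m(1) by (simp add: embD tv_emb)
      finally show "emb s \<otimes>\<^bsub>L\<^esub> (\<kappa> p \<odot>\<^bsub>L\<^esub> (m \<otimes>\<^bsub>L\<^esub> tv q)) = emb (\<kappa> p \<odot>\<^bsub>S\<^esub> (b \<otimes>\<^bsub>S\<^esub> VH.sv q))" .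
    qed
    also have "\<dots> = emb (Gm S VH.sv \<kappa> (tens K S H b h))"
      unfolding Gm_pure[OF S_alg VH.sv_lin \<kappa> m(1) pure(2)] using pure m(1)
      by (intro lift_map[symmetric, OF H_mod H_mod S_mod embD(1) Gm_inner[OF S_alg VH.sv_lin \<kappa>]]) simp_all
    finally show "emb s \<otimes>\<^bsub>L\<^esub> Gm L tv \<kappa> (tens K L H m h) = emb (Gm S VH.sv \<kappa> (tens K S H b h))" .
  qed (use m pure in simp_all)
next
  case (add y1 y2)
  obtain a1 z1 where 1: "a1 \<in> carrier S" "a1 \<noteq> \<zero>\<^bsub>S\<^esub>" "z1 \<in> carrier (tensor K S H)"
    "\<And>\<kappa>. \<kappa> \<in> dual \<Longrightarrow> emb a1 \<otimes>\<^bsub>L\<^esub> coef L \<kappa> y1 = emb (coef S \<kappa> z1) \<and> emb a1 \<otimes>\<^bsub>L\<^esub> Gm L tv \<kappa> y1 = emb (Gm S VH.sv \<kappa> z1)"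
    using add(3) by blast
  obtain a2 z2 where 2: "a2 \<in> carrier S" "a2 \<noteq> \<zero>\<^bsub>S\<^esub>" "z2 \<in> carrier (tensor K S H)"
    "\<And>\<kappa>. \<kappa> \<in> dual \<Longrightarrow> emb a2 \<otimes>\<^bsub>L\<^esub> coef L \<kappa> y2 = emb (coef S \<kappa> z2) \<and> emb a2 \<otimes>\<^bsub>L\<^esub> Gm L tv \<kappa> y2 = emb (Gm S VH.sv \<kappa> z2)"
    using add(4) by blast
  note a = lin_mapD(1)[OF act_lin[OF S_alg]]
  have key: "emb (a1 \<otimes>\<^bsub>S\<^esub> a2) \<otimes>\<^bsub>L\<^esub> f (y1 \<oplus>\<^bsub>tensor K L H\<^esub> y2) =
      emb (g (act S a2 z1 \<oplus>\<^bsub>tensor K S H\<^esub> act S a1 z2))"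
    if f: "f \<in> lin_map K (tensor K L H) L" and g: "g \<in> lin_map K (tensor K S H) S"
      and ga: "\<And>a y. a \<in> carrier S \<Longrightarrow> y \<in> carrier (tensor K S H) \<Longrightarrow> g (act S a y) = a \<otimes>\<^bsub>S\<^esub> g y"
      and e: "emb a1 \<otimes>\<^bsub>L\<^esub> f y1 = emb (g z1)" "emb a2 \<otimes>\<^bsub>L\<^esub> f y2 = emb (g z2)" for f g
  proof -
    note cl = lin_mapD(1)[OF f add(1)] lin_mapD(1)[OF f add(2)] lin_mapD(1)[OF g 1(3)] lin_mapD(1)[OF g 2(3)]
      embD(2)[OF 1(1)] embD(2)[OF 2(1)]
    have "emb (a1 \<otimes>\<^bsub>S\<^esub> a2) \<otimes>\<^bsub>L\<^esub> f (y1 \<oplus>\<^bsub>tensor K L H\<^esub> y2) =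
        emb a2 \<otimes>\<^bsub>L\<^esub> (emb a1 \<otimes>\<^bsub>L\<^esub> f y1) \<oplus>\<^bsub>L\<^esub> emb a1 \<otimes>\<^bsub>L\<^esub> (emb a2 \<otimes>\<^bsub>L\<^esub> f y2)"
      using cl 1(1) 2(1) by (simp add: embD(3) lin_mapD(2)[OF f add(1,2)] LF.r_distr LF.m_ac)
    also have "\<dots> = emb (a2 \<otimes>\<^bsub>S\<^esub> g z1 \<oplus>\<^bsub>S\<^esub> a1 \<otimes>\<^bsub>S\<^esub> g z2)"
      unfolding e using cl 1(1) 2(1) by (simp add: embD)
    also have "\<dots> = emb (g (act S a2 z1 \<oplus>\<^bsub>tensor K S H\<^esub> act S a1 z2))"
      using 1(1,3) 2(1,3) a by (simp add: lin_mapD(2)[OF g] ga)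
    finally show ?thesis .
  qed
  show ?case
  proof (intro bexI[of _ "a1 \<otimes>\<^bsub>S\<^esub> a2"] conjI bexI[of _ "act S a2 z1 \<oplus>\<^bsub>tensor K S H\<^esub> act S a1 z2"] ballI)
    fix \<kappa> assume \<kappa>: "\<kappa> \<in> dual"
    show "emb (a1 \<otimes>\<^bsub>S\<^esub> a2) \<otimes>\<^bsub>L\<^esub> coef L \<kappa> (y1 \<oplus>\<^bsub>tensor K L H\<^esub> y2) =
      emb (coef S \<kappa> (act S a2 z1 \<oplus>\<^bsub>tensor K S H\<^esub> act S a1 z2))"
      using 1(4)[OF \<kappa>] 2(4)[OF \<kappa>] by (intro key coef_lin \<kappa> coef_act[OF S_alg \<kappa>]) simp_all
    show "emb (a1 \<otimes>\<^bsub>S\<^esub> a2) \<otimes>\<^bsub>L\<^esub> Gm L tv \<kappa> (y1 \<oplus>\<^bsub>tensor K L H\<^esub> y2) =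
      emb (Gm S VH.sv \<kappa> (act S a2 z1 \<oplus>\<^bsub>tensor K S H\<^esub> act S a1 z2))"
      using 1(4)[OF \<kappa>] 2(4)[OF \<kappa>]
      by (intro key Gm_lin[OF L_alg tv_lin \<kappa>] Gm_lin[OF S_alg VH.sv_lin \<kappa>] Gm_act[OF S_alg VH.sv_lin \<kappa>]) simp_all
  next
    interpret T: module K "tensor K S H" by simp
    show "act S a2 z1 \<oplus>\<^bsub>tensor K S H\<^esub> act S a1 z2 \<in> carrier (tensor K S H)"
      using a 1 2 by simp
  qed (use 1 2 Fr.prod_nz in simp_all)
qed

text \<open>Along the line from \<open>\<epsilon>\<close> to \<open>l\<close> the operator \<open>b \<otimes> h \<mapsto> \<Sum> b t\<^bsub>h(2)\<^esub> \<otimes> h\<^sub>(\<^sub>1\<^sub>)\<close> becomes the identity plus a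
  multiple of the indeterminate, so the coefficients of an element of its kernel are divisible by
  all powers of the indeterminate.\<close>

lemma coef_zero:
  assumes y: "y \<in> carrier (tensor K S H)" and 0: "\<And>\<kappa>. \<kappa> \<in> dual \<Longrightarrow> Gm S VH.sv \<kappa> y = \<zero>\<^bsub>S\<^esub>"
    and \<kappa>: "\<kappa> \<in> dual"
  shows "coef S \<kappa> y = \<zero>\<^bsub>S\<^esub>"
proof (rule VH.SA_eq_zeroI[OF inf lin_mapD(1)[OF coef_lin[OF S_mod \<kappa>] y]])
  fix l assume l: "l \<in> dual"
  \<comment> \<open>The direction l - \<epsilon>: the line starts at \<epsilon> and reaches l at
    parameter 1.\<close>
  let ?d = "\<lambda>v. l v \<oplus>\<^bsub>K\<^esub> (\<ominus>\<^bsub>K\<^esub> \<one>\<^bsub>K\<^esub>) \<otimes>\<^bsub>K\<^esub> counit H v"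
  have d: "?d \<in> dual" by (rule VH.dual_shift[OF l counit_dual]) simp
  let ?P = "UP K" let ?f = "VH.line (counit H) ?d" let ?X = "monom ?P \<one>\<^bsub>K\<^esub> 1"
  note P = VH.P_alg assoc_algebra_module[OF VH.P_alg]
  interpret PA: assoc_algebra K ?P by (rule P(1))
  note f = VH.line(1)[OF counit_dual d] and fsv = VH.line(2)[OF counit_dual d]
  note fD = alg_homD[OF f]
  \<comment> \<open>\<delta>(k) is h \<mapsto> \<Sum> k(p) (l - \<epsilon>)(q) over the legs p, q of
    \<Gamma>(h): the functional that accompanies the indeterminate when t_q is replaced by
    \<epsilon>(q) + X (l - \<epsilon>)(q).\<close>
  define \<delta> where "\<delta> k h = tlift K H H (self_algebra K) (\<lambda>p q. k p \<otimes>\<^bsub>K\<^esub> ?d q) (\<Gamma> h)" for k h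
  have db: "(\<lambda>p q. k p \<otimes>\<^bsub>K\<^esub> ?d q) \<in> bilin_map K H H (self_algebra K)" if k: "k \<in> dual" for k
    using lin_mapD(1)[OF d] lin_mapD(1)[OF k] lin_mult_l[OF K_alg k] lin_mult_r[OF K_alg d]
    by (intro bilin_mapI) simp_all
  have \<delta>: "\<delta> k \<in> dual" if k: "k \<in> dual" for k
    unfolding \<delta>_def by (intro lin_lift_arg db[OF k] \<Gamma>) simp_all
  have Fc: "?f (coef S k y) \<in> carrier ?P" if k: "k \<in> dual" for k
    using fD(2) lin_mapD(1)[OF coef_lin[OF S_mod k] y] by simp
  \<comment> \<open>The vanishing of \<open>Gm\<close> for k, restricted to the line: writing F(k)
    for the restricted coefficient, it reads F(k) + X F(\<delta> k) = 0.\<close>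
  have rec: "?f (coef S k y) \<oplus>\<^bsub>?P\<^esub> ?X \<otimes>\<^bsub>?P\<^esub> ?f (coef S (\<delta> k) y) = \<zero>\<^bsub>?P\<^esub>" if k: "k \<in> dual" for k
  proof -
    have kc: "k h \<in> carrier K" if "h \<in> carrier H" for h using lin_mapD(1)[OF k that] by simp
    have dc: "?d h \<in> carrier K" if "h \<in> carrier H" for h using lin_mapD(1)[OF d that] by simp
    have \<delta>c: "\<delta> k h \<in> carrier K" if "h \<in> carrier H" for h using lin_mapD(1)[OF \<delta>[OF k] that] by simp
    have "?f (Gm S VH.sv k y) = ?f (coef S k y) \<oplus>\<^bsub>?P\<^esub> ?X \<otimes>\<^bsub>?P\<^esub> ?f (coef S (\<delta> k) y)"
    proof (rule lin_eq_tensor[OF S_mod H_mod lin_comp[OF fD(1) Gm_lin[OF S_alg VH.sv_lin k]] _ _ y])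
      show "(\<lambda>y. ?f (coef S k y) \<oplus>\<^bsub>?P\<^esub> ?X \<otimes>\<^bsub>?P\<^esub> ?f (coef S (\<delta> k) y)) \<in> lin_map K (tensor K S H) ?P"
        by (intro lin_add lin_mult_r P lin_comp[OF fD(1) coef_lin[OF S_mod k]]
            lin_comp[OF fD(1) coef_lin[OF S_mod \<delta>[OF k]]]) simp
      fix b h assume bh: "b \<in> carrier S" "h \<in> carrier H"
      have fb: "?f b \<in> carrier ?P" by (rule fD(2)[OF bh(1)])
      let ?A = "\<lambda>p q. (k p \<otimes>\<^bsub>K\<^esub> counit H q) \<odot>\<^bsub>?P\<^esub> ?f b"
      let ?B = "\<lambda>p q. ?X \<otimes>\<^bsub>?P\<^esub> ((k p \<otimes>\<^bsub>K\<^esub> ?d q) \<odot>\<^bsub>?P\<^esub> ?f b)"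
      have kb: "(\<lambda>p q. k p \<otimes>\<^bsub>K\<^esub> counit H q) \<in> bilin_map K H H (self_algebra K)"
        using kc lin_mult_l[OF K_alg k] lin_mult_r[OF K_alg counit_dual] by (intro bilin_mapI) simp_all
      have sm: "(\<lambda>c. c \<odot>\<^bsub>?P\<^esub> ?f b) \<in> lin_map K (self_algebra K) ?P"
        by (intro lin_smult_const lin_id P fb)
      have Xsm: "(\<lambda>c. ?X \<otimes>\<^bsub>?P\<^esub> (c \<odot>\<^bsub>?P\<^esub> ?f b)) \<in> lin_map K (self_algebra K) ?P"
        by (intro lin_mult_r P sm) simp
      have cb: "(\<lambda>p q. h' (g p q)) \<in> bilin_map K H H ?P" if "g \<in> bilin_map K H H (self_algebra K)"
        "h' \<in> lin_map K (self_algebra K) ?P" for g h'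
        using bilin_mapD(1,2)[OF that(1)] by (intro bilin_mapI lin_comp[OF that(2)])
      have Ab: "?A \<in> bilin_map K H H ?P" by (rule cb[OF kb sm])
      have Bb: "?B \<in> bilin_map K H H ?P" by (rule cb[OF db[OF k] Xsm])
      have "?f (Gm S VH.sv k (tens K S H b h)) =
          tlift K H H ?P (\<lambda>p q. ?f (k p \<odot>\<^bsub>S\<^esub> (b \<otimes>\<^bsub>S\<^esub> VH.sv q))) (\<Gamma> h)"
        unfolding Gm_pure[OF S_alg VH.sv_lin k bh] using bh
        by (intro lift_map[OF H_mod H_mod S_mod fD(1) Gm_inner[OF S_alg VH.sv_lin k]]) simp_all
      also have "\<dots> = tlift K H H ?P (\<lambda>p q. ?A p q \<oplus>\<^bsub>?P\<^esub> ?B p q) (\<Gamma> h)"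
      proof (intro fun_cong[OF tensor_lift_cong])
        fix p q assume pq: "p \<in> carrier H" "q \<in> carrier H"
        note c = kc[OF pq(1)] dc[OF pq(2)] counit_closed[OF pq(2)] fb
        have "?f (k p \<odot>\<^bsub>S\<^esub> (b \<otimes>\<^bsub>S\<^esub> VH.sv q)) = k p \<odot>\<^bsub>?P\<^esub> (?f b \<otimes>\<^bsub>?P\<^esub> (monom ?P (counit H q) 0 \<oplus>\<^bsub>?P\<^esub> monom ?P (?d q) 1))"
          using c(1) bh pq by (simp add: fD fsv)
        also have "\<dots> = k p \<odot>\<^bsub>?P\<^esub> (counit H q \<odot>\<^bsub>?P\<^esub> ?f b \<oplus>\<^bsub>?P\<^esub> ?d q \<odot>\<^bsub>?P\<^esub> (?X \<otimes>\<^bsub>?P\<^esub> ?f b))"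
        proof -
          have "monom ?P (?d q) 1 = ?d q \<odot>\<^bsub>?P\<^esub> ?X"
            using VH.UPd.monom_mult_smult[OF c(2) K.one_closed, of 1] c(2) by simp
          then have "?f b \<otimes>\<^bsub>?P\<^esub> monom ?P (?d q) 1 = ?d q \<odot>\<^bsub>?P\<^esub> (?X \<otimes>\<^bsub>?P\<^esub> ?f b)"
            using c VH.UPd.P.m_comm[of ?X "?f b"] by (simp add: PA.smult_mult_right)
          moreover have "?f b \<otimes>\<^bsub>?P\<^esub> monom ?P (counit H q) 0 = counit H q \<odot>\<^bsub>?P\<^esub> ?f b"
            using c VH.UPd.P.m_comm[of "monom ?P (counit H q) 0" "?f b"] VH.UPd.monom_mult_is_smult[OF c(3,4)] by simp
          ultimately show ?thesis using c by (simp add: VH.UPd.P.r_distr)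
        qed
        also have "\<dots> = ?A p q \<oplus>\<^bsub>?P\<^esub> ?B p q"
          using c by (simp add: module.smult_r_distr[OF P(2)] module.smult_assoc1[OF P(2)] PA.smult_mult_right)
        finally show "?f (k p \<odot>\<^bsub>S\<^esub> (b \<otimes>\<^bsub>S\<^esub> VH.sv q)) = ?A p q \<oplus>\<^bsub>?P\<^esub> ?B p q" .
      qed
      also have "\<dots> = tlift K H H ?P ?A (\<Gamma> h) \<oplus>\<^bsub>?P\<^esub> tlift K H H ?P ?B (\<Gamma> h)"
        by (intro lift_add H_mod P Ab Bb \<Gamma>_closed bh)
      \<comment> \<open>The counit condition on \<Gamma> makes the part free of the indeterminate
        the identity.\<close>
      also have "tlift K H H ?P ?A (\<Gamma> h) = k h \<odot>\<^bsub>?P\<^esub> ?f b"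
      proof -
        have "k h = k (tlift K H H H (\<lambda>a b. counit H b \<odot> a) (\<Gamma> h))"
          by (simp only: \<Gamma>_counit[OF bh(2)])
        also have "\<dots> = tlift K H H (self_algebra K) (\<lambda>p q. k (counit H q \<odot> p)) (\<Gamma> h)"
          using bh by (intro lift_map[OF H_mod H_mod H_mod k] bilin_mapI lin) simp_all
        also have "\<dots> = tlift K H H (self_algebra K) (\<lambda>p q. k p \<otimes>\<^bsub>K\<^esub> counit H q) (\<Gamma> h)"
          using kc lin_mapD(3)[OF k] by (intro fun_cong[OF tensor_lift_cong]) (simp add: K.m_comm)
        finally show ?thesis
          using lift_map[OF H_mod H_mod K_mod sm kb \<Gamma>_closed[OF bh(2)]] by simp
      qed
      also have "tlift K H H ?P ?B (\<Gamma> h) = ?X \<otimes>\<^bsub>?P\<^esub> (\<delta> k h \<odot>\<^bsub>?P\<^esub> ?f b)"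
        using lift_map[OF H_mod H_mod K_mod Xsm db[OF k] \<Gamma>_closed[OF bh(2)]] by (simp add: \<delta>_def)
      finally show "?f (Gm S VH.sv k (tens K S H b h)) = ?f (coef S k (tens K S H b h)) \<oplus>\<^bsub>?P\<^esub>
          ?X \<otimes>\<^bsub>?P\<^esub> ?f (coef S (\<delta> k) (tens K S H b h))"
        using bh kc \<delta>c by (simp add: coef_pure[OF S_mod k] coef_pure[OF S_mod \<delta>[OF k]] fD)
    qed
    then show ?thesis
      using 0[OF k] lin_map_zero[OF fD(1)] VH.SA.M.abelian_group_axioms VH.UPd.P.abelian_group_axioms by simp
  qed
  \<comment> \<open>By \<open>rec\<close> the constant term vanishes for every functional, and the
    coefficient of index n + 1 at k is minus the one of index n at \<delta>(k). Hence the induction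
    on n runs for all functionals at once.\<close>
  have cf: "coeff ?P (?f (coef S k y)) n = \<zero>\<^bsub>K\<^esub>" if k: "k \<in> dual" for k n
    using k
  proof (induction n arbitrary: k)
    case 0
    have "coeff ?P (?X \<otimes>\<^bsub>?P\<^esub> ?f (coef S (\<delta> k) y)) 0 = \<zero>\<^bsub>K\<^esub>"
      using Fc[OF \<delta>[OF 0]] by simp
    then show ?case
      using arg_cong[OF rec[OF 0], of "\<lambda>p. coeff ?P p 0"] Fc[OF 0] Fc[OF \<delta>[OF 0]] by simp
  next
    case (Suc n)
    have "coeff ?P (?X \<otimes>\<^bsub>?P\<^esub> ?f (coef S (\<delta> k) y)) (n + 1) = coeff ?P (?f (coef S (\<delta> k) y)) n"
      using Fc[OF \<delta>[OF Suc(2)]] VH.UPd.coeff_monom_mult[of "\<one>\<^bsub>K\<^esub>" "?f (coef S (\<delta> k) y)" 1 n] by (simp add: add.commute)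
    also have "\<dots> = \<zero>\<^bsub>K\<^esub>" by (rule Suc(1)[OF \<delta>[OF Suc(2)]])
    finally show ?case
      using arg_cong[OF rec[OF Suc(2)], of "\<lambda>p. coeff ?P p (n + 1)"] Fc[OF Suc(2)] Fc[OF \<delta>[OF Suc(2)]] by simp
  qed
  have "?f (coef S \<kappa> y) = \<zero>\<^bsub>?P\<^esub>"
    by (rule VH.UPd.up_eqI) (use cf[OF \<kappa>] Fc[OF \<kappa>] in simp_all)
  \<comment> \<open>Parameter 1 is the point l.\<close>
  then have z: "VH.pev \<one>\<^bsub>K\<^esub> (?f (coef S \<kappa> y)) = \<zero>\<^bsub>K\<^esub>"
    using lin_map_zero[OF alg_homD(1)[OF VH.pev_hom[OF K.one_closed]]] VH.UPd.P.abelian_group_axioms module_abelian[OF K_mod] by simp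
  have lc: "l v \<in> carrier K" if "v \<in> carrier H" for v using lin_mapD(1)[OF l that] by simp
  have cy: "coef S \<kappa> y \<in> carrier S" by (rule lin_mapD(1)[OF coef_lin[OF S_mod \<kappa>] y])
  have "VH.ev l (coef S \<kappa> y) = VH.ev (\<lambda>v. counit H v \<oplus>\<^bsub>K\<^esub> \<one>\<^bsub>K\<^esub> \<otimes>\<^bsub>K\<^esub> ?d v) (coef S \<kappa> y)"
  proof (rule VH.ev_cong[OF l VH.dual_shift[OF counit_dual d K.one_closed] _ cy])
    fix v assume v: "v \<in> carrier H"
    show "l v = counit H v \<oplus>\<^bsub>K\<^esub> \<one>\<^bsub>K\<^esub> \<otimes>\<^bsub>K\<^esub> ?d v"
      using lc[OF v] v K.a_lcomm[of "counit H v" "l v" "\<ominus>\<^bsub>K\<^esub> counit H v"] by (simp add: K.l_minus K.r_neg)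
  qed
  also have "\<dots> = \<zero>\<^bsub>K\<^esub>" using VH.pev_line[OF counit_dual d K.one_closed cy] z by simp
  finally show "VH.ev l (coef S \<kappa> y) = \<zero>\<^bsub>K\<^esub>" .
qed

text \<open>Clearing denominators turns a kernel element into an element of S \<otimes> H to which
  \<open>coef_zero\<close> applies. The common denominator is nonzero in the field L, so all
  coefficients of the original element vanish as well.\<close>

lemma Tm_inj: "inj_on Tm (carrier (tensor K L H))"
proof (rule lin_map_inj[OF Tm_lin])
  fix y assume y: "y \<in> carrier (tensor K L H)" and 0: "Tm y = \<zero>\<^bsub>tensor K L H\<^esub>"
  obtain a z where a: "a \<in> carrier S" "a \<noteq> \<zero>\<^bsub>S\<^esub>" "z \<in> carrier (tensor K S H)"
    "\<And>\<kappa>. \<kappa> \<in> dual \<Longrightarrow> emb a \<otimes>\<^bsub>L\<^esub> coef L \<kappa> y = emb (coef S \<kappa> z) \<and> emb a \<otimes>\<^bsub>L\<^esub> Gm L tv \<kappa> y = emb (Gm S VH.sv \<kappa> z)"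
    using common_denominator[OF y] by blast
  have ea: "emb a \<in> carrier L" "emb a \<noteq> \<zero>\<^bsub>L\<^esub>"
    using a(1,2) embD(2) Fr.emb_zero_iff unfolding K_field_def by auto
  have ez: "emb b = \<zero>\<^bsub>L\<^esub> \<longleftrightarrow> b = \<zero>\<^bsub>S\<^esub>" if "b \<in> carrier S" for b
    using Fr.emb_zero_iff[OF that] unfolding K_field_def .
  have g: "Gm S VH.sv \<kappa> z = \<zero>\<^bsub>S\<^esub>" if \<kappa>: "\<kappa> \<in> dual" for \<kappa>
  proof -
    have "Gm L tv \<kappa> y = \<zero>\<^bsub>L\<^esub>"
      unfolding coef_Tm[OF \<kappa> y, symmetric] 0
      by (rule lin_map_zero[OF coef_lin[OF L_mod \<kappa>]]) (simp_all add: LF.abelian_group_axioms)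
    then have "emb (Gm S VH.sv \<kappa> z) = \<zero>\<^bsub>L\<^esub>" using a(4)[OF \<kappa>] ea by simp
    then show ?thesis using ez lin_mapD(1)[OF Gm_lin[OF S_alg VH.sv_lin \<kappa>] a(3)] by simp
  qed
  show "y = \<zero>\<^bsub>tensor K L H\<^esub>"
  proof (rule tensor_eq_zeroI[OF K H_mod L_mod y])
    fix \<kappa> assume \<kappa>: "\<kappa> \<in> dual"
    have "emb a \<otimes>\<^bsub>L\<^esub> coef L \<kappa> y = \<zero>\<^bsub>L\<^esub>"
      using a(4)[OF \<kappa>] coef_zero[OF a(3) g \<kappa>] ez[of "\<zero>\<^bsub>S\<^esub>"] VH.SA.M.zero_closed by simp
    then show "coef L \<kappa> y = \<zero>\<^bsub>L\<^esub>"
      using LF.integral[OF _ ea(1) lin_mapD(1)[OF coef_lin[OF L_mod \<kappa>] y]] ea by blast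
  qed
qed simp_all

text \<open>Extend id \<otimes> \<epsilon> along the injective \<open>Tm\<close> to an L-linear
  \<psi> and put s(h) = \<psi>(1 \<otimes> h). By L-linearity \<psi>(\<open>Tm\<close>(1 \<otimes>
  h)) is the sum of s(p) t_q over the legs of \<Gamma>(h), while by construction it equals
  \<epsilon>(h).\<close>

lemma conv_inverse_exists:
  "\<exists>s \<in> lin_map K H L. \<forall>h\<in>carrier H.
     tlift K H H L (\<lambda>p q. s p \<otimes>\<^bsub>L\<^esub> tv q) (\<Gamma> h) = counit H h \<odot>\<^bsub>L\<^esub> \<one>\<^bsub>L\<^esub>"
proof -
  have Tl: "Tm \<in> lin_map L LH LH"
    using lin_mapD[OF Tm_lin] Tm_act by (intro lin_mapI) simp_all
  have Ti: "inj_on Tm (carrier LH)" using Tm_inj by simp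
  have cl: "coef L (counit H) \<in> lin_map L LH (self_algebra L)"
    using lin_mapD[OF coef_lin[OF L_mod counit_dual]] coef_act[OF L_alg counit_dual] by (intro lin_mapI) simp_all
  obtain \<psi> where \<psi>: "\<psi> \<in> lin_map L LH (self_algebra L)" "\<And>y. y \<in> carrier LH \<Longrightarrow> \<psi> (Tm y) = coef L (counit H) y"
    using functional_extension[OF L_field LH_module LH_module Tl Ti cl] by blast
  note \<psi>D = lin_mapD[OF \<psi>(1), simplified]
  have \<psi>K: "\<psi> \<in> lin_map K (tensor K L H) L"
  proof (rule lin_mapI)
    fix c y assume c: "c \<in> carrier K" and y: "y \<in> carrier (tensor K L H)"
    have "\<psi> (c \<odot>\<^bsub>tensor K L H\<^esub> y) = (c \<odot>\<^bsub>L\<^esub> \<one>\<^bsub>L\<^esub>) \<otimes>\<^bsub>L\<^esub> \<psi> y"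
      unfolding act_smult[OF L_alg c y, symmetric] using c y by (simp add: \<psi>D)
    then show "\<psi> (c \<odot>\<^bsub>tensor K L H\<^esub> y) = c \<odot>\<^bsub>L\<^esub> \<psi> y"
      using c y \<psi>D(1) by (simp add: LA.smult_mult_left)
  qed (simp_all add: \<psi>D)
  let ?s = "\<lambda>h. \<psi> (tens K L H \<one>\<^bsub>L\<^esub> h)"
  have s: "?s \<in> lin_map K H L"
    by (rule lin_comp[OF \<psi>K]) (intro lin; simp)
  moreover have "tlift K H H L (\<lambda>p q. ?s p \<otimes>\<^bsub>L\<^esub> tv q) (\<Gamma> h) = counit H h \<odot>\<^bsub>L\<^esub> \<one>\<^bsub>L\<^esub>"
    if h: "h \<in> carrier H" for h
  proof -
    have "tlift K H H L (\<lambda>p q. ?s p \<otimes>\<^bsub>L\<^esub> tv q) (\<Gamma> h) =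
        tlift K H H L (\<lambda>p q. \<psi> (tens K L H (\<one>\<^bsub>L\<^esub> \<otimes>\<^bsub>L\<^esub> tv q) p)) (\<Gamma> h)"
    proof (intro fun_cong[OF tensor_lift_cong])
      fix p q assume pq: "p \<in> carrier H" "q \<in> carrier H"
      then show "?s p \<otimes>\<^bsub>L\<^esub> tv q = \<psi> (tens K L H (\<one>\<^bsub>L\<^esub> \<otimes>\<^bsub>L\<^esub> tv q) p)"
        using \<psi>D(3)[of "tv q" "tens K L H \<one>\<^bsub>L\<^esub> p"] \<psi>D(1) by (simp add: act_pure[OF L_alg] LF.m_comm)
    qed
    also have "\<dots> = \<psi> (Tm (tens K L H \<one>\<^bsub>L\<^esub> h))"
      unfolding Tm_pure[OF LF.one_closed h]
      by (rule lift_map[symmetric, OF H_mod H_mod _ \<psi>K Tm_inner]) (simp_all add: h)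
    also have "\<dots> = counit H h \<odot>\<^bsub>L\<^esub> \<one>\<^bsub>L\<^esub>"
      using \<psi>(2) h by (simp add: coef_pure[OF L_mod counit_dual])
    finally show ?thesis .
  qed
  ultimately show ?thesis by (intro bexI[of _ ?s] ballI)
qed

end

end

section \<open>Subalgebras\<close>

definition subalgebra :: "('r, 'l) ring_scheme \<Rightarrow> ('r, 'a, 'm) module_scheme \<Rightarrow> 'a set \<Rightarrow> bool" where
  "subalgebra R A B \<longleftrightarrow> subring B A \<and> (\<forall>c\<in>carrier R. \<forall>b\<in>B. c \<odot>\<^bsub>A\<^esub> b \<in> B)"

lemma subalgebraD:
  assumes "subalgebra R A B"
  shows "subring B A" "B \<subseteq> carrier A" "\<one>\<^bsub>A\<^esub> \<in> B" "\<zero>\<^bsub>A\<^esub> \<in> B"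
    "c \<in> carrier R \<Longrightarrow> b \<in> B \<Longrightarrow> c \<odot>\<^bsub>A\<^esub> b \<in> B"
    "a \<in> B \<Longrightarrow> b \<in> B \<Longrightarrow> a \<otimes>\<^bsub>A\<^esub> b \<in> B" "a \<in> B \<Longrightarrow> b \<in> B \<Longrightarrow> a \<oplus>\<^bsub>A\<^esub> b \<in> B"
  using assms subringE[of B A] by (auto simp: subalgebra_def)

context
  fixes R :: "('r, 'l) ring_scheme" and A :: "('r, 'a, 'm) module_scheme"
  assumes A: "assoc_algebra R A"
begin

interpretation A: assoc_algebra R A by (rule A)

lemma subalg_gen:
  assumes X: "X \<subseteq> carrier A"
  shows "subalgebra R A (subalg_gen R A X)" "X \<subseteq> subalg_gen R A X"
proof -
  let ?F = "{B. subring B A \<and> (\<forall>c\<in>carrier R. \<forall>b\<in>B. c \<odot>\<^bsub>A\<^esub> b \<in> B) \<and> X \<subseteq> B}"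
  have C: "carrier A \<in> ?F" using X A.A.carrier_is_subring by auto
  have s: "subring B A" if "B \<in> ?F" for B using that by blast
  have "subring (\<Inter>?F) A"
  proof (rule A.A.subringI)
    show "\<Inter>?F \<subseteq> carrier A" using C by blast
    show "\<one>\<^bsub>A\<^esub> \<in> \<Inter>?F" using subringE(3)[OF s] by blast
    show "\<ominus>\<^bsub>A\<^esub> h \<in> \<Inter>?F" if "h \<in> \<Inter>?F" for h using subringE(5)[OF s] that by blast
    show "h1 \<otimes>\<^bsub>A\<^esub> h2 \<in> \<Inter>?F" if "h1 \<in> \<Inter>?F" "h2 \<in> \<Inter>?F" for h1 h2
      using subringE(6)[OF s] that by blast
    show "h1 \<oplus>\<^bsub>A\<^esub> h2 \<in> \<Inter>?F" if "h1 \<in> \<Inter>?F" "h2 \<in> \<Inter>?F" for h1 h2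
      using subringE(7)[OF s] that by blast
  qed
  then show "subalgebra R A (subalg_gen R A X)" unfolding subalgebra_def subalg_gen_def by blast
  show "X \<subseteq> subalg_gen R A X" unfolding subalg_gen_def by blast
qed

lemma subalg_gen_minimal: "subalgebra R A B \<Longrightarrow> X \<subseteq> B \<Longrightarrow> subalg_gen R A X \<subseteq> B"
  unfolding subalg_gen_def subalgebra_def by blast

lemma subalgebra_alg:
  assumes B: "subalgebra R A B"
  shows "assoc_algebra R (A\<lparr>carrier := B\<rparr>)"
proof -
  note s = subalgebraD[OF B]
  interpret B: ring "A\<lparr>carrier := B\<rparr>" by (rule A.A.subring_is_ring[OF s(1)])
  have c: "b \<in> carrier A" if "b \<in> B" for b using s(2) that by blast
  show ?thesis
    using c s
    by (intro assoc_algebra.intro module.intro module_axioms.intro assoc_algebra_axioms.intro A.is_cring B.ring_axioms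
        B.abelian_group_axioms)
      (simp_all add: A.smult_l_distr A.smult_r_distr A.smult_assoc1 A.smult_mult_left A.smult_mult_right)
qed

lemma subalgebra_incl: "subalgebra R A B \<Longrightarrow> (\<lambda>x. x) \<in> alg_hom R (A\<lparr>carrier := B\<rparr>) A"
  using subalgebraD(2) by (intro alg_homI lin_mapI) auto

end

lemma subalgebra_cring:
  assumes "assoc_algebra R A" "cring A" "subalgebra R A B" shows "cring (A\<lparr>carrier := B\<rparr>)"
proof -
  interpret A: cring A by fact
  interpret B: assoc_algebra R "A\<lparr>carrier := B\<rparr>" by (rule subalgebra_alg[OF assms(1,3)])
  show ?thesis
    using subalgebraD(2)[OF assms(3)] A.m_comm
    by (intro cring.intro B.A.ring_axioms comm_monoid.intro B.A.monoid_axioms comm_monoid_axioms.intro) auto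
qed

lemma lin_bilin:
  assumes "f \<in> bilin_map R M N P"
  shows "g \<in> lin_map R Q M \<Longrightarrow> y \<in> carrier N \<Longrightarrow> (\<lambda>q. f (g q) y) \<in> lin_map R Q P"
    and "h \<in> lin_map R Q N \<Longrightarrow> x \<in> carrier M \<Longrightarrow> (\<lambda>q. f x (h q)) \<in> lin_map R Q P"
  using lin_comp[OF bilin_mapD(2)[OF assms]] lin_comp[OF bilin_mapD(1)[OF assms]] by blast+

section \<open>The comodule map \<open>h \<mapsto> \<Sum> l(h\<^sub>(\<^sub>1\<^sub>)) \<otimes> h\<^sub>(\<^sub>2\<^sub>)\<close>\<close>

context twisted
begin

abbreviation B2 where "B2 \<equiv> bilin_map K H H R"

text \<open>The convolution product of Hom(H \<otimes> H, R), on bilinear maps.\<close>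

definition cv2 where
  "cv2 f g x y = sw K H R (\<lambda>x1 x2. sw K H R (\<lambda>y1 y2. f x1 y1 \<cdot> g x2 y2) y) x"

lemma cv2_bilin:
  assumes f: "f \<in> B2" and g: "g \<in> B2" shows "cv2 f g \<in> B2"
  using bilin_mapD(3)[OF f] bilin_mapD(3)[OF g] unfolding cv2_def
  by (intro bilin_mapI lin lin_bilin[OF f] lin_bilin[OF g]; simp)

lemma cv2_cong:
  "(\<And>x y. x \<in> carrier H \<Longrightarrow> y \<in> carrier H \<Longrightarrow> f x y = f' x y) \<Longrightarrow> (\<And>x y. x \<in> carrier H \<Longrightarrow> y \<in> carrier H \<Longrightarrow> g x y = g' x y)
    \<Longrightarrow> cv2 f g x y = cv2 f' g' x y"
  unfolding cv2_def by (intro sw_cong) simp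

lemma cv2_map:
  assumes P: "module K P" and F: "F \<in> lin_map K R P" and f: "f \<in> B2" and g: "g \<in> B2"
    and [simp]: "x \<in> carrier H" "y \<in> carrier H"
  shows "F (cv2 f g x y) = sw K H P (\<lambda>x1 x2. sw K H P (\<lambda>y1 y2. F (f x1 y1 \<cdot> g x2 y2)) y) x"
proof -
  note c [simp] = bilin_mapD(3)[OF f] bilin_mapD(3)[OF g]
  have "F (cv2 f g x y) = sw K H P (\<lambda>x1 x2. F (sw K H R (\<lambda>y1 y2. f x1 y1 \<cdot> g x2 y2) y)) x"
    unfolding cv2_def by (rule sw_map[OF R_mod F]; (intro bilin_mapI lin lin_bilin[OF f] lin_bilin[OF g])?; simp)
  also have "\<dots> = sw K H P (\<lambda>x1 x2. sw K H P (\<lambda>y1 y2. F (f x1 y1 \<cdot> g x2 y2)) y) x"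
    by (intro sw_cong sw_map[OF R_mod F]; (intro bilin_mapI lin lin_bilin[OF f] lin_bilin[OF g])?; simp)
  finally show ?thesis .
qed

lemma cv2_assoc:
  assumes f: "f \<in> B2" and g: "g \<in> B2" and h: "h \<in> B2" and [simp]: "x \<in> carrier H" "y \<in> carrier H"
  shows "cv2 (cv2 f g) h x y = cv2 f (cv2 g h) x y"
proof -
  note [simp] = bilin_mapD(3)[OF f] bilin_mapD(3)[OF g] bilin_mapD(3)[OF h]
    bilin_mapD(3)[OF cv2_bilin[OF f g]] bilin_mapD(3)[OF cv2_bilin[OF g h]]
  let ?S = "sw K H R"
  have "cv2 (cv2 f g) h x y = ?S (\<lambda>x' x3. ?S (\<lambda>y' y3. ?S (\<lambda>x1 x2. ?S (\<lambda>y1 y2.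
      f x1 y1 \<cdot> g x2 y2 \<cdot> h x3 y3) y') x') y) x"
    unfolding cv2_def[of "cv2 f g"]
    by (intro sw_cong cv2_map[OF R_mod lin_mult_l[OF R_alg lin_id] f g]) simp_all
  also have "\<dots> = ?S (\<lambda>x1 x'. ?S (\<lambda>y1 y'. ?S (\<lambda>x2 x3. ?S (\<lambda>y2 y3.
      f x1 y1 \<cdot> g x2 y2 \<cdot> h x3 y3) y') x') y) x"
    by (rule sw_assoc2[symmetric]; (intro lin lin_bilin[OF f] lin_bilin[OF g] lin_bilin[OF h])?; simp)
  also have "\<dots> = ?S (\<lambda>x1 x'. ?S (\<lambda>y1 y'. ?S (\<lambda>x2 x3. ?S (\<lambda>y2 y3.
      f x1 y1 \<cdot> (g x2 y2 \<cdot> h x3 y3)) y') x') y) x"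
    by (intro sw_cong) (simp add: R.A.m_assoc)
  also have "\<dots> = cv2 f (cv2 g h) x y"
    unfolding cv2_def[of f]
    by (intro sw_cong cv2_map[symmetric, OF R_mod lin_mult_r[OF R_alg lin_id] g h]) simp_all
  finally show ?thesis .
qed

lemma cv2_unit:
  assumes f: "f \<in> B2" and [simp]: "x \<in> carrier H" "y \<in> carrier H"
  shows "cv2 f (\<lambda>x y. (counit H x \<otimes>\<^bsub>K\<^esub> counit H y) \<odot>\<^bsub>R\<^esub> \<one>\<^bsub>R\<^esub>) x y = f x y"
proof -
  note [simp] = bilin_mapD(3)[OF f]
  have "cv2 f (\<lambda>x y. (counit H x \<otimes>\<^bsub>K\<^esub> counit H y) \<odot>\<^bsub>R\<^esub> \<one>\<^bsub>R\<^esub>) x y =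
     sw K H R (\<lambda>x1 x2. counit H x2 \<odot>\<^bsub>R\<^esub> f x1 y) x"
    unfolding cv2_def
  proof (intro sw_cong)
    fix x1 x2 assume [simp]: "x1 \<in> carrier H" "x2 \<in> carrier H"
    have "sw K H R (\<lambda>y1 y2. f x1 y1 \<cdot> ((counit H x2 \<otimes>\<^bsub>K\<^esub> counit H y2) \<odot>\<^bsub>R\<^esub> \<one>\<^bsub>R\<^esub>)) y =
       sw K H R (\<lambda>y1 y2. counit H y2 \<odot>\<^bsub>R\<^esub> (counit H x2 \<odot>\<^bsub>R\<^esub> f x1 y1)) y"
      by (intro sw_cong) (simp add: R.smult_mult_right R.smult_assoc1[symmetric] K.m_comm)
    also have "\<dots> = counit H x2 \<odot>\<^bsub>R\<^esub> f x1 y"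
      by (rule sw_counit_r; (intro lin lin_bilin[OF f])?; simp)
    finally show "sw K H R (\<lambda>y1 y2. f x1 y1 \<cdot> ((counit H x2 \<otimes>\<^bsub>K\<^esub> counit H y2) \<odot>\<^bsub>R\<^esub> \<one>\<^bsub>R\<^esub>)) y =
      counit H x2 \<odot>\<^bsub>R\<^esub> f x1 y" .
  qed
  also have "\<dots> = f x y"
    by (rule sw_counit_r; (intro lin_bilin(1)[OF f] lin_id)?; simp)
  finally show ?thesis .
qed

lemma cv2_one:
  assumes f: "f \<in> B2" and g: "g \<in> B2"
  shows "cv2 f g \<one> \<one> = f \<one> \<one> \<cdot> g \<one> \<one>"
proof -
  note [simp] = bilin_mapD(3)[OF f] bilin_mapD(3)[OF g]
  have "cv2 f g \<one> \<one> = sw K H R (\<lambda>y1 y2. f \<one> y1 \<cdot> g \<one> y2) \<one>"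
    unfolding cv2_def by (rule sw_one; (intro bilin_mapI lin lin_bilin[OF f] lin_bilin[OF g])?; simp)
  also have "\<dots> = f \<one> \<one> \<cdot> g \<one> \<one>"
    by (rule sw_one; (intro bilin_mapI lin lin_bilin[OF f] lin_bilin[OF g])?; simp)
  finally show ?thesis .
qed

text \<open>Coefficients from the commutative ring R are central in the twisted algebra: they can be
  taken out of either factor.\<close>

lemma act_mult_W:
  assumes b: "b \<in> carrier R" and s: "s \<in> carrier T" and t: "t \<in> carrier T"
  shows "act R b s \<star> t = act R b (s \<star> t)" "s \<star> act R b t = act R b (s \<star> t)"
proof -
  note al = act_lin[OF R_alg b]
  have ac: "act R b s \<in> carrier T" if "s \<in> carrier T" for s by (rule lin_mapD(1)[OF al that])
  have m: "act R b (mul c x d y) = mul (b \<cdot> c) x d y" "act R b (mul c x d y) = mul c x (b \<cdot> d) y"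
    if [simp]: "c \<in> carrier R" "x \<in> carrier H" "d \<in> carrier R" "y \<in> carrier H" for c x d y
  proof -
    have e: "act R b (mul c x d y) = sw K H T (\<lambda>x1 x2. sw K H T (\<lambda>y1 y2.
        act R b (tens K R H (c \<cdot> d \<cdot> \<gamma> x1 y1) (x2 \<otimes> y2))) y) x"
      by (rule mul_map[OF _ al]) simp_all
    show "act R b (mul c x d y) = mul (b \<cdot> c) x d y"
      unfolding e unfolding mul_def using b by (intro sw_cong) (simp add: act_pure[OF R_alg] RC.m_ac)
    show "act R b (mul c x d y) = mul c x (b \<cdot> d) y"
      unfolding e unfolding mul_def using b by (intro sw_cong) (simp add: act_pure[OF R_alg] RC.m_ac)
  qed
  have "act R b s \<star> t = act R b (s \<star> t) \<and> s \<star> act R b t = act R b (s \<star> t)"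
  proof (intro conjI)
    show "act R b s \<star> t = act R b (s \<star> t)"
    proof (rule lin_eq_tensor[OF R_mod H_mod _ _ _ s, of _ T])
      fix c x assume cx: "c \<in> carrier R" "x \<in> carrier H"
      show "act R b (tens K R H c x) \<star> t = act R b (tens K R H c x \<star> t)"
      proof (rule lin_eq_tensor[OF R_mod H_mod _ _ _ t, of _ T])
        show "(\<lambda>t. act R b (tens K R H c x) \<star> t) \<in> lin_map K T T"
          using cx ac by (intro lin; simp)
        show "(\<lambda>t. act R b (tens K R H c x \<star> t)) \<in> lin_map K T T"
          using cx by (intro lin_comp[OF al] lin; simp)
      qed (use cx b in \<open>simp add: act_pure[OF R_alg] mult_pure m(1)\<close>)
    qed (intro lin lin_comp[OF al] al t)+
    show "s \<star> act R b t = act R b (s \<star> t)"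
    proof (rule lin_eq_tensor[OF R_mod H_mod _ _ _ s, of _ T])
      fix c x assume cx: "c \<in> carrier R" "x \<in> carrier H"
      show "tens K R H c x \<star> act R b t = act R b (tens K R H c x \<star> t)"
      proof (rule lin_eq_tensor[OF R_mod H_mod _ _ _ t, of _ T])
        show "(\<lambda>t. tens K R H c x \<star> act R b t) \<in> lin_map K T T"
          using cx by (intro lin al; simp)
        show "(\<lambda>t. act R b (tens K R H c x \<star> t)) \<in> lin_map K T T"
          using cx by (intro lin_comp[OF al] lin; simp)
      qed (use cx b in \<open>simp add: act_pure[OF R_alg] mult_pure m(2)\<close>)
    qed (intro lin lin_comp[OF al] ac t)+
  qed
  then show "act R b s \<star> t = act R b (s \<star> t)" "s \<star> act R b t = act R b (s \<star> t)" by blast+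
qed

text \<open>The comodule map attached to a linear map l : H \<rightarrow> R. Over k every comodule
  map from H arises in this way, as \<open>comod_alg_hom_ml\<close> uses; for l = t it is the \<tau>
  of the overview.\<close>

definition tau where "tau l h = sw K H T (\<lambda>h1 h2. tens K R H (l h1) h2) h"

context
  fixes l
  assumes l: "l \<in> lin_map K H R"
begin

lemma l_closed [simp]: "h \<in> carrier H \<Longrightarrow> l h \<in> carrier R"
  by (rule lin_mapD(1)[OF l])

lemma lin_l: "f \<in> lin_map K Q H \<Longrightarrow> (\<lambda>x. l (f x)) \<in> lin_map K Q R"
  by (rule lin_comp[OF l])

lemma tau_inner: "(\<lambda>h1 h2. tens K R H (l h1) h2) \<in> bilin_map K H H T"
  by (intro bilin_mapI lin lin_l; simp)

lemma tau_lin: "tau l \<in> lin_map K H T"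
  unfolding tau_def[abs_def] by (rule sw_lin[OF _ tau_inner]) simp

lemma lin_tau: "f \<in> lin_map K Q H \<Longrightarrow> (\<lambda>x. tau l (f x)) \<in> lin_map K Q T"
  by (rule lin_comp[OF tau_lin])

lemma tau_closed [simp]: "h \<in> carrier H \<Longrightarrow> tau l h \<in> carrier T"
  by (rule lin_mapD(1)[OF tau_lin])

lemma tau_map:
  assumes "module K P" "F \<in> lin_map K T P" "h \<in> carrier H"
  shows "F (tau l h) = sw K H P (\<lambda>h1 h2. F (tens K R H (l h1) h2)) h"
  unfolding tau_def by (rule sw_map[OF _ assms(2) tau_inner assms(3)]) simp

lemma coact_tau: "h \<in> carrier H \<Longrightarrow> coact W (tau l h) = sw K H TH (\<lambda>h1 h2. tens K T H (tau l h1) h2) h"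
proof -
  assume [simp]: "h \<in> carrier H"
  have "coact W (tau l h) = sw K H TH (\<lambda>h1 h'. coact W (tens K R H (l h1) h')) h"
    by (rule tau_map[OF _ coact_lin]) simp_all
  also have "\<dots> = sw K H TH (\<lambda>h1 h'. sw K H TH (\<lambda>h2 h3. tens K T H (tens K R H (l h1) h2) h3) h') h"
    by (intro sw_cong) (simp add: coact_pure dpure_def)
  also have "\<dots> = sw K H TH (\<lambda>h' h3. sw K H TH (\<lambda>h1 h2. tens K T H (tens K R H (l h1) h2) h3) h') h"
    by (rule sw_assoc; (intro bilin_mapI lin lin_l)?; simp)
  also have "\<dots> = sw K H TH (\<lambda>h' h3. tens K T H (tau l h') h3) h"
    by (intro sw_cong tau_map[symmetric, where F = "\<lambda>t. tens K T H t _"]; (intro lin)?; simp)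
  finally show ?thesis .
qed

text \<open>\<open>ll\<close> and \<open>lm\<close> are the factors of \<sigma> in the convolution
  algebra: \<sigma> is the product of \<open>ll\<close> for t, of \<alpha>, and of \<open>lm\<close>
  for t^{-1} (\<open>sigma_cv2\<close>).\<close>

definition ll where "ll x y = l x \<cdot> l y"
definition lm where "lm x y = l (x \<otimes> y)"

lemma ll_bilin: "ll \<in> B2"
  unfolding ll_def by (intro bilin_mapI lin lin_l; simp)

lemma lm_bilin: "lm \<in> B2"
  unfolding lm_def by (intro bilin_mapI lin lin_l; simp)

lemma tau_mult:
  assumes [simp]: "x \<in> carrier H" "y \<in> carrier H"
  shows "tau l x \<star> tau l y = sw K H T (\<lambda>x1 x2. sw K H T (\<lambda>y1 y2. tens K R H (cv2 ll \<gamma> x1 y1) (x2 \<otimes> y2)) y) x"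
proof -
  let ?S = "sw K H T"
  have "tau l x \<star> tau l y = ?S (\<lambda>x1 x2. tens K R H (l x1) x2 \<star> tau l y) x"
    by (rule tau_map[where F = "\<lambda>t. t \<star> tau l y"]; (intro lin)?; simp)
  also have "\<dots> = ?S (\<lambda>x1 x2. ?S (\<lambda>y1 y2. tens K R H (l x1) x2 \<star> tens K R H (l y1) y2) y) x"
    by (intro sw_cong tau_map[where F = "\<lambda>t. _ \<star> t"]; (intro lin)?; simp)
  also have "\<dots> = ?S (\<lambda>x1 x'. ?S (\<lambda>y1 y'. ?S (\<lambda>x2 x3. ?S (\<lambda>y2 y3.
      tens K R H (ll x1 y1 \<cdot> \<gamma> x2 y2) (x3 \<otimes> y3)) y') x') y) x"
    by (intro sw_cong) (simp add: mult_pure mul_def ll_def)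
  also have "\<dots> = ?S (\<lambda>x' x3. ?S (\<lambda>y' y3. ?S (\<lambda>x1 x2. ?S (\<lambda>y1 y2.
      tens K R H (ll x1 y1 \<cdot> \<gamma> x2 y2) (x3 \<otimes> y3)) y') x') y) x"
    by (rule sw_assoc2; (intro bilin_mapI lin lin_bilin[OF ll_bilin])?; simp add: bilin_mapD(3)[OF ll_bilin])
  also have "\<dots> = ?S (\<lambda>x' x3. ?S (\<lambda>y' y3. tens K R H (cv2 ll \<gamma> x' y') (x3 \<otimes> y3)) y) x"
    by (intro sw_cong cv2_map[symmetric, OF _ _ ll_bilin \<gamma>_bilin, where F = "\<lambda>r. tens K R H r _"]; (intro lin)?; simp)
  finally show ?thesis .
qed

text \<open>The right side has the same shape as in \<open>tau_mult\<close>. A product rule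
  \<tau>(x) \<tau>(y) = \<Sum> s(x(1), y(1)) \<tau>(x(2) y(2)) thereby reduces to one equation
  between convolution products of bilinear maps.\<close>

lemma act_tau_mult:
  assumes s: "s \<in> B2" and [simp]: "x \<in> carrier H" "y \<in> carrier H"
  shows "sw K H T (\<lambda>x1 x2. sw K H T (\<lambda>y1 y2. act R (s x1 y1) (tau l (x2 \<otimes> y2))) y) x =
    sw K H T (\<lambda>x1 x2. sw K H T (\<lambda>y1 y2. tens K R H (cv2 s lm x1 y1) (x2 \<otimes> y2)) y) x"
proof -
  let ?S = "sw K H T"
  note [simp] = bilin_mapD(3)[OF s] bilin_mapD(3)[OF lm_bilin]
  have "?S (\<lambda>x1 x2. ?S (\<lambda>y1 y2. act R (s x1 y1) (tau l (x2 \<otimes> y2))) y) x =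
     ?S (\<lambda>x1 x'. ?S (\<lambda>y1 y'. ?S (\<lambda>x2 x3. ?S (\<lambda>y2 y3.
      tens K R H (s x1 y1 \<cdot> lm x2 y2) (x3 \<otimes> y3)) y') x') y) x"
  proof (intro sw_cong)
    fix x1 x' y1 y' assume [simp]: "x1 \<in> carrier H" "x' \<in> carrier H" "y1 \<in> carrier H" "y' \<in> carrier H"
    have "act R (s x1 y1) (tau l (x' \<otimes> y')) = ?S (\<lambda>p q. act R (s x1 y1) (tens K R H (l p) q)) (x' \<otimes> y')"
      by (rule tau_map[OF _ act_lin[OF R_alg]]) simp_all
    also have "\<dots> = ?S (\<lambda>p q. tens K R H (s x1 y1 \<cdot> l p) q) (x' \<otimes> y')"
      by (intro sw_cong) (simp add: act_pure)
    also have "\<dots> = ?S (\<lambda>x2 x3. ?S (\<lambda>y2 y3. tens K R H (s x1 y1 \<cdot> lm x2 y2) (x3 \<otimes> y3)) y') x'"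
      unfolding lm_def by (intro sw_mult bilin_mapI lin lin_l; simp)
    finally show "act R (s x1 y1) (tau l (x' \<otimes> y')) = \<dots>" .
  qed
  also have "\<dots> = ?S (\<lambda>x' x3. ?S (\<lambda>y' y3. ?S (\<lambda>x1 x2. ?S (\<lambda>y1 y2.
      tens K R H (s x1 y1 \<cdot> lm x2 y2) (x3 \<otimes> y3)) y') x') y) x"
    by (rule sw_assoc2; (intro bilin_mapI lin lin_bilin[OF s] lin_bilin[OF lm_bilin])?; simp)
  also have "\<dots> = ?S (\<lambda>x' x3. ?S (\<lambda>y' y3. tens K R H (cv2 s lm x' y') (x3 \<otimes> y3)) y) x"
    by (intro sw_cong cv2_map[symmetric, OF _ _ s lm_bilin, where F = "\<lambda>r. tens K R H r _"]; (intro lin)?; simp)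
  finally show ?thesis .
qed

text \<open>The R-linear extension of \<open>tau l\<close>. For l = t it is \<phi>, for l = t^{-1}
  it is the inverse of \<phi>.\<close>

definition Theta where
  "Theta = tlift K R H T (\<lambda>b h. sw K H T (\<lambda>h1 h2. tens K R H (b \<cdot> l h1) h2) h)"

lemma Theta_bilin: "(\<lambda>b h. sw K H T (\<lambda>h1 h2. tens K R H (b \<cdot> l h1) h2) h) \<in> bilin_map K R H T"
  by (intro bilin_mapI lin lin_l; simp)

lemma Theta_lin: "Theta \<in> lin_map K T T"
  unfolding Theta_def by (intro lin_lift Theta_bilin; simp)

lemma Theta_tens: "b \<in> carrier R \<Longrightarrow> h \<in> carrier H \<Longrightarrow>
    Theta (tens K R H b h) = sw K H T (\<lambda>h1 h2. tens K R H (b \<cdot> l h1) h2) h"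
  unfolding Theta_def by (simp add: Theta_bilin)

lemma Theta_pure: "b \<in> carrier R \<Longrightarrow> h \<in> carrier H \<Longrightarrow> Theta (tens K R H b h) = act R b (tau l h)"
proof -
  assume bh: "b \<in> carrier R" "h \<in> carrier H"
  have "act R b (tau l h) = sw K H T (\<lambda>h1 h2. act R b (tens K R H (l h1) h2)) h"
    by (rule tau_map[OF _ act_lin[OF R_alg bh(1)] bh(2)]) simp
  also have "\<dots> = sw K H T (\<lambda>h1 h2. tens K R H (b \<cdot> l h1) h2) h"
    by (intro sw_cong) (simp add: act_pure[OF R_alg] bh)
  finally show ?thesis using bh by (simp add: Theta_tens)
qed

lemma Theta_act:
  assumes b: "b \<in> carrier R" and t: "t \<in> carrier T"
  shows "Theta (act R b t) = act R b (Theta t)"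
  by (rule lin_eq_tensor[OF R_mod H_mod lin_comp[OF Theta_lin act_lin[OF R_alg b]]
        lin_comp[OF act_lin[OF R_alg b] Theta_lin] _ t])
    (simp add: act_pure[OF R_alg] b Theta_pure act_mult[OF R_alg])

end

text \<open>Coassociativity makes the composite of two such maps the one for the convolution product
  of l and m, which is the unit \<epsilon>.\<close>

lemma Theta_inverse:
  assumes l: "l \<in> lin_map K H R" and m: "m \<in> lin_map K H R"
    and inv: "\<And>h. h \<in> carrier H \<Longrightarrow> sw K H R (\<lambda>x y. l x \<cdot> m y) h = counit H h \<odot>\<^bsub>R\<^esub> \<one>\<^bsub>R\<^esub>"
    and t: "t \<in> carrier T"
  shows "Theta m (Theta l t) = t"
proof (rule lin_eq_tensor[OF R_mod H_mod lin_comp[OF Theta_lin[OF m] Theta_lin[OF l]] lin_id _ t])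
  fix b h assume bh [simp]: "b \<in> carrier R" "h \<in> carrier H"
  let ?S = "sw K H T"
  note [simp] = lin_mapD(1)[OF l] lin_mapD(1)[OF m]
  note ll' = lin_comp[OF l] lin_comp[OF m]
  have "Theta m (tau l h) = ?S (\<lambda>h1 h'. Theta m (tens K R H (l h1) h')) h"
    by (rule tau_map[OF l _ Theta_lin[OF m] bh(2)]) simp
  also have "\<dots> = ?S (\<lambda>h1 h'. ?S (\<lambda>h2 h3. tens K R H (l h1 \<cdot> m h2) h3) h') h"
    by (intro sw_cong) (simp add: Theta_tens[OF m])
  also have "\<dots> = ?S (\<lambda>h' h3. ?S (\<lambda>h1 h2. tens K R H (l h1 \<cdot> m h2) h3) h') h"
    by (rule sw_assoc; (intro bilin_mapI lin lin_comp[OF l] lin_comp[OF m] lin_id l m)?; simp)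
  also have "\<dots> = ?S (\<lambda>h' h3. tens K R H (sw K H R (\<lambda>h1 h2. l h1 \<cdot> m h2) h') h3) h"
    by (intro sw_cong sw_map[symmetric, where g = "\<lambda>r. tens K R H r _"]; (intro bilin_mapI lin l m)?; simp)
  also have "\<dots> = ?S (\<lambda>h' h3. counit H h' \<odot>\<^bsub>T\<^esub> tens K R H \<one>\<^bsub>R\<^esub> h3) h"
    by (intro sw_cong) (simp add: inv smult_tens)
  also have "\<dots> = tens K R H \<one>\<^bsub>R\<^esub> h"
    by (rule sw_counit_l; (intro lin)?; simp)
  finally have "Theta m (tau l h) = tens K R H \<one>\<^bsub>R\<^esub> h" .
  then show "Theta m (Theta l (tens K R H b h)) = tens K R H b h"
    by (simp add: Theta_pure[OF l] Theta_act[OF m] tau_closed[OF l] act_pure[OF R_alg])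
qed

end

section \<open>The function t^{-1} and the ring S(t_H)_\<Theta>\<close>

context hopf_inf
begin

abbreviation ti where "ti \<equiv> t_inv K H"

text \<open>\<open>conv_inverse_exists\<close> gives a left inverse s for \<Delta> and a left
  inverse r for the flipped \<Delta>; as L is commutative, r is a right inverse for \<Delta>. A left
  and a right inverse agree by associativity of convolution.\<close>

lemma t_inv_exists:
  "\<exists>s. s \<in> lin_map K H L \<and> (\<forall>h\<in>carrier H.
     sw K H L (\<lambda>x y. tv x \<otimes>\<^bsub>L\<^esub> s y) h = counit H h \<odot>\<^bsub>L\<^esub> \<one>\<^bsub>L\<^esub> \<and>
     sw K H L (\<lambda>x y. s x \<otimes>\<^bsub>L\<^esub> tv y) h = counit H h \<odot>\<^bsub>L\<^esub> \<one>\<^bsub>L\<^esub>)"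
proof -
  let ?T2 = "tensor K H H"
  \<comment> \<open>The flip of H \<otimes> H.\<close>
  let ?fl = "tlift K H H ?T2 (\<lambda>x y. tens K H H y x)"
  have flb: "(\<lambda>x y. tens K H H y x) \<in> bilin_map K H H ?T2"
    by (intro bilin_mapI lin; simp)
  have fl: "tlift K H H P f (?fl (comult H h)) = sw K H P (\<lambda>x y. f y x) h"
    if "module K P" "f \<in> bilin_map K H H P" "h \<in> carrier H" for P :: "('k, 'z, 'y) module_scheme" and f h
    using that lift_map[OF H_mod H_mod _ lin_lift[OF H_mod H_mod that(1,2)] flb, of "comult H h"]
    by (simp add: sw_def cong: tensor_lift_cong)
  have eb: "(\<lambda>a b. counit H b \<odot> a) \<in> bilin_map K H H H"
    by (intro bilin_mapI lin; simp)
  have c1: "tlift K H H H (\<lambda>a b. counit H b \<odot> a) (comult H h) = h" if "h \<in> carrier H" for h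
    using sw_counit_r[OF H_mod lin_id that] by (simp add: sw_def)
  have c2: "tlift K H H H (\<lambda>a b. counit H b \<odot> a) (?fl (comult H h)) = h" if "h \<in> carrier H" for h
    using sw_counit_l[OF H_mod lin_id that] fl[OF H_mod eb that] by simp
  obtain s where s: "s \<in> lin_map K H L" "\<And>h. h \<in> carrier H \<Longrightarrow>
      sw K H L (\<lambda>p q. s p \<otimes>\<^bsub>L\<^esub> tv q) h = counit H h \<odot>\<^bsub>L\<^esub> \<one>\<^bsub>L\<^esub>"
    using conv_inverse_exists[OF comult_lin c1] unfolding sw_def by blast
  obtain r where r: "r \<in> lin_map K H L" "\<And>h. h \<in> carrier H \<Longrightarrow>
      tlift K H H L (\<lambda>p q. r p \<otimes>\<^bsub>L\<^esub> tv q) (?fl (comult H h)) = counit H h \<odot>\<^bsub>L\<^esub> \<one>\<^bsub>L\<^esub>"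
    using conv_inverse_exists[OF lin_comp[OF lin_lift[OF H_mod H_mod _ flb] comult_lin] c2] by auto
  note [simp] = lin_mapD(1)[OF s(1)] lin_mapD(1)[OF r(1)]
  note ls = lin_comp[OF s(1)] lin_comp[OF r(1)]
  have rb: "(\<lambda>p q. r p \<otimes>\<^bsub>L\<^esub> tv q) \<in> bilin_map K H H L"
    by (intro bilin_mapI lin tv_lin r(1); simp)
  have r2: "sw K H L (\<lambda>x y. tv x \<otimes>\<^bsub>L\<^esub> r y) h = counit H h \<odot>\<^bsub>L\<^esub> \<one>\<^bsub>L\<^esub>" if h: "h \<in> carrier H" for h
  proof -
    have "sw K H L (\<lambda>x y. tv x \<otimes>\<^bsub>L\<^esub> r y) h = sw K H L (\<lambda>x y. r y \<otimes>\<^bsub>L\<^esub> tv x) h"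
      by (intro sw_cong) (simp add: LF.m_comm)
    also have "\<dots> = counit H h \<odot>\<^bsub>L\<^esub> \<one>\<^bsub>L\<^esub>" using fl[OF L_mod rb h] r(2)[OF h] by simp
    finally show ?thesis .
  qed
  have eq: "s h = r h" if h [simp]: "h \<in> carrier H" for h
  proof -
    have "r h = sw K H L (\<lambda>a b. counit H a \<odot>\<^bsub>L\<^esub> r b) h"
      by (rule sw_counit_l[symmetric]) (simp_all add: r(1))
    also have "\<dots> = sw K H L (\<lambda>a b. sw K H L (\<lambda>p q. s p \<otimes>\<^bsub>L\<^esub> tv q) a \<otimes>\<^bsub>L\<^esub> r b) h"
      by (intro sw_cong) (simp add: s(2) LA.smult_mult_left)
    also have "\<dots> = sw K H L (\<lambda>a b. sw K H L (\<lambda>p q. s p \<otimes>\<^bsub>L\<^esub> tv q \<otimes>\<^bsub>L\<^esub> r b) a) h"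
      by (intro sw_cong sw_map[OF L_mod lin_mult_l[OF L_alg lin_id]]; (intro bilin_mapI lin tv_lin s(1))?; simp)
    also have "\<dots> = sw K H L (\<lambda>a b. sw K H L (\<lambda>p q. s a \<otimes>\<^bsub>L\<^esub> tv p \<otimes>\<^bsub>L\<^esub> r q) b) h"
      by (rule sw_assoc[symmetric]; (intro bilin_mapI lin tv_lin s(1) r(1))?; simp)
    also have "\<dots> = sw K H L (\<lambda>a b. s a \<otimes>\<^bsub>L\<^esub> sw K H L (\<lambda>p q. tv p \<otimes>\<^bsub>L\<^esub> r q) b) h"
    proof (intro sw_cong)
      fix a b assume [simp]: "a \<in> carrier H" "b \<in> carrier H"
      have "s a \<otimes>\<^bsub>L\<^esub> sw K H L (\<lambda>p q. tv p \<otimes>\<^bsub>L\<^esub> r q) b = sw K H L (\<lambda>p q. s a \<otimes>\<^bsub>L\<^esub> (tv p \<otimes>\<^bsub>L\<^esub> r q)) b"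
        by (rule sw_map[OF L_mod lin_mult_r[OF L_alg lin_id]]; (intro bilin_mapI lin tv_lin r(1))?; simp)
      also have "\<dots> = sw K H L (\<lambda>p q. s a \<otimes>\<^bsub>L\<^esub> tv p \<otimes>\<^bsub>L\<^esub> r q) b"
        by (intro sw_cong) (simp add: LF.m_assoc)
      finally show "sw K H L (\<lambda>p q. s a \<otimes>\<^bsub>L\<^esub> tv p \<otimes>\<^bsub>L\<^esub> r q) b = s a \<otimes>\<^bsub>L\<^esub> sw K H L (\<lambda>p q. tv p \<otimes>\<^bsub>L\<^esub> r q) b" by simp
    qed
    also have "\<dots> = sw K H L (\<lambda>a b. counit H b \<odot>\<^bsub>L\<^esub> s a) h"
      by (intro sw_cong) (simp add: r2 LA.smult_mult_right)
    also have "\<dots> = s h"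
      by (rule sw_counit_r) (simp_all add: s(1))
    finally show ?thesis by simp
  qed
  have "sw K H L (\<lambda>x y. tv x \<otimes>\<^bsub>L\<^esub> s y) h = counit H h \<odot>\<^bsub>L\<^esub> \<one>\<^bsub>L\<^esub>" if "h \<in> carrier H" for h
    using r2[OF that] eq by (simp cong: sw_cong)
  then show ?thesis using s by (intro exI[of _ s]) auto
qed

lemma t_inv:
  shows ti_linL: "ti \<in> lin_map K H L"
    and tv_ti: "h \<in> carrier H \<Longrightarrow> sw K H L (\<lambda>x y. tv x \<otimes>\<^bsub>L\<^esub> ti y) h = counit H h \<odot>\<^bsub>L\<^esub> \<one>\<^bsub>L\<^esub>"
    and ti_tv: "h \<in> carrier H \<Longrightarrow> sw K H L (\<lambda>x y. ti x \<otimes>\<^bsub>L\<^esub> tv y) h = counit H h \<odot>\<^bsub>L\<^esub> \<one>\<^bsub>L\<^esub>"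
proof -
  let ?P = "\<lambda>s. s \<in> lin_map K H L \<and> (\<forall>h\<in>carrier H.
     sw K H L (\<lambda>x y. tv x \<otimes>\<^bsub>L\<^esub> s y) h = counit H h \<odot>\<^bsub>L\<^esub> \<one>\<^bsub>L\<^esub> \<and>
     sw K H L (\<lambda>x y. s x \<otimes>\<^bsub>L\<^esub> tv y) h = counit H h \<odot>\<^bsub>L\<^esub> \<one>\<^bsub>L\<^esub>)"
  have "?P ti" unfolding t_inv_def by (rule someI_ex[of ?P, OF t_inv_exists])
  then show "ti \<in> lin_map K H L" "h \<in> carrier H \<Longrightarrow> sw K H L (\<lambda>x y. tv x \<otimes>\<^bsub>L\<^esub> ti y) h = counit H h \<odot>\<^bsub>L\<^esub> \<one>\<^bsub>L\<^esub>"
    "h \<in> carrier H \<Longrightarrow> sw K H L (\<lambda>x y. ti x \<otimes>\<^bsub>L\<^esub> tv y) h = counit H h \<odot>\<^bsub>L\<^esub> \<one>\<^bsub>L\<^esub>" by blast+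
qed

abbreviation R1 where "R1 \<equiv> S_theta K H"

lemma gens_L: "tv ` carrier H \<union> ti ` carrier H \<subseteq> carrier L"
  using lin_mapD(1)[OF ti_linL] by auto

lemma R1_sub: "subalgebra K L (carrier R1)" "tv ` carrier H \<union> ti ` carrier H \<subseteq> carrier R1"
  using subalg_gen[OF L_alg gens_L] by (simp_all add: S_theta_def)

lemma R1_eq: "R1 = L\<lparr>carrier := carrier R1\<rparr>"
  by (simp add: S_theta_def)

lemma R1_ops: "ring.add R1 = ring.add L" "monoid.mult R1 = monoid.mult L" "smult R1 = smult L"
  "\<one>\<^bsub>R1\<^esub> = \<one>\<^bsub>L\<^esub>" "\<zero>\<^bsub>R1\<^esub> = \<zero>\<^bsub>L\<^esub>"
  by (simp_all add: S_theta_def)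

lemma R1_alg [simp]: "assoc_algebra K R1"
  by (subst R1_eq, rule subalgebra_alg[OF L_alg R1_sub(1)])

lemma R1_mod [simp]: "module K R1" by (rule assoc_algebra_module) simp

lemma R1_cring: "cring R1"
  by (subst R1_eq, rule subalgebra_cring[OF L_alg LF.is_cring R1_sub(1)])

lemma R1_incl: "(\<lambda>x. x) \<in> lin_map K R1 L"
  using alg_homD(1)[OF subalgebra_incl[OF L_alg R1_sub(1)]] R1_eq by simp

lemma tv_R1: "tv \<in> lin_map K H R1"
  using R1_sub(2) lin_mapD[OF tv_lin] by (intro lin_mapI) (auto simp: R1_ops)

lemma ti_R1: "ti \<in> lin_map K H R1"
  using R1_sub(2) lin_mapD[OF ti_linL] by (intro lin_mapI) (auto simp: R1_ops)

text \<open>The definition of \<sigma> forms its sums in K_H, while the twisted algebras live over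
  S(t_H)_\<Theta>. Sums whose terms lie in the subring have the same value in both.\<close>

lemma sw_R1: "f \<in> bilin_map K H H R1 \<Longrightarrow> h \<in> carrier H \<Longrightarrow> sw K H L f h = sw K H R1 f h"
  using sw_map[OF R1_mod R1_incl, of f h] by simp

lemma tv_ti_R1: "h \<in> carrier H \<Longrightarrow> sw K H R1 (\<lambda>x y. tv x \<otimes>\<^bsub>R1\<^esub> ti y) h = counit H h \<odot>\<^bsub>R1\<^esub> \<one>\<^bsub>R1\<^esub>"
  using tv_ti[of h] sw_R1[of "\<lambda>x y. tv x \<otimes>\<^bsub>R1\<^esub> ti y" h] bilin_mapI[OF lin_mult_r[OF R1_alg ti_R1] lin_mult_l[OF R1_alg tv_R1]]
    lin_mapD(1)[OF tv_R1] lin_mapD(1)[OF ti_R1] by (simp add: R1_ops)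

lemma ti_tv_R1: "h \<in> carrier H \<Longrightarrow> sw K H R1 (\<lambda>x y. ti x \<otimes>\<^bsub>R1\<^esub> tv y) h = counit H h \<odot>\<^bsub>R1\<^esub> \<one>\<^bsub>R1\<^esub>"
  using ti_tv[of h] sw_R1[of "\<lambda>x y. ti x \<otimes>\<^bsub>R1\<^esub> tv y" h] bilin_mapI[OF lin_mult_r[OF R1_alg tv_R1] lin_mult_l[OF R1_alg ti_R1]]
    lin_mapD(1)[OF tv_R1] lin_mapD(1)[OF ti_R1] by (simp add: R1_ops)

end

section \<open>The universal cocycle\<close>

locale hopf_cocycle = hopf_inf K H for K :: "'k ring" and H :: "('k, 'h) hopf" (structure) +
  fixes \<alpha> :: "'h \<Rightarrow> 'h \<Rightarrow> 'k"
  assumes cocyc: "two_cocycle K H (self_algebra K) \<alpha>"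
    and norm: "normalized_cocycle H (self_algebra K) \<alpha>"
    and cinv: "conv_invertible K H (self_algebra K) \<alpha>"
begin

abbreviation KA where "KA \<equiv> self_algebra K"
abbreviation "scal R c \<equiv> c \<odot>\<^bsub>R\<^esub> \<one>\<^bsub>R\<^esub>"
abbreviation "aR R \<equiv> (\<lambda>x y. scal R (\<alpha> x y))"

lemma \<alpha>_bilin: "\<alpha> \<in> bilin_map K H H KA"
  using cocyc by (simp add: two_cocycle_def)

lemma scal_lin: "assoc_algebra K R \<Longrightarrow> scal R \<in> lin_map K KA R"
  by (intro lin_smult_const lin_id assoc_algebra_module)
    (simp_all add: ring.ring_simprules(6)[OF assoc_algebra_ring])

lemma scal_mult:
  assumes "assoc_algebra K R" "a \<in> carrier K" "b \<in> carrier K"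
  shows "scal R a \<otimes>\<^bsub>R\<^esub> scal R b = scal R (a \<otimes>\<^bsub>K\<^esub> b)"
proof -
  interpret R: assoc_algebra K R by fact
  show ?thesis using assms by (simp add: R.smult_mult_left R.smult_assoc1)
qed

lemma scal_bilin:
  assumes R: "assoc_algebra K R" and \<beta>: "\<beta> \<in> bilin_map K H H KA"
  shows "(\<lambda>x y. scal R (\<beta> x y)) \<in> bilin_map K H H R"
  using bilin_mapD(1,2)[OF \<beta>] by (intro bilin_mapI lin_comp[OF scal_lin[OF R]])

lemma aR_cocycle:
  fixes R :: "('k, 'r) module"
  assumes R: "assoc_algebra K R" shows "two_cocycle K H R (aR R)"
  unfolding two_cocycle_def
proof (intro conjI ballI scal_bilin[OF R \<alpha>_bilin])
  fix x y z assume [simp]: "x \<in> carrier H" "y \<in> carrier H" "z \<in> carrier H"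
  note [simp] = bilin_mapD(3)[OF \<alpha>_bilin, simplified]
  note l = scal_lin[OF R]
  note b = lin_bilin[OF \<alpha>_bilin]
  note mm = lin_mult_l[OF K_alg, simplified] lin_mult_r[OF K_alg, simplified]
  have e1: "scal R (sw K H KA (\<lambda>x1 x2. sw K H KA (\<lambda>y1 y2. \<alpha> x1 y1 \<otimes>\<^bsub>K\<^esub> \<alpha> (x2 \<otimes> y2) z) y) x) =
    sw K H R (\<lambda>x1 x2. sw K H R (\<lambda>y1 y2. aR R x1 y1 \<otimes>\<^bsub>R\<^esub> aR R (x2 \<otimes> y2) z) y) x"
  proof -
    have "scal R (sw K H KA (\<lambda>x1 x2. sw K H KA (\<lambda>y1 y2. \<alpha> x1 y1 \<otimes>\<^bsub>K\<^esub> \<alpha> (x2 \<otimes> y2) z) y) x) =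
        sw K H R (\<lambda>x1 x2. scal R (sw K H KA (\<lambda>y1 y2. \<alpha> x1 y1 \<otimes>\<^bsub>K\<^esub> \<alpha> (x2 \<otimes> y2) z) y)) x"
      by (rule sw_map[OF K_mod l]; (intro bilin_mapI lin mm b)?; simp)
    also have "\<dots> = sw K H R (\<lambda>x1 x2. sw K H R (\<lambda>y1 y2. scal R (\<alpha> x1 y1 \<otimes>\<^bsub>K\<^esub> \<alpha> (x2 \<otimes> y2) z)) y) x"
      by (intro sw_cong sw_map[OF K_mod l]; (intro bilin_mapI lin mm b)?; simp)
    finally show ?thesis by (simp add: scal_mult[OF R] cong: sw_cong)
  qed
  have e2: "scal R (sw K H KA (\<lambda>y1 y2. sw K H KA (\<lambda>z1 z2. \<alpha> y1 z1 \<otimes>\<^bsub>K\<^esub> \<alpha> x (y2 \<otimes> z2)) z) y) =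
    sw K H R (\<lambda>y1 y2. sw K H R (\<lambda>z1 z2. aR R y1 z1 \<otimes>\<^bsub>R\<^esub> aR R x (y2 \<otimes> z2)) z) y"
  proof -
    have "scal R (sw K H KA (\<lambda>y1 y2. sw K H KA (\<lambda>z1 z2. \<alpha> y1 z1 \<otimes>\<^bsub>K\<^esub> \<alpha> x (y2 \<otimes> z2)) z) y) =
        sw K H R (\<lambda>y1 y2. scal R (sw K H KA (\<lambda>z1 z2. \<alpha> y1 z1 \<otimes>\<^bsub>K\<^esub> \<alpha> x (y2 \<otimes> z2)) z)) y"
      by (rule sw_map[OF K_mod l]; (intro bilin_mapI lin mm b)?; simp)
    also have "\<dots> = sw K H R (\<lambda>y1 y2. sw K H R (\<lambda>z1 z2. scal R (\<alpha> y1 z1 \<otimes>\<^bsub>K\<^esub> \<alpha> x (y2 \<otimes> z2))) z) y"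
      by (intro sw_cong sw_map[OF K_mod l]; (intro bilin_mapI lin mm b)?; simp)
    finally show ?thesis by (simp add: scal_mult[OF R] cong: sw_cong)
  qed
  have "sw K H KA (\<lambda>x1 x2. sw K H KA (\<lambda>y1 y2. \<alpha> x1 y1 \<otimes>\<^bsub>K\<^esub> \<alpha> (x2 \<otimes> y2) z) y) x =
    sw K H KA (\<lambda>y1 y2. sw K H KA (\<lambda>z1 z2. \<alpha> y1 z1 \<otimes>\<^bsub>K\<^esub> \<alpha> x (y2 \<otimes> z2)) z) y"
    using cocyc unfolding two_cocycle_def by simp
  then show "sw K H R (\<lambda>x1 x2. sw K H R (\<lambda>y1 y2. aR R x1 y1 \<otimes>\<^bsub>R\<^esub> aR R (x2 \<otimes> y2) z) y) x =
    sw K H R (\<lambda>y1 y2. sw K H R (\<lambda>z1 z2. aR R y1 z1 \<otimes>\<^bsub>R\<^esub> aR R x (y2 \<otimes> z2)) z) y"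
    using e1 e2 by simp
qed

lemma aR_normalized: "assoc_algebra K R \<Longrightarrow> normalized_cocycle H R (aR R)"
  using norm by (simp add: normalized_cocycle_def)

lemma aR_twisted:
  fixes R :: "('k, 'r) module"
  assumes "assoc_algebra K R" "cring R" shows "twisted K H R (aR R) \<one>\<^bsub>R\<^esub>"
  using assms scal_bilin[OF assms(1) \<alpha>_bilin] ring.ring_simprules(6)[OF assoc_algebra_ring[OF assms(1)]]
  by (intro twisted.intro hopf_axioms twisted_axioms.intro) simp_all

text \<open>Three base rings for the cocycle \<alpha>: S(t_H)_\<Theta>, where A and U are embedded;
  S(t_H), whose elements can be evaluated at functionals; and k, where the morphisms defining
  identities end.\<close>

sublocale Om: twisted K H R1 "aR R1" "\<one>\<^bsub>R1\<^esub>"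
  by (rule aR_twisted) (simp_all add: R1_cring)

sublocale Ss: twisted K H S "aR S" "\<one>\<^bsub>S\<^esub>"
  by (rule aR_twisted) (simp_all add: VH.SA_cring)

sublocale Ca: twisted K H KA \<alpha> "\<one>\<^bsub>K\<^esub>"
  using \<alpha>_bilin VH.KA_cring by (intro twisted.intro hopf_axioms twisted_axioms.intro) simp_all

lemma Om_comodule: "comodule_algebra K H Om.W"
  by (rule Om.W_comodule_algebra[OF aR_cocycle[OF R1_alg] aR_normalized[OF R1_alg] refl])

lemma Ss_comodule: "comodule_algebra K H Ss.W"
  by (rule Ss.W_comodule_algebra[OF aR_cocycle[OF S_alg] aR_normalized[OF S_alg] refl])

lemma Ca_comodule: "comodule_algebra K H Ca.W"
  by (rule Ca.W_comodule_algebra[OF cocyc norm]) simp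

abbreviation \<alpha>i where "\<alpha>i \<equiv> cocycle_inv K H \<alpha>"

lemma \<alpha>i: "conv_inverse K H KA \<alpha> \<alpha>i"
  unfolding cocycle_inv_def using cinv unfolding conv_invertible_def by (rule someI_ex)

lemma \<alpha>i_bilin: "\<alpha>i \<in> bilin_map K H H KA"
  using \<alpha>i by (simp add: conv_inverse_def)

abbreviation "aiR R \<equiv> (\<lambda>x y. scal R (\<alpha>i x y))"

lemma \<alpha>_one: "\<alpha> \<one> \<one> = \<one>\<^bsub>K\<^esub>"
  using norm by (simp add: normalized_cocycle_def)

lemma \<alpha>i_one: "\<alpha>i \<one> \<one> = \<one>\<^bsub>K\<^esub>"
proof -
  have "Ca.cv2 \<alpha> \<alpha>i \<one> \<one> = \<one>\<^bsub>K\<^esub>"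
    using \<alpha>i unfolding conv_inverse_def Ca.cv2_def by simp
  then show ?thesis
    using Ca.cv2_one[OF \<alpha>_bilin \<alpha>i_bilin] \<alpha>_one bilin_mapD(3)[OF \<alpha>i_bilin] by simp
qed

abbreviation \<sigma> where "\<sigma> \<equiv> sigma K H \<alpha>"
abbreviation \<sigma>i where "\<sigma>i \<equiv> sigma_inv K H \<alpha>"
abbreviation B2 where "B2 \<equiv> bilin_map K H H R1"

text \<open>Turns the nested sums of \<open>sigma\<close> and \<open>sigma_inv\<close>, in which all
  legs of x come before those of y, into iterated convolution over the subring. The sums are carried
  from K_H to the subring one layer at a time, from the inside out.\<close>

lemma sw3_cv2:
  assumes f: "f \<in> B2" and g: "g \<in> B2" and h: "h \<in> B2" and [simp]: "x \<in> carrier H" "y \<in> carrier H"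
    and e: "\<And>x1 x2 x3 y1 y2 y3. \<lbrakk>x1 \<in> carrier H; x2 \<in> carrier H; x3 \<in> carrier H; y1 \<in> carrier H; y2 \<in> carrier H; y3 \<in> carrier H\<rbrakk>
      \<Longrightarrow> G x1 x2 x3 y1 y2 y3 = f x1 y1 \<otimes>\<^bsub>R1\<^esub> (g x2 y2 \<otimes>\<^bsub>R1\<^esub> h x3 y3)"
  shows "sw3 K H L (\<lambda>x1 x2 x3. sw3 K H L (\<lambda>y1 y2 y3. G x1 x2 x3 y1 y2 y3) y) x = Om.cv2 f (Om.cv2 g h) x y"
proof -
  note [simp] = bilin_mapD(3)[OF f] bilin_mapD(3)[OF g] bilin_mapD(3)[OF h]
  note bl = lin_bilin[OF f] lin_bilin[OF g] lin_bilin[OF h]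
  let ?G = "\<lambda>x1 x2 x3 y1 y2 y3. f x1 y1 \<otimes>\<^bsub>R1\<^esub> (g x2 y2 \<otimes>\<^bsub>R1\<^esub> h x3 y3)"
  have "sw3 K H L (\<lambda>x1 x2 x3. sw3 K H L (\<lambda>y1 y2 y3. G x1 x2 x3 y1 y2 y3) y) x =
     sw K H L (\<lambda>x1 x'. sw K H L (\<lambda>x2 x3. sw K H L (\<lambda>y1 y'. sw K H L (\<lambda>y2 y3. ?G x1 x2 x3 y1 y2 y3) y') y) x') x"
    unfolding sw3_def by (intro sw_cong e)
  also have "\<dots> = sw K H L (\<lambda>x1 x'. sw K H L (\<lambda>x2 x3. sw K H L (\<lambda>y1 y'. sw K H R1 (\<lambda>y2 y3. ?G x1 x2 x3 y1 y2 y3) y') y) x') x"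
    by (intro sw_cong sw_R1; (intro bilin_mapI lin bl)?; simp)
  also have "\<dots> = sw K H L (\<lambda>x1 x'. sw K H L (\<lambda>x2 x3. sw K H R1 (\<lambda>y1 y'. sw K H R1 (\<lambda>y2 y3. ?G x1 x2 x3 y1 y2 y3) y') y) x') x"
    by (intro sw_cong sw_R1; (intro bilin_mapI lin bl)?; simp)
  also have "\<dots> = sw K H L (\<lambda>x1 x'. sw K H R1 (\<lambda>x2 x3. sw K H R1 (\<lambda>y1 y'. sw K H R1 (\<lambda>y2 y3. ?G x1 x2 x3 y1 y2 y3) y') y) x') x"
    by (intro sw_cong sw_R1; (intro bilin_mapI lin bl)?; simp)
  also have "\<dots> = sw K H R1 (\<lambda>x1 x'. sw K H R1 (\<lambda>x2 x3. sw K H R1 (\<lambda>y1 y'. sw K H R1 (\<lambda>y2 y3. ?G x1 x2 x3 y1 y2 y3) y') y) x') x"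
    by (intro sw_R1; (intro bilin_mapI lin bl)?; simp)
  also have "\<dots> = sw K H R1 (\<lambda>x1 x'. sw K H R1 (\<lambda>y1 y'. sw K H R1 (\<lambda>x2 x3. sw K H R1 (\<lambda>y2 y3. ?G x1 x2 x3 y1 y2 y3) y') x') y) x"
    by (intro sw_cong sw_swap; (intro bilin_mapI lin bl)?; simp)
  also have "\<dots> = Om.cv2 f (Om.cv2 g h) x y"
    unfolding Om.cv2_def[of f]
    by (intro sw_cong Om.cv2_map[symmetric, OF R1_mod lin_mult_r[OF R1_alg lin_id] g h]) simp_all
  finally show ?thesis .
qed

lemma tvR [simp]: "h \<in> carrier H \<Longrightarrow> tv h \<in> carrier R1"
  and tiR [simp]: "h \<in> carrier H \<Longrightarrow> ti h \<in> carrier R1"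
  using lin_mapD(1)[OF tv_R1] lin_mapD(1)[OF ti_R1] by blast+

lemma sigma_cv2:
  assumes "x \<in> carrier H" "y \<in> carrier H"
  shows "\<sigma> x y = Om.cv2 (Om.ll tv) (Om.cv2 (aR R1) (Om.lm ti)) x y"
  unfolding sigma_def Let_def
proof (rule sw3_cv2[OF Om.ll_bilin[OF tv_R1] scal_bilin[OF R1_alg \<alpha>_bilin] Om.lm_bilin[OF ti_R1] assms])
  fix x1 x2 x3 y1 y2 y3
  assume "x1 \<in> carrier H" "x2 \<in> carrier H" "x3 \<in> carrier H" "y1 \<in> carrier H" "y2 \<in> carrier H" "y3 \<in> carrier H"
  then have "\<alpha> x2 y2 \<odot>\<^bsub>R1\<^esub> (tv x1 \<otimes>\<^bsub>R1\<^esub> tv y1 \<otimes>\<^bsub>R1\<^esub> ti (x3 \<otimes> y3)) =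
      Om.ll tv x1 y1 \<otimes>\<^bsub>R1\<^esub> (scal R1 (\<alpha> x2 y2) \<otimes>\<^bsub>R1\<^esub> Om.lm ti x3 y3)"
    using bilin_mapD(3)[OF \<alpha>_bilin] by (simp add: Om.ll_def[OF tv_R1] Om.lm_def[OF ti_R1] Om.R.smult_mult_left Om.R.smult_mult_right)
  then show "\<alpha> x2 y2 \<odot>\<^bsub>L\<^esub> (tv x1 \<otimes>\<^bsub>L\<^esub> tv y1 \<otimes>\<^bsub>L\<^esub> ti (x3 \<otimes> y3)) =
      Om.ll tv x1 y1 \<otimes>\<^bsub>R1\<^esub> (scal R1 (\<alpha> x2 y2) \<otimes>\<^bsub>R1\<^esub> Om.lm ti x3 y3)" by (simp add: R1_ops)
qed

lemma sigma_inv_cv2: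
  assumes "x \<in> carrier H" "y \<in> carrier H"
  shows "\<sigma>i x y = Om.cv2 (Om.lm tv) (Om.cv2 (aiR R1) (Om.ll ti)) x y"
  unfolding sigma_inv_def Let_def
proof (rule sw3_cv2[OF Om.lm_bilin[OF tv_R1] scal_bilin[OF R1_alg \<alpha>i_bilin] Om.ll_bilin[OF ti_R1] assms])
  fix x1 x2 x3 y1 y2 y3
  assume "x1 \<in> carrier H" "x2 \<in> carrier H" "x3 \<in> carrier H" "y1 \<in> carrier H" "y2 \<in> carrier H" "y3 \<in> carrier H"
  then have "\<alpha>i x2 y2 \<odot>\<^bsub>R1\<^esub> (tv (x1 \<otimes> y1) \<otimes>\<^bsub>R1\<^esub> ti x3 \<otimes>\<^bsub>R1\<^esub> ti y3) =
      Om.lm tv x1 y1 \<otimes>\<^bsub>R1\<^esub> (scal R1 (\<alpha>i x2 y2) \<otimes>\<^bsub>R1\<^esub> Om.ll ti x3 y3)"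
    using bilin_mapD(3)[OF \<alpha>i_bilin]
    by (simp add: Om.ll_def[OF ti_R1] Om.lm_def[OF tv_R1] Om.R.smult_mult_left Om.R.smult_mult_right Om.R.A.m_assoc)
  then show "\<alpha>i x2 y2 \<odot>\<^bsub>L\<^esub> (tv (x1 \<otimes> y1) \<otimes>\<^bsub>L\<^esub> ti x3 \<otimes>\<^bsub>L\<^esub> ti y3) =
      Om.lm tv x1 y1 \<otimes>\<^bsub>R1\<^esub> (scal R1 (\<alpha>i x2 y2) \<otimes>\<^bsub>R1\<^esub> Om.ll ti x3 y3)" by (simp add: R1_ops)
qed

lemma bilin_cong:
  assumes "f \<in> bilin_map K H H P" "\<And>x y. x \<in> carrier H \<Longrightarrow> y \<in> carrier H \<Longrightarrow> g x y = f x y"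
  shows "g \<in> bilin_map K H H P"
proof (intro bilin_mapI lin_mapI)
qed (simp_all add: assms(2) bilin_mapD(3)[OF assms(1)] lin_mapD[OF bilin_mapD(1)[OF assms(1)]] lin_mapD[OF bilin_mapD(2)[OF assms(1)]])

lemma sigma_bilin: "\<sigma> \<in> B2"
  by (rule bilin_cong[OF _ sigma_cv2]) (intro Om.cv2_bilin Om.ll_bilin Om.lm_bilin tv_R1 ti_R1 scal_bilin R1_alg \<alpha>_bilin)

lemma sigma_inv_bilin: "\<sigma>i \<in> B2"
  by (rule bilin_cong[OF _ sigma_inv_cv2]) (intro Om.cv2_bilin Om.ll_bilin Om.lm_bilin tv_R1 ti_R1 scal_bilin R1_alg \<alpha>i_bilin)

text \<open>\<sigma> ends with the factor t^{-1}(xy), which cancels against the t(xy) multiplied on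
  the right: the convolution product of these two is \<epsilon> \<otimes> \<epsilon>, because
  \<Delta> is multiplicative. What remains is t(x) t(y) convolved with \<alpha>.\<close>

lemma sigma_tv:
  assumes xy: "x \<in> carrier H" "y \<in> carrier H"
  shows "Om.cv2 \<sigma> (Om.lm tv) x y = Om.cv2 (Om.ll tv) (aR R1) x y"
proof -
  note b = Om.ll_bilin[OF tv_R1] scal_bilin[OF R1_alg \<alpha>_bilin] Om.lm_bilin[OF ti_R1] Om.lm_bilin[OF tv_R1]
  have e: "Om.cv2 (Om.lm ti) (Om.lm tv) x y = (counit H x \<otimes>\<^bsub>K\<^esub> counit H y) \<odot>\<^bsub>R1\<^esub> \<one>\<^bsub>R1\<^esub>"
    if "x \<in> carrier H" "y \<in> carrier H" for x y
  proof -
    have "Om.cv2 (Om.lm ti) (Om.lm tv) x y = sw K H R1 (\<lambda>a b. ti a \<otimes>\<^bsub>R1\<^esub> tv b) (x \<otimes> y)"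
      unfolding Om.cv2_def Om.lm_def[OF ti_R1] Om.lm_def[OF tv_R1]
      by (rule sw_mult[symmetric]; (intro bilin_mapI lin tv_R1 ti_R1)?; simp add: that)
    then show ?thesis using that by (simp add: ti_tv_R1)
  qed
  have "Om.cv2 \<sigma> (Om.lm tv) x y = Om.cv2 (Om.cv2 (Om.ll tv) (Om.cv2 (aR R1) (Om.lm ti))) (Om.lm tv) x y"
    by (intro Om.cv2_cong sigma_cv2 refl)
  also have "\<dots> = Om.cv2 (Om.ll tv) (Om.cv2 (Om.cv2 (aR R1) (Om.lm ti)) (Om.lm tv)) x y"
    by (intro Om.cv2_assoc b Om.cv2_bilin xy)
  also have "\<dots> = Om.cv2 (Om.ll tv) (Om.cv2 (aR R1) (Om.cv2 (Om.lm ti) (Om.lm tv))) x y"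
    by (intro Om.cv2_cong Om.cv2_assoc b refl)
  also have "\<dots> = Om.cv2 (Om.ll tv) (Om.cv2 (aR R1) (\<lambda>x y. (counit H x \<otimes>\<^bsub>K\<^esub> counit H y) \<odot>\<^bsub>R1\<^esub> \<one>\<^bsub>R1\<^esub>)) x y"
    by (intro Om.cv2_cong e refl)
  also have "\<dots> = Om.cv2 (Om.ll tv) (aR R1) x y"
    by (intro Om.cv2_cong Om.cv2_unit b refl)
  finally show ?thesis .
qed

abbreviation tau where "tau \<equiv> Om.tau tv"

text \<open>By \<open>tau_mult\<close> and \<open>act_tau_mult\<close> both sides have the same
  normal form, and \<open>sigma_tv\<close> equates their coefficients.\<close>

lemma tau_mult_sigma:
  assumes "x \<in> carrier H" "y \<in> carrier H"
  shows "tau x \<otimes>\<^bsub>Om.W\<^esub> tau y =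
    sw K H Om.T (\<lambda>x1 x2. sw K H Om.T (\<lambda>y1 y2. act R1 (\<sigma> x1 y1) (tau (x2 \<otimes> y2))) y) x"
  unfolding Om.tau_mult[OF tv_R1 assms] Om.act_tau_mult[OF tv_R1 sigma_bilin assms]
  by (intro sw_cong) (simp add: sigma_tv)

end

context twisted
begin

lemma act_tau:
  assumes l: "l \<in> lin_map K H R" and [simp]: "b \<in> carrier R" "h \<in> carrier H"
  shows "act R b (tau l h) = tau (\<lambda>h. b \<cdot> l h) h"
  using Theta_pure[OF l assms(2,3)] Theta_tens[OF l assms(2,3)] by (simp add: tau_def)

lemma coact_act_tau:
  assumes l: "l \<in> lin_map K H R" and [simp]: "b \<in> carrier R" "h \<in> carrier H"
  shows "coact W (act R b (tau l h)) = sw K H TH (\<lambda>h1 h2. tens K T H (act R b (tau l h1)) h2) h"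
  unfolding act_tau[OF assms]
  by (subst coact_tau[OF lin_mult_r[OF R_alg l]]) (auto intro!: sw_cong simp: act_tau[OF l])

end

section \<open>The algebras B and A, and the embedding of A into S(t_H)_\<Theta> \<otimes>^\<alpha>
  H\<close>

context hopf_cocycle
begin

abbreviation B where "B \<equiv> B_alg K H \<alpha>"

abbreviation "B_gens \<equiv> {\<sigma> x y | x y. x \<in> carrier H \<and> y \<in> carrier H} \<union> {\<sigma>i x y | x y. x \<in> carrier H \<and> y \<in> carrier H}"

lemma B_gens_R1: "B_gens \<subseteq> carrier R1"
  using bilin_mapD(3)[OF sigma_bilin] bilin_mapD(3)[OF sigma_inv_bilin] by auto

lemma R1_L: "carrier R1 \<subseteq> carrier L"
  using subalgebraD(2)[OF R1_sub(1)] .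

lemma B_sub: "subalgebra K L (carrier B)" and B_gens: "B_gens \<subseteq> carrier B"
  using subalg_gen[OF L_alg order_trans[OF B_gens_R1 R1_L]] by (simp_all add: B_alg_def)

lemma B_R1: "carrier B \<subseteq> carrier R1"
  using subalg_gen_minimal[OF L_alg R1_sub(1) B_gens_R1] by (simp add: B_alg_def)

lemma B_eq: "B = L\<lparr>carrier := carrier B\<rparr>"
  by (simp add: B_alg_def)

lemma B_L_ops: "ring.add B = ring.add L" "monoid.mult B = monoid.mult L" "smult B = smult L"
  "\<one>\<^bsub>B\<^esub> = \<one>\<^bsub>L\<^esub>" "\<zero>\<^bsub>B\<^esub> = \<zero>\<^bsub>L\<^esub>"
  by (simp_all add: B_alg_def)

lemma B_ops: "ring.add B = ring.add R1" "monoid.mult B = monoid.mult R1" "smult B = smult R1"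
  "\<one>\<^bsub>B\<^esub> = \<one>\<^bsub>R1\<^esub>" "\<zero>\<^bsub>B\<^esub> = \<zero>\<^bsub>R1\<^esub>"
  by (simp_all add: B_L_ops R1_ops)

lemma B_in_R1 [simp]: "b \<in> carrier B \<Longrightarrow> b \<in> carrier R1"
  using B_R1 by blast

lemma B_alg' [simp]: "assoc_algebra K B"
  by (subst B_eq, rule subalgebra_alg[OF L_alg B_sub])

lemma B_mod [simp]: "module K B" by (rule assoc_algebra_module) simp

lemma B_cring: "cring B"
  by (subst B_eq, rule subalgebra_cring[OF L_alg LF.is_cring B_sub])

lemma B_incl: "(\<lambda>x. x) \<in> lin_map K B R1"
  by (intro lin_mapI) (simp_all add: B_ops)

lemma sigma_in_B: "x \<in> carrier H \<Longrightarrow> y \<in> carrier H \<Longrightarrow> \<sigma> x y \<in> carrier B"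
  by (rule subsetD[OF B_gens], rule UnI1, rule CollectI, rule exI[of _ x], rule exI[of _ y]) simp

lemma sigma_inv_in_B: "x \<in> carrier H \<Longrightarrow> y \<in> carrier H \<Longrightarrow> \<sigma>i x y \<in> carrier B"
  by (rule subsetD[OF B_gens], rule UnI2, rule CollectI, rule exI[of _ x], rule exI[of _ y]) simp

lemma sigma_B: "\<sigma> \<in> bilin_map K H H B"
proof (intro bilin_mapI lin_mapI)
  note l = lin_mapD(2,3)[OF bilin_mapD(1)[OF sigma_bilin]] lin_mapD(2,3)[OF bilin_mapD(2)[OF sigma_bilin]]
  show "\<sigma> x (y \<oplus> z) = \<sigma> x y \<oplus>\<^bsub>B\<^esub> \<sigma> x z" "\<sigma> (y \<oplus> z) x = \<sigma> y x \<oplus>\<^bsub>B\<^esub> \<sigma> z x"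
    if "x \<in> carrier H" "y \<in> carrier H" "z \<in> carrier H" for x y z
    unfolding B_ops by ((rule l; rule that)+)
  show "\<sigma> x (c \<odot> y) = c \<odot>\<^bsub>B\<^esub> \<sigma> x y" "\<sigma> (c \<odot> y) x = c \<odot>\<^bsub>B\<^esub> \<sigma> y x"
    if "x \<in> carrier H" "c \<in> carrier K" "y \<in> carrier H" for c x y
    unfolding B_ops by ((rule l; rule that)+)
qed (rule sigma_in_B; assumption)+

lemma tv_ti_one: "tv \<one> \<otimes>\<^bsub>R1\<^esub> ti \<one> = \<one>\<^bsub>R1\<^esub>"
proof -
  have "sw K H R1 (\<lambda>x y. tv x \<otimes>\<^bsub>R1\<^esub> ti y) \<one> = tv \<one> \<otimes>\<^bsub>R1\<^esub> ti \<one>"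
    by (rule sw_one; (intro bilin_mapI lin tv_R1 ti_R1)?; simp)
  then show ?thesis using tv_ti_R1[of "\<one>"] alg_homD(4)[OF counit_hom] by simp
qed

lemma ti_tv_one: "ti \<one> \<otimes>\<^bsub>R1\<^esub> tv \<one> = \<one>\<^bsub>R1\<^esub>"
  using tv_ti_one by (simp add: Om.RC.m_comm)

lemma sigma_one: "\<sigma> \<one> \<one> = tv \<one>"
proof -
  note b = Om.ll_bilin[OF tv_R1] scal_bilin[OF R1_alg \<alpha>_bilin] Om.lm_bilin[OF ti_R1]
  have "\<sigma> \<one> \<one> = tv \<one> \<otimes>\<^bsub>R1\<^esub> tv \<one> \<otimes>\<^bsub>R1\<^esub> ti \<one>"
    using Om.cv2_one[OF b(1) Om.cv2_bilin[OF b(2,3)]] Om.cv2_one[OF b(2,3)]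
    by (simp add: sigma_cv2 \<alpha>_one Om.ll_def[OF tv_R1] Om.lm_def[OF ti_R1])
  then show ?thesis by (simp add: Om.R.A.m_assoc tv_ti_one)
qed

lemma sigma_inv_one: "\<sigma>i \<one> \<one> = ti \<one>"
proof -
  note b = Om.lm_bilin[OF tv_R1] scal_bilin[OF R1_alg \<alpha>i_bilin] Om.ll_bilin[OF ti_R1]
  have "\<sigma>i \<one> \<one> = tv \<one> \<otimes>\<^bsub>R1\<^esub> (ti \<one> \<otimes>\<^bsub>R1\<^esub> ti \<one>)"
    using Om.cv2_one[OF b(1) Om.cv2_bilin[OF b(2,3)]] Om.cv2_one[OF b(2,3)]
    by (simp add: sigma_inv_cv2 \<alpha>i_one Om.ll_def[OF ti_R1] Om.lm_def[OF tv_R1])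
  then show ?thesis by (simp add: Om.R.A.m_assoc[symmetric] tv_ti_one)
qed

text \<open>Both are values at (1, 1), of \<sigma> and of its convolution inverse, because \<alpha>
  is normalized. This puts the unit t^{-1}_1 \<otimes> 1 into A, and in \<open>zc_exists\<close> it
  allows division by t^{-1}_1 inside B.\<close>

lemma tv1_B [simp]: "tv \<one> \<in> carrier B" and ti1_B [simp]: "ti \<one> \<in> carrier B"
proof -
  show "tv \<one> \<in> carrier B" "ti \<one> \<in> carrier B"
    using sigma_in_B[of "\<one>" "\<one>"] sigma_inv_in_B[of "\<one>" "\<one>"] by (simp_all add: sigma_one sigma_inv_one)
qed

sublocale Aa: twisted K H B \<sigma> "ti \<one>"
  by (intro twisted.intro hopf_axioms twisted_axioms.intro B_cring sigma_B) simp_all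

lemma A_eq: "A_alg K H \<alpha> = Aa.W"
  by (simp add: A_alg_def)

lemma A_incl_eq: "A_incl K H \<alpha> = tmap K B H R1 (\<lambda>x. x)"
  by (simp add: A_incl_def)

lemma A_incl_lin: "A_incl K H \<alpha> \<in> lin_map K Aa.T Om.T"
  unfolding A_incl_eq by (rule lin_tmap[OF B_mod R1_mod H_mod B_incl])

lemma A_incl_pure: "b \<in> carrier B \<Longrightarrow> h \<in> carrier H \<Longrightarrow> A_incl K H \<alpha> (tens K B H b h) = tens K R1 H b h"
  unfolding A_incl_eq by (rule lift_tens[OF B_mod H_mod _ bilin_tmap[OF B_mod R1_mod H_mod B_incl]]) simp_all

lemma A_incl_inj: "inj_on (A_incl K H \<alpha>) (carrier Aa.T)"
  unfolding A_incl_eq by (rule tmap_inj[OF K H_mod B_mod R1_mod B_incl]) simp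

lemma A_incl_act:
  assumes "b \<in> carrier B" "t \<in> carrier Aa.T"
  shows "A_incl K H \<alpha> (act B b t) = act R1 b (A_incl K H \<alpha> t)"
  by (rule lin_eq_tensor[OF B_mod H_mod lin_comp[OF A_incl_lin act_lin[OF B_alg' assms(1)]]
        lin_comp[OF act_lin[OF R1_alg] A_incl_lin] _ assms(2)])
    (use assms(1) in \<open>simp_all add: act_pure A_incl_pure B_ops[symmetric]\<close>)

text \<open>The restriction of \<phi> to A, that is b \<otimes> h \<mapsto> b \<tau>(h).\<close>

definition psi where "psi a = Om.Theta tv (A_incl K H \<alpha> a)"

lemma psi_lin: "psi \<in> lin_map K Aa.T Om.T"
  unfolding psi_def[abs_def] by (rule lin_comp[OF Om.Theta_lin[OF tv_R1] A_incl_lin])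

lemma psi_closed [simp]: "a \<in> carrier Aa.T \<Longrightarrow> psi a \<in> carrier Om.T"
  by (rule lin_mapD(1)[OF psi_lin])

lemma psi_pure: "b \<in> carrier B \<Longrightarrow> h \<in> carrier H \<Longrightarrow> psi (tens K B H b h) = act R1 b (tau h)"
  by (simp add: psi_def A_incl_pure Om.Theta_pure[OF tv_R1])

lemma psi_act: "b \<in> carrier B \<Longrightarrow> t \<in> carrier Aa.T \<Longrightarrow> psi (act B b t) = act R1 b (psi t)"
  by (simp add: psi_def A_incl_act Om.Theta_act[OF tv_R1] lin_mapD(1)[OF A_incl_lin])

lemma Theta_ti_tv: "t \<in> carrier Om.T \<Longrightarrow> Om.Theta ti (Om.Theta tv t) = t"
  by (rule Om.Theta_inverse[OF tv_R1 ti_R1 tv_ti_R1])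

lemma Theta_tv_ti: "t \<in> carrier Om.T \<Longrightarrow> Om.Theta tv (Om.Theta ti t) = t"
  by (rule Om.Theta_inverse[OF ti_R1 tv_R1 ti_tv_R1])

text \<open>\<open>phi_inv\<close> is \<open>Theta\<close> for t^{-1} and undoes
  \<open>Theta\<close> for t, so only the inclusion of A is left. This links the chosen formula for
  \<open>mu_sigma\<close> with \<open>psi\<close>.\<close>

lemma phi_inv_psi: "a \<in> carrier Aa.T \<Longrightarrow> phi_inv K H (psi a) = A_incl K H \<alpha> a"
proof -
  have "phi_inv K H = Om.Theta ti" by (simp add: phi_inv_def Let_def Om.Theta_def[OF ti_R1])
  then show "a \<in> carrier Aa.T \<Longrightarrow> phi_inv K H (psi a) = A_incl K H \<alpha> a"
    by (simp add: psi_def Theta_ti_tv lin_mapD(1)[OF A_incl_lin])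
qed

lemma psi_inj: "inj_on psi (carrier Aa.T)"
proof (rule inj_onI)
  fix a a' assume "a \<in> carrier Aa.T" "a' \<in> carrier Aa.T" "psi a = psi a'"
  then show "a = a'" using phi_inv_psi[of a] phi_inv_psi[of a'] inj_onD[OF A_incl_inj] by simp
qed

lemma psi_one: "psi \<one>\<^bsub>Aa.W\<^esub> = \<one>\<^bsub>Om.W\<^esub>"
proof -
  have "tau \<one> = tens K R1 H (tv \<one>) \<one>"
    unfolding Om.tau_def by (rule sw_one; (intro bilin_mapI lin tv_R1)?; simp)
  then show ?thesis by (simp add: psi_pure act_pure ti_tv_one)
qed

lemma lin_act_R1:
  "f \<in> lin_map K Q R1 \<Longrightarrow> t \<in> carrier Om.T \<Longrightarrow> (\<lambda>q. act R1 (f q) t) \<in> lin_map K Q Om.T"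
  "g \<in> lin_map K Q Om.T \<Longrightarrow> b \<in> carrier R1 \<Longrightarrow> (\<lambda>q. act R1 b (g q)) \<in> lin_map K Q Om.T"
  using lin_comp[OF act_lin_l[OF R1_alg]] lin_comp[OF act_lin[OF R1_alg]] by blast+

text \<open>On pure tensors the coefficients from B are taken out of the sums, and the rest is
  \<open>tau_mult_sigma\<close>.\<close>

lemma psi_mult:
  assumes s: "s \<in> carrier Aa.T" and t: "t \<in> carrier Aa.T"
  shows "psi (s \<otimes>\<^bsub>Aa.W\<^esub> t) = psi s \<otimes>\<^bsub>Om.W\<^esub> psi t"
proof (rule lin_eq_tensor[OF B_mod H_mod _ _ _ s])
  show "(\<lambda>s. psi (s \<otimes>\<^bsub>Aa.W\<^esub> t)) \<in> lin_map K Aa.T Om.T"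
    by (intro lin_comp[OF psi_lin] Aa.lin_W_mult lin_id t)
  show "(\<lambda>s. psi s \<otimes>\<^bsub>Om.W\<^esub> psi t) \<in> lin_map K Aa.T Om.T"
    by (intro Om.lin_W_mult psi_lin psi_closed t)
  fix b x assume bx [simp]: "b \<in> carrier B" "x \<in> carrier H"
  show "psi (tens K B H b x \<otimes>\<^bsub>Aa.W\<^esub> t) = psi (tens K B H b x) \<otimes>\<^bsub>Om.W\<^esub> psi t"
  proof (rule lin_eq_tensor[OF B_mod H_mod _ _ _ t])
    show "(\<lambda>t. psi (tens K B H b x \<otimes>\<^bsub>Aa.W\<^esub> t)) \<in> lin_map K Aa.T Om.T"
      by (intro lin_comp[OF psi_lin] Aa.lin_W_mult lin_id) simp
    show "(\<lambda>t. psi (tens K B H b x) \<otimes>\<^bsub>Om.W\<^esub> psi t) \<in> lin_map K Aa.T Om.T"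
      by (intro Om.lin_W_mult psi_lin psi_closed) simp
    fix c y assume cy [simp]: "c \<in> carrier B" "y \<in> carrier H"
    note [simp] = bilin_mapD(3)[OF sigma_bilin] Om.tau_closed[OF tv_R1]
    note bl = lin_bilin[OF sigma_bilin] lin_act_R1 Om.lin_tau[OF tv_R1]
    let ?S = "sw K H Om.T"
    have bc [simp]: "b \<otimes>\<^bsub>R1\<^esub> c \<in> carrier R1" by simp
    have "psi (tens K B H b x \<otimes>\<^bsub>Aa.W\<^esub> tens K B H c y) = psi (Aa.mul b x c y)"
      by (simp add: Aa.mult_pure)
    also have "\<dots> = ?S (\<lambda>x1 x2. ?S (\<lambda>y1 y2. psi (tens K B H (b \<otimes>\<^bsub>B\<^esub> c \<otimes>\<^bsub>B\<^esub> \<sigma> x1 y1) (x2 \<otimes> y2))) y) x"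
      by (rule Aa.mul_map[OF _ psi_lin]) simp_all
    also have "\<dots> = ?S (\<lambda>x1 x2. ?S (\<lambda>y1 y2. act R1 (b \<otimes>\<^bsub>R1\<^esub> c) (act R1 (\<sigma> x1 y1) (tau (x2 \<otimes> y2)))) y) x"
      using Aa.\<gamma>_closed by (intro sw_cong) (simp add: psi_pure act_mult B_ops(2)[symmetric])
    also have "\<dots> = ?S (\<lambda>x1 x2. act R1 (b \<otimes>\<^bsub>R1\<^esub> c) (?S (\<lambda>y1 y2. act R1 (\<sigma> x1 y1) (tau (x2 \<otimes> y2))) y)) x"
      by (intro sw_cong sw_map[symmetric, OF _ act_lin[OF R1_alg bc]]; (intro bilin_mapI lin bl)?; simp)
    also have "\<dots> = act R1 (b \<otimes>\<^bsub>R1\<^esub> c) (?S (\<lambda>x1 x2. ?S (\<lambda>y1 y2. act R1 (\<sigma> x1 y1) (tau (x2 \<otimes> y2))) y) x)"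
      by (rule sw_map[symmetric, OF _ act_lin[OF R1_alg bc]]; (intro bilin_mapI lin bl)?; simp)
    also have "\<dots> = act R1 (b \<otimes>\<^bsub>R1\<^esub> c) (tau x \<otimes>\<^bsub>Om.W\<^esub> tau y)"
      by (simp add: tau_mult_sigma)
    also have "\<dots> = act R1 b (tau x) \<otimes>\<^bsub>Om.W\<^esub> act R1 c (tau y)"
      using Om.mult_closed lin_mapD(1)[OF act_lin[OF R1_alg]] by (simp add: Om.act_mult_W act_mult Om.RC.m_comm)
    finally show "psi (tens K B H b x \<otimes>\<^bsub>Aa.W\<^esub> tens K B H c y) = psi (tens K B H b x) \<otimes>\<^bsub>Om.W\<^esub> psi (tens K B H c y)"
      by (simp add: psi_pure)
  qed
qed

lemma psi_coact:
  assumes a: "a \<in> carrier Aa.T"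
  shows "tmap K Aa.T H Om.T psi (coact Aa.W a) = coact Om.W (psi a)"
proof (rule lin_eq_tensor[OF B_mod H_mod _ _ _ a])
  have m: "module K Aa.T" "module K Om.T" by simp_all
  let ?F = "tmap K Aa.T H Om.T psi"
  have F: "?F \<in> lin_map K Aa.TH Om.TH" by (rule lin_tmap[OF m H_mod psi_lin])
  show "(\<lambda>a. ?F (coact Aa.W a)) \<in> lin_map K Aa.T Om.TH"
    by (intro lin_comp[OF F] Aa.coact_lin)
  show "(\<lambda>a. coact Om.W (psi a)) \<in> lin_map K Aa.T Om.TH"
    by (intro Om.lin_coact psi_lin)
  fix b h assume bh [simp]: "b \<in> carrier B" "h \<in> carrier H"
  have "?F (coact Aa.W (tens K B H b h)) = sw K H Om.TH (\<lambda>h1 h2. ?F (tens K Aa.T H (tens K B H b h1) h2)) h"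
    using Aa.dpure_map[OF _ F bh] by (simp add: Aa.coact_pure)
  also have "\<dots> = sw K H Om.TH (\<lambda>h1 h2. tens K Om.T H (act R1 b (tau h1)) h2) h"
    using lift_tens[OF m(1) H_mod _ bilin_tmap[OF m H_mod psi_lin]]
    by (intro sw_cong) (simp add: psi_pure)
  also have "\<dots> = coact Om.W (psi (tens K B H b h))"
    by (simp add: psi_pure Om.coact_act_tau[OF tv_R1])
  finally show "?F (coact Aa.W (tens K B H b h)) = coact Om.W (psi (tens K B H b h))" .
qed

lemma A_comodule: "comodule_algebra K H Aa.W"
proof (rule comodule_algebra_transport[OF Om_comodule Aa.W_mod, of psi])
  show "tmap K Aa.W H Om.W psi (coact Aa.W x) = coact Om.W (psi x)"
    if "x \<in> carrier Aa.W" for x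
    using psi_coact[of x] that by (simp add: Aa.tensor_lift_W Om.tensor_lift_W_group)
  show "coact Aa.W \<in> lin_map K Aa.W (tensor K Aa.W H)"
    using Aa.coact_lin by (simp add: lin_map_def)
qed (simp_all add: psi_lin psi_inj psi_mult psi_one[simplified] Aa.mult_closed)

end

section \<open>Identities\<close>

lemma alg_hom_cong:
  assumes "carrier A = carrier A'" "ring.add A = ring.add A'" "monoid.mult A = monoid.mult A'"
    "\<one>\<^bsub>A\<^esub> = \<one>\<^bsub>A'\<^esub>" "smult A = smult A'"
  shows "alg_hom R A C = alg_hom R A' C"
  using assms by (simp add: alg_hom_def ring_hom_def lin_map_def)

text \<open>Base change along a morphism of coefficient rings that matches the cocycles. It is
  applied to the inclusion of S(t_H) into S(t_H)_\<Theta> and to the evaluations S(t_H)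
  \<rightarrow> k.\<close>

lemma twisted_map:
  fixes R :: "('k, 'r) module" and R' :: "('k, 's) module"
  assumes tw: "twisted K H R \<gamma> u" and tw': "twisted K H R' \<gamma>' u'"
    and f: "f \<in> alg_hom K R R'" and fg: "\<forall>x\<in>carrier H. \<forall>y\<in>carrier H. f (\<gamma> x y) = \<gamma>' x y"
    and fu: "f u = u'"
  defines "F \<equiv> tmap K R H R' f"
  shows twisted_map_hom: "F \<in> alg_hom K (twisted_algebra K H R \<gamma> u) (twisted_algebra K H R' \<gamma>' u')"
    and twisted_map_tau: "l \<in> lin_map K H R \<Longrightarrow> h \<in> carrier H \<Longrightarrow> F (twisted.tau K H R l h) = twisted.tau K H R' (\<lambda>h. f (l h)) h"
proof -
  interpret A: twisted K H R \<gamma> u by (rule tw)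
  interpret B: twisted K H R' \<gamma>' u' by (rule tw')
  note fD = alg_homD[OF f]
  note [simp] = fD(2)
  have F: "F \<in> lin_map K A.T B.T" unfolding F_def by (rule lin_tmap[OF A.R_mod B.R_mod A.H_mod fD(1)])
  have Fc: "F t \<in> carrier B.T" if "t \<in> carrier A.T" for t using lin_mapD(1)[OF F that] .
  have Fp: "F (tens K R H b h) = tens K R' H (f b) h" if "b \<in> carrier R" "h \<in> carrier H" for b h
    unfolding F_def by (rule lift_tens[OF A.R_mod A.H_mod _ bilin_tmap[OF A.R_mod B.R_mod A.H_mod fD(1)] that]) simp
  have m: "F (s \<otimes>\<^bsub>A.W\<^esub> t) = F s \<otimes>\<^bsub>B.W\<^esub> F t" if s: "s \<in> carrier A.T" and t: "t \<in> carrier A.T" for s t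
  proof (rule lin_eq_tensor[OF A.R_mod A.H_mod _ _ _ s])
    show "(\<lambda>s. F (s \<otimes>\<^bsub>A.W\<^esub> t)) \<in> lin_map K A.T B.T"
      by (intro lin_comp[OF F] A.lin_W_mult lin_id t)
    show "(\<lambda>s. F s \<otimes>\<^bsub>B.W\<^esub> F t) \<in> lin_map K A.T B.T"
      by (intro B.lin_W_mult F Fc t)
    fix b x assume bx [simp]: "b \<in> carrier R" "x \<in> carrier H"
    show "F (tens K R H b x \<otimes>\<^bsub>A.W\<^esub> t) = F (tens K R H b x) \<otimes>\<^bsub>B.W\<^esub> F t"
    proof (rule lin_eq_tensor[OF A.R_mod A.H_mod _ _ _ t])
      show "(\<lambda>t. F (tens K R H b x \<otimes>\<^bsub>A.W\<^esub> t)) \<in> lin_map K A.T B.T"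
        by (intro lin_comp[OF F] A.lin_W_mult lin_id) simp
      show "(\<lambda>t. F (tens K R H b x) \<otimes>\<^bsub>B.W\<^esub> F t) \<in> lin_map K A.T B.T"
        by (intro B.lin_W_mult F Fc) simp
      fix c y assume cy [simp]: "c \<in> carrier R" "y \<in> carrier H"
      have "F (A.mul b x c y) = sw K H B.T (\<lambda>x1 x2. sw K H B.T (\<lambda>y1 y2.
          F (tens K R H (b \<otimes>\<^bsub>R\<^esub> c \<otimes>\<^bsub>R\<^esub> \<gamma> x1 y1) (x2 \<otimes>\<^bsub>H\<^esub> y2))) y) x"
        by (rule A.mul_map[OF _ F]) simp_all
      also have "\<dots> = B.mul (f b) x (f c) y"
        unfolding B.mul_def by (intro A.sw_cong) (simp add: Fp fD(3) fg)
      finally show "F (tens K R H b x \<otimes>\<^bsub>A.W\<^esub> tens K R H c y) = F (tens K R H b x) \<otimes>\<^bsub>B.W\<^esub> F (tens K R H c y)"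
        by (simp add: A.mult_pure B.mult_pure Fp)
    qed
  qed
  show "F \<in> alg_hom K A.W B.W"
    by (intro alg_homI) (simp_all add: F m Fp fu)
  show "F (A.tau l h) = B.tau (\<lambda>h. f (l h)) h" if l: "l \<in> lin_map K H R" and h: "h \<in> carrier H"
  proof -
    have "F (A.tau l h) = sw K H B.T (\<lambda>h1 h2. F (tens K R H (l h1) h2)) h"
      by (rule A.tau_map[OF l _ F h]) simp
    also have "\<dots> = B.tau (\<lambda>h. f (l h)) h"
      unfolding B.tau_def by (intro A.sw_cong) (simp add: Fp lin_mapD(1)[OF l])
    finally show ?thesis .
  qed
qed

section \<open>Comodule algebra morphisms out of the tensor algebra\<close>

context hopf_cocycle
begin

abbreviation TA where "TA \<equiv> VH.TA"
abbreviation XV where "XV \<equiv> VH.XV"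
abbreviation TT where "TT \<equiv> T_alg K H"

lemma TA_alg [simp]: "assoc_algebra K TA" by (rule VH.TA_alg)
lemma TA_mod [simp]: "module K TA" by (rule assoc_algebra_module) simp

lemma T_simps [simp]: "carrier TT = carrier TA" "ring.add TT = ring.add TA" "monoid.mult TT = monoid.mult TA"
  "\<one>\<^bsub>TT\<^esub> = \<one>\<^bsub>TA\<^esub>" "\<zero>\<^bsub>TT\<^esub> = \<zero>\<^bsub>TA\<^esub>" "smult TT = smult TA"
  by (simp_all add: T_alg_def Let_def with_coact_def)

lemma tensor_lift_T: "tensor_lift K TT H G f = tensor_lift K TA H G f"
  by (rule tensor_lift_left_cong) simp_all

definition TA_ext where
  "TA_ext A \<phi> = (SOME f. f \<in> alg_hom K TA A \<and> (\<forall>h\<in>carrier H. f (XV h) = \<phi> h))"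

lemma TA_ext:
  assumes "assoc_algebra K A" "\<phi> \<in> lin_map K H A"
  shows "TA_ext A \<phi> \<in> alg_hom K TA A" "h \<in> carrier H \<Longrightarrow> TA_ext A \<phi> (XV h) = \<phi> h"
proof -
  let ?P = "\<lambda>f. f \<in> alg_hom K TA A \<and> (\<forall>h\<in>carrier H. f (XV h) = \<phi> h)"
  have "\<exists>f. ?P f" using VH.TA_universal[OF assms] by blast
  then have "?P (TA_ext A \<phi>)" unfolding TA_ext_def by (rule someI_ex[of ?P])
  then show "TA_ext A \<phi> \<in> alg_hom K TA A" "h \<in> carrier H \<Longrightarrow> TA_ext A \<phi> (XV h) = \<phi> h" by blast+
qed

abbreviation TAH where "TAH \<equiv> tensor K TA H"

lemma TAH_alg: "assoc_algebra K TAH" by (intro tensor_assoc_algebra TA_alg H_alg)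

lemma XV_bilin: "(\<lambda>h1 h2. tens K TA H (XV h1) h2) \<in> bilin_map K H H TAH"
  by (intro bilin_mapI lin VH.XV_lin; simp)

lemma T_coact:
  shows T_coact_hom: "coact TT \<in> alg_hom K TA TAH"
    and T_coact_XV: "h \<in> carrier H \<Longrightarrow> coact TT (XV h) = sw K H TAH (\<lambda>h1 h2. tens K TA H (XV h1) h2) h"
proof -
  let ?\<phi> = "sw K H TAH (\<lambda>h1 h2. tens K TA H (XV h1) h2)"
  have "?\<phi> \<in> lin_map K H TAH" by (rule sw_lin[OF _ XV_bilin]) simp
  moreover have "coact TT = TA_ext TAH ?\<phi>"
    by (simp add: T_alg_def Let_def with_coact_def TA_ext_def)
  ultimately show "coact TT \<in> alg_hom K TA TAH" "h \<in> carrier H \<Longrightarrow> coact TT (XV h) = ?\<phi> h"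
    using TA_ext[OF TAH_alg] by simp_all
qed

text \<open>Both sides are algebra morphisms in P, so the generators decide; there the equation is
  \<open>coact_tau\<close>.\<close>

lemma TA_ext_comodule:
  fixes R :: "('k, 'r) module"
  assumes tw: "twisted K H R \<gamma> u" and co: "comodule_algebra K H (twisted_algebra K H R \<gamma> u)"
    and l: "l \<in> lin_map K H R"
    and m: "m \<in> alg_hom K TA (twisted_algebra K H R \<gamma> u)" "\<And>h. h \<in> carrier H \<Longrightarrow> m (XV h) = twisted.tau K H R l h"
    and P: "P \<in> carrier TA"
  shows "coact (twisted_algebra K H R \<gamma> u) (m P) =
    tmap K TA H (twisted_algebra K H R \<gamma> u) m (coact TT P)"
proof -
  interpret A: twisted K H R \<gamma> u by (rule tw)
  let ?F = "tmap K TA H A.W m"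
  note c = comodule_algebraD[OF co]
  have F: "?F \<in> alg_hom K TAH (tensor K A.W H)" by (rule alg_hom_tmap[OF TA_alg c(1) H_alg m(1)])
  show ?thesis
  proof (rule VH.TA_hom_unique[OF _ alg_hom_comp[OF c(3) m(1)] alg_hom_comp[OF F T_coact_hom] _ P])
    show "assoc_algebra K (tensor K A.W H)" by (intro tensor_assoc_algebra c H_alg)
    fix h assume h: "h \<in> carrier H"
    have "?F (coact TT (XV h)) = sw K H (tensor K A.W H) (\<lambda>h1 h2. ?F (tens K TA H (XV h1) h2)) h"
      unfolding T_coact_XV[OF h] by (rule sw_map[OF _ alg_homD(1)[OF F] XV_bilin h]) simp
    also have "\<dots> = sw K H (tensor K A.W H) (\<lambda>h1 h2. tens K A.T H (A.tau l h1) h2) h"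
      by (intro sw_cong, subst lift_tens[OF TA_mod H_mod _ bilin_tmap[OF TA_mod A.W_mod H_mod alg_homD(1)[OF m(1)]]])
        (simp_all add: m(2))
    also have "\<dots> = coact A.W (m (XV h))"
      using h by (simp add: m(2) A.coact_tau[OF l] sw_def A.tensor_lift_W_group)
    finally show "coact A.W (m (XV h)) = ?F (coact TT (XV h))" by simp
  qed
qed

text \<open>The generic morphism over S(t_H)_\<Theta>, the same morphism over S(t_H), and its
  specialization t_h = l(h) over k.\<close>

abbreviation mt where "mt \<equiv> TA_ext Om.W tau"
abbreviation mS where "mS \<equiv> TA_ext Ss.W (Ss.tau VH.sv)"
abbreviation ml where "ml l \<equiv> TA_ext Ca.W (Ca.tau l)"

lemmas Om_alg = comodule_algebraD(1)[OF Om_comodule]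
lemmas Ss_alg = comodule_algebraD(1)[OF Ss_comodule]
lemmas Ca_alg = comodule_algebraD(1)[OF Ca_comodule]

lemma mt: "mt \<in> alg_hom K TA Om.W" "h \<in> carrier H \<Longrightarrow> mt (XV h) = tau h"
  using TA_ext[OF Om_alg, of tau] Om.tau_lin[OF tv_R1] by simp_all

lemma mS: "mS \<in> alg_hom K TA Ss.W" "h \<in> carrier H \<Longrightarrow> mS (XV h) = Ss.tau VH.sv h"
  using TA_ext[OF Ss_alg, of "Ss.tau VH.sv"] Ss.tau_lin[OF VH.sv_lin] by simp_all

lemma ml:
  assumes l: "l \<in> dual"
  shows "ml l \<in> alg_hom K TA Ca.W" "h \<in> carrier H \<Longrightarrow> ml l (XV h) = Ca.tau l h"
  using TA_ext[OF Ca_alg, of "Ca.tau l"] Ca.tau_lin[OF l] by simp_all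

lemma emb_R1: "emb \<in> alg_hom K S R1"
proof -
  have c: "emb t \<in> carrier R1" if "t \<in> carrier S" for t
    using that
  proof (induction t rule: VH.SA_induct)
    case (scal c)
    then show ?case using subalgebraD(3,5)[OF R1_sub(1)] by (simp add: embD)
  next
    case (var v t)
    then show ?case using Om.R.A.m_closed[of "tv v" "emb t"] VH.SA.A.ring_axioms lin_mapD(1)[OF VH.sv_lin]
      by (simp add: embD tv_emb[symmetric] R1_ops)
  next
    case (add s t)
    then show ?case using subalgebraD(7)[OF R1_sub(1)] by (simp add: embD)
  qed
  show ?thesis
    by (intro alg_homI lin_mapI) (simp_all add: c embD R1_ops)
qed

lemma mt_mS:
  assumes P: "P \<in> carrier TA"
  shows "tmap K S H R1 emb (mS P) = mt P"
proof -
  have e: "\<forall>x\<in>carrier H. \<forall>y\<in>carrier H. emb (aR S x y) = aR R1 x y"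
    using bilin_mapD(3)[OF \<alpha>_bilin] VH.SA.A.one_closed by (simp add: embD R1_ops)
  have 1: "emb \<one>\<^bsub>S\<^esub> = \<one>\<^bsub>R1\<^esub>" by (simp add: embD R1_ops)
  note tm = twisted_map[OF Ss.twisted_axioms Om.twisted_axioms emb_R1 e 1]
  show ?thesis
    by (rule VH.TA_hom_unique[OF Om_alg alg_hom_comp[OF tm(1) mS(1)] mt(1) _ P])
      (simp add: mS mt tm(2)[OF VH.sv_lin] tv_emb[abs_def, symmetric] del: Om.W_simps)
qed

text \<open>Evaluation of the coefficients at the point l replaces each t_h by l(h), which can be
  checked on generators.\<close>

lemma ml_mS:
  assumes l: "l \<in> dual" and P: "P \<in> carrier TA"
  shows "tmap K S H KA (VH.ev l) (mS P) = ml l P"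
proof -
  note ev = alg_homD[OF VH.ev(1)[OF l]]
  have e: "\<forall>x\<in>carrier H. \<forall>y\<in>carrier H. VH.ev l (aR S x y) = \<alpha> x y"
    using bilin_mapD(3)[OF \<alpha>_bilin] VH.SA.A.one_closed by (simp add: ev)
  have 1: "VH.ev l \<one>\<^bsub>S\<^esub> = \<one>\<^bsub>K\<^esub>" by (simp add: ev)
  note tm = twisted_map[OF Ss.twisted_axioms Ca.twisted_axioms VH.ev(1)[OF l] e 1]
  show ?thesis
  proof (rule VH.TA_hom_unique[OF Ca_alg alg_hom_comp[OF tm(1) mS(1)] ml(1)[OF l] _ P])
    fix h assume h: "h \<in> carrier H"
    have "Ca.tau (\<lambda>h. VH.ev l (VH.sv h)) h = Ca.tau l h"
      unfolding Ca.tau_def by (intro sw_cong) (simp add: VH.ev(2)[OF l])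
    then show "tmap K S H KA (VH.ev l) (mS (XV h)) = ml l (XV h)"
      using h by (simp add: mS ml[OF l] tm(2)[OF VH.sv_lin])
  qed
qed

lemma ml_comod_alg_hom: "l \<in> dual \<Longrightarrow> ml l \<in> comod_alg_hom K H TT Ca.W"
  using TA_ext_comodule[OF Ca.twisted_axioms Ca_comodule _ ml, of l] ml(1)[of l]
  by (simp add: comod_alg_hom_def alg_hom_cong[of TT TA] tensor_lift_T)

text \<open>A comodule map into k \<otimes> H is recovered from its composite with id \<otimes>
  \<epsilon>. Hence a morphism \<mu> is given on generators by l(h) = (id \<otimes>
  \<epsilon>)(\<mu>(X_h)): all morphisms are specializations of the generic one.\<close>

lemma comod_alg_hom_ml:
  assumes \<mu>: "\<mu> \<in> comod_alg_hom K H TT Ca.W"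
  obtains l where "l \<in> dual" "\<And>P. P \<in> carrier TA \<Longrightarrow> \<mu> P = ml l P"
proof -
  have m: "\<mu> \<in> alg_hom K TA Ca.W" using \<mu> by (simp add: comod_alg_hom_def alg_hom_cong[of TT TA])
  note mD = alg_homD[OF m]
  have co: "coact Ca.W (\<mu> P) = tmap K TA H Ca.W \<mu> (coact TT P)"
    if "P \<in> carrier TA" for P
    using \<mu> that by (simp add: comod_alg_hom_def tensor_lift_T)
  define e where "e = coef KA (counit H)"
  have el: "e \<in> lin_map K Ca.T KA" unfolding e_def by (rule coef_lin[OF K_mod counit_dual])
  have ep: "e (tens K KA H b h) = counit H h \<otimes>\<^bsub>K\<^esub> b" if "b \<in> carrier K" "h \<in> carrier H" for b h
    using coef_pure[OF K_mod counit_dual, of b h] that by (simp add: e_def)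
  have mX: "(\<lambda>h. \<mu> (XV h)) \<in> lin_map K H Ca.T" using lin_comp[OF mD(1) VH.XV_lin] by simp
  define l where "l h = e (\<mu> (XV h))" for h
  have l: "l \<in> dual" unfolding l_def by (rule lin_comp[OF el mX])
  let ?G = "tmap K Ca.T H KA e"
  have Gb: "(\<lambda>t h. tens K KA H (e t) h) \<in> bilin_map K Ca.T H Ca.T"
    by (rule bilin_tmap[OF _ K_mod H_mod el]) simp
  have G: "?G \<in> lin_map K Ca.TH Ca.T" by (rule lin_lift[OF _ H_mod _ Gb]) simp_all
  have Gp: "?G (tens K Ca.T H t h) = tens K KA H (e t) h" if "t \<in> carrier Ca.T" "h \<in> carrier H" for t h
    by (rule lift_tens[OF _ H_mod _ Gb that]) simp_all
  \<comment> \<open>The left counit law: applying id \<otimes> \<epsilon> to the first two of the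
    three legs of the coaction returns the element.\<close>
  have GC: "?G (coact Ca.W t) = t" if t: "t \<in> carrier Ca.T" for t
  proof (rule lin_eq_tensor[OF K_mod H_mod lin_comp[OF G Ca.coact_lin] lin_id _ t])
    fix b h assume bh: "b \<in> carrier KA" "h \<in> carrier H"
    have "?G (coact Ca.W (tens K KA H b h)) = sw K H Ca.T (\<lambda>h1 h2. ?G (tens K Ca.T H (tens K KA H b h1) h2)) h"
      using Ca.dpure_map[OF _ G bh] bh by (simp add: Ca.coact_pure)
    also have "\<dots> = sw K H Ca.T (\<lambda>h1 h2. counit H h1 \<odot>\<^bsub>Ca.T\<^esub> tens K KA H b h2) h"
      using bh by (intro sw_cong) (simp add: Gp ep smult_tens)
    also have "\<dots> = tens K KA H b h"
      using bh by (intro sw_counit_l; (intro lin)?; simp)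
    finally show "?G (coact Ca.W (tens K KA H b h)) = tens K KA H b h" .
  qed
  have X: "\<mu> (XV h) = Ca.tau l h" if h: "h \<in> carrier H" for h
  proof -
    let ?F = "tmap K TA H Ca.W \<mu>"
    have F: "?F \<in> lin_map K TAH (tensor K Ca.W H)" by (rule lin_tmap[OF TA_mod Ca.W_mod H_mod mD(1)])
    have GF: "(\<lambda>x. ?G (?F x)) \<in> lin_map K TAH Ca.T"
      using lin_comp[of ?G K "tensor K Ca.W H" Ca.T, OF _ F] G by (simp add: lin_map_def)
    have "\<mu> (XV h) = ?G (?F (coact TT (XV h)))"
      using GC[of "\<mu> (XV h)"] lin_mapD(1)[OF mX h] h by (simp add: co)
    also have "\<dots> = sw K H Ca.T (\<lambda>h1 h2. ?G (?F (tens K TA H (XV h1) h2))) h"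
      unfolding T_coact_XV[OF h] by (rule sw_map[OF _ GF XV_bilin h]) simp
    also have "\<dots> = sw K H Ca.T (\<lambda>h1 h2. tens K KA H (l h1) h2) h"
      by (intro sw_cong, subst lift_tens[OF TA_mod H_mod _ bilin_tmap[OF TA_mod Ca.W_mod H_mod mD(1)]])
        (simp_all add: Gp l_def lin_mapD(1)[OF mX])
    finally show ?thesis by (simp add: Ca.tau_def)
  qed
  show thesis
    by (rule that[OF l]) (rule VH.TA_hom_unique[OF Ca_alg m ml(1)[OF l]], simp_all add: X ml[OF l])
qed

end

section \<open>The algebra U and the maps \<open>mu_alpha\<close> and
  \<open>mu_sigma\<close>\<close>

context hopf_cocycle
begin

abbreviation I where "I \<equiv> identities K H \<alpha>"
abbreviation U where "U \<equiv> U_alg K H \<alpha>"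
abbreviation Q where "Q \<equiv> quot_algebra TA I"
abbreviation mu where "mu \<equiv> mu_alpha K H \<alpha>"

lemma cocycle_algebra_eq: "cocycle_algebra K H \<alpha> = Ca.W"
  by (simp add: cocycle_algebra_def)

lemma S_theta_alpha_eq: "S_theta_alpha K H \<alpha> = Om.W"
  by (simp add: S_theta_alpha_def)

lemma coef_ev:
  assumes l: "l \<in> dual" and \<kappa>: "\<kappa> \<in> dual" and y: "y \<in> carrier (tensor K S H)"
  shows "VH.ev l (coef S \<kappa> y) = coef KA \<kappa> (tmap K S H KA (VH.ev l) y)"
  by (rule lift_natural[OF S_mod K_mod H_mod S_mod K_mod alg_homD(1)[OF VH.ev(1)[OF l]] alg_homD(1)[OF VH.ev(1)[OF l]]
        coef_bilin[OF S_mod \<kappa>] coef_bilin[OF K_mod \<kappa>] _ y])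
    (use lin_mapD(1)[OF \<kappa>] in \<open>simp add: alg_homD[OF VH.ev(1)[OF l]]\<close>)

lemma identities_iff:
  assumes P: "P \<in> carrier TA"
  shows "P \<in> I \<longleftrightarrow> mt P = \<zero>\<^bsub>Om.T\<^esub>"
proof
  let ?e = "\<lambda>l. tmap K S H KA (VH.ev l)"
  let ?E = "tmap K S H R1 emb"
  have mP: "mS P \<in> carrier (tensor K S H)" using alg_homD(2)[OF mS(1) P] by simp
  have el: "?e l \<in> lin_map K (tensor K S H) Ca.T" if "l \<in> dual" for l
    by (rule lin_tmap[OF S_mod K_mod H_mod alg_homD(1)[OF VH.ev(1)[OF that]]])
  have El: "?E \<in> lin_map K (tensor K S H) Om.T"
    by (rule lin_tmap[OF S_mod R1_mod H_mod alg_homD(1)[OF emb_R1]])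
  have ab: "abelian_group (tensor K S H)" "abelian_group Ca.T" "abelian_group Om.T" "abelian_group S" "abelian_group KA"
    using module_abelian[OF S_mod] module_abelian[OF K_mod] by simp_all
  {
    assume PI: "P \<in> I"
    have 0: "?e l (mS P) = \<zero>\<^bsub>Ca.T\<^esub>" if l: "l \<in> dual" for l
      using PI ml_comod_alg_hom[OF l] ml_mS[OF l P] by (simp add: identities_def cocycle_algebra_eq)
    have "mS P = \<zero>\<^bsub>tensor K S H\<^esub>"
    proof (rule tensor_eq_zeroI[OF K H_mod S_mod mP])
      fix \<kappa> assume \<kappa>: "\<kappa> \<in> dual"
      show "coef S \<kappa> (mS P) = \<zero>\<^bsub>S\<^esub>"
      proof (rule VH.SA_eq_zeroI[OF inf lin_mapD(1)[OF coef_lin[OF S_mod \<kappa>] mP]])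
        fix l assume l: "l \<in> dual"
        have "VH.ev l (coef S \<kappa> (mS P)) = coef KA \<kappa> \<zero>\<^bsub>Ca.T\<^esub>"
          unfolding coef_ev[OF l \<kappa> mP] 0[OF l] ..
        also have "\<dots> = \<zero>\<^bsub>K\<^esub>"
          using lin_map_zero[OF coef_lin[OF K_mod \<kappa>] ab(2,5)] by (simp only: self_algebra_simps)
        finally show "VH.ev l (coef S \<kappa> (mS P)) = \<zero>\<^bsub>K\<^esub>" .
      qed
    qed
    then show "mt P = \<zero>\<^bsub>Om.T\<^esub>"
      using mt_mS[OF P] lin_map_zero[OF El ab(1,3)] by simp
  }
  {
    assume 0: "mt P = \<zero>\<^bsub>Om.T\<^esub>"
    have inj: "inj_on ?E (carrier (tensor K S H))"
    proof (rule tmap_inj[OF K H_mod S_mod R1_mod alg_homD(1)[OF emb_R1]])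
      show "inj_on emb (carrier S)" by (rule Fr.emb_inj)
    qed
    have z: "mS P = \<zero>\<^bsub>tensor K S H\<^esub>"
      using 0 mt_mS[OF P] lin_map_zero[OF El ab(1,3)]
      by (intro inj_onD[OF inj _ mP]) (simp_all add: abelian_group.axioms(1) abelian_monoid.zero_closed[OF abelian_group.axioms(1)] ab)
    have "\<mu> P = \<zero>\<^bsub>Ca.T\<^esub>" if \<mu>: "\<mu> \<in> comod_alg_hom K H TT Ca.W" for \<mu>
    proof -
      obtain l where l: "l \<in> dual" and e: "\<And>P. P \<in> carrier TA \<Longrightarrow> \<mu> P = ml l P"
        using comod_alg_hom_ml[OF \<mu>] by blast
      show ?thesis
        using e[OF P] ml_mS[OF l P] lin_map_zero[OF el[OF l] ab(1,2)] z by simp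
    qed
    then show "P \<in> I" using P by (simp add: identities_def cocycle_algebra_eq)
  }
qed

lemma I_TA: "I \<subseteq> carrier TA"
  by (auto simp: identities_def)

lemma mt_closed [simp]: "P \<in> carrier TA \<Longrightarrow> mt P \<in> carrier Om.T"
  using alg_homD(2)[OF mt(1)] by simp

lemma mt_minus: "P \<in> carrier TA \<Longrightarrow> P' \<in> carrier TA \<Longrightarrow> mt (P \<ominus>\<^bsub>TA\<^esub> P') = mt P \<ominus>\<^bsub>Om.W\<^esub> mt P'"
  by (rule lin_map_minus[OF alg_homD(1)[OF mt(1)] assoc_algebra_abelian[OF TA_alg] assoc_algebra_abelian[OF Om_alg]])

interpretation OmA: assoc_algebra K Om.W by (rule Om_alg)

lemma I_ideal: "ideal I TA"
proof -
  have "ring_hom_ring TA Om.W mt"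
    using mt(1) by (intro ring_hom_ringI2 VH.TA.A.ring_axioms OmA.A.ring_axioms) (simp add: alg_hom_def)
  then have "ideal (a_kernel TA Om.W mt) TA" by (rule ring_hom_ring.kernel_is_ideal)
  moreover have "a_kernel TA Om.W mt = I"
    using I_TA identities_iff by (auto simp: a_kernel_def' )
  ultimately show ?thesis by simp
qed

text \<open>\<open>T_alg\<close> is the tensor algebra with a coaction field attached. The two
  records have different types, so equality of the quotients is read off from the
  definitions.\<close>

lemma quot_T: "quot_algebra TT I = Q" "I +>\<^bsub>TT\<^esub> P = I +>\<^bsub>TA\<^esub> P"
proof -
  show c: "I +>\<^bsub>TT\<^esub> P = I +>\<^bsub>TA\<^esub> P" for P by (simp add: a_r_coset_def r_coset_def)
  show "quot_algebra TT I = Q"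
    by (simp add: quot_algebra_def with_smult_def FactRing_def A_RCOSETS_def RCOSETS_def rcoset_mult_def[abs_def]
        set_add_def[abs_def] set_mult_def[abs_def] r_coset_def a_r_coset_def[abs_def] fun_eq_iff)
qed

lemma Q_alg [simp]: "assoc_algebra K Q" by (rule quot_assoc_algebra[OF TA_alg I_ideal])
lemma Q_mod [simp]: "module K Q" by (rule assoc_algebra_module) simp

abbreviation QH where "QH \<equiv> tensor K Q H"
abbreviation pr where "pr P \<equiv> I +>\<^bsub>TA\<^esub> P"

lemma pr_hom: "pr \<in> alg_hom K TA Q" by (rule coset_hom[OF TA_alg I_ideal])

lemma pr_eq_iff: "P \<in> carrier TA \<Longrightarrow> P' \<in> carrier TA \<Longrightarrow> pr P = pr P' \<longleftrightarrow> mt P = mt P'"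
  using coset_eq_iff[OF TA_alg I_ideal, of P P'] identities_iff[of "P \<ominus>\<^bsub>TA\<^esub> P'"] mt_minus[of P P']
    OmA.A.r_right_minus_eq[of "mt P" "mt P'"] VH.TA.M.minus_closed by simp

lemma U_simps [simp]: "carrier U = carrier Q" "ring.add U = ring.add Q" "monoid.mult U = monoid.mult Q"
  "\<one>\<^bsub>U\<^esub> = \<one>\<^bsub>Q\<^esub>" "\<zero>\<^bsub>U\<^esub> = \<zero>\<^bsub>Q\<^esub>" "smult U = smult Q"
  by (simp_all add: U_alg_def Let_def with_coact_def quot_T)

lemma tensor_lift_U: "tensor_lift K U H G f = tensor_lift K Q H G f"
  by (rule tensor_lift_left_cong) simp_all

lemma mu_exists: "\<exists>f \<in> alg_hom K Q Om.W. \<forall>P\<in>carrier TA. f (pr P) = mt P"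
proof (rule quot_universal_alg[OF TA_alg I_ideal Om_alg mt(1)])
  show "mt P = \<zero>\<^bsub>Om.W\<^esub>" if "P \<in> I" for P
    using identities_iff[of P] I_TA that by auto
qed

lemma mu:
  shows mu_hom: "mu \<in> alg_hom K Q Om.W" and mu_pr: "P \<in> carrier TA \<Longrightarrow> mu (pr P) = mt P"
proof -
  let ?P = "\<lambda>f. f \<in> alg_hom K Q Om.W \<and> (\<forall>h\<in>carrier H. f (pr (XV h)) = tau h)"
  have e: "mu = (SOME f. ?P f)"
    by (simp add: mu_alpha_def S_theta_alpha_eq alg_hom_cong[of U Q] quot_T Om.tau_def)
  have "\<exists>f. ?P f" using mu_exists mt(2) by auto
  then have m: "?P mu" unfolding e by (rule someI_ex[of ?P])
  then show h: "mu \<in> alg_hom K Q Om.W" by blast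
  show "mu (pr P) = mt P" if P: "P \<in> carrier TA"
    by (rule VH.TA_hom_unique[OF Om_alg alg_hom_comp[OF h pr_hom] mt(1) _ P]) (use m mt(2) in simp)
qed

lemma U_cases: "w \<in> carrier Q \<Longrightarrow> (\<And>P. P \<in> carrier TA \<Longrightarrow> w = pr P \<Longrightarrow> thesis) \<Longrightarrow> thesis"
  using quot_cases[OF TA_alg I_ideal] by blast

lemma mu_inj: "inj_on mu (carrier Q)"
  by (intro inj_onI) (elim U_cases, simp add: mu_pr pr_eq_iff)

lemma mu_lin: "mu \<in> lin_map K Q Om.T"
  using alg_homD(1)[OF mu_hom] by simp

lemma mu_closed [simp]: "w \<in> carrier Q \<Longrightarrow> mu w \<in> carrier Om.T"
  by (rule lin_mapD(1)[OF mu_lin])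

abbreviation muH where "muH \<equiv> tmap K Q H Om.W mu"

lemma muH: "muH \<in> alg_hom K QH (tensor K Om.W H)"
  by (rule alg_hom_tmap[OF Q_alg Om_alg H_alg mu_hom])

lemma muH_inj: "inj_on muH (carrier QH)"
  by (rule tmap_inj[OF K H_mod Q_mod Om.W_mod alg_homD(1)[OF mu_hom] mu_inj])

abbreviation prH where "prH \<equiv> tmap K TA H Q pr"

lemma prH: "prH \<in> alg_hom K TAH QH"
  by (rule alg_hom_tmap[OF TA_alg Q_alg H_alg pr_hom])

lemma muH_prH: "P \<in> carrier TA \<Longrightarrow> muH (prH (coact TT P)) = coact Om.W (mt P)"
proof -
  assume P: "P \<in> carrier TA"
  have cP: "coact TT P \<in> carrier TAH" by (rule alg_homD(2)[OF T_coact_hom P])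
  have "muH (prH (coact TT P)) = tmap K TA H Om.W mt (coact TT P)"
  proof (rule lin_eq_tensor[OF TA_mod H_mod lin_comp[OF alg_homD(1)[OF muH] alg_homD(1)[OF prH]]
          lin_tmap[OF TA_mod Om.W_mod H_mod alg_homD(1)[OF mt(1)]] _ cP])
    fix x h assume xh: "x \<in> carrier TA" "h \<in> carrier H"
    have "prH (tens K TA H x h) = tens K Q H (pr x) h"
      by (rule lift_tens[OF TA_mod H_mod _ bilin_tmap[OF TA_mod Q_mod H_mod alg_homD(1)[OF pr_hom]] xh]) simp
    moreover have "muH (tens K Q H (pr x) h) = tens K Om.W H (mu (pr x)) h"
      by (rule lift_tens[OF Q_mod H_mod _ bilin_tmap[OF Q_mod Om.W_mod H_mod alg_homD(1)[OF mu_hom]] alg_homD(2)[OF pr_hom xh(1)] xh(2)]) simp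
    moreover have "tmap K TA H Om.W mt (tens K TA H x h) = tens K Om.W H (mt x) h"
      by (rule lift_tens[OF TA_mod H_mod _ bilin_tmap[OF TA_mod Om.W_mod H_mod alg_homD(1)[OF mt(1)]] xh]) simp
    ultimately show "muH (prH (tens K TA H x h)) =
        tmap K TA H Om.W mt (tens K TA H x h)"
      using xh by (simp only: mu_pr)
  qed
  then show ?thesis
    using TA_ext_comodule[OF Om.twisted_axioms Om_comodule tv_R1 mt P] by simp
qed

text \<open>The coaction descends to U if it sends identities to 0 in U \<otimes> H. This is checked
  after the injective \<open>muH\<close>, where the image of P becomes the coaction of
  \<open>mt P\<close>, and \<open>mt P\<close> = 0.\<close>

lemma U_coact:
  shows U_coact_hom: "coact U \<in> alg_hom K Q QH"
    and U_coact_pr: "P \<in> carrier TA \<Longrightarrow> coact U (pr P) = prH (coact TT P)"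
proof -
  have QHa: "assoc_algebra K QH" by (intro tensor_assoc_algebra Q_alg H_alg)
  have OHa: "abelian_group (tensor K Om.W H)" by (simp add: module_abelian)
  let ?P = "\<lambda>d. d \<in> alg_hom K Q QH \<and> (\<forall>P\<in>carrier TA. d (pr P) = prH (coact TT P))"
  have e: "coact U = (SOME d. ?P d)"
    by (simp add: U_alg_def Let_def with_coact_def quot_T tensor_lift_T)
  have "\<exists>d \<in> alg_hom K Q QH. \<forall>P\<in>carrier TA. d (pr P) = prH (coact TT P)"
  proof (rule quot_universal_alg[OF TA_alg I_ideal QHa alg_hom_comp[OF prH T_coact_hom]])
    fix P assume PI: "P \<in> I"
    then have P: "P \<in> carrier TA" using I_TA by blast
    have "muH (prH (coact TT P)) = coact Om.W \<zero>\<^bsub>Om.W\<^esub>"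
      using muH_prH[OF P] identities_iff[OF P] PI by simp
    also have "\<dots> = \<zero>\<^bsub>tensor K Om.W H\<^esub>"
      by (rule lin_map_zero[OF comodule_algebraD(4)[OF Om_comodule] assoc_algebra_abelian[OF Om_alg] OHa])
    also have "\<dots> = muH \<zero>\<^bsub>QH\<^esub>"
      by (rule lin_map_zero[OF alg_homD(1)[OF muH] assoc_algebra_abelian[OF QHa] OHa, symmetric])
    finally show "prH (coact TT P) = \<zero>\<^bsub>QH\<^esub>"
      by (rule inj_onD[OF muH_inj])
        (use alg_homD(2)[OF prH alg_homD(2)[OF T_coact_hom P]]
          abelian_monoid.zero_closed[OF abelian_group.axioms(1)[OF assoc_algebra_abelian[OF QHa]]] in simp_all)
  qed
  then have "\<exists>d. ?P d" by blast
  then have "?P (coact U)" unfolding e by (rule someI_ex[of ?P])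
  then show "coact U \<in> alg_hom K Q QH" "P \<in> carrier TA \<Longrightarrow> coact U (pr P) = prH (coact TT P)" by blast+
qed

lemma mu_coact: "w \<in> carrier Q \<Longrightarrow> muH (coact U w) = coact Om.W (mu w)"
  by (erule U_cases) (simp only: U_coact_pr muH_prH mu_pr)

lemma act_one_tau: "h \<in> carrier H \<Longrightarrow> psi (tens K B H \<one>\<^bsub>B\<^esub> h) = tau h"
  using Aa.R.A.one_closed Om.tau_closed[OF tv_R1] by (simp add: psi_pure B_ops act_one)

text \<open>The image of \<open>psi\<close> is closed under the algebra operations and contains
  \<tau>(h), the image of 1 \<otimes> h; the elements \<tau>(h) are the images of the generators of
  U.\<close>

lemma mu_in_psi: "w \<in> carrier Q \<Longrightarrow> \<exists>a\<in>carrier Aa.T. psi a = mu w"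
proof (erule U_cases)
  note pl = lin_mapD[OF psi_lin]
  note A = module.smult_closed[OF Aa.W_mod, simplified]
  note mtD = alg_homD[OF mt(1)]
  fix P assume P: "P \<in> carrier TA" and w: "w = pr P"
  have "\<exists>a\<in>carrier Aa.T. psi a = mt P"
    using P
  proof (induction P rule: VH.TA_induct)
    case (scal c)
    let ?o = "\<one>\<^bsub>Aa.W\<^esub>"
    have o: "?o \<in> carrier Aa.T" by simp
    have "mt (c \<odot>\<^bsub>TA\<^esub> \<one>\<^bsub>TA\<^esub>) = c \<odot>\<^bsub>Om.T\<^esub> psi ?o"
      using scal mtD(6)[of c "\<one>\<^bsub>TA\<^esub>"] mtD(4) psi_one by simp
    also have "\<dots> = psi (c \<odot>\<^bsub>Aa.T\<^esub> ?o)" by (rule pl(3)[symmetric, OF scal o])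
    finally have "psi (c \<odot>\<^bsub>Aa.T\<^esub> ?o) = mt (c \<odot>\<^bsub>TA\<^esub> \<one>\<^bsub>TA\<^esub>)" by simp
    then show ?case using A[OF scal o] by blast
  next
    case (var v t)
    then obtain a where a: "a \<in> carrier Aa.T" "psi a = mt t" by blast
    have o: "tens K B H \<one>\<^bsub>B\<^esub> v \<in> carrier Aa.T" using var(1) by simp
    have "psi (tens K B H \<one>\<^bsub>B\<^esub> v \<otimes>\<^bsub>Aa.W\<^esub> a) = mt (XV v \<otimes>\<^bsub>TA\<^esub> t)"
      using var(1,2) a by (simp add: psi_mult[OF o a(1)] act_one_tau mtD mt(2))
    then show ?case using Aa.mult_closed[OF o a(1)] by blast
  next
    case (add s t)
    then obtain a b where ab: "a \<in> carrier Aa.T" "psi a = mt s" "b \<in> carrier Aa.T" "psi b = mt t" by blast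
    have "psi (a \<oplus>\<^bsub>Aa.T\<^esub> b) = mt (s \<oplus>\<^bsub>TA\<^esub> t)"
      using add(1,2) ab by (simp add: pl mtD)
    moreover have "a \<oplus>\<^bsub>Aa.T\<^esub> b \<in> carrier Aa.T"
      by (rule abelian_monoid.a_closed[OF abelian_group.axioms(1)[OF tensor_abelian[OF B_mod H_mod]] ab(1,3)])
    ultimately show ?case by blast
  qed
  then show ?thesis using P w by (simp add: mu_pr)
qed

abbreviation ms where "ms \<equiv> mu_sigma K H \<alpha>"

text \<open>Replaces the definite description by the equation \<open>psi (ms w) = mu w\<close>. The
  algebraic properties of \<open>ms\<close> follow from those of \<open>mu\<close> by cancelling the
  injective \<open>psi\<close>.\<close>

lemma mu_sigma:
  assumes w: "w \<in> carrier Q"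
  shows "ms w \<in> carrier Aa.T" "psi (ms w) = mu w"
proof -
  obtain a where a: "a \<in> carrier Aa.T" "psi a = mu w" using mu_in_psi[OF w] by blast
  have "ms w = a"
    unfolding mu_sigma_def A_eq
  proof (rule the_equality)
    show "a \<in> carrier Aa.W \<and> A_incl K H \<alpha> a = phi_inv K H (mu w)"
      using a phi_inv_psi[OF a(1)] by simp
    show "a' = a" if "a' \<in> carrier Aa.W \<and> A_incl K H \<alpha> a' = phi_inv K H (mu w)" for a'
      using that a phi_inv_psi[OF a(1)] inj_onD[OF A_incl_inj, of a' a] by simp
  qed
  then show "ms w \<in> carrier Aa.T" "psi (ms w) = mu w" using a by simp_all
qed

end

section \<open>The center\<close>

lemma center_subring:
  assumes "ring A" shows "subring (center A) A" and "cring (A\<lparr>carrier := center A\<rparr>)"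
proof -
  interpret A: ring A by fact
  show s: "subring (center A) A"
  proof (rule A.subringI)
    show "\<ominus>\<^bsub>A\<^esub> z \<in> center A" if "z \<in> center A" for z
      using that by (auto simp: center_def A.l_minus A.r_minus)
    show "z \<otimes>\<^bsub>A\<^esub> z' \<in> center A" if z: "z \<in> center A" "z' \<in> center A" for z z'
    proof -
      have c [simp]: "z \<in> carrier A" "z' \<in> carrier A" using z by (auto simp: center_def)
      have cm: "z \<otimes>\<^bsub>A\<^esub> a = a \<otimes>\<^bsub>A\<^esub> z" "z' \<otimes>\<^bsub>A\<^esub> a = a \<otimes>\<^bsub>A\<^esub> z'" if "a \<in> carrier A" for a
        using z that unfolding center_def by blast+
      have "z \<otimes>\<^bsub>A\<^esub> z' \<otimes>\<^bsub>A\<^esub> a = a \<otimes>\<^bsub>A\<^esub> (z \<otimes>\<^bsub>A\<^esub> z')" if a: "a \<in> carrier A" for a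
        using A.m_assoc[OF c a] A.m_assoc[OF c(1) a c(2)] A.m_assoc[OF a c] cm[OF a] by simp
      then show ?thesis by (simp add: center_def)
    qed
  qed (auto simp: center_def A.l_distr A.r_distr)
  interpret Z: ring "A\<lparr>carrier := center A\<rparr>" by (rule A.subring_is_ring[OF s])
  have c: "x \<otimes>\<^bsub>A\<^esub> y = y \<otimes>\<^bsub>A\<^esub> x" if "x \<in> center A" "y \<in> center A" for x y
    using that unfolding center_def by blast
  show "cring (A\<lparr>carrier := center A\<rparr>)"
    by (intro cring.intro Z.ring_axioms comm_monoid.intro Z.monoid_axioms comm_monoid_axioms.intro) (simp add: c)
qed

context hopf
begin

lemma tmap_tmap:
  assumes M: "module K M" and M': "module K M'" and M'': "module K M''"
    and f: "f \<in> lin_map K M M'" and g: "g \<in> lin_map K M' M''" and t: "t \<in> carrier (tensor K M H)"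
  shows "tmap K M' H M'' g
      (tmap K M H M' f t) =
    tmap K M H M'' (\<lambda>x. g (f x)) t"
  by (rule lift_eqI[symmetric, OF M H_mod lin_comp[OF lin_tmap[OF M' M'' H_mod g] lin_tmap[OF M M' H_mod f]] _ t])
    (simp add: M M' M'' lift_tens[OF _ _ _ bilin_tmap[OF M M' H_mod f]] lift_tens[OF _ _ _ bilin_tmap[OF M' M'' H_mod g]]
      lin_mapD(1)[OF f] lin_mapD(1)[OF g])

end

context twisted
begin

lemma coact_act:
  assumes b: "b \<in> carrier R" and t: "t \<in> carrier T"
  shows "coact W (act R b t) = tmap K T H T (act R b) (coact W t)"
proof (rule lin_eq_tensor[OF R_mod H_mod _ _ _ t])
  let ?F = "tmap K T H T (act R b)"
  have Tm: "module K T" by simp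
  note al = act_lin[OF R_alg b]
  have F: "?F \<in> lin_map K TH TH" by (rule lin_tmap[OF Tm Tm H_mod al])
  show "(\<lambda>t. coact W (act R b t)) \<in> lin_map K T TH" by (intro lin_coact al)
  show "(\<lambda>t. ?F (coact W t)) \<in> lin_map K T TH" by (intro lin_comp[OF F] coact_lin)
  fix c h assume ch [simp]: "c \<in> carrier R" "h \<in> carrier H"
  have "?F (coact W (tens K R H c h)) = sw K H TH (\<lambda>h1 h2. ?F (tens K T H (tens K R H c h1) h2)) h"
    using dpure_map[OF _ F ch] by (simp add: coact_pure)
  also have "\<dots> = sw K H TH (\<lambda>h1 h2. tens K T H (tens K R H (b \<cdot> c) h1) h2) h"
    using lift_tens[OF Tm H_mod _ bilin_tmap[OF Tm Tm H_mod al]] b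
    by (intro sw_cong) (simp add: act_pure)
  finally show "coact W (act R b (tens K R H c h)) = ?F (coact W (tens K R H c h))"
    using b by (simp add: act_pure coact_pure dpure_def)
qed

end

context hopf_cocycle
begin

text \<open>Functionals of H detect an element of the tensor product through its coefficients in
  S(t_H)_\<Theta>, and functionals of S(t_H)_\<Theta> detect these. Contractions of the two factors
  commute, so the maps g \<otimes> id suffice.\<close>

lemma tensor_R1_eqI:
  assumes y: "y \<in> carrier Om.T" and y': "y' \<in> carrier Om.T"
    and e: "\<And>g. g \<in> lin_map K R1 KA \<Longrightarrow>
      tmap K R1 H KA g y =
      tmap K R1 H KA g y'"
  shows "y = y'"
proof -
  interpret OT: module K Om.T by simp
  have ab: "abelian_group R1" "abelian_group KA"
    using module_abelian[OF R1_mod] module_abelian[OF K_mod] by simp_all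
  let ?d = "y \<ominus>\<^bsub>Om.T\<^esub> y'"
  have d: "?d \<in> carrier Om.T" using y y' by simp
  have "?d = \<zero>\<^bsub>Om.T\<^esub>"
  proof (rule tensor_eq_zeroI[OF K H_mod R1_mod d])
    fix \<kappa> assume \<kappa>: "\<kappa> \<in> dual"
    note cl = coef_lin[OF R1_mod \<kappa>]
    have g: "g (coef R1 \<kappa> y) = g (coef R1 \<kappa> y')" if g: "g \<in> lin_map K R1 KA" for g
    proof -
      have "g (coef R1 \<kappa> y) = coef KA \<kappa> (tmap K R1 H KA g y)" if "y \<in> carrier Om.T" for y
        by (rule lift_natural[OF R1_mod K_mod H_mod R1_mod K_mod g g coef_bilin[OF R1_mod \<kappa>] coef_bilin[OF K_mod \<kappa>] _ that])
          (use lin_mapD(1)[OF \<kappa>] in \<open>simp add: lin_mapD[OF g]\<close>)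
      then show ?thesis using y y' e[OF g] by simp
    qed
    show "coef R1 \<kappa> ?d = \<zero>\<^bsub>R1\<^esub>"
    proof (rule functionals_separate_points[OF K R1_mod lin_mapD(1)[OF cl d]])
      fix g assume gl: "g \<in> lin_map K R1 KA"
      have c: "coef R1 \<kappa> y \<in> carrier R1" "coef R1 \<kappa> y' \<in> carrier R1" using lin_mapD(1)[OF cl] y y' by auto
      have "g (coef R1 \<kappa> ?d) = g (coef R1 \<kappa> y \<ominus>\<^bsub>R1\<^esub> coef R1 \<kappa> y')"
        by (subst lin_map_minus[OF cl OT.M.abelian_group_axioms ab(1) y y']) simp
      also have "\<dots> = g (coef R1 \<kappa> y) \<ominus>\<^bsub>KA\<^esub> g (coef R1 \<kappa> y')"
        by (rule lin_map_minus[OF gl ab c])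
      also have "\<dots> = \<zero>\<^bsub>KA\<^esub>"
        using g[OF gl] lin_mapD(1)[OF gl c(2)] abelian_group.r_neg[OF ab(2)] by (simp add: a_minus_def)
      finally show "g (coef R1 \<kappa> ?d) = \<zero>\<^bsub>K\<^esub>" by simp
    qed
  qed
  moreover have "y = ?d \<oplus>\<^bsub>Om.T\<^esub> y'"
    using y y' by (simp add: a_minus_def OT.M.a_assoc OT.M.l_neg)
  ultimately show ?thesis using y' by simp
qed

text \<open>The map g \<otimes> id is not multiplicative, but it respects multiplication by 1
  \<otimes> h on either side: the cocycle takes its values in k, and scalars pass through g.\<close>

lemma functional_mult:
  assumes g: "g \<in> lin_map K R1 KA" and y: "y \<in> carrier Om.T" and h: "h \<in> carrier H"
  defines "G \<equiv> tmap K R1 H KA g"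
  shows "G (y \<otimes>\<^bsub>Om.W\<^esub> tens K R1 H \<one>\<^bsub>R1\<^esub> h) = G y \<otimes>\<^bsub>Ca.W\<^esub> tens K KA H \<one>\<^bsub>K\<^esub> h"
    and "G (tens K R1 H \<one>\<^bsub>R1\<^esub> h \<otimes>\<^bsub>Om.W\<^esub> y) = tens K KA H \<one>\<^bsub>K\<^esub> h \<otimes>\<^bsub>Ca.W\<^esub> G y"
proof -
  note [simp] = h lin_mapD(1)[OF g, simplified] bilin_mapD(3)[OF \<alpha>_bilin, simplified]
  have G: "G \<in> lin_map K Om.T Ca.T" unfolding G_def by (rule lin_tmap[OF R1_mod K_mod H_mod g])
  have Gp: "G (tens K R1 H b h) = tens K KA H (g b) h" if "b \<in> carrier R1" "h \<in> carrier H" for b h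
    unfolding G_def by (rule lift_tens[OF R1_mod H_mod _ bilin_tmap[OF R1_mod K_mod H_mod g] that]) simp
  have o: "tens K R1 H \<one>\<^bsub>R1\<^esub> h \<in> carrier Om.T" "tens K KA H \<one>\<^bsub>K\<^esub> h \<in> carrier Ca.T" by simp_all
  have ga: "g (c \<odot>\<^bsub>R1\<^esub> b) = c \<otimes>\<^bsub>K\<^esub> g b" if "b \<in> carrier R1" "c \<in> carrier K" for b c
    using that lin_mapD(3)[OF g] by simp
  show "G (y \<otimes>\<^bsub>Om.W\<^esub> tens K R1 H \<one>\<^bsub>R1\<^esub> h) = G y \<otimes>\<^bsub>Ca.W\<^esub> tens K KA H \<one>\<^bsub>K\<^esub> h"
  proof (rule lin_eq_tensor[OF R1_mod H_mod lin_comp[OF G Om.lin_W_mult(1)[OF lin_id o(1)]] Ca.lin_W_mult(1)[OF G o(2)] _ y])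
    fix b x assume bx [simp]: "b \<in> carrier R1" "x \<in> carrier H"
    have "G (Om.mul b x \<one>\<^bsub>R1\<^esub> h) = sw K H Ca.T (\<lambda>x1 x2. sw K H Ca.T (\<lambda>y1 y2.
        G (tens K R1 H (b \<otimes>\<^bsub>R1\<^esub> \<one>\<^bsub>R1\<^esub> \<otimes>\<^bsub>R1\<^esub> aR R1 x1 y1) (x2 \<otimes> y2))) h) x"
      by (rule Om.mul_map[OF _ G]) simp_all
    also have "\<dots> = Ca.mul (g b) x \<one>\<^bsub>K\<^esub> h"
      unfolding Ca.mul_def by (intro sw_cong) (simp add: Gp Om.R.smult_mult_right ga K.m_comm)
    finally show "G (tens K R1 H b x \<otimes>\<^bsub>Om.W\<^esub> tens K R1 H \<one>\<^bsub>R1\<^esub> h) = G (tens K R1 H b x) \<otimes>\<^bsub>Ca.W\<^esub> tens K KA H \<one>\<^bsub>K\<^esub> h"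
      by (simp add: Om.mult_pure Ca.mult_pure Gp)
  qed
  show "G (tens K R1 H \<one>\<^bsub>R1\<^esub> h \<otimes>\<^bsub>Om.W\<^esub> y) = tens K KA H \<one>\<^bsub>K\<^esub> h \<otimes>\<^bsub>Ca.W\<^esub> G y"
  proof (rule lin_eq_tensor[OF R1_mod H_mod lin_comp[OF G Om.lin_W_mult(2)[OF lin_id o(1)]] Ca.lin_W_mult(2)[OF G o(2)] _ y])
    fix b x assume bx [simp]: "b \<in> carrier R1" "x \<in> carrier H"
    have "G (Om.mul \<one>\<^bsub>R1\<^esub> h b x) = sw K H Ca.T (\<lambda>x1 x2. sw K H Ca.T (\<lambda>y1 y2.
        G (tens K R1 H (\<one>\<^bsub>R1\<^esub> \<otimes>\<^bsub>R1\<^esub> b \<otimes>\<^bsub>R1\<^esub> aR R1 x1 y1) (x2 \<otimes> y2))) x) h"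
      by (rule Om.mul_map[OF _ G]) simp_all
    also have "\<dots> = Ca.mul \<one>\<^bsub>K\<^esub> h (g b) x"
      unfolding Ca.mul_def by (intro sw_cong) (simp add: Gp Om.R.smult_mult_right ga K.m_comm)
    finally show "G (tens K R1 H \<one>\<^bsub>R1\<^esub> h \<otimes>\<^bsub>Om.W\<^esub> tens K R1 H b x) = tens K KA H \<one>\<^bsub>K\<^esub> h \<otimes>\<^bsub>Ca.W\<^esub> G (tens K R1 H b x)"
      by (simp add: Om.mult_pure Ca.mult_pure Gp)
  qed
qed

end

section \<open>Central elements of S(t_H)_\<Theta> \<otimes>^\<alpha> H and of U\<close>

locale hopf_nondegenerate = hopf_cocycle +
  assumes nondeg: "nondegenerate K H \<alpha>"
begin

text \<open>For each functional g the element (g \<otimes> id)(y) commutes with all 1 \<otimes> h,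
  so it is central in the cocycle algebra and equals c \<otimes> 1 by nondegeneracy. Applying id
  \<otimes> \<epsilon> shows c = g(l) for one and the same l = (id \<otimes> \<epsilon>)(y), and the
  maps g \<otimes> id separate elements.\<close>

lemma center_Om:
  assumes y: "y \<in> center Om.W"
  shows "y = tens K R1 H (coef R1 (counit H) y) \<one>"
proof (rule tensor_R1_eqI)
  show yT: "y \<in> carrier Om.T" using y by (simp add: center_def)
  let ?l = "coef R1 (counit H) y"
  note cl = coef_lin[OF R1_mod counit_dual]
  have l: "?l \<in> carrier R1" by (rule lin_mapD(1)[OF cl yT])
  then show lT: "tens K R1 H ?l \<one> \<in> carrier Om.T" by simp
  fix g assume g: "g \<in> lin_map K R1 KA"
  let ?G = "tmap K R1 H KA g"
  have G: "?G \<in> lin_map K Om.T Ca.T" by (rule lin_tmap[OF R1_mod K_mod H_mod g])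
  have Gy: "?G y \<in> carrier Ca.T" by (rule lin_mapD(1)[OF G yT])
  interpret CT: module K Ca.T by simp
  have comm: "?G y \<otimes>\<^bsub>Ca.W\<^esub> s = s \<otimes>\<^bsub>Ca.W\<^esub> ?G y" if s: "s \<in> carrier Ca.T" for s
  proof (rule lin_eq_tensor[OF K_mod H_mod Ca.lin_W_mult(2)[OF lin_id Gy] Ca.lin_W_mult(1)[OF lin_id Gy] _ s])
    fix c h assume ch: "c \<in> carrier KA" "h \<in> carrier H"
    have o: "tens K R1 H \<one>\<^bsub>R1\<^esub> h \<in> carrier Om.T" "tens K KA H \<one>\<^bsub>K\<^esub> h \<in> carrier Ca.T" using ch by simp_all
    have "y \<otimes>\<^bsub>Om.W\<^esub> tens K R1 H \<one>\<^bsub>R1\<^esub> h = tens K R1 H \<one>\<^bsub>R1\<^esub> h \<otimes>\<^bsub>Om.W\<^esub> y"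
      using y o(1) unfolding center_def Om.W_simps by blast
    then have e: "?G y \<otimes>\<^bsub>Ca.W\<^esub> tens K KA H \<one>\<^bsub>K\<^esub> h = tens K KA H \<one>\<^bsub>K\<^esub> h \<otimes>\<^bsub>Ca.W\<^esub> ?G y"
      using functional_mult[OF g yT ch(2)] by simp
    have s: "tens K KA H c h = c \<odot>\<^bsub>Ca.T\<^esub> tens K KA H \<one>\<^bsub>K\<^esub> h"
      using ch by (simp add: smult_tens)
    show "?G y \<otimes>\<^bsub>Ca.W\<^esub> tens K KA H c h = tens K KA H c h \<otimes>\<^bsub>Ca.W\<^esub> ?G y"
      unfolding s using ch(1) o(2) e
      by (simp add: lin_mapD(3)[OF Ca.lin_W_mult(2)[OF lin_id Gy]] lin_mapD(3)[OF Ca.lin_W_mult(1)[OF lin_id Gy]])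
  qed
  then have "?G y \<in> center Ca.W" using Gy by (simp add: center_def)
  then obtain c where c: "c \<in> carrier K" "?G y = c \<odot>\<^bsub>Ca.T\<^esub> tens K KA H \<one>\<^bsub>K\<^esub> \<one>"
    using nondeg unfolding nondegenerate_def cocycle_algebra_eq by auto
  have Gc: "?G y = tens K KA H c \<one>" using c by (simp add: smult_tens)
  have "g ?l = coef KA (counit H) (?G y)"
    by (rule lift_natural[OF R1_mod K_mod H_mod R1_mod K_mod g g coef_bilin[OF R1_mod counit_dual] coef_bilin[OF K_mod counit_dual] _ yT])
      (use lin_mapD(1)[OF counit_dual] in \<open>simp add: lin_mapD[OF g]\<close>)
  also have "\<dots> = c"
    unfolding Gc using coef_pure[OF K_mod counit_dual, of c "\<one>"] c alg_homD(4)[OF counit_hom] by simp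
  finally have "g ?l = c" .
  moreover have "?G (tens K R1 H ?l \<one>) = tens K KA H (g ?l) \<one>"
    by (rule lift_tens[OF R1_mod H_mod _ bilin_tmap[OF R1_mod K_mod H_mod g] l]) simp_all
  ultimately show "?G y = ?G (tens K R1 H ?l \<one>)" using Gc by simp
qed

text \<open>Commuting with all \<tau>(h) implies commuting with the image of
  \<open>Theta tv\<close>, since coefficients are central. \<open>Theta tv\<close> is onto because
  \<open>Theta ti\<close> inverts it.\<close>

lemma mu_center:
  assumes z: "z \<in> center U" shows "mu z \<in> center Om.W"
proof -
  have zQ: "z \<in> carrier Q" using z by (simp add: center_def)
  let ?y = "mu z"
  have y: "?y \<in> carrier Om.T" using zQ by simp
  have t: "?y \<otimes>\<^bsub>Om.W\<^esub> tau h = tau h \<otimes>\<^bsub>Om.W\<^esub> ?y" if h: "h \<in> carrier H" for h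
  proof -
    have X: "pr (XV h) \<in> carrier Q" using h by (intro alg_homD(2)[OF pr_hom]) simp
    have e: "tau h = mu (pr (XV h))" using h by (simp add: mu_pr mt)
    have "z \<otimes>\<^bsub>Q\<^esub> pr (XV h) = pr (XV h) \<otimes>\<^bsub>Q\<^esub> z" using z X unfolding center_def by simp
    then show ?thesis unfolding e using alg_homD(3)[OF mu_hom zQ X] alg_homD(3)[OF mu_hom X zQ] by simp
  qed
  have Th: "?y \<otimes>\<^bsub>Om.W\<^esub> Om.Theta tv s = Om.Theta tv s \<otimes>\<^bsub>Om.W\<^esub> ?y" if s: "s \<in> carrier Om.T" for s
    by (rule lin_eq_tensor[OF R1_mod H_mod Om.lin_W_mult(2)[OF Om.Theta_lin[OF tv_R1] y] Om.lin_W_mult(1)[OF Om.Theta_lin[OF tv_R1] y] _ s])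
      (simp add: Om.Theta_pure[OF tv_R1] Om.act_mult_W y Om.tau_closed[OF tv_R1] t)
  have "?y \<otimes>\<^bsub>Om.W\<^esub> s = s \<otimes>\<^bsub>Om.W\<^esub> ?y" if s: "s \<in> carrier Om.T" for s
    using Th[of "Om.Theta ti s"] Theta_tv_ti[OF s] lin_mapD(1)[OF Om.Theta_lin[OF ti_R1] s] by simp
  then show ?thesis using y by (simp add: center_def)
qed

abbreviation zc where "zc \<equiv> mu_alpha_center K H \<alpha>"

text \<open>id \<otimes> \<epsilon> is a left inverse of b \<mapsto> b \<otimes> 1.\<close>

lemma tens_one_inj:
  assumes "tens K R1 H b \<one> = tens K R1 H b' \<one>" "b \<in> carrier R1" "b' \<in> carrier R1" shows "b = b'"
proof -
  have "coef R1 (counit H) (tens K R1 H b \<one>) = b" if "b \<in> carrier R1" for b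
    using coef_pure[OF R1_mod counit_dual that, of "\<one>"] that alg_homD(4)[OF counit_hom] by simp
  then show ?thesis using assms by metis
qed

text \<open>\<open>center_Om\<close> gives \<open>mu z\<close> = l \<otimes> 1 with l only in
  S(t_H)_\<Theta>. But \<open>mu z\<close> also comes from A: the inverse of \<phi> sends l
  \<otimes> 1 to l t^{-1}_1 \<otimes> 1, which lies in B \<otimes> H, so id \<otimes> \<epsilon>
  gives l t^{-1}_1 in B. Multiplying by t_1, an element of B, yields l.\<close>

lemma zc_exists:
  assumes z: "z \<in> center U"
  shows "\<exists>b\<in>carrier B. mu z = tens K R1 H b \<one>"
proof -
  have zQ: "z \<in> carrier Q" using z by (simp add: center_def)
  let ?l = "coef R1 (counit H) (mu z)"
  have l: "?l \<in> carrier R1" by (rule lin_mapD(1)[OF coef_lin[OF R1_mod counit_dual]]) (simp add: zQ)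
  have e: "mu z = tens K R1 H ?l \<one>" by (rule center_Om[OF mu_center[OF z]])
  let ?a = "ms z"
  note a = mu_sigma[OF zQ]
  have "A_incl K H \<alpha> ?a = Om.Theta ti (mu z)"
    using a Theta_ti_tv[of "A_incl K H \<alpha> ?a"] lin_mapD(1)[OF A_incl_lin a(1)] by (simp add: psi_def)
  also have "\<dots> = act R1 ?l (Om.tau ti \<one>)"
    using l by (subst e) (simp add: Om.Theta_pure[OF ti_R1])
  also have "Om.tau ti \<one> = tens K R1 H (ti \<one>) \<one>"
    unfolding Om.tau_def by (rule sw_one; (intro bilin_mapI lin ti_R1)?; simp)
  finally have i: "A_incl K H \<alpha> ?a = tens K R1 H (?l \<otimes>\<^bsub>R1\<^esub> ti \<one>) \<one>"
    using l by (simp add: act_pure)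
  have "coef B (counit H) ?a = coef R1 (counit H) (A_incl K H \<alpha> ?a)"
    unfolding A_incl_eq
    by (rule lift_natural[OF B_mod R1_mod H_mod B_mod R1_mod B_incl B_incl coef_bilin[OF B_mod counit_dual] coef_bilin[OF R1_mod counit_dual] _ a(1)])
      (simp add: B_ops)
  also have "\<dots> = ?l \<otimes>\<^bsub>R1\<^esub> ti \<one>"
    unfolding i using coef_pure[OF R1_mod counit_dual, of "?l \<otimes>\<^bsub>R1\<^esub> ti \<one>" "\<one>"] l alg_homD(4)[OF counit_hom] by simp
  finally have "?l \<otimes>\<^bsub>R1\<^esub> ti \<one> \<in> carrier B"
    using lin_mapD(1)[OF coef_lin[OF B_mod counit_dual] a(1)] by simp
  then have "?l \<otimes>\<^bsub>R1\<^esub> ti \<one> \<otimes>\<^bsub>B\<^esub> tv \<one> \<in> carrier B"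
    by (rule Aa.R.A.m_closed) simp
  moreover have "?l \<otimes>\<^bsub>R1\<^esub> ti \<one> \<otimes>\<^bsub>B\<^esub> tv \<one> = ?l"
    using l by (simp add: B_ops Om.R.A.m_assoc ti_tv_one)
  ultimately have "?l \<in> carrier B" by simp
  then show ?thesis using e by blast
qed

lemma zc:
  assumes z: "z \<in> center U"
  shows zc_closed: "zc z \<in> carrier B" and mu_zc: "mu z = tens K R1 H (zc z) \<one>"
proof -
  let ?P = "\<lambda>b. b \<in> carrier B \<and> mu z = tens K R1 H b \<one>"
  obtain b where b: "?P b" using zc_exists[OF z] by blast
  have "\<exists>!b. ?P b"
  proof (rule ex1I[of ?P, OF b])
    fix b' assume b': "?P b'"
    show "b' = b" by (rule tens_one_inj) (use b b' in simp_all)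
  qed
  then have "?P (zc z)" unfolding mu_alpha_center_def by (rule theI')
  then show "zc z \<in> carrier B" "mu z = tens K R1 H (zc z) \<one>" by blast+
qed

lemma zc_eqI: "z \<in> center U \<Longrightarrow> b \<in> carrier B \<Longrightarrow> mu z = tens K R1 H b \<one> \<Longrightarrow> zc z = b"
  using mu_zc zc_closed by (intro tens_one_inj) simp_all

lemma mu_zc_act: "z \<in> center U \<Longrightarrow> mu z = act R1 (zc z) \<one>\<^bsub>Om.W\<^esub>"
  using mu_zc[of z] zc_closed[of z] by (simp add: act_pure)

lemma U_comodule: "comodule_algebra K H U"
proof (rule comodule_algebra_transport[OF Om_comodule, of U mu])
  show "module K U" by (rule module_cong[of _ Q]) simp_all
  interpret Q: assoc_algebra K Q by (rule Q_alg)
  show "mu \<in> lin_map K U Om.W" using mu_lin by (simp add: lin_map_cong[of U Q])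
  have t: "carrier (tensor K U H) = carrier QH" "ring.add (tensor K U H) = ring.add QH" "smult (tensor K U H) = smult QH"
    using tensor_left_cong[of U Q K H] by simp_all
  show "coact U \<in> lin_map K U (tensor K U H)"
    using alg_homD(1)[OF U_coact_hom] t by (simp add: lin_map_def)
  show "tmap K U H Om.W mu (coact U x) = coact Om.W (mu x)"
    if "x \<in> carrier U" for x
    using mu_coact[of x] that by (simp only: tensor_lift_U U_simps)
  show "mu (x \<otimes>\<^bsub>U\<^esub> y) = mu x \<otimes>\<^bsub>Om.W\<^esub> mu y" if "x \<in> carrier U" "y \<in> carrier U" for x y
    using that alg_homD(3)[OF mu_hom] by simp
  show "x \<otimes>\<^bsub>U\<^esub> y \<in> carrier U" if "x \<in> carrier U" "y \<in> carrier U" for x y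
    using that by simp
  show "mu \<one>\<^bsub>U\<^esub> = \<one>\<^bsub>Om.W\<^esub>" using alg_homD(4)[OF mu_hom] by simp
  show "\<one>\<^bsub>U\<^esub> \<in> carrier U" by simp
  show "inj_on mu (carrier U)" using mu_inj by simp
qed

sublocale UA: assoc_algebra K U
  by (rule comodule_algebraD(1)[OF U_comodule])

abbreviation Z where "Z \<equiv> Z_ring K H \<alpha>"
abbreviation BZ where "BZ \<equiv> B_over_Z K H \<alpha>"
abbreviation UZ where "UZ \<equiv> U_over_Z K H \<alpha>"

lemma Z_cring: "cring Z"
  unfolding Z_ring_def by (rule center_subring(2)[OF UA.A.ring_axioms])

lemma Z_simps [simp]: "carrier Z = center U" "ring.add Z = ring.add Q" "monoid.mult Z = monoid.mult Q"
  "\<one>\<^bsub>Z\<^esub> = \<one>\<^bsub>Q\<^esub>" "\<zero>\<^bsub>Z\<^esub> = \<zero>\<^bsub>Q\<^esub>"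
  by (simp_all add: Z_ring_def)

lemma center_Q: "z \<in> center U \<Longrightarrow> z \<in> carrier Q"
  by (simp add: center_def)

lemma center_ops:
  "z \<in> center U \<Longrightarrow> z' \<in> center U \<Longrightarrow> z \<otimes>\<^bsub>Q\<^esub> z' \<in> center U"
  "z \<in> center U \<Longrightarrow> z' \<in> center U \<Longrightarrow> z \<oplus>\<^bsub>Q\<^esub> z' \<in> center U"
  "\<one>\<^bsub>Q\<^esub> \<in> center U"
  using subringE(3,6,7)[OF center_subring(1)[OF UA.A.ring_axioms]] by simp_all

lemma scal_center: "c \<in> carrier K \<Longrightarrow> c \<odot>\<^bsub>U\<^esub> \<one>\<^bsub>U\<^esub> \<in> center U"
  using UA.smult_closed[of c "\<one>\<^bsub>U\<^esub>"] UA.A.one_closed UA.smult_mult_left[of c "\<one>\<^bsub>U\<^esub>"] UA.smult_mult_right[of c _ "\<one>\<^bsub>U\<^esub>"]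
    UA.A.l_one UA.A.r_one by (simp add: center_def)

text \<open>By \<open>mu_zc_act\<close> the image of z is \<open>zc z\<close> times the unit, and
  coefficients can be taken out of products.\<close>

lemma mu_mult_zc: "z \<in> center U \<Longrightarrow> w \<in> carrier Q \<Longrightarrow> mu (z \<otimes>\<^bsub>Q\<^esub> w) = act R1 (zc z) (mu w)"
proof -
  assume z: "z \<in> center U" and w: "w \<in> carrier Q"
  interpret O: assoc_algebra K Om.W by (rule Om_alg)
  have o: "\<one>\<^bsub>Om.W\<^esub> \<in> carrier Om.T" by simp
  have "mu (z \<otimes>\<^bsub>Q\<^esub> w) = act R1 (zc z) \<one>\<^bsub>Om.W\<^esub> \<otimes>\<^bsub>Om.W\<^esub> mu w"
    by (simp only: alg_homD(3)[OF mu_hom center_Q[OF z] w] mu_zc_act[OF z])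
  also have "\<dots> = act R1 (zc z) (\<one>\<^bsub>Om.W\<^esub> \<otimes>\<^bsub>Om.W\<^esub> mu w)"
    by (rule Om.act_mult_W(1)) (use zc_closed[OF z] w o in simp_all)
  also have "\<one>\<^bsub>Om.W\<^esub> \<otimes>\<^bsub>Om.W\<^esub> mu w = mu w" using w by (intro O.A.l_one) simp
  finally show ?thesis .
qed

lemma zc_mult:
  assumes z: "z \<in> center U" and z': "z' \<in> center U"
  shows "zc (z \<otimes>\<^bsub>Q\<^esub> z') = zc z \<otimes>\<^bsub>B\<^esub> zc z'"
proof (rule zc_eqI[OF center_ops(1)[OF z z'] Aa.R.A.m_closed[OF zc_closed[OF z] zc_closed[OF z']]])
  show "mu (z \<otimes>\<^bsub>Q\<^esub> z') = tens K R1 H (zc z \<otimes>\<^bsub>B\<^esub> zc z') \<one>"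
    using zc_closed[OF z] zc_closed[OF z'] by (simp add: mu_mult_zc[OF z center_Q[OF z']] mu_zc[OF z'] act_pure B_ops)
qed

lemma zc_add:
  assumes z: "z \<in> center U" and z': "z' \<in> center U"
  shows "zc (z \<oplus>\<^bsub>Q\<^esub> z') = zc z \<oplus>\<^bsub>B\<^esub> zc z'"
proof (rule zc_eqI[OF center_ops(2)[OF z z'] Aa.R.M.a_closed[OF zc_closed[OF z] zc_closed[OF z']]])
  show "mu (z \<oplus>\<^bsub>Q\<^esub> z') = tens K R1 H (zc z \<oplus>\<^bsub>B\<^esub> zc z') \<one>"
    using zc_closed[OF z] zc_closed[OF z'] lin_mapD(2)[OF mu_lin center_Q[OF z] center_Q[OF z']]
    by (simp add: mu_zc[OF z] mu_zc[OF z'] B_ops tens_add_l)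
qed

lemma zc_scal:
  assumes c: "c \<in> carrier K"
  shows "zc (c \<odot>\<^bsub>Q\<^esub> \<one>\<^bsub>Q\<^esub>) = c \<odot>\<^bsub>B\<^esub> \<one>\<^bsub>B\<^esub>"
proof (rule zc_eqI)
  show "c \<odot>\<^bsub>Q\<^esub> \<one>\<^bsub>Q\<^esub> \<in> center U" using scal_center[OF c] by simp
  show "c \<odot>\<^bsub>B\<^esub> \<one>\<^bsub>B\<^esub> \<in> carrier B" using c by simp
  have "mu (c \<odot>\<^bsub>Q\<^esub> \<one>\<^bsub>Q\<^esub>) = c \<odot>\<^bsub>Om.T\<^esub> mu \<one>\<^bsub>Q\<^esub>"
    by (rule lin_mapD(3)[OF mu_lin c center_Q[OF center_ops(3)]])
  then show "mu (c \<odot>\<^bsub>Q\<^esub> \<one>\<^bsub>Q\<^esub>) = tens K R1 H (c \<odot>\<^bsub>B\<^esub> \<one>\<^bsub>B\<^esub>) \<one>"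
    using c alg_homD(4)[OF mu_hom] by (simp add: smult_tens B_ops)
qed

lemma zc_one: "zc \<one>\<^bsub>Q\<^esub> = \<one>\<^bsub>B\<^esub>"
  using alg_homD(4)[OF mu_hom] Aa.R.A.one_closed by (intro zc_eqI center_ops) (simp_all add: B_ops)

end

section \<open>The tensor product over the center\<close>

lemma abelian_group_with_smult:
  assumes "abelian_group A" shows "abelian_group (with_smult A f)"
proof -
  interpret A: abelian_group A by fact
  show ?thesis
  proof (rule abelian_groupI)
    fix x assume "x \<in> carrier (with_smult A f)"
    then show "\<exists>y\<in>carrier (with_smult A f). y \<oplus>\<^bsub>with_smult A f\<^esub> x = \<zero>\<^bsub>with_smult A f\<^esub>"
      by (intro bexI[of _ "\<ominus>\<^bsub>A\<^esub> x"]) (simp_all add: with_smult_def A.l_neg)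
  qed (simp_all add: with_smult_def A.a_ac)
qed

context hopf_nondegenerate
begin

lemma BZ_simps [simp]: "carrier BZ = carrier B" "ring.add BZ = ring.add B" "monoid.mult BZ = monoid.mult B"
  "\<one>\<^bsub>BZ\<^esub> = \<one>\<^bsub>B\<^esub>" "\<zero>\<^bsub>BZ\<^esub> = \<zero>\<^bsub>B\<^esub>" "z \<odot>\<^bsub>BZ\<^esub> b = zc z \<otimes>\<^bsub>B\<^esub> b"
  by (simp_all add: B_over_Z_def with_smult_def)

lemma UZ_simps [simp]: "carrier UZ = carrier Q" "ring.add UZ = ring.add Q" "monoid.mult UZ = monoid.mult Q"
  "\<one>\<^bsub>UZ\<^esub> = \<one>\<^bsub>Q\<^esub>" "\<zero>\<^bsub>UZ\<^esub> = \<zero>\<^bsub>Q\<^esub>" "smult UZ = monoid.mult Q"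
  by (simp_all add: U_over_Z_def with_smult_def)

interpretation QA: assoc_algebra K Q by (rule Q_alg)
interpretation AT: module K Aa.T by simp

lemma BZ_mod [simp]: "module Z BZ"
proof (intro module.intro module_axioms.intro Z_cring)
  show "abelian_group BZ"
    unfolding B_over_Z_def by (intro abelian_group_with_smult module_abelian) (rule B_mod)
qed (simp_all add: zc_closed zc_mult zc_add zc_one Aa.R.A.l_distr Aa.R.A.r_distr Aa.R.A.m_assoc)

lemma UZ_mod [simp]: "module Z UZ"
proof (intro module.intro module_axioms.intro Z_cring)
  show "abelian_group UZ"
    unfolding U_over_Z_def by (intro abelian_group_with_smult) (rule UA.M.abelian_group_axioms)
qed (simp_all add: center_Q QA.A.l_distr QA.A.r_distr QA.A.m_assoc)

abbreviation BUT where "BUT \<equiv> tensor Z BZ UZ"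

lemma psi_eqI: "psi a = psi a' \<Longrightarrow> a \<in> carrier Aa.T \<Longrightarrow> a' \<in> carrier Aa.T \<Longrightarrow> a = a'"
  by (rule inj_onD[OF psi_inj])

lemma act_B_closed [simp]: "b \<in> carrier B \<Longrightarrow> t \<in> carrier Aa.T \<Longrightarrow> act B b t \<in> carrier Aa.T"
  by (rule lin_mapD(1)[OF act_lin[OF B_alg']])

lemma ms_lin: "ms \<in> lin_map K Q Aa.T"
proof (intro lin_mapI)
  note p = lin_mapD[OF psi_lin] and m = lin_mapD[OF mu_lin]
  show "ms w \<in> carrier Aa.T" if "w \<in> carrier Q" for w by (rule mu_sigma(1)[OF that])
  show "ms (w \<oplus>\<^bsub>Q\<^esub> w') = ms w \<oplus>\<^bsub>Aa.T\<^esub> ms w'" if "w \<in> carrier Q" "w' \<in> carrier Q" for w w'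
    by (rule psi_eqI) (use that in \<open>simp_all add: p m mu_sigma\<close>)
  show "ms (c \<odot>\<^bsub>Q\<^esub> w) = c \<odot>\<^bsub>Aa.T\<^esub> ms w" if "c \<in> carrier K" "w \<in> carrier Q" for c w
    by (rule psi_eqI) (use that in \<open>simp_all add: p m mu_sigma\<close>)
qed

lemmas msD = lin_mapD[OF ms_lin]

lemma ms_mult: "w \<in> carrier Q \<Longrightarrow> w' \<in> carrier Q \<Longrightarrow> ms (w \<otimes>\<^bsub>Q\<^esub> w') = ms w \<otimes>\<^bsub>Aa.W\<^esub> ms w'"
  by (rule psi_eqI) (simp_all add: psi_mult mu_sigma msD(1) alg_homD(3)[OF mu_hom] Aa.mult_closed)

lemma ms_zc: "z \<in> center U \<Longrightarrow> w \<in> carrier Q \<Longrightarrow> ms (z \<otimes>\<^bsub>Q\<^esub> w) = act B (zc z) (ms w)"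
  by (rule psi_eqI) (simp_all add: psi_act mu_sigma msD(1) mu_mult_zc zc_closed center_Q)

lemma ms_one: "ms \<one>\<^bsub>Q\<^esub> = \<one>\<^bsub>Aa.W\<^esub>"
proof (rule psi_eqI)
  show "psi (ms \<one>\<^bsub>Q\<^esub>) = psi \<one>\<^bsub>Aa.W\<^esub>"
    unfolding psi_one mu_sigma(2)[OF QA.A.one_closed] by (rule alg_homD(4)[OF mu_hom])
qed (simp_all add: msD(1))

text \<open>Both sides are compared after the injective map \<open>psi\<close> \<otimes> id, where
  they become the coaction of \<open>mu w\<close>.\<close>

lemma ms_coact:
  assumes w: "w \<in> carrier Q"
  shows "coact Aa.W (ms w) = tmap K Q H Aa.T ms (coact U w)"
proof -
  have m: "module K Aa.T" "module K Om.T" by simp_all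
  have cU: "coact U w \<in> carrier QH" by (rule alg_homD(2)[OF U_coact_hom w])
  let ?M = "tmap K Q H Aa.T ms"
  let ?F = "tmap K Aa.T H Om.T psi"
  have "?F (?M (coact U w)) = tmap K Q H Om.T (\<lambda>x. psi (ms x)) (coact U w)"
    by (rule tmap_tmap[OF Q_mod m ms_lin psi_lin cU])
  also have "\<dots> = tmap K Q H Om.T mu (coact U w)"
    by (rule fun_cong[OF tensor_lift_cong]) (simp add: mu_sigma)
  also have "\<dots> = muH (coact U w)" by (simp add: Om.tensor_lift_W_group)
  also have "\<dots> = ?F (coact Aa.W (ms w))"
    unfolding mu_coact[OF w] psi_coact[OF mu_sigma(1)[OF w]] mu_sigma(2)[OF w] ..
  finally have e: "?F (?M (coact U w)) = ?F (coact Aa.W (ms w))" .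
  have inj: "inj_on ?F (carrier Aa.TH)"
    by (rule tmap_inj[OF K H_mod m psi_lin psi_inj])
  have c: "?M (coact U w) \<in> carrier Aa.TH"
    by (rule lin_mapD(1)[OF lin_tmap[OF Q_mod m(1) H_mod ms_lin] cU])
  have c': "coact Aa.W (ms w) \<in> carrier Aa.TH"
    by (rule Aa.coact_closed[OF msD(1)[OF w]])
  have "?M (coact U w) = coact Aa.W (ms w)"
    by (rule inj_onD[OF inj e c c'])
  then show ?thesis ..
qed

text \<open>The lift is taken over Z, whereas A is a module record over k only. Its values on pure
  tensors and its additivity therefore come from \<open>Phi_balanced\<close>, and k-linearity is
  added afterwards in \<open>Phi_lin\<close>.\<close>

definition Phi where
  "Phi = tlift Z BZ UZ Aa.T (\<lambda>b w. act B b (ms w))"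

lemma Phi_balanced: "balanced Z BZ UZ (add_monoid Aa.T) (\<lambda>b w. act B b (ms w))"
  unfolding balanced_def
proof (intro conjI ballI)
  fix z b w assume "z \<in> carrier Z" "b \<in> carrier BZ" "w \<in> carrier UZ"
  then have *: "z \<in> center U" "b \<in> carrier B" "w \<in> carrier Q" by simp_all
  then show "act B (z \<odot>\<^bsub>BZ\<^esub> b) (ms w) = act B b (ms (z \<odot>\<^bsub>UZ\<^esub> w))"
    by (simp add: ms_zc act_mult zc_closed msD(1) Aa.RC.m_comm)
next
  fix b b' w assume "b \<in> carrier BZ" "b' \<in> carrier BZ" "w \<in> carrier UZ"
  then show "act B (b \<oplus>\<^bsub>BZ\<^esub> b') (ms w) = act B b (ms w) \<otimes>\<^bsub>add_monoid Aa.T\<^esub> act B b' (ms w)"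
    using lin_mapD(2)[OF act_lin_l[OF B_alg' msD(1)]] by simp
next
  fix b w w' assume "b \<in> carrier BZ" "w \<in> carrier UZ" "w' \<in> carrier UZ"
  then show "act B b (ms (w \<oplus>\<^bsub>UZ\<^esub> w')) = act B b (ms w) \<otimes>\<^bsub>add_monoid Aa.T\<^esub> act B b (ms w')"
    using lin_mapD(2)[OF act_lin[OF B_alg']] by (simp add: msD)
qed (simp add: msD(1))

lemma Phi_tens: "b \<in> carrier B \<Longrightarrow> w \<in> carrier Q \<Longrightarrow> Phi (tens Z BZ UZ b w) = act B b (ms w)"
  and Phi_closed [simp]: "t \<in> carrier BUT \<Longrightarrow> Phi t \<in> carrier Aa.T"
  and Phi_add: "s \<in> carrier BUT \<Longrightarrow> t \<in> carrier BUT \<Longrightarrow> Phi (s \<oplus>\<^bsub>BUT\<^esub> t) = Phi s \<oplus>\<^bsub>Aa.T\<^esub> Phi t"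
  using tensor_lift_balanced[OF BZ_mod UZ_mod AT.M.abelian_group_axioms Phi_balanced]
  by (simp_all add: Phi_def)

lemma BU_tens_closed [simp]: "b \<in> carrier B \<Longrightarrow> w \<in> carrier Q \<Longrightarrow> tens Z BZ UZ b w \<in> carrier BUT"
  using tens_closed[OF BZ_mod UZ_mod] by simp

definition TK where "TK = with_smult BUT (\<lambda>c s. (c \<odot>\<^bsub>U\<^esub> \<one>\<^bsub>U\<^esub>) \<odot>\<^bsub>BUT\<^esub> s)"

lemma TK_simps [simp]: "carrier TK = carrier BUT" "ring.add TK = ring.add BUT" "monoid.mult TK = monoid.mult BUT"
  "\<one>\<^bsub>TK\<^esub> = \<one>\<^bsub>BUT\<^esub>" "\<zero>\<^bsub>TK\<^esub> = \<zero>\<^bsub>BUT\<^esub>" "c \<odot>\<^bsub>TK\<^esub> s = (c \<odot>\<^bsub>Q\<^esub> \<one>\<^bsub>Q\<^esub>) \<odot>\<^bsub>BUT\<^esub> s"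
  by (simp_all add: TK_def with_smult_def)

interpretation M: module Z BUT by simp

lemmas scal_center' = scal_center[simplified]

lemma TK_mod [simp]: "module K TK"
proof (intro module.intro module_axioms.intro K.is_cring)
  show "abelian_group TK" unfolding TK_def by (rule abelian_group_with_smult[OF M.M.abelian_group_axioms])
next
  fix c d x assume "c \<in> carrier K" "d \<in> carrier K" "x \<in> carrier TK"
  then show "(c \<oplus>\<^bsub>K\<^esub> d) \<odot>\<^bsub>TK\<^esub> x = c \<odot>\<^bsub>TK\<^esub> x \<oplus>\<^bsub>TK\<^esub> d \<odot>\<^bsub>TK\<^esub> x"
    "(c \<otimes>\<^bsub>K\<^esub> d) \<odot>\<^bsub>TK\<^esub> x = c \<odot>\<^bsub>TK\<^esub> (d \<odot>\<^bsub>TK\<^esub> x)"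
    using M.smult_l_distr[of "c \<odot>\<^bsub>Q\<^esub> \<one>\<^bsub>Q\<^esub>" "d \<odot>\<^bsub>Q\<^esub> \<one>\<^bsub>Q\<^esub>" x] M.smult_assoc1[of "c \<odot>\<^bsub>Q\<^esub> \<one>\<^bsub>Q\<^esub>" "d \<odot>\<^bsub>Q\<^esub> \<one>\<^bsub>Q\<^esub>" x]
    by (simp_all add: scal_center' QA.smult_l_distr scal_mult[OF Q_alg])
next
  fix c x y assume "c \<in> carrier K" "x \<in> carrier TK" "y \<in> carrier TK"
  then show "c \<odot>\<^bsub>TK\<^esub> (x \<oplus>\<^bsub>TK\<^esub> y) = c \<odot>\<^bsub>TK\<^esub> x \<oplus>\<^bsub>TK\<^esub> c \<odot>\<^bsub>TK\<^esub> y" "c \<odot>\<^bsub>TK\<^esub> x \<in> carrier TK"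
    by (simp_all add: scal_center' M.smult_r_distr)
next
  fix x assume "x \<in> carrier TK"
  then show "\<one>\<^bsub>K\<^esub> \<odot>\<^bsub>TK\<^esub> x = x"
    using M.smult_one[of x] by simp
qed

lemma Phi_lin: "Phi \<in> lin_map K TK Aa.T"
proof (intro lin_mapI)
  fix c t assume c: "c \<in> carrier K" and "t \<in> carrier TK"
  then have "t \<in> carrier BUT" by simp
  with BZ_mod UZ_mod show "Phi (c \<odot>\<^bsub>TK\<^esub> t) = c \<odot>\<^bsub>Aa.T\<^esub> Phi t"
  proof (induction t rule: tensor_induct)
    case (pure b w)
    then have bw: "b \<in> carrier B" "w \<in> carrier Q" by simp_all
    have "c \<odot>\<^bsub>TK\<^esub> tens Z BZ UZ b w = tens Z BZ UZ ((c \<odot>\<^bsub>B\<^esub> \<one>\<^bsub>B\<^esub>) \<otimes>\<^bsub>B\<^esub> b) w"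
      using bw c by (simp add: smult_tens scal_center' zc_scal)
    then show ?case
      using bw c by (simp add: Phi_tens act_mult[symmetric] act_smult msD(1))
  next
    case (add s t)
    then show ?case using c by (simp add: scal_center' M.smult_r_distr Phi_add AT.smult_r_distr)
  qed
qed (simp_all add: Phi_add)

text \<open>\<open>mu_sigma\<close> sends the class of X_h to 1 \<otimes> h, both being mapped to
  \<tau>(h) by the embedding into S(t_H)_\<Theta> \<otimes>^\<alpha> H; hence b \<otimes> X_h is a
  preimage of b \<otimes> h.\<close>

lemma Phi_surj:
  assumes "a \<in> carrier Aa.T" shows "\<exists>t\<in>carrier BUT. Phi t = a"
  using B_mod H_mod assms
proof (induction a rule: tensor_induct)
  case (pure b h)
  have X: "pr (XV h) \<in> carrier Q" using pure(2) by (intro alg_homD(2)[OF pr_hom]) simp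
  have "ms (pr (XV h)) = tens K B H \<one>\<^bsub>B\<^esub> h"
    by (rule psi_eqI) (use pure X in \<open>simp_all add: mu_sigma mu_pr mt act_one_tau\<close>)
  then have "Phi (tens Z BZ UZ b (pr (XV h))) = tens K B H b h"
    using pure X by (simp add: Phi_tens act_pure)
  then show ?case using pure(1) X by (intro bexI[of _ "tens Z BZ UZ b (pr (XV h))"]) simp_all
next
  case (add s t)
  then show ?case using Phi_add M.M.a_closed by metis
qed

lemma Phi_mult_pure:
  assumes "b \<in> carrier B" "w \<in> carrier Q" "b' \<in> carrier B" "w' \<in> carrier Q"
  shows "Phi (tens Z BZ UZ (b \<otimes>\<^bsub>BZ\<^esub> b') (w \<otimes>\<^bsub>UZ\<^esub> w')) =
    Phi (tens Z BZ UZ b w) \<otimes>\<^bsub>Aa.W\<^esub> Phi (tens Z BZ UZ b' w')"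
  using assms by (simp add: Phi_tens ms_mult Aa.act_mult_W msD(1) act_mult Aa.mult_closed Aa.RC.m_comm)

end

section \<open>Localization, injectivity of \<open>Phi\<close>, and the algebra B \<otimes>_Z
  U\<close>

locale hopf_nice = hopf_nondegenerate +
  assumes localization: "is_localization B (zc ` center U)"
begin

interpretation QA: assoc_algebra K Q by (rule Q_alg)
interpretation AT: module K Aa.T by simp
interpretation M: module Z BUT by simp

text \<open>A numerator from Z moves across the tensor sign, and sums are brought to a common
  denominator. Denominators are recorded as units of B in the image of the center, a set closed
  under products by \<open>zc_mult\<close>.\<close>

lemma fraction_tens:
  assumes "t \<in> carrier BUT"
  shows "\<exists>s\<in>zc ` center U \<inter> Units B. \<exists>w\<in>carrier Q. t = tens Z BZ UZ (inv\<^bsub>B\<^esub> s) w"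
  using BZ_mod UZ_mod assms
proof (induction t rule: tensor_induct)
  case (pure b w)
  then have bw: "b \<in> carrier B" "w \<in> carrier Q" by simp_all
  obtain S where S: "S \<subseteq> zc ` center U" "S \<subseteq> Units B"
    and loc: "\<forall>b\<in>carrier B. \<exists>x\<in>zc ` center U. \<exists>s\<in>S. b = x \<otimes>\<^bsub>B\<^esub> inv\<^bsub>B\<^esub> s"
    using localization unfolding is_localization_def by (elim exE conjE)
  obtain x s where x: "x \<in> zc ` center U" and s': "s \<in> S" and b': "b = x \<otimes>\<^bsub>B\<^esub> inv\<^bsub>B\<^esub> s"
    using bspec[OF loc bw(1)] by (elim bexE)
  obtain z where z: "z \<in> center U" "x = zc z" using x by (elim imageE)
  have s: "s \<in> zc ` center U \<inter> Units B" using S s' by (intro IntI subsetD[OF S(1)] subsetD[OF S(2)])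
  have b: "b = zc z \<otimes>\<^bsub>B\<^esub> inv\<^bsub>B\<^esub> s" unfolding b' z(2) ..
  have si: "inv\<^bsub>B\<^esub> s \<in> carrier B" using s by simp
  have "tens Z BZ UZ b w = tens Z BZ UZ (inv\<^bsub>B\<^esub> s) (z \<otimes>\<^bsub>Q\<^esub> w)"
    using tens_balanced[OF BZ_mod UZ_mod, of z "inv\<^bsub>B\<^esub> s" w] z bw si by (simp add: b)
  moreover have "z \<otimes>\<^bsub>Q\<^esub> w \<in> carrier Q" using z(1) bw by (simp add: center_Q)
  ultimately show ?case by (rule_tac bexI[OF _ s], rule_tac bexI)
next
  case (add t t')
  then obtain s w s' w' where s: "s \<in> zc ` center U \<inter> Units B" "s' \<in> zc ` center U \<inter> Units B"
    and w: "w \<in> carrier Q" "w' \<in> carrier Q"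
    and t: "t = tens Z BZ UZ (inv\<^bsub>B\<^esub> s) w" "t' = tens Z BZ UZ (inv\<^bsub>B\<^esub> s') w'" by blast
  obtain z z' where z: "z \<in> center U" "s = zc z" "z' \<in> center U" "s' = zc z'" using s by blast
  have sU: "s \<in> Units B" "s' \<in> Units B" using s by simp_all
  then have sc [simp]: "s \<in> carrier B" "s' \<in> carrier B" "inv\<^bsub>B\<^esub> s \<in> carrier B" "inv\<^bsub>B\<^esub> s' \<in> carrier B"
    by (simp_all add: Aa.R.A.Units_closed)
  \<comment> \<open>The common denominator: s'/r = 1/s and s/r = 1/s', where s and s' come from Z
    and can therefore be moved to the right factor.\<close>
  let ?r = "s \<otimes>\<^bsub>B\<^esub> s'"
  have rU: "?r \<in> Units B" by (rule Aa.R.A.Units_m_closed[OF sU])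
  have ri: "inv\<^bsub>B\<^esub> ?r \<in> carrier B" using rU by simp
  have e: "s' \<otimes>\<^bsub>B\<^esub> inv\<^bsub>B\<^esub> ?r = inv\<^bsub>B\<^esub> s"
  proof -
    have "s' \<otimes>\<^bsub>B\<^esub> inv\<^bsub>B\<^esub> ?r = (inv\<^bsub>B\<^esub> s \<otimes>\<^bsub>B\<^esub> s) \<otimes>\<^bsub>B\<^esub> (s' \<otimes>\<^bsub>B\<^esub> inv\<^bsub>B\<^esub> ?r)"
      using sU ri by (simp add: Aa.R.A.Units_l_inv)
    also have "\<dots> = inv\<^bsub>B\<^esub> s \<otimes>\<^bsub>B\<^esub> (?r \<otimes>\<^bsub>B\<^esub> inv\<^bsub>B\<^esub> ?r)" using ri by (simp add: Aa.R.A.m_assoc)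
    finally show ?thesis using rU by (simp add: Aa.R.A.Units_r_inv)
  qed
  have e': "s \<otimes>\<^bsub>B\<^esub> inv\<^bsub>B\<^esub> ?r = inv\<^bsub>B\<^esub> s'"
  proof -
    have "s \<otimes>\<^bsub>B\<^esub> inv\<^bsub>B\<^esub> ?r = (inv\<^bsub>B\<^esub> s' \<otimes>\<^bsub>B\<^esub> s') \<otimes>\<^bsub>B\<^esub> (s \<otimes>\<^bsub>B\<^esub> inv\<^bsub>B\<^esub> ?r)"
      using sU ri by (simp add: Aa.R.A.Units_l_inv)
    also have "\<dots> = inv\<^bsub>B\<^esub> s' \<otimes>\<^bsub>B\<^esub> (s' \<otimes>\<^bsub>B\<^esub> s \<otimes>\<^bsub>B\<^esub> inv\<^bsub>B\<^esub> ?r)" using ri by (simp add: Aa.R.A.m_assoc)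
    also have "s' \<otimes>\<^bsub>B\<^esub> s = ?r" by (rule Aa.RC.m_comm[OF sc(2,1)])
    finally show ?thesis using rU by (simp add: Aa.R.A.Units_r_inv)
  qed
  have "t = tens Z BZ UZ (inv\<^bsub>B\<^esub> ?r) (z' \<otimes>\<^bsub>Q\<^esub> w)" "t' = tens Z BZ UZ (inv\<^bsub>B\<^esub> ?r) (z \<otimes>\<^bsub>Q\<^esub> w')"
    using tens_balanced[OF BZ_mod UZ_mod, of z' "inv\<^bsub>B\<^esub> ?r" w] tens_balanced[OF BZ_mod UZ_mod, of z "inv\<^bsub>B\<^esub> ?r" w']
      z w ri e e' t by simp_all
  then have "t \<oplus>\<^bsub>BUT\<^esub> t' = tens Z BZ UZ (inv\<^bsub>B\<^esub> ?r) (z' \<otimes>\<^bsub>Q\<^esub> w \<oplus>\<^bsub>Q\<^esub> z \<otimes>\<^bsub>Q\<^esub> w')"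
    using tens_add_r[OF BZ_mod UZ_mod, of "inv\<^bsub>B\<^esub> ?r" "z' \<otimes>\<^bsub>Q\<^esub> w" "z \<otimes>\<^bsub>Q\<^esub> w'"] ri z w center_Q by simp
  moreover have "?r \<in> zc ` center U \<inter> Units B"
  proof (rule IntI[OF image_eqI rU])
    show "?r = zc (z \<otimes>\<^bsub>Q\<^esub> z')" using z by (simp add: zc_mult)
    show "z \<otimes>\<^bsub>Q\<^esub> z' \<in> center U" using z by (simp add: center_ops)
  qed
  moreover have "z' \<otimes>\<^bsub>Q\<^esub> w \<oplus>\<^bsub>Q\<^esub> z \<otimes>\<^bsub>Q\<^esub> w' \<in> carrier Q" using z w center_Q by simp
  ultimately show ?case by blast
qed

lemma Phi_inj: "inj_on Phi (carrier BUT)"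
proof -
  note ab = module_abelian[OF TK_mod] AT.M.abelian_group_axioms
  have "inj_on Phi (carrier TK)"
  proof (rule lin_map_inj[OF Phi_lin ab])
    fix t assume t: "t \<in> carrier TK" and 0: "Phi t = \<zero>\<^bsub>Aa.T\<^esub>"
    have "t \<in> carrier BUT" using t by simp
    then obtain s w where s: "s \<in> Units B" and w: "w \<in> carrier Q" and tt: "t = tens Z BZ UZ (inv\<^bsub>B\<^esub> s) w"
      using fraction_tens by blast
    have sc: "s \<in> carrier B" "inv\<^bsub>B\<^esub> s \<in> carrier B" using s by (simp_all add: Aa.R.A.Units_closed)
    have "ms w = act B s (act B (inv\<^bsub>B\<^esub> s) (ms w))"
      using s sc w by (simp add: act_mult msD(1) act_one)
    also have "\<dots> = act B s \<zero>\<^bsub>Aa.T\<^esub>"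
      using 0 Phi_tens[OF sc(2) w] unfolding tt by simp
    also have "\<dots> = \<zero>\<^bsub>Aa.T\<^esub>" by (rule lin_map_zero[OF act_lin[OF B_alg' sc(1)] ab(2,2)])
    finally have "mu w = psi \<zero>\<^bsub>Aa.T\<^esub>" using mu_sigma(2)[OF w] by simp
    also have "\<dots> = \<zero>\<^bsub>Om.T\<^esub>" by (rule lin_map_zero[OF psi_lin ab(2) tensor_abelian[OF R1_mod H_mod]])
    also have "\<dots> = mu \<zero>\<^bsub>Q\<^esub>"
      by (rule lin_map_zero[OF mu_lin assoc_algebra_abelian[OF Q_alg] tensor_abelian[OF R1_mod H_mod], symmetric])
    finally have "w = \<zero>\<^bsub>Q\<^esub>" using inj_onD[OF mu_inj _ w] by simp
    moreover have "(\<lambda>w. tens Z BZ UZ (inv\<^bsub>B\<^esub> s) w) \<in> lin_map Z UZ BUT"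
      using sc by (intro lin_tens_r lin_id) simp_all
    then have "tens Z BZ UZ (inv\<^bsub>B\<^esub> s) \<zero>\<^bsub>UZ\<^esub> = \<zero>\<^bsub>BUT\<^esub>"
      by (rule lin_map_zero[OF _ module_abelian[OF UZ_mod] tensor_abelian[OF BZ_mod UZ_mod]])
    ultimately show "t = \<zero>\<^bsub>TK\<^esub>" using tt by simp
  qed
  then show ?thesis by simp
qed

text \<open>The inverse of \<open>Phi\<close>, available before B \<otimes>_Z U is known to be an
  algebra; its product and coaction are computed through it.\<close>

definition Pinv where "Pinv = inv_into (carrier BUT) Phi"

lemma Pinv:
  assumes "a \<in> carrier Aa.T" shows "Pinv a \<in> carrier BUT" "Phi (Pinv a) = a"
proof -
  have "a \<in> Phi ` carrier BUT" using Phi_surj[OF assms] by blast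
  then show "Pinv a \<in> carrier BUT" "Phi (Pinv a) = a"
    unfolding Pinv_def by (rule inv_into_into, rule f_inv_into_f)
qed

lemma Pinv_Phi: "t \<in> carrier BUT \<Longrightarrow> Pinv (Phi t) = t"
  unfolding Pinv_def by (rule inv_into_f_f[OF Phi_inj])

lemma Phi_eqI: "Phi s = Phi t \<Longrightarrow> s \<in> carrier BUT \<Longrightarrow> t \<in> carrier BUT \<Longrightarrow> s = t"
  by (rule inj_onD[OF Phi_inj])

lemma Pinv_lin: "Pinv \<in> lin_map K Aa.T TK"
proof (intro lin_mapI)
  note P = lin_mapD[OF Phi_lin]
  show "Pinv a \<in> carrier TK" if "a \<in> carrier Aa.T" for a using Pinv(1)[OF that] by simp
  show "Pinv (a \<oplus>\<^bsub>Aa.T\<^esub> a') = Pinv a \<oplus>\<^bsub>TK\<^esub> Pinv a'" if "a \<in> carrier Aa.T" "a' \<in> carrier Aa.T" for a a'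
    by (rule Phi_eqI) (use that in \<open>simp_all add: Phi_add Pinv\<close>)
  show "Pinv (c \<odot>\<^bsub>Aa.T\<^esub> a) = c \<odot>\<^bsub>TK\<^esub> Pinv a" if ca: "c \<in> carrier K" "a \<in> carrier Aa.T" for c a
  proof (rule Phi_eqI)
    have p: "Pinv a \<in> carrier TK" using Pinv(1)[OF ca(2)] by simp
    show "Phi (Pinv (c \<odot>\<^bsub>Aa.T\<^esub> a)) = Phi (c \<odot>\<^bsub>TK\<^esub> Pinv a)"
      unfolding P(3)[OF ca(1) p] using ca by (simp add: Pinv)
    show "c \<odot>\<^bsub>TK\<^esub> Pinv a \<in> carrier BUT"
      using ca Pinv(1)[OF ca(2)] by (simp add: scal_center')
  qed (use ca in \<open>simp add: Pinv\<close>)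
qed

text \<open>The expression on the right is additive in each argument and takes the prescribed values
  on pure tensors by \<open>Phi_mult_pure\<close>. \<open>tensor_lift_eqI\<close> then identifies it
  with the inner lift and, in a second application, with the outer one.\<close>

lemma BUT_mult:
  assumes s: "s \<in> carrier BUT" and t: "t \<in> carrier BUT"
  shows "s \<otimes>\<^bsub>BUT\<^esub> t = Pinv (Phi s \<otimes>\<^bsub>Aa.W\<^esub> Phi t)"
proof -
  note lm = bilin_mapD[OF Aa.W_mult_bilin]
  \<comment> \<open>The lifts run over Z, but only additivity is required of the candidate, so
    k-linear maps qualify.\<close>
  have hom: "g \<in> hom (tensor_group Z BZ UZ) (add_monoid BUT)" if "g \<in> lin_map K TK TK" for g
    using lin_map_hom[OF that] unfolding hom_add_monoid_tensor[symmetric] by (simp add: hom_def)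
  have in_lm: "tlift Z BZ UZ BUT (\<lambda>b' w'. tens Z BZ UZ (b \<otimes>\<^bsub>BZ\<^esub> b') (w \<otimes>\<^bsub>UZ\<^esub> w')) t =
      Pinv (Phi (tens Z BZ UZ b w) \<otimes>\<^bsub>Aa.W\<^esub> Phi t)" if bw: "b \<in> carrier B" "w \<in> carrier Q" for b w
  proof (rule tensor_lift_eqI[OF BZ_mod UZ_mod hom _ t, of "\<lambda>t. Pinv (Phi (tens Z BZ UZ b w) \<otimes>\<^bsub>Aa.W\<^esub> Phi t)"])
    show "(\<lambda>t. Pinv (Phi (tens Z BZ UZ b w) \<otimes>\<^bsub>Aa.W\<^esub> Phi t)) \<in> lin_map K TK TK"
      using bw by (intro lin_comp[OF Pinv_lin] Aa.lin_W_mult(2) Phi_lin Phi_closed BU_tens_closed)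
    fix b' w' assume bw': "b' \<in> carrier BZ" "w' \<in> carrier UZ"
    have "Pinv (Phi (tens Z BZ UZ b w) \<otimes>\<^bsub>Aa.W\<^esub> Phi (tens Z BZ UZ b' w')) =
        Pinv (Phi (tens Z BZ UZ (b \<otimes>\<^bsub>BZ\<^esub> b') (w \<otimes>\<^bsub>UZ\<^esub> w')))"
      using bw bw' by (subst Phi_mult_pure) simp_all
    also have "\<dots> = tens Z BZ UZ (b \<otimes>\<^bsub>BZ\<^esub> b') (w \<otimes>\<^bsub>UZ\<^esub> w')"
      using bw bw' by (intro Pinv_Phi) simp
    finally show "Pinv (Phi (tens Z BZ UZ b w) \<otimes>\<^bsub>Aa.W\<^esub> Phi (tens Z BZ UZ b' w')) = \<dots>" .
  qed
  show ?thesis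
    unfolding tensor_mult
  proof (rule tensor_lift_eqI[OF BZ_mod UZ_mod hom _ s, of "\<lambda>s. Pinv (Phi s \<otimes>\<^bsub>Aa.W\<^esub> Phi t)"])
    show "(\<lambda>s. Pinv (Phi s \<otimes>\<^bsub>Aa.W\<^esub> Phi t)) \<in> lin_map K TK TK"
      using t by (intro lin_comp[OF Pinv_lin] Aa.lin_W_mult(1) Phi_lin Phi_closed)
  qed (use in_lm in simp)
qed

abbreviation BU where "BU \<equiv> BU_alg K H \<alpha>"

lemma BU_eq: "BU = with_coact TK (tlift Z BZ UZ (tensor K TK H) (\<lambda>b w.
    tmap K U H TK (BU_tens K H \<alpha> b) (coact U w)))"
  unfolding BU_alg_def Let_def TK_def ..

lemma BU_simps [simp]: "carrier BU = carrier BUT" "ring.add BU = ring.add BUT" "monoid.mult BU = monoid.mult BUT"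
  "\<one>\<^bsub>BU\<^esub> = \<one>\<^bsub>BUT\<^esub>" "\<zero>\<^bsub>BU\<^esub> = \<zero>\<^bsub>BUT\<^esub>" "smult BU = smult TK"
  by (simp_all add: BU_eq with_coact_def)

abbreviation TKH where "TKH \<equiv> tensor K TK H"

lemma BU_tens_K_H [simp]:
  "carrier (tensor K BU H) = carrier TKH" "ring.add (tensor K BU H) = ring.add TKH"
  "smult (tensor K BU H) = smult TKH"
proof -
  have e: "carrier BU = carrier TK" "ring.add BU = ring.add TK" "smult BU = smult TK"
    by (simp_all only: BU_simps TK_simps)
  show "carrier (tensor K BU H) = carrier TKH" "ring.add (tensor K BU H) = ring.add TKH"
    "smult (tensor K BU H) = smult TKH"
    by (rule tensor_left_cong(1)[OF e] tensor_left_cong(2)[OF e] tensor_left_cong(3)[OF e])+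
qed

abbreviation PinvH where "PinvH \<equiv> tmap K Aa.T H TK Pinv"

lemma AT_mod: "module K Aa.T" by simp

lemma PinvH: "PinvH \<in> lin_map K Aa.TH TKH"
  by (rule lin_tmap[OF AT_mod TK_mod H_mod Pinv_lin])

lemma BU_coact_lin: "(\<lambda>t. PinvH (coact Aa.W (Phi t))) \<in> lin_map K TK TKH"
  by (intro lin_comp[OF PinvH] Aa.lin_coact Phi_lin)

text \<open>Left multiplication by b and the map \<open>ms\<close> both commute with the coactions,
  so the coaction of b \<open>ms\<close>(w) is obtained by applying the composite to the left legs
  of the coaction of w; \<open>Pinv\<close> turns b \<open>ms\<close>(x) back into b \<otimes>
  x.\<close>

lemma BU_coact_pure:
  assumes bw: "b \<in> carrier B" "w \<in> carrier Q"
  shows "PinvH (coact Aa.W (Phi (tens Z BZ UZ b w))) =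
    tmap K U H TK (BU_tens K H \<alpha> b) (coact U w)"
proof -
  have cU: "coact U w \<in> carrier QH" by (rule alg_homD(2)[OF U_coact_hom bw(2)])
  note al = act_lin[OF B_alg' bw(1)]
  have "PinvH (coact Aa.W (Phi (tens Z BZ UZ b w))) =
    PinvH (tmap K Aa.T H Aa.T (act B b)
      (tmap K Q H Aa.T ms (coact U w)))"
    unfolding Phi_tens[OF bw] Aa.coact_act[OF bw(1) msD(1)[OF bw(2)]] ms_coact[OF bw(2)] ..
  also have "\<dots> = PinvH (tmap K Q H Aa.T (\<lambda>x. act B b (ms x)) (coact U w))"
    by (rule arg_cong[of _ _ PinvH], rule tmap_tmap[OF Q_mod AT_mod AT_mod ms_lin al cU])
  also have "\<dots> = tmap K Q H TK (\<lambda>x. Pinv (act B b (ms x))) (coact U w)"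
    by (rule tmap_tmap[OF Q_mod AT_mod TK_mod lin_comp[OF al ms_lin] Pinv_lin cU])
  also have "\<dots> = tmap K Q H TK (BU_tens K H \<alpha> b) (coact U w)"
  proof (rule fun_cong[OF tensor_lift_cong])
    fix x h assume "x \<in> carrier Q" "h \<in> carrier H"
    then have "Pinv (act B b (ms x)) = BU_tens K H \<alpha> b x"
      using Pinv_Phi[of "tens Z BZ UZ b x"] bw by (simp add: Phi_tens BU_tens_def)
    then show "tens K TK H (Pinv (act B b (ms x))) h = tens K TK H (BU_tens K H \<alpha> b x) h" by simp
  qed
  finally show ?thesis unfolding tensor_lift_U .
qed

text \<open>As for the product: the transported coaction is additive and has the values of
  \<open>BU_coact_pure\<close> on pure tensors, so it is the chosen lift.\<close>

lemma BU_coact: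
  assumes t: "t \<in> carrier BUT" shows "coact BU t = PinvH (coact Aa.W (Phi t))"
proof -
  have "coact BU t = tlift Z BZ UZ TKH (\<lambda>b w. tmap K U H TK (BU_tens K H \<alpha> b) (coact U w)) t"
    by (simp add: BU_eq with_coact_def)
  also have "\<dots> = PinvH (coact Aa.W (Phi t))"
  proof (rule tensor_lift_eqI[OF BZ_mod UZ_mod _ _ t, of "\<lambda>t. PinvH (coact Aa.W (Phi t))"])
    show "(\<lambda>t. PinvH (coact Aa.W (Phi t))) \<in> hom (tensor_group Z BZ UZ) (add_monoid TKH)"
      using lin_map_hom[OF BU_coact_lin] unfolding hom_add_monoid_tensor[symmetric] by (simp add: hom_def)
  qed (rule BU_coact_pure, simp_all)
  finally show ?thesis .
qed

lemma Phi_coact: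
  assumes t: "t \<in> carrier BUT"
  shows "tmap K BU H Aa.W Phi (coact BU t) = coact Aa.W (Phi t)"
proof -
  have e: "carrier BU = carrier TK" "ring.add BU = ring.add TK" "smult BU = smult TK"
    by (simp_all only: BU_simps TK_simps)
  have cA: "coact Aa.W (Phi t) \<in> carrier Aa.TH" using t by (intro Aa.coact_closed Phi_closed)
  have "tmap K BU H Aa.W Phi (coact BU t) =
     tmap K TK H Aa.T Phi (PinvH (coact Aa.W (Phi t)))"
    unfolding BU_coact[OF t] tensor_lift_left_cong[OF e] Aa.tensor_lift_W_group Aa.tensor_W ..
  also have "\<dots> = tmap K Aa.T H Aa.T (\<lambda>x. Phi (Pinv x)) (coact Aa.W (Phi t))"
    by (rule tmap_tmap[OF AT_mod TK_mod AT_mod Pinv_lin Phi_lin cA])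
  also have "\<dots> = coact Aa.W (Phi t)"
    by (rule lift_eqI[OF AT_mod H_mod lin_id _ cA]) (simp add: Pinv)
  finally show ?thesis .
qed

lemma BU_mod: "module K BU"
  by (rule module_cong[OF _ _ _ _ TK_mod]) (simp_all only: BU_simps TK_simps)

lemma Phi_lin_BU: "Phi \<in> lin_map K BU Aa.W"
  using Phi_lin by (simp add: lin_map_def)

lemma Phi_mult: "s \<in> carrier BUT \<Longrightarrow> t \<in> carrier BUT \<Longrightarrow> Phi (s \<otimes>\<^bsub>BUT\<^esub> t) = Phi s \<otimes>\<^bsub>Aa.W\<^esub> Phi t"
  by (simp add: BUT_mult Pinv Aa.mult_closed)

lemma BUT_mult_closed: "s \<in> carrier BUT \<Longrightarrow> t \<in> carrier BUT \<Longrightarrow> s \<otimes>\<^bsub>BUT\<^esub> t \<in> carrier BUT"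
  by (simp add: BUT_mult Pinv Aa.mult_closed)

lemma Phi_one: "Phi \<one>\<^bsub>BUT\<^esub> = \<one>\<^bsub>Aa.W\<^esub>"
  unfolding tensor_one BZ_simps UZ_simps
  by (simp only: Phi_tens Aa.R.A.one_closed QA.A.one_closed ms_one) (simp add: act_one)

lemma BU_comodule: "comodule_algebra K H BU"
proof (rule comodule_algebra_transport[OF A_comodule BU_mod Phi_lin_BU])
  show "coact BU \<in> lin_map K BU (tensor K BU H)"
    using BU_coact_lin by (simp add: lin_map_def BU_coact Pi_iff scal_center')
  show "Phi \<one>\<^bsub>BU\<^esub> = \<one>\<^bsub>Aa.W\<^esub>" unfolding BU_simps by (rule Phi_one)
  show "tmap K BU H Aa.W Phi (coact BU t) = coact Aa.W (Phi t)"
    if "t \<in> carrier BU" for t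
    using that unfolding BU_simps by (rule Phi_coact)
qed (simp_all add: Phi_inj BUT_mult_closed Phi_mult tensor_one)

lemma Phi_iso: "Phi \<in> comod_alg_iso K H BU (A_alg K H \<alpha>)"
proof -
  have "Phi \<in> alg_hom K BU Aa.W"
    by (intro alg_homI Phi_lin_BU) (simp_all only: BU_simps Phi_mult Phi_one)
  moreover have "bij_betw Phi (carrier BU) (carrier Aa.W)"
    using Phi_inj Phi_surj by (auto simp: bij_betw_def)
  ultimately show ?thesis
    unfolding A_eq comod_alg_iso_def comod_alg_hom_def
    by (intro CollectI conjI BU_comodule A_comodule ballI Phi_coact[symmetric]) (simp_all only: BU_simps)
qed

lemma Phi_BU_tens:
  assumes "b \<in> carrier B" "w \<in> carrier U"
  shows "Phi (BU_tens K H \<alpha> b w) = B_act K H \<alpha> b (ms w)"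
proof -
  have "B_act K H \<alpha> b = act B b"
    unfolding B_act_def A_eq act_def Aa.tensor_lift_W_group ..
  then show ?thesis using assms by (simp add: BU_tens_def Phi_tens)
qed

end

theorem theorem9p3:
  fixes K :: "'k ring" and H :: "('k, 'h) hopf" and \<alpha> :: "'h \<Rightarrow> 'h \<Rightarrow> 'k"
  assumes "field K" and "infinite (carrier K)"
    and "hopf_algebra K H"
    and "two_cocycle K H (self_algebra K) \<alpha>"
    and "normalized_cocycle H (self_algebra K) \<alpha>"
    and "conv_invertible K H (self_algebra K) \<alpha>"
    and "nondegenerate K H \<alpha>"
    and "nice K H \<alpha>"
  shows "\<exists>\<Phi> \<in> comod_alg_iso K H (BU_alg K H \<alpha>) (A_alg K H \<alpha>).
    \<forall>b \<in> carrier (B_alg K H \<alpha>). \<forall>w \<in> carrier (U_alg K H \<alpha>).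
      \<Phi> (BU_tens K H \<alpha> b w) = B_act K H \<alpha> b (mu_sigma K H \<alpha> w)"
proof -
  interpret hopf_nondegenerate K H \<alpha>
    using assms by (intro hopf_nondegenerate.intro hopf_cocycle.intro hopf_inf.intro hopf.intro
        hopf_inf_axioms.intro hopf_cocycle_axioms.intro hopf_nondegenerate_axioms.intro)
  interpret hopf_nice K H \<alpha>
    using \<open>nice K H \<alpha>\<close> by unfold_locales (simp add: nice_def)
  show ?thesis using Phi_iso Phi_BU_tens by blast
qed

end
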